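(* Let $n\in\mathbb N$. If $n=0$ put $m=1$; if $n\ge 1$ let $m$ be such that $m-1$ is the length of the longest word appearing at stage $n$. Then: (i) for every simple arc $[s,t]$ of $T_n$ there is a unique element $P_u$ of $\mathscr P_m$ such that $f_Q(P_u)=T_\tau(s,t)$; (ii) conversely, for every $P_u\in\mathscr P_m$ there is a simple arc $[s,t]$ of $T_n$ such that $f_Q(P_u)=T_\tau(s,t)$. (One then says that $T_n$ determines the partition $\mathscr P_m$.)
   Context: **Symbolic system.** Let $d\ge 3$, $A=\{1,\dots,d\}$, and let $\sigma$ be the substitution (morphism of the free monoid $A^*$) $\sigma(1)=12$, $\sigma(k)=k+1$ for $2\le k\le d-1$, $\sigma(d)=1$; $\sigma$ is also regarded as an automorphism of the free group $F_d$ with basis $A$ (elements are reduced words; $\epsilon$ is the empty word; length means reduced length). Let $\omega=\lim_n\sigma^n(1)\in A^{\mathbb N}$, $S$ the shift, $\Omega^+$ the closure of $\{S^n(\omega):n\ge0\}$ in $A^{\mathbb N}$, $\Omega^+_p=\{S^n(\omega):n\ge 0\}$, $\mathfrak L(\Omega)$ the set of finite factors of $\omega$, and $\Omega\subset A^{\mathbb Z}$ the set of bi-infinite words all of whose finite factors are in $\mathfrak L(\Omega)$; a bi-infinite word is written $U.V$ with $U$ left-infinite and $V\in A^{\mathbb N}$ starting at index $0$. For $u\in\mathfrak L(\Omega)$, $P_u=\{V\in\Omega^+: uV\in\Omega^+\}$, and $\mathscr P_m=\{P_u: u\in\mathfrak L(\Omega),\ |u|=m\}$ (a partition of $\Omega^+$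 modulo a finite set). **Simplicial trees.** Let $A_\tau=\{1,\dots,2d-2\}$. Trees have oriented edges $(x,y,i)$ (from $x$ to $y$) coloured by $i\in A_\tau$. The tree substitution $\tau$ replaces each edge as follows, keeping its endpoints: $(x,y,1)\mapsto(x,y,d)$; $(x,y,i)\mapsto(x,y,i-1)$ for $3\le i\le d$ and for $d+2\le i\le 2d-2$; $(x,y,d+1)\mapsto(x,y,1)$; and $(x,y,2)$ is replaced by the $d$ edges $(z,x,d)$, $(z,y,1)$ and $(z,z_h,d+h)$ for $1\le h\le d-2$, where $z,z_1,\dots,z_{d-2}$ are new vertices. $T_0^s$ is the tree with root $x_0$ and edges $(x_0,x_j,j)$, $1\le j\le d$, and $T_n^s=\tau^n(T_0^s)$. $\mathcal V_n^s$ is the vertex set of $T_n^s$ (so $\mathcal V_n^s\subset\mathcal V_{n+1}^s$) and $\mathcal W_n^s$ the set of its branch vertices (degree $d$; all other vertices have degree $1$). For vertices $x,x'$ of $T_n^s$, $\gamma_n(x,x')$ is the word in $(A_\tau\cup\overline{A_\tau})^*$ read along the shortest path from $x$ to $x'$, an edge of colour $i$ contributing $i$ if traversed along its orientation and $\overline i$ otherwise. The morphism $p_*:(A_\tau\cup\overline{A_\tau})^*\to F_d$ is given by $p_*(k)=k$ for $1\le k\le d$, $p_*(d+k)=\sigma^k(1)$ for $1\le k\le d-2$, $p_*(\overline k)=p_*(k)^{-1}$. **Real trees.** Let $\eta>1$ satisfy $\eta^d=\eta+1$. Let $\mathscr R^d$ be the free product of $d$ copies of $(\mathbb R,+)$ indexed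 by $0,\dots,d-1$; $j^t$ denotes the element $t$ of the $j$-th copy, $O$ the identity; it carries the left-invariant distance for which a reduced word $j_0^{t_0}\cdots j_q^{t_q}$ is at distance $\sum|t_i|$ from $O$, which makes it a real tree; $\overline{\mathscr R^d}$ is its metric completion. Injective maps $\nu_n:\mathcal V_n^s\to\mathscr R^d$ are defined by $\nu_0(x_0)=O$, $\nu_0(x_1)=0^1$, $\nu_0(x_j)=(j-1)^{\eta^{d-j+1}}$ for $2\le j\le d$; $\nu_n=\nu_{n-1}$ on $\mathcal V_{n-1}^s$; and if $y$ is a new branch vertex of $T_n^s$ with edges $(y,y_1,1)$, $(y,y_2,d)$, $(y,z_h,d+h)$ and $\nu_{n-1}(y_1)^{-1}\nu_{n-1}(y_2)=j^p$, $\alpha=p/|p|$, then $\nu_n(y)=\nu_{n-1}(y_1)j^{\alpha\eta^{-n}}$ and $\nu_n(z_h)=\nu_n(y)k^{\eta^{-n-h}}$ with $k\equiv j+h \pmod d$. $T_n$ is the convex hull of $\mathcal V_n=\nu_n(\mathcal V_n^s)$, and $T_\tau$ is the limit of $(T_n)_n$ in $\overline{\mathscr R^d}$ for the Hausdorff distance (the closure of the increasing union of the $T_n$), a compact real tree. An arc $[s,t]$ of $T_n$ is simple if $s,t\in\mathcal V_n$ and its interior contains no element of $\mathcal V_n$; for such an arc, $T_\tau(s,t)=\{x\in T_\tau: s\notin\,]x,t[\ \text{and}\ t\notin\,]x,s[\}$ (open arcs). **Appearance and the map $f_Q$.** For $x\in\bigcup_n\mathcal W_n^s$ put $f_0(x)=\sigma^k(p_*(\gamma_k(x_0,x)))\in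 F_d$ for any $k$ such that $x\in\mathcal V_k^s$ (independent of $k$). A word $u^{-1}$ appears at stage $k\ge1$ if $u^{-1}=f_0(x)$ for some branch vertex $x$ of $T_k^s$ that is not a vertex of $T_{k-1}^s$. By convention $\epsilon$ appears at stage $-(d-2)$, and no other word appears at a stage $\le 0$. The map $f_0$ is a bijection onto $\{u^{-1}: u \text{ prefix of }\omega\}$. For $u^{-1}\omega\in\Omega^+_p$ ($u$ a prefix of $\omega$), $f_Q(u^{-1}\omega)=\nu_k(f_0^{-1}(u^{-1}))$ for any $k$ such that $f_0^{-1}(u^{-1})\in\mathcal V_k^s$. For $V\in\Omega^+\setminus\Omega_p^+$, let $U$ be the unique left-infinite word with $U.V\in\Omega$, let $(p_i,a_i,s_i)_{i\ge0}$ be the prefix-suffix development of $U.V$, and $f_Q(V)=\lim_n f_Q(u_n^{-1}\omega)$, where $u_n^{-1}=p_0^{-1}\sigma(p_1^{-1})\cdots\sigma^n(p_n^{-1})$ (the limit exists). The prefix-suffix development of $W\in\Omega$: every $W\in\Omega$ is uniquely $W=S^k(\sigma(W'))$ with $W'\in\Omega$, $0\le k<|\sigma(W'_0)|$; write $\sigma(W'_0)=p_0a_0s_0$ with $|p_0|=k$, $a_0=W_0$; then iterate with $W'$ to get $(p_1,a_1,s_1)$, etc. *)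

theory Defs
  imports "HOL-Analysis.Analysis" "HOL-Library.Sublist"
begin

section \<open>The substitution and its symbolic system\<close>

text \<open>
  The alphabet is \<open>{1..d}\<close>, as a subset of \<^typ>\<open>nat\<close>. One-sided infinite words are functions
  on \<^typ>\<open>nat\<close>, bi-infinite words are functions on \<^typ>\<open>int\<close>; in \<open>U.V\<close> the word \<open>V\<close> occupies the
  non-negative indices.
\<close>

definition sigma_letter :: "nat \<Rightarrow> nat \<Rightarrow> nat list" where
  "sigma_letter d k = (if k = 1 then [1, 2] else if k = d then [1] else [k + 1])"

definition sigma_word :: "nat \<Rightarrow> nat list \<Rightarrow> nat list" where
  "sigma_word d w = concat (map (sigma_letter d) w)"

text \<open>
  The word \<open>\<sigma>\<^sup>n(1)\<close> is a prefix of \<open>\<sigma>\<^sup>n\<^sup>+\<^sup>1(1)\<close> and has length greater than \<open>n\<close>, so \<open>\<sigma>\<^sup>i(1)\<close>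
  already determines the letter of \<open>\<omega>\<close> at position \<open>i\<close>; see \<open>omega_limit\<close>.
\<close>

definition omega :: "nat \<Rightarrow> nat \<Rightarrow> nat" where
  "omega d i = (sigma_word d ^^ i) [1] ! i"

lemma sigma_append: "sigma_word d (u @ v) = sigma_word d u @ sigma_word d v"
  by (simp add: sigma_word_def)

lemma sigma_pow_append: "(sigma_word d ^^ n) (u @ v) = (sigma_word d ^^ n) u @ (sigma_word d ^^ n) v"
  by (induction n) (simp_all add: sigma_append)

lemma sigma_pow_nonempty: "w \<noteq> [] \<Longrightarrow> (sigma_word d ^^ n) w \<noteq> []"
proof (induction n)
  case (Suc n)
  then obtain a v where "(sigma_word d ^^ n) w = a # v"
    by (meson neq_Nil_conv)
  then show ?case by (simp only: funpow.simps comp_apply) (simp add: sigma_word_def sigma_letter_def)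
qed simp

lemma sigma_pow_Suc: "(sigma_word d ^^ Suc n) [1] = (sigma_word d ^^ n) [1] @ (sigma_word d ^^ n) [2]"
proof -
  have "(sigma_word d ^^ Suc n) [1] = (sigma_word d ^^ n) (sigma_word d [1])"
    by (simp add: funpow_swap1)
  also have "sigma_word d [1] = [1] @ [2]"
    by (simp add: sigma_word_def sigma_letter_def)
  finally show ?thesis by (simp only: sigma_pow_append)
qed

lemma length_sigma_pow: "n < length ((sigma_word d ^^ n) [1])"
proof (induction n)
  case (Suc n)
  have "0 < length ((sigma_word d ^^ n) [2])"
    using sigma_pow_nonempty by blast
  with Suc show ?case by (simp only: sigma_pow_Suc length_append)
qed simp

lemma sigma_pow_prefix: "m \<le> n \<Longrightarrow> prefix ((sigma_word d ^^ m) [1]) ((sigma_word d ^^ n) [1])"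
proof (induction n rule: dec_induct)
  case (step n)
  then show ?case by (simp only: sigma_pow_Suc prefix_prefix)
qed simp

lemma omega_limit:
  assumes "i < length ((sigma_word d ^^ n) [1])"
  shows "omega d i = (sigma_word d ^^ n) [1] ! i"
proof -
  have "prefix ((sigma_word d ^^ i) [1]) ((sigma_word d ^^ n) [1]) \<or> prefix ((sigma_word d ^^ n) [1]) ((sigma_word d ^^ i) [1])"
    by (meson sigma_pow_prefix nat_le_linear)
  then show ?thesis
    using assms length_sigma_pow[of i d] unfolding omega_def
    by (auto simp: prefix_def nth_append)
qed

definition sshift :: "nat \<Rightarrow> (nat \<Rightarrow> nat) \<Rightarrow> nat \<Rightarrow> nat" where
  "sshift n V = (\<lambda>i. V (i + n))"

definition swapp :: "nat list \<Rightarrow> (nat \<Rightarrow> nat) \<Rightarrow> nat \<Rightarrow> nat" where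
  "swapp u V = (\<lambda>i. if i < length u then u ! i else V (i - length u))"

definition sprefix :: "nat \<Rightarrow> (nat \<Rightarrow> nat) \<Rightarrow> nat list" where
  "sprefix n V = map V [0..<n]"

definition Omega_orbit :: "nat \<Rightarrow> (nat \<Rightarrow> nat) set" where
  "Omega_orbit d = {sshift n (omega d) |n. True}"

text \<open>The closure is taken in the product topology, \<^typ>\<open>nat\<close> being discrete.\<close>

definition Omega_plus :: "nat \<Rightarrow> (nat \<Rightarrow> nat) set" where
  "Omega_plus d = closure (Omega_orbit d)"

definition lang :: "nat \<Rightarrow> nat list set" where
  "lang d = {sprefix l (sshift n (omega d)) |l n. True}"

definition Omega :: "nat \<Rightarrow> (int \<Rightarrow> nat) set" where
  "Omega d = {W. \<forall>i l. map (\<lambda>k. W (i + int k)) [0..<l] \<in> lang d}"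

definition cyl :: "nat \<Rightarrow> nat list \<Rightarrow> (nat \<Rightarrow> nat) set" where
  "cyl d u = {V \<in> Omega_plus d. swapp u V \<in> Omega_plus d}"

definition cyl_partition :: "nat \<Rightarrow> nat \<Rightarrow> (nat \<Rightarrow> nat) set set" where
  "cyl_partition d m = {cyl d u |u. u \<in> lang d \<and> length u = m}"


subsection \<open>Prefix-suffix development\<close>

text \<open>
  In \<open>\<sigma>(W)\<close> the block \<open>\<sigma>(W\<^sub>i)\<close> starts at index \<open>block_start d W i\<close>; in particular the block of \<open>W\<^sub>0\<close>
  starts at index \<open>0\<close>.
\<close>

definition block_start :: "nat \<Rightarrow> (int \<Rightarrow> nat) \<Rightarrow> int \<Rightarrow> int" where
  "block_start d W i = (if 0 \<le> i then (\<Sum>j\<in>{0..<i}. int (length (sigma_letter d (W j))))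
                else - (\<Sum>j\<in>{i..<0}. int (length (sigma_letter d (W j)))))"

definition sigma_bi :: "nat \<Rightarrow> (int \<Rightarrow> nat) \<Rightarrow> int \<Rightarrow> nat" where
  "sigma_bi d W n =
    (THE a. \<exists>i k. k < length (sigma_letter d (W i)) \<and> n = block_start d W i + int k
                  \<and> a = sigma_letter d (W i) ! k)"

definition bshift :: "nat \<Rightarrow> (int \<Rightarrow> nat) \<Rightarrow> int \<Rightarrow> nat" where
  "bshift k W = (\<lambda>i. W (i + int k))"

definition ps_development ::
    "nat \<Rightarrow> (int \<Rightarrow> nat) \<Rightarrow> (nat \<Rightarrow> nat list \<times> nat \<times> nat list) \<Rightarrow> bool" where
  "ps_development d W D \<longleftrightarrow>
    (\<exists>Ws. Ws 0 = W \<and>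
      (\<forall>i. Ws (Suc i) \<in> Omega d \<and>
        (case D i of (p, a, s) \<Rightarrow>
           sigma_letter d (Ws (Suc i) 0) = p @ a # s \<and>
           Ws i = bshift (length p) (sigma_bi d (Ws (Suc i))) \<and>
           a = Ws i 0)))"


section \<open>The free group\<close>

text \<open>
  Elements are reduced words over signed letters; \<open>(k, True)\<close> stands for the inverse of \<open>k\<close>.
  The same type is used for words over \<open>A\<^sub>\<tau>\<close> and its barred copy.
\<close>

type_synonym sword = "(nat \<times> bool) list"

definition fg_cons :: "nat \<times> bool \<Rightarrow> sword \<Rightarrow> sword" where
  "fg_cons a w = (case w of [] \<Rightarrow> [a]
     | b # v \<Rightarrow> if fst a = fst b \<and> snd a \<noteq> snd b then v else a # w)"

definition fg_reduce :: "sword \<Rightarrow> sword" where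
  "fg_reduce w = foldr fg_cons w []"

definition fg_mult :: "sword \<Rightarrow> sword \<Rightarrow> sword" where
  "fg_mult u v = fg_reduce (u @ v)"

definition fg_inv :: "sword \<Rightarrow> sword" where
  "fg_inv w = rev (map (\<lambda>(k, b). (k, \<not> b)) w)"

definition fg_pos :: "nat list \<Rightarrow> sword" where
  "fg_pos w = map (\<lambda>k. (k, False)) w"

definition fg_lift :: "(nat \<Rightarrow> sword) \<Rightarrow> sword \<Rightarrow> sword" where
  "fg_lift h w = fg_reduce (concat (map (\<lambda>(k, b). if b then fg_inv (h k) else h k) w))"

definition fg_sigma :: "nat \<Rightarrow> sword \<Rightarrow> sword" where
  "fg_sigma d = fg_lift (\<lambda>k. fg_pos (sigma_letter d k))"

definition p_star :: "nat \<Rightarrow> sword \<Rightarrow> sword" where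
  "p_star d = fg_lift (\<lambda>k. if k \<le> d then fg_pos [k] else fg_pos ((sigma_word d ^^ (k - d)) [1]))"


section \<open>The simplicial trees\<close>

text \<open>
  \<open>Base j\<close> is \<open>x\<^sub>j\<close>. Substituting an edge \<open>(x, y, 2)\<close> creates \<open>z = New x y 0\<close> and
  \<open>z\<^sub>h = New x y h\<close>. These vertices are new, because after the substitution \<open>x\<close> and \<open>y\<close> are
  separated by \<open>z\<close> and never become adjacent again.
\<close>

datatype vertex = Base nat | New vertex vertex nat

type_synonym stree = "(vertex \<times> vertex \<times> nat) set"

fun subst_edge :: "nat \<Rightarrow> vertex \<times> vertex \<times> nat \<Rightarrow> stree" where
  "subst_edge d (x, y, i) =
    (if i = 1 then {(x, y, d)}
     else if i = 2 then
       {(New x y 0, x, d), (New x y 0, y, 1)} \<union> {(New x y 0, New x y h, d + h) |h. 1 \<le> h \<and> h \<le> d - 2}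
     else if i = d + 1 then {(x, y, 1)}
     else {(x, y, i - 1)})"

definition subst_tree :: "nat \<Rightarrow> stree \<Rightarrow> stree" where
  "subst_tree d E = (\<Union>e\<in>E. subst_edge d e)"

definition stree_at :: "nat \<Rightarrow> nat \<Rightarrow> stree" where
  "stree_at d n = (subst_tree d ^^ n) {(Base 0, Base j, j) |j. 1 \<le> j \<and> j \<le> d}"

definition verts :: "stree \<Rightarrow> vertex set" where
  "verts E = {x. \<exists>y i. (x, y, i) \<in> E \<or> (y, x, i) \<in> E}"

definition degree :: "stree \<Rightarrow> vertex \<Rightarrow> nat" where
  "degree E x = card {(y, z, i). (y, z, i) \<in> E \<and> (x = y \<or> x = z)}"

definition branch_verts :: "nat \<Rightarrow> nat \<Rightarrow> vertex set" where
  "branch_verts d n = {x \<in> verts (stree_at d n). degree (stree_at d n) x = d}"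

inductive walk :: "stree \<Rightarrow> vertex \<Rightarrow> sword \<Rightarrow> vertex \<Rightarrow> bool" for E where
  walk_refl: "walk E x [] x"
| walk_fwd: "(x, y, i) \<in> E \<Longrightarrow> walk E y w z \<Longrightarrow> walk E x ((i, False) # w) z"
| walk_bwd: "(y, x, i) \<in> E \<Longrightarrow> walk E y w z \<Longrightarrow> walk E x ((i, True) # w) z"

definition gamma :: "nat \<Rightarrow> nat \<Rightarrow> vertex \<Rightarrow> vertex \<Rightarrow> sword" where
  "gamma d n x x' =
    (THE w. walk (stree_at d n) x w x' \<and> (\<forall>w'. walk (stree_at d n) x w' x' \<longrightarrow> length w \<le> length w'))"

text \<open>The least stage containing the vertex is chosen; the value is the same at all later stages.\<close>

definition birth :: "nat \<Rightarrow> vertex \<Rightarrow> nat" where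
  "birth d x = (LEAST k. x \<in> verts (stree_at d k))"

definition f_zero :: "nat \<Rightarrow> vertex \<Rightarrow> sword" where
  "f_zero d x = (let k = birth d x in (fg_sigma d ^^ k) (p_star d (gamma d k (Base 0) x)))"

definition appears :: "nat \<Rightarrow> sword \<Rightarrow> int \<Rightarrow> bool" where
  "appears d w k \<longleftrightarrow>
    (k = - (int d - 2) \<and> w = []) \<or>
    (k \<ge> 1 \<and> (\<exists>x \<in> branch_verts d (nat k). x \<notin> verts (stree_at d (nat k - 1)) \<and> w = f_zero d x))"


section \<open>The free product of copies of the real line\<close>

text \<open>
  A reduced word is a list of pairs \<open>(j, t)\<close> (for \<open>j\<^sup>t\<close>), with exponents different from \<open>0\<close> and
  consecutive indices distinct.
\<close>

type_synonym fpword = "(nat \<times> real) list"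

definition fp_carrier :: "nat \<Rightarrow> fpword set" where
  "fp_carrier d = {w. (\<forall>(j, t) \<in> set w. j < d \<and> t \<noteq> 0) \<and> successively (\<lambda>a b. fst a \<noteq> fst b) w}"

definition fp_letter :: "nat \<Rightarrow> real \<Rightarrow> fpword" where
  "fp_letter j t = (if t = 0 then [] else [(j, t)])"

definition fp_cons :: "nat \<times> real \<Rightarrow> fpword \<Rightarrow> fpword" where
  "fp_cons a w = (case w of [] \<Rightarrow> fp_letter (fst a) (snd a)
     | b # v \<Rightarrow> if fst a = fst b then fp_letter (fst a) (snd a + snd b) @ v
               else fp_letter (fst a) (snd a) @ w)"

definition fp_reduce :: "fpword \<Rightarrow> fpword" where
  "fp_reduce w = foldr fp_cons w []"

definition fp_mult :: "fpword \<Rightarrow> fpword \<Rightarrow> fpword" where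
  "fp_mult u v = fp_reduce (u @ v)"

definition fp_inv :: "fpword \<Rightarrow> fpword" where
  "fp_inv w = rev (map (\<lambda>(j, t). (j, - t)) w)"

definition fp_norm :: "fpword \<Rightarrow> real" where
  "fp_norm w = (\<Sum>(j, t)\<leftarrow>w. \<bar>t\<bar>)"

definition fp_dist :: "fpword \<Rightarrow> fpword \<Rightarrow> real" where
  "fp_dist u v = fp_norm (fp_mult (fp_inv u) v)"

lemma fp_carrier_Nil [simp]: "[] \<in> fp_carrier d"
  by (simp add: fp_carrier_def)

lemma fp_carrier_Cons:
  "(j, t) # w \<in> fp_carrier d \<longleftrightarrow>
    j < d \<and> t \<noteq> 0 \<and> w \<in> fp_carrier d \<and> (w \<noteq> [] \<longrightarrow> j \<noteq> fst (hd w))"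
  by (cases w) (auto simp: fp_carrier_def)

lemma fp_cons_closed: "j < d \<Longrightarrow> w \<in> fp_carrier d \<Longrightarrow> fp_cons (j, t) w \<in> fp_carrier d"
  by (cases w) (auto simp: fp_cons_def fp_letter_def fp_carrier_Cons)

lemma fp_cons_zero: "w \<in> fp_carrier d \<Longrightarrow> fp_cons (j, 0) w = w"
  by (cases w) (auto simp: fp_cons_def fp_letter_def fp_carrier_Cons)

lemma fp_cons_reduced: "(j, t) # w \<in> fp_carrier d \<Longrightarrow> fp_cons (j, t) w = (j, t) # w"
  by (cases w) (auto simp: fp_cons_def fp_letter_def fp_carrier_Cons)

lemma fp_cons_cons:
  assumes "w \<in> fp_carrier d"
  shows "fp_cons (j, t) (fp_cons (j, s) w) = fp_cons (j, t + s) w"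
proof (cases w)
  case Nil
  then show ?thesis by (auto simp: fp_cons_def fp_letter_def)
next
  case (Cons b v)
  then show ?thesis
    using assms by (cases b; cases v) (auto simp: fp_cons_def fp_letter_def fp_carrier_Cons)
qed

lemma fp_carrier_index: "w \<in> fp_carrier d \<Longrightarrow> \<forall>a\<in>set w. fst a < d"
  by (auto simp: fp_carrier_def)

lemma fp_act_closed: "\<forall>a\<in>set u. fst a < d \<Longrightarrow> x \<in> fp_carrier d \<Longrightarrow> foldr fp_cons u x \<in> fp_carrier d"
  by (induction u) (auto simp: fp_cons_closed)

lemma fp_reduce_closed: "\<forall>a\<in>set u. fst a < d \<Longrightarrow> fp_reduce u \<in> fp_carrier d"
  by (simp add: fp_reduce_def fp_act_closed)

lemma fp_reduce_reduced: "w \<in> fp_carrier d \<Longrightarrow> fp_reduce w = w"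
  unfolding fp_reduce_def by (induction w) (auto simp: fp_carrier_Cons fp_cons_reduced)

lemma fp_mult_eq: "v \<in> fp_carrier d \<Longrightarrow> fp_mult u v = foldr fp_cons u v"
  using fp_reduce_reduced by (simp add: fp_mult_def fp_reduce_def)

lemma fp_mult_closed: "u \<in> fp_carrier d \<Longrightarrow> v \<in> fp_carrier d \<Longrightarrow> fp_mult u v \<in> fp_carrier d"
  by (simp add: fp_mult_eq fp_act_closed fp_carrier_index)

lemma fp_act_cons:
  assumes "j < d" "u \<in> fp_carrier d" "x \<in> fp_carrier d"
  shows "foldr fp_cons (fp_cons (j, t) u) x = fp_cons (j, t) (foldr fp_cons u x)"
proof (cases u)
  case Nil
  then show ?thesis
    using assms by (auto simp: fp_cons_def[of _ "[]"] fp_letter_def fp_cons_zero)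
next
  case (Cons b u')
  obtain k s where b: "b = (k, s)" by fastforce
  have u': "u' \<in> fp_carrier d" "k < d"
    using assms Cons b by (simp_all add: fp_carrier_Cons)
  then have m: "foldr fp_cons u' x \<in> fp_carrier d" "fp_cons (k, s) (foldr fp_cons u' x) \<in> fp_carrier d"
    using assms by (simp_all add: fp_act_closed fp_cons_closed fp_carrier_index)
  show ?thesis
  proof (cases "j = k")
    case True
    have "foldr fp_cons (fp_cons (j, t) u) x = fp_cons (k, t + s) (foldr fp_cons u' x)"
      using True Cons b m by (simp add: fp_cons_def[of _ "_ # _"] fp_letter_def fp_cons_zero)
    then show ?thesis
      using True Cons b m by (simp add: fp_cons_cons)
  next
    case False
    then show ?thesis
      using Cons b m by (simp add: fp_cons_def[of _ "_ # _"] fp_letter_def fp_cons_zero)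
  qed
qed

lemma fp_act_act:
  assumes "\<forall>a\<in>set u. fst a < d" "v \<in> fp_carrier d" "x \<in> fp_carrier d"
  shows "foldr fp_cons (foldr fp_cons u v) x = foldr fp_cons u (foldr fp_cons v x)"
  using assms
proof (induction u)
  case (Cons a u)
  obtain j t where "a = (j, t)" by fastforce
  with Cons show ?case by (simp add: fp_act_cons[where d = d] fp_act_closed[where d = d])
qed simp

lemma fp_mult_assoc:
  assumes "u \<in> fp_carrier d" "v \<in> fp_carrier d" "w \<in> fp_carrier d"
  shows "fp_mult (fp_mult u v) w = fp_mult u (fp_mult v w)"
  using fp_mult_closed[OF assms(2,3)] fp_act_act[OF fp_carrier_index[OF assms(1)] assms(2,3)] assms
  by (simp add: fp_mult_eq)

lemma fp_inv_inv: "fp_inv (fp_inv w) = w"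
  by (simp add: fp_inv_def rev_map case_prod_beta map_idI)

lemma fp_inv_index: "\<forall>a\<in>set u. fst a < d \<Longrightarrow> \<forall>a\<in>set (fp_inv u). fst a < d"
  by (auto simp: fp_inv_def)

lemma fp_inv_closed: "w \<in> fp_carrier d \<Longrightarrow> fp_inv w \<in> fp_carrier d"
  by (auto simp: fp_carrier_def fp_inv_def successively_rev successively_map case_prod_beta
           intro: successively_mono)

lemma fp_act_inv:
  assumes "\<forall>a\<in>set u. fst a < d" "x \<in> fp_carrier d"
  shows "foldr fp_cons u (foldr fp_cons (fp_inv u) x) = x"
  using assms
proof (induction u arbitrary: x)
  case (Cons a u)
  obtain j t where a: "a = (j, t)" by fastforce
  have "fp_cons (j, - t) x \<in> fp_carrier d"
    using Cons.prems a by (simp add: fp_cons_closed)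
  moreover have "fp_inv (a # u) = fp_inv u @ [(j, - t)]"
    by (simp add: fp_inv_def a)
  ultimately show ?case
    using Cons a by (simp add: fp_cons_cons fp_cons_zero)
qed (simp add: fp_inv_def)

lemma fp_mult_inv:
  assumes "u \<in> fp_carrier d" "v \<in> fp_carrier d"
  shows "fp_mult u (fp_mult (fp_inv u) v) = v"
  using fp_mult_closed[OF fp_inv_closed[OF assms(1)] assms(2)]
    fp_act_inv[OF fp_carrier_index[OF assms(1)] assms(2)] assms(2)
  by (simp add: fp_mult_eq)

lemma fp_reduce_inv: "fp_reduce (fp_inv w) = fp_inv (fp_reduce w)"
proof -
  define d where "d = Suc (Max (insert 0 (fst ` set w)))"
  have w: "\<forall>a\<in>set w. fst a < d"
    by (simp add: d_def less_Suc_eq_le)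
  define r where "r = fp_reduce w"
  have r: "r \<in> fp_carrier d" "fp_inv r \<in> fp_carrier d"
    using w by (simp_all add: r_def fp_reduce_closed fp_inv_closed)
  have "foldr fp_cons r (fp_inv r) = []"
    using fp_act_inv[OF fp_carrier_index[OF r(1)] fp_carrier_Nil] fp_reduce_reduced[OF r(2)]
    by (simp add: fp_reduce_def)
  then have "foldr fp_cons w (fp_inv r) = []"
    using fp_act_act[OF w fp_carrier_Nil r(2)] by (simp add: r_def fp_reduce_def)
  then have "fp_reduce (fp_inv w) = foldr fp_cons (fp_inv w) (foldr fp_cons (fp_inv (fp_inv w)) (fp_inv r))"
    by (simp add: fp_reduce_def fp_inv_inv)
  also have "\<dots> = fp_inv r"
    using fp_act_inv[OF fp_inv_index[OF w] r(2)] .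
  finally show ?thesis by (simp add: r_def)
qed

lemma fp_norm_simps [simp]: "fp_norm [] = 0" "fp_norm (a # w) = \<bar>snd a\<bar> + fp_norm w"
  by (simp_all add: fp_norm_def case_prod_beta)

lemma fp_norm_inv: "fp_norm (fp_inv w) = fp_norm w"
  by (simp add: fp_norm_def fp_inv_def case_prod_unfold comp_def rev_map[symmetric])

lemma fp_norm_nonneg: "0 \<le> fp_norm w"
  by (induction w) auto

lemma fp_norm_cons: "fp_norm (fp_cons a w) \<le> \<bar>snd a\<bar> + fp_norm w"
  by (cases w) (auto simp: fp_cons_def fp_letter_def)

lemma fp_norm_act: "fp_norm (foldr fp_cons u v) \<le> fp_norm u + fp_norm v"
proof (induction u)
  case (Cons a u)
  then show ?case using fp_norm_cons[of a "foldr fp_cons u v"] by simp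
qed simp

lemma fp_norm_eq_0:
  assumes "w \<in> fp_carrier d"
  shows "fp_norm w = 0 \<longleftrightarrow> w = []"
proof (cases w)
  case (Cons a v)
  then have "\<bar>snd a\<bar> > 0" using assms by (cases a) (simp add: fp_carrier_Cons)
  then show ?thesis using Cons fp_norm_nonneg[of v] by simp
qed simp

lemma Metric_space_fp: "Metric_space (fp_carrier d) fp_dist"
proof
  fix x y
  show "0 \<le> fp_dist x y" by (simp add: fp_dist_def fp_norm_nonneg)
  have "fp_inv (fp_inv x @ y) = fp_inv y @ x"
    by (simp add: fp_inv_def rev_map case_prod_beta comp_def)
  then have "fp_mult (fp_inv y) x = fp_inv (fp_mult (fp_inv x) y)"
    by (metis fp_mult_def fp_reduce_inv)
  then show "fp_dist x y = fp_dist y x"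
    by (simp add: fp_dist_def fp_norm_inv)
next
  fix x y
  assume x: "x \<in> fp_carrier d" and y: "y \<in> fp_carrier d"
  have cl: "fp_mult (fp_inv x) y \<in> fp_carrier d"
    using x y by (simp add: fp_mult_closed fp_inv_closed)
  show "fp_dist x y = 0 \<longleftrightarrow> x = y"
  proof
    assume "fp_dist x y = 0"
    then have "fp_mult (fp_inv x) y = []"
      using cl by (simp add: fp_dist_def fp_norm_eq_0)
    then have "y = fp_mult x []"
      using fp_mult_inv[OF x y] by simp
    then show "x = y"
      using fp_reduce_reduced[OF x] by (simp add: fp_mult_def)
  next
    assume "x = y"
    then have "fp_mult (fp_inv x) y = []"
      using fp_act_inv[OF fp_carrier_index[OF fp_inv_closed[OF x]] fp_carrier_Nil]
        fp_reduce_reduced[OF x] x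
      by (simp add: fp_mult_eq fp_inv_inv fp_reduce_def)
    then show "fp_dist x y = 0"
      by (simp add: fp_dist_def)
  qed
next
  fix x y z
  assume x: "x \<in> fp_carrier d" and y: "y \<in> fp_carrier d" and z: "z \<in> fp_carrier d"
  have yz: "fp_mult (fp_inv y) z \<in> fp_carrier d"
    using y z by (simp add: fp_mult_closed fp_inv_closed)
  have "fp_mult (fp_inv x) z = fp_mult (fp_inv x) (fp_mult y (fp_mult (fp_inv y) z))"
    using y z by (simp add: fp_mult_inv)
  also have "\<dots> = fp_mult (fp_mult (fp_inv x) y) (fp_mult (fp_inv y) z)"
    using fp_mult_assoc[OF fp_inv_closed[OF x] y yz] by simp
  finally show "fp_dist x z \<le> fp_dist x y + fp_dist y z"
    using fp_norm_act[of "fp_mult (fp_inv x) y" "fp_mult (fp_inv y) z"]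
    by (simp add: fp_dist_def fp_mult_eq[OF yz])
qed

definition fp_metric :: "nat \<Rightarrow> fpword metric" where
  "fp_metric d = metric (fp_carrier d, fp_dist)"


section \<open>Metric completion\<close>

definition is_completion :: "'a metric \<Rightarrow> 'b metric \<Rightarrow> ('a \<Rightarrow> 'b) \<Rightarrow> bool" where
  "is_completion m m' e \<longleftrightarrow>
    mcomplete_of m' \<and>
    e \<in> mspace m \<rightarrow> mspace m' \<and>
    mtopology_of m' closure_of e ` mspace m = mspace m' \<and>
    (\<forall>x\<in>mspace m. \<forall>y\<in>mspace m. mdist m' (e x) (e y) = mdist m x y)"

text \<open>
  A completion, unique up to isometry, is fixed once and for all together with the embedding;
  it exists by \<open>Metric_space.metric_completion\<close>.
\<close>

definition completion_pair :: "'a metric \<Rightarrow> ('a \<Rightarrow> real) metric \<times> ('a \<Rightarrow> 'a \<Rightarrow> real)" where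
  "completion_pair m = (SOME (m', e). is_completion m m' e)"

lemma is_completion_completion_pair: "is_completion m (fst (completion_pair m)) (snd (completion_pair m))"
proof -
  obtain e :: "'a \<Rightarrow> 'a \<Rightarrow> real" and m' where "is_completion m m' e"
    using Metric_space.metric_completion[OF Metric_space_mspace_mdist[of m]]
    unfolding is_completion_def by metis
  then have "\<exists>q :: ('a \<Rightarrow> real) metric \<times> ('a \<Rightarrow> 'a \<Rightarrow> real). case q of (m', e) \<Rightarrow> is_completion m m' e"
    by auto
  then have "case completion_pair m of (m', e) \<Rightarrow> is_completion m m' e"
    unfolding completion_pair_def by (rule someI_ex)
  then show ?thesis by (simp add: case_prod_beta)
qed

type_synonym cpoint = "fpword \<Rightarrow> real"

definition fp_completion :: "nat \<Rightarrow> cpoint metric" where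
  "fp_completion d = fst (completion_pair (fp_metric d))"

definition fp_embed :: "nat \<Rightarrow> fpword \<Rightarrow> cpoint" where
  "fp_embed d = snd (completion_pair (fp_metric d))"


section \<open>The real trees\<close>

text \<open>In a real tree the arc between two points is the metric interval they span.\<close>

definition seg :: "'a metric \<Rightarrow> 'a \<Rightarrow> 'a \<Rightarrow> 'a set" where
  "seg m x y = {z \<in> mspace m. mdist m x z + mdist m z y = mdist m x y}"

definition open_seg :: "'a metric \<Rightarrow> 'a \<Rightarrow> 'a \<Rightarrow> 'a set" where
  "open_seg m x y = seg m x y - {x, y}"

definition tree_convex :: "'a metric \<Rightarrow> 'a set \<Rightarrow> bool" where
  "tree_convex m S \<longleftrightarrow> S \<subseteq> mspace m \<and> (\<forall>x\<in>S. \<forall>y\<in>S. seg m x y \<subseteq> S)"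

text \<open>
  For a vertex \<open>New x y h\<close> created at stage \<open>n + 1\<close> from the edge \<open>(x, y, 2)\<close>, the two old
  neighbours of the new branch vertex are \<open>y\<^sub>1 = y\<close> (colour \<open>1\<close>) and \<open>y\<^sub>2 = x\<close> (colour \<open>d\<close>), and
  \<open>\<nu>\<^sub>n(y)\<^sup>-\<^sup>1 \<nu>\<^sub>n(x)\<close> is a one-letter word. Values off the vertex set of stage \<open>n\<close> are irrelevant.
\<close>

primrec nu :: "nat \<Rightarrow> real \<Rightarrow> nat \<Rightarrow> vertex \<Rightarrow> fpword" where
  "nu d \<eta> 0 v =
    (case v of
       Base j \<Rightarrow> if j = 0 then [] else if j = 1 then fp_letter 0 1
                 else fp_letter (j - 1) (\<eta> ^ (d - j + 1))
     | New x y h \<Rightarrow> [])"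
| "nu d \<eta> (Suc n) v =
    (if v \<in> verts (stree_at d n) then nu d \<eta> n v
     else case v of
       Base j \<Rightarrow> []
     | New x y h \<Rightarrow>
        (case hd (fp_mult (fp_inv (nu d \<eta> n y)) (nu d \<eta> n x)) of (j, p) \<Rightarrow>
          let z = fp_mult (nu d \<eta> n y) (fp_letter j (p / \<bar>p\<bar> * \<eta> powi (- int (Suc n))))
          in if h = 0 then z
             else fp_mult z (fp_letter ((j + h) mod d) (\<eta> powi (- int (Suc n) - int h)))))"

definition Vpts :: "nat \<Rightarrow> real \<Rightarrow> nat \<Rightarrow> fpword set" where
  "Vpts d \<eta> n = nu d \<eta> n ` verts (stree_at d n)"

definition rtree :: "nat \<Rightarrow> real \<Rightarrow> nat \<Rightarrow> fpword set" where
  "rtree d \<eta> n = tree_convex (fp_metric d) hull Vpts d \<eta> n"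

text \<open>
  The sets \<open>rtree d \<eta> n\<close> increase with \<open>n\<close>; their limit for the Hausdorff distance is the closure of
  the union, taken in the completion.
\<close>

definition T_tau :: "nat \<Rightarrow> real \<Rightarrow> cpoint set" where
  "T_tau d \<eta> = mtopology_of (fp_completion d) closure_of (\<Union>n. fp_embed d ` rtree d \<eta> n)"

definition simple_arc :: "nat \<Rightarrow> real \<Rightarrow> nat \<Rightarrow> fpword \<Rightarrow> fpword \<Rightarrow> bool" where
  "simple_arc d \<eta> n s t \<longleftrightarrow>
    s \<in> Vpts d \<eta> n \<and> t \<in> Vpts d \<eta> n \<and> s \<noteq> t \<and>
    seg (fp_metric d) s t \<subseteq> rtree d \<eta> n \<and> open_seg (fp_metric d) s t \<inter> Vpts d \<eta> n = {}"

definition T_tau_arc :: "nat \<Rightarrow> real \<Rightarrow> fpword \<Rightarrow> fpword \<Rightarrow> cpoint set" where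
  "T_tau_arc d \<eta> s t =
    {x \<in> T_tau d \<eta>. fp_embed d s \<notin> open_seg (fp_completion d) x (fp_embed d t) \<and>
                     fp_embed d t \<notin> open_seg (fp_completion d) x (fp_embed d s)}"


section \<open>The map from words to points\<close>

text \<open>For a prefix \<open>u\<close> of \<open>\<omega>\<close>, \<open>orbit_point d \<eta> (u\<^sup>-\<^sup>1)\<close> is the image of the word \<open>u\<^sup>-\<^sup>1\<omega>\<close>.\<close>

definition orbit_point :: "nat \<Rightarrow> real \<Rightarrow> sword \<Rightarrow> fpword" where
  "orbit_point d \<eta> g =
    (let x = inv_into (\<Union>n. branch_verts d n) (f_zero d) g in nu d \<eta> (birth d x) x)"

primrec ps_inverse :: "nat \<Rightarrow> (nat \<Rightarrow> nat list \<times> nat \<times> nat list) \<Rightarrow> nat \<Rightarrow> sword" where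
  "ps_inverse d D 0 = fg_inv (fg_pos (fst (D 0)))"
| "ps_inverse d D (Suc n) =
    fg_mult (ps_inverse d D n) ((fg_sigma d ^^ Suc n) (fg_inv (fg_pos (fst (D (Suc n))))))"

definition f_Q :: "nat \<Rightarrow> real \<Rightarrow> (nat \<Rightarrow> nat) \<Rightarrow> cpoint" where
  "f_Q d \<eta> V =
    (if V \<in> Omega_orbit d then
       (let l = (THE l. V = sshift l (omega d))
        in fp_embed d (orbit_point d \<eta> (fg_inv (fg_pos (sprefix l (omega d))))))
     else
       (let W = (THE W. W \<in> Omega d \<and> (\<forall>i. W (int i) = V i));
            D = (THE D. ps_development d W D)
        in (THE q. limitin (mtopology_of (fp_completion d))
                     (\<lambda>n. fp_embed d (orbit_point d \<eta> (ps_inverse d D n))) q sequentially)))"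

end

theory Submission
  imports Defs
begin

text \<open>
  An edge \<open>(x, y, i)\<close> of \<open>T\<^sub>n\<^sup>s\<close> whose origin is the branch vertex with \<open>f\<^sub>0(x) = u\<^sup>-\<^sup>1\<close> corresponds to the set
  of those \<open>V\<close> for which \<open>uV = \<sigma>\<^sup>n(X)\<close> with \<open>X\<close> preceded by a letter \<open>c(i)\<close>; substituting an edge of
  colour \<open>2\<close> splits this set according to the letter two places to the left. Each prefix of \<open>\<omega>\<close> of length
  \<open>k\<close> is split off exactly once, and the lengths split off at consecutive stages are consecutive
  intervals. Since the left special words are exactly the prefixes of \<open>\<omega>\<close>, the sets attached to the
  edges of stage \<open>n\<close> are therefore exactly the cylinders of length \<open>m\<close>.

  On the geometric side the edges of stage \<open>n\<close> are in gated position in the real tree, so that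
  \<open>T\<^sub>\<tau>(s, t)\<close> is the closure of the vertices descending from the edge \<open>[s, t]\<close>. Both
  families of sets are refined by the same substitution, the pieces of the tree have diameters tending
  to \<open>0\<close> and the cylinders are compact; hence \<open>f\<^sub>Q\<close> maps the cylinder of an edge onto its piece.
\<close>

section \<open>Symbolic side: desubstitution, left special words, cylinders and the count of
  prefixes\<close>

section \<open>Infinite words\<close>

text \<open>Two points shape the development. First, facts about the embedded tree are obtained as
  equalities of distances between vertices, not from the topology of arcs. Even the freshness of new
  vertices is read off from edge lengths, which for a fixed colour shrink with the stage; these
  lengths are consistent because eta^d = eta + 1 makes an edge of colour 2 as long as its two
  halves. Second, the condition defining T_tau(s,t) does not pass to limits by itself, so vertices
  descending from an edge are shown to satisfy a stronger linear inequality
  (\<open>desc_separation\<close>) that survives the closure. On the symbolic side the cylinders of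
  one stage overlap in orbit points of omega; uniqueness of P_u is therefore proved on the geometric
  side, where pieces of different edges differ. The bookkeeping of lengths is uniform because the
  empty word counts as appearing at stage -(d-2): with this convention the prefixes attached to a
  colour are those that appeared during an interval of stages.\<close>

lemma length_sprefix [simp]: "length (sprefix n V) = n"
  by (simp add: sprefix_def)

lemma nth_sprefix [simp]: "i < n \<Longrightarrow> sprefix n V ! i = V i"
  by (simp add: sprefix_def)

lemma sprefix_0 [simp]: "sprefix 0 V = []"
  by (simp add: sprefix_def)

lemma sprefix_Suc: "sprefix (Suc n) V = sprefix n V @ [V n]"
  by (simp add: sprefix_def)

lemma sprefix_add: "sprefix (m + n) V = sprefix m V @ sprefix n (sshift m V)"
  by (rule nth_equalityI) (auto simp: nth_append sshift_def add.commute)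

lemma take_sprefix: "take m (sprefix n V) = sprefix (min m n) V"
  by (rule nth_equalityI) auto

lemma sprefix_mono: "m \<le> n \<Longrightarrow> prefix (sprefix m V) (sprefix n V)"
  by (metis min.absorb1 take_is_prefix take_sprefix)

lemma sprefix_eq_iff: "sprefix n V = sprefix n V' \<longleftrightarrow> (\<forall>i<n. V i = V' i)"
  by (auto simp: list_eq_iff_nth_eq)

lemma sprefix_eq_mono: "sprefix n V = sprefix n V' \<Longrightarrow> m \<le> n \<Longrightarrow> sprefix m V = sprefix m V'"
  by (auto simp: sprefix_eq_iff)

lemma eq_if_sprefix_eq: "(\<And>n. sprefix n V = sprefix n V') \<Longrightarrow> V = V'"
  by (metis lessI sprefix_eq_iff ext)

lemma swapp_Nil [simp]: "swapp [] V = V"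
  by (simp add: swapp_def)

lemma swapp_append: "swapp (u @ v) V = swapp u (swapp v V)"
  by (auto simp: swapp_def fun_eq_iff nth_append)

lemma swapp_Cons_0 [simp]: "swapp (a # u) V 0 = a"
  by (simp add: swapp_def)

lemma swapp_Cons_Suc [simp]: "swapp (a # u) V (Suc i) = swapp u V i"
  by (simp add: swapp_def)

lemma sshift_0 [simp]: "sshift 0 V = V"
  by (simp add: sshift_def)

lemma sshift_sshift: "sshift m (sshift n V) = sshift (m + n) V"
  by (simp add: sshift_def add.assoc)

lemma sshift_swapp [simp]: "sshift (length u) (swapp u V) = V"
  by (simp add: sshift_def swapp_def)

lemma swapp_sprefix_sshift: "swapp (sprefix n V) (sshift n V) = V"
  by (auto simp: swapp_def sshift_def fun_eq_iff)

lemma swapp_inject [simp]: "swapp u V = swapp u V' \<longleftrightarrow> V = V'"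
  by (metis sshift_swapp)

lemma sprefix_swapp_length [simp]: "sprefix (length u) (swapp u V) = u"
  by (rule nth_equalityI) (auto simp: swapp_def)

lemma sprefix_swapp: "sprefix (length u + n) (swapp u V) = u @ sprefix n V"
  by (simp add: sprefix_add)

lemma sprefix_swapp_le: "n \<le> length u \<Longrightarrow> sprefix n (swapp u V) = take n u"
  by (rule nth_equalityI) (auto simp: swapp_def)

text \<open>Compactness for a finite alphabet: a word is good if it begins infinitely many terms,
  and by pigeonhole a good word has a good extension by one letter. A cluster point is enough later,
  since the cylinders that must contain it are nested.\<close>

lemma konig_words:
  fixes V :: "nat \<Rightarrow> nat \<Rightarrow> nat"
  assumes "finite A" and VA: "\<And>N i. V N i \<in> A"
  shows "\<exists>X. \<forall>l. infinite {N. sprefix l (V N) = sprefix l X}"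
proof -
  define good where "good w = infinite {N. sprefix (length w) (V N) = w}" for w
  have ext: "\<exists>a. good (w @ [a])" if "good w" for w
  proof (rule ccontr)
    assume "\<not> ?thesis"
    then have "\<forall>a. finite {N. sprefix (length (w @ [a])) (V N) = w @ [a]}"
      by (auto simp: good_def)
    then have "finite (\<Union>a\<in>A. {N. sprefix (length (w @ [a])) (V N) = w @ [a]})"
      using assms(1) by blast
    moreover have "{N. sprefix (length w) (V N) = w} \<subseteq> (\<Union>a\<in>A. {N. sprefix (length (w @ [a])) (V N) = w @ [a]})"
      using VA by (auto simp: sprefix_Suc)
    ultimately show False using that finite_subset unfolding good_def by blast
  qed
  define ws where "ws = rec_nat [] (\<lambda>_ w. w @ [SOME a. good (w @ [a])])"
  have ws: "ws 0 = []" "\<And>n. ws (Suc n) = ws n @ [SOME a. good (ws n @ [a])]"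
    by (simp_all add: ws_def)
  have len: "length (ws n) = n" for n by (induction n) (simp_all add: ws)
  have g: "good (ws n)" for n
  proof (induction n)
    case 0 then show ?case by (simp add: ws good_def)
  next
    case (Suc n) then show ?case using someI_ex[OF ext] by (simp add: ws)
  qed
  define X where "X n = ws (Suc n) ! n" for n
  have "sprefix n X = ws n" for n
  proof (induction n)
    case (Suc n)
    then show ?case by (simp add: sprefix_Suc X_def ws len nth_append)
  qed (simp add: ws)
  then show ?thesis using g len unfolding good_def by metis
qed

section \<open>The language of the substitution\<close>

locale subst =
  fixes d :: nat
  assumes d3: "3 \<le> d"
begin

abbreviation "sg \<equiv> sigma_word d"
abbreviation "om \<equiv> omega d"

definition L :: "nat \<Rightarrow> nat" where
  "L n = length ((sg ^^ n) [1])"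

lemma sg_Nil [simp]: "sg [] = []"
  by (simp add: sigma_word_def)

lemma sg_Cons: "sg (a # w) = sigma_letter d a @ sg w"
  by (simp add: sigma_word_def)

lemma sl_nonempty [simp]: "sigma_letter d a \<noteq> []"
  by (simp add: sigma_letter_def)

lemma length_sl_pos: "0 < length (sigma_letter d a)"
  by simp

lemma length_sg: "length w \<le> length (sg w)"
proof (induction w)
  case (Cons a w)
  then show ?case using length_sl_pos[of a] by (simp add: sg_Cons del: length_greater_0_conv)
qed simp

lemma sg_pow_Nil [simp]: "(sg ^^ n) [] = []"
  by (induction n) simp_all

lemma sprefix_omega: "n \<le> L N \<Longrightarrow> sprefix n om = take n ((sg ^^ N) [1])"
  using omega_limit[where n = N] by (intro nth_equalityI) (auto simp: L_def)

lemma sprefix_omega_L: "sprefix (L N) om = (sg ^^ N) [1]"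
  using sprefix_omega[of "L N" N] by (simp add: L_def)

lemma L_gt: "n < L n"
  using length_sigma_pow by (simp add: L_def)

text \<open>Replaces positions in the limit word by finite iterates, which makes the closure of the
  language under factors and under sigma visible.\<close>

lemma lang_iff: "w \<in> lang d \<longleftrightarrow> (\<exists>N. sublist w ((sg ^^ N) [1]))"
proof
  assume "w \<in> lang d"
  then obtain l n where "w = sprefix l (sshift n om)" by (auto simp: lang_def)
  then have "sprefix (n + l) om = sprefix n om @ w"
    by (simp add: sprefix_add)
  moreover have "prefix (sprefix (n + l) om) ((sg ^^ (n + l)) [1])"
    using sprefix_omega[of "n + l" "n + l"] L_gt[of "n + l"] by (simp add: take_is_prefix)
  ultimately have "sublist w ((sg ^^ (n + l)) [1])"
    by (auto simp: prefix_def)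
  then show "\<exists>N. sublist w ((sg ^^ N) [1])" by blast
next
  assume "\<exists>N. sublist w ((sg ^^ N) [1])"
  then obtain N u v where uv: "(sg ^^ N) [1] = u @ w @ v" by (auto simp: sublist_def)
  then have "sprefix (length u + length w) om = u @ w"
    using sprefix_omega[of "length u + length w" N] by (simp add: L_def)
  then have "w = sprefix (length w) (sshift (length u) om)" by (simp add: sprefix_add)
  then show "w \<in> lang d" by (auto simp: lang_def)
qed

lemma lang_sublist: "w \<in> lang d \<Longrightarrow> sublist v w \<Longrightarrow> v \<in> lang d"
  unfolding lang_iff by (meson sublist_order.order_trans)

lemma sg_sublist: "sublist v w \<Longrightarrow> sublist (sg v) (sg w)"
  unfolding sublist_def by (metis sigma_append)

lemma lang_sg: "w \<in> lang d \<Longrightarrow> sg w \<in> lang d"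
  unfolding lang_iff by (metis comp_apply funpow.simps(2) sg_sublist)

text \<open>A condition on two-letter factors that the language satisfies but that does not
  characterise it. Its use: a letter other than 1 determines the letter before it; in particular 2
  only follows 1.\<close>

definition adm :: "nat list \<Rightarrow> bool" where
  "adm w \<longleftrightarrow> set w \<subseteq> {1..d} \<and> successively (\<lambda>a b. b = 1 \<or> b = Suc a) w"

lemma adm_Cons: "adm (a # w) \<longleftrightarrow> a \<in> {1..d} \<and> adm w \<and> (w = [] \<or> hd w = 1 \<or> hd w = Suc a)"
  by (auto simp: adm_def successively_Cons)

lemma adm_append: "adm (u @ v) \<longleftrightarrow> adm u \<and> adm v \<and> (u = [] \<or> v = [] \<or> hd v = 1 \<or> hd v = Suc (last u))"
  by (auto simp: adm_def successively_append_iff)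

lemma hd_sg_Cons: "hd (sg (b # w)) = (if b = 1 \<or> b = d then 1 else Suc b)"
  by (auto simp: sg_Cons sigma_letter_def)

lemma adm_sl: "a \<in> {1..d} \<Longrightarrow> adm (sigma_letter d a)"
  using d3 by (auto simp: adm_def sigma_letter_def)

lemma last_sl: "last (sigma_letter d a) = (if a = d then 1 else Suc a)"
  using d3 by (auto simp: sigma_letter_def)

lemma adm_sg: "adm w \<Longrightarrow> adm (sg w)"
proof (induction w)
  case (Cons a w)
  then have *: "a \<in> {1..d}" "adm (sg w)" by (simp_all add: adm_Cons)
  show ?case
  proof (cases w)
    case Nil
    then show ?thesis using * by (simp add: sg_Cons adm_sl)
  next
    case (Cons b w')
    then have "b = 1 \<or> b = Suc a" "b \<le> d" using Cons.prems by (auto simp: adm_Cons)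
    then have "hd (sg w) = 1 \<or> hd (sg w) = Suc (last (sigma_letter d a))"
      unfolding Cons hd_sg_Cons last_sl by auto
    then show ?thesis using * by (simp add: sg_Cons[of a] adm_append adm_sl)
  qed
qed (simp add: adm_def)

lemma adm_sg_pow: "adm w \<Longrightarrow> adm ((sg ^^ n) w)"
  by (induction n) (simp_all add: adm_sg)

lemma adm_sublist: "adm w \<Longrightarrow> sublist v w \<Longrightarrow> adm v"
  by (auto simp: sublist_def adm_append)

lemma adm_lang: "w \<in> lang d \<Longrightarrow> adm w"
proof -
  assume "w \<in> lang d"
  then obtain N where "sublist w ((sg ^^ N) [1])" by (auto simp only: lang_iff)
  moreover have "adm [1]" using d3 by (simp add: adm_def)
  ultimately show ?thesis using adm_sg_pow adm_sublist by blast
qed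

lemma sg_pow_1: "n < d \<Longrightarrow> (sg ^^ n) [1] = [1..<Suc (Suc n)]"
proof (induction n)
  case (Suc n)
  have "sg [1..<Suc k] = [1..<Suc (Suc k)]" if "1 \<le> k" "k < d" for k
    using that
  proof (induction k rule: dec_induct)
    case base
    then show ?case using d3 by (simp add: sg_Cons sigma_letter_def upt_rec)
  next
    case (step k)
    then have "sg [1..<Suc (Suc k)] = sg ([1..<Suc k] @ [Suc k])" by simp
    also have "\<dots> = sg [1..<Suc k] @ sg [Suc k]" by (rule sigma_append)
    also have "sg [Suc k] = [Suc (Suc k)]" using step by (simp add: sg_Cons sigma_letter_def)
    finally show ?case using step by simp
  qed
  from this[of "Suc n"] Suc show ?case by simp
qed simp

lemma sg_pow_d: "(sg ^^ d) [1] = [1..<Suc d] @ [1]"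
proof -
  have "(sg ^^ d) [1] = (sg ^^ (d - 1)) [1] @ (sg ^^ (d - 1)) [2]"
    using sigma_pow_Suc[of "d - 1" d] d3 by simp
  moreover have "k \<le> d - 2 \<Longrightarrow> (sg ^^ k) [2] = [2 + k]" for k
    by (induction k) (auto simp: sg_Cons sigma_letter_def)
  from this[of "d - 2"] have "(sg ^^ (d - 1)) [2] = [1]"
    using d3 funpow.simps(2)[of "d - 2" sg] by (simp add: sg_Cons sigma_letter_def Suc_diff_Suc numeral_2_eq_2 del: funpow.simps)
  ultimately show ?thesis using sg_pow_1[of "d - 1"] d3 by simp
qed

text \<open>The word sigma^d(1) = 1 2 ... d 1 ends in 1, so sigma^N(1) recurs inside sigma^(N+d)(1)
  at a position other than the first. Hence even an initial factor of omega has a letter to its left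
  somewhere.\<close>

lemma lang_left:
  assumes "w \<in> lang d"
  shows "\<exists>a\<in>{1..d}. a # w \<in> lang d"
proof -
  obtain N u v where uv: "(sg ^^ N) [1] = u @ w @ v"
    using assms by (auto simp: lang_iff sublist_def)
  have "(sg ^^ (N + d)) [1] = (sg ^^ N) ((sg ^^ d) [1])" by (simp add: funpow_add)
  also have "\<dots> = (sg ^^ N) [1..<Suc d] @ u @ w @ v" 
    unfolding sg_pow_d sigma_pow_append uv ..
  finally have e: "(sg ^^ (N + d)) [1] = ((sg ^^ N) [1..<Suc d] @ u) @ w @ v" by simp
  have "(sg ^^ N) [1..<Suc d] \<noteq> []" using d3 by (intro sigma_pow_nonempty) auto
  then obtain y a where y: "(sg ^^ N) [1..<Suc d] @ u = y @ [a]"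
    by (metis append_is_Nil_conv rev_exhaust)
  have "a # w \<in> lang d"
    unfolding lang_iff sublist_def using e y by (intro exI[of _ "N + d"] exI[of _ y] exI[of _ v]) simp
  then show ?thesis using adm_lang[of "a # w"] by (auto simp: adm_Cons)
qed

lemma lang_map_range: "w \<in> lang d \<Longrightarrow> set w \<subseteq> {1..d}"
  using adm_lang by (auto simp: adm_def)

section \<open>The one-sided system\<close>

text \<open>Closure in a product of discrete spaces is tested on basic open sets fixing finitely
  many coordinates, that is on prefixes.\<close>

lemma Omega_plus_iff: "V \<in> Omega_plus d \<longleftrightarrow> (\<forall>l. sprefix l V \<in> lang d)"
proof
  assume V: "V \<in> Omega_plus d"
  show "\<forall>l. sprefix l V \<in> lang d"
  proof
    fix l
    define U where "U = (\<Pi>\<^sub>E i\<in>UNIV. if i < l then {V i} else (UNIV :: nat set))"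
    have "open U" unfolding U_def
    proof (rule open_PiE)
      show "\<And>i. open (if i < l then {V i} else UNIV)" by (simp add: open_discrete)
      show "finite {i. (if i < l then {V i} else UNIV) \<noteq> UNIV}"
        by (rule finite_subset[of _ "{..<l}"]) auto
    qed
    moreover have "V \<in> U" by (auto simp: U_def)
    ultimately obtain X where "X \<in> Omega_orbit d" "X \<in> U"
      using V unfolding Omega_plus_def closure_iff_nhds_not_empty by (metis Int_emptyI order_refl)
    moreover then have "sprefix l X = sprefix l V"
      by (auto simp: U_def sprefix_eq_iff PiE_iff split: if_splits)
    moreover obtain n where "X = sshift n om" using \<open>X \<in> Omega_orbit d\<close> by (auto simp: Omega_orbit_def)
    ultimately have "sprefix l V = sprefix l (sshift n om)" by simp
    then show "sprefix l V \<in> lang d" unfolding lang_def by blast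
  qed
next
  assume V: "\<forall>l. sprefix l V \<in> lang d"
  have "\<exists>X\<in>Omega_orbit d. X \<in> U" if "open U" "V \<in> U" for U
  proof -
    have "openin (product_topology (\<lambda>i. euclidean) UNIV) U" using that by (simp add: open_fun_def)
    from product_topology_open_contains_basis[OF this \<open>V \<in> U\<close>]
    obtain B where B: "V \<in> (\<Pi>\<^sub>E i\<in>UNIV. B i)" "finite {i. B i \<noteq> UNIV}" "(\<Pi>\<^sub>E i\<in>UNIV. B i) \<subseteq> U"
      by auto
    define l where "l = Suc (Max (insert 0 {i. B i \<noteq> UNIV}))"
    have l: "i < l" if "B i \<noteq> UNIV" for i
      using B(2) that by (simp add: l_def less_Suc_eq_le)
    obtain n k where n: "sprefix l V = sprefix k (sshift n om)"
      using V unfolding lang_def by blast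
    then have "k = l" by (metis length_sprefix)
    with n have "\<forall>i<l. sshift n om i = V i" by (simp add: sprefix_eq_iff)
    then have "sshift n om \<in> (\<Pi>\<^sub>E i\<in>UNIV. B i)"
      using B(1) l by (auto simp: PiE_iff) (metis UNIV_I)
    then show ?thesis using B(3) by (auto simp: Omega_orbit_def)
  qed
  then show "V \<in> Omega_plus d"
    unfolding Omega_plus_def closure_iff_nhds_not_empty by (metis disjoint_iff subsetD)
qed

lemma Omega_plus_sshift: "V \<in> Omega_plus d \<Longrightarrow> sshift n V \<in> Omega_plus d"
  unfolding Omega_plus_iff by (metis lang_sublist sprefix_add sublist_append_leftI)

lemma Omega_plus_swapp: "swapp u V \<in> Omega_plus d \<Longrightarrow> V \<in> Omega_plus d"
  using Omega_plus_sshift[of "swapp u V" "length u"] by simp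

lemma om_Omega_plus: "sshift n om \<in> Omega_plus d"
  unfolding Omega_plus_iff lang_def by blast

lemma Omega_plus_letter: "V \<in> Omega_plus d \<Longrightarrow> V i \<in> {1..d}"
proof -
  assume "V \<in> Omega_plus d"
  then have "sprefix (Suc i) V \<in> lang d" by (simp only: Omega_plus_iff)
  from lang_map_range[OF this] show ?thesis by (simp add: sprefix_Suc)
qed

lemma Omega_plus_step: "V \<in> Omega_plus d \<Longrightarrow> V (Suc i) = 1 \<or> V (Suc i) = Suc (V i)"
proof -
  assume "V \<in> Omega_plus d"
  then have "sprefix (Suc (Suc i)) V \<in> lang d" by (simp only: Omega_plus_iff)
  from adm_lang[OF this] show ?thesis by (auto simp: sprefix_Suc adm_append adm_Cons)
qed

lemma swapp_lang: "swapp u V \<in> Omega_plus d \<Longrightarrow> u \<in> lang d"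
  by (metis Omega_plus_iff sprefix_swapp_length)

lemma lang_swapp: "w \<in> lang d \<Longrightarrow> \<exists>V. swapp w V \<in> Omega_plus d"
proof -
  assume "w \<in> lang d"
  then obtain n where "w = sprefix (length w) (sshift n om)" unfolding lang_def by (auto)
  then have "swapp w (sshift (length w) (sshift n om)) = sshift n om"
    by (metis swapp_sprefix_sshift)
  then show ?thesis using om_Omega_plus by metis
qed

text \<open>Compactness again: if every letter failed at some finite length,
  \<open>lang_left\<close> applied at the largest of these lengths would give a
  contradiction.\<close>

lemma Omega_plus_left:
  assumes "V \<in> Omega_plus d"
  shows "\<exists>a\<in>{1..d}. swapp [a] V \<in> Omega_plus d"
proof (rule ccontr)
  assume "\<not> ?thesis"
  then have "\<forall>a\<in>{1..d}. \<exists>l. sprefix l (swapp [a] V) \<notin> lang d" by (auto simp: Omega_plus_iff)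
  then obtain l where l: "\<And>a. a \<in> {1..d} \<Longrightarrow> sprefix (l a) (swapp [a] V) \<notin> lang d" by metis
  define M where "M = Max (l ` {1..d})"
  obtain a where a: "a \<in> {1..d}" "a # sprefix M V \<in> lang d"
    using lang_left assms unfolding Omega_plus_iff by blast
  have "l a \<le> M" using a by (simp add: M_def)
  then have "prefix (sprefix (l a) (swapp [a] V)) (sprefix (Suc M) (swapp [a] V))"
    by (intro sprefix_mono) simp
  moreover have "sprefix (Suc M) (swapp [a] V) = a # sprefix M V"
    using sprefix_swapp[of "[a]" M V] by simp
  ultimately show False using l[OF a(1)] a(2) lang_sublist by (metis prefix_imp_sublist)
qed

section \<open>The substitution on infinite words\<close>

text \<open>The action of sigma on infinite words. Index i may be read from the image of i+1 letters
  because sigma shortens no word (\<open>length_sg\<close>).\<close>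

definition SS :: "(nat \<Rightarrow> nat) \<Rightarrow> nat \<Rightarrow> nat" where
  "SS V i = sg (sprefix (Suc i) V) ! i"

lemma SS_prefix: "sprefix (length (sg (sprefix l V))) (SS V) = sg (sprefix l V)"
proof (rule nth_equalityI)
  fix i assume "i < length (sprefix (length (sg (sprefix l V))) (SS V))"
  then have i: "i < length (sg (sprefix l V))" by simp
  have i2: "i < length (sg (sprefix (Suc i) V))"
    using length_sg[of "sprefix (Suc i) V"] by simp
  have "prefix (sg (sprefix l V)) (sg (sprefix (Suc i) V)) \<or> prefix (sg (sprefix (Suc i) V)) (sg (sprefix l V))"
    by (metis nat_le_linear prefix_def sigma_append sprefix_mono)
  then have "sg (sprefix (Suc i) V) ! i = sg (sprefix l V) ! i"
    using i i2 by (auto simp: prefix_def nth_append)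
  then show "sprefix (length (sg (sprefix l V))) (SS V) ! i = sg (sprefix l V) ! i"
    using i by (simp add: SS_def)
qed simp

lemma SS_unique:
  assumes "\<And>l. sprefix (length (sg (sprefix l V))) X = sg (sprefix l V)"
  shows "X = SS V"
proof (rule eq_if_sprefix_eq)
  fix n
  have "sprefix (length (sg (sprefix n V))) X = sprefix (length (sg (sprefix n V))) (SS V)"
    using assms SS_prefix by simp
  moreover have "n \<le> length (sg (sprefix n V))" using length_sg[of "sprefix n V"] by simp
  ultimately show "sprefix n X = sprefix n (SS V)" by (rule sprefix_eq_mono)
qed

lemma SS_swapp: "SS (swapp u V) = swapp (sg u) (SS V)"
proof (rule SS_unique[symmetric])
  fix l
  show "sprefix (length (sg (sprefix l (swapp u V)))) (swapp (sg u) (SS V)) = sg (sprefix l (swapp u V))"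
  proof (cases "l \<le> length u")
    case True
    obtain v where "u = take l u @ v" by (metis append_take_drop_id)
    then have "sg u = sg (take l u) @ sg v" by (metis sigma_append)
    then show ?thesis using True by (simp add: sprefix_swapp_le)
  next
    case False
    then obtain k where "l = length u + k" by (metis le_add_diff_inverse nat_le_linear)
    then show ?thesis by (simp add: sprefix_swapp sigma_append SS_prefix)
  qed
qed

lemma SS_pow_swapp: "(SS ^^ n) (swapp u V) = swapp ((sg ^^ n) u) ((SS ^^ n) V)"
  by (induction n) (simp_all add: SS_swapp)

lemma SS_om: "SS om = om"
proof (rule SS_unique[symmetric])
  fix l
  have "sprefix l om = take l ((sg ^^ l) [1])" using sprefix_omega[of l l] L_gt[of l] by simp
  then obtain v where "(sg ^^ l) [1] = sprefix l om @ v" by (metis append_take_drop_id)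
  then have *: "(sg ^^ Suc l) [1] = sg (sprefix l om) @ sg v" by (simp add: sigma_append)
  then have "length (sg (sprefix l om)) \<le> L (Suc l)" by (simp add: L_def)
  then show "sprefix (length (sg (sprefix l om))) om = sg (sprefix l om)"
    using * by (simp add: sprefix_omega)
qed

lemma SS_pow_om [simp]: "(SS ^^ n) om = om"
  by (induction n) (simp_all add: SS_om)

lemma SS_Omega_plus: "V \<in> Omega_plus d \<Longrightarrow> SS V \<in> Omega_plus d"
proof -
  assume V: "V \<in> Omega_plus d"
  have "sprefix l (SS V) \<in> lang d" for l
  proof -
    have "l \<le> length (sg (sprefix l V))" using length_sg[of "sprefix l V"] by simp
    then have "prefix (sprefix l (SS V)) (sg (sprefix l V))" by (metis SS_prefix sprefix_mono)
    then show ?thesis using V lang_sg lang_sublist unfolding Omega_plus_iff by (metis prefix_imp_sublist)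
  qed
  then show ?thesis by (simp add: Omega_plus_iff)
qed

lemma SS_pow_Omega_plus: "V \<in> Omega_plus d \<Longrightarrow> (SS ^^ n) V \<in> Omega_plus d"
  by (induction n) (simp_all add: SS_Omega_plus)

lemma swapp_sprefix_0: "swapp [V 0] (sshift 1 V) = V"
  using swapp_sprefix_sshift[of 1 V] by (simp add: sprefix_Suc)

lemma SS_0: "SS V 0 = (if V 0 = 1 \<or> V 0 = d then 1 else Suc (V 0))"
  by (simp add: SS_def sprefix_Suc sg_Cons sigma_letter_def)

lemma SS_neq2: "V 0 \<in> {1..d} \<Longrightarrow> SS V 0 \<noteq> 2"
  using d3 by (auto simp: SS_0)

section \<open>Desubstitution\<close>

text \<open>The letter 2 starts no block, it only ends sigma(1) = 12. Hence a cut in front of any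
  other letter falls between two blocks.\<close>

lemma sg_cut:
  assumes "set W \<subseteq> {1..d}" "sg W = y @ t" "t = [] \<or> hd t \<noteq> 2"
  shows "\<exists>W1 W2. W = W1 @ W2 \<and> sg W1 = y \<and> sg W2 = t"
  using assms
proof (induction W arbitrary: y)
  case (Cons a W)
  show ?case
  proof (cases "y = []")
    case True
    then show ?thesis using Cons.prems by (intro exI[of _ "[]"] exI[of _ "a # W"]) auto
  next
    case False
    have "\<exists>y'. y = sigma_letter d a @ y'"
    proof (cases "a = 1")
      case True
      then have "[1, 2] @ sg W = y @ t" using Cons.prems by (simp add: sg_Cons sigma_letter_def)
      then show ?thesis using False Cons.prems(3) True
        by (cases y; cases "tl y") (auto simp: sigma_letter_def)
    next
      case a: False
      then obtain c where c: "sigma_letter d a = [c]" by (cases "a = d") (auto simp: sigma_letter_def)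
      then show ?thesis using Cons.prems False by (cases y) (auto simp: sg_Cons)
    qed
    then obtain y' where y': "y = sigma_letter d a @ y'" by blast
    then have "sg W = y' @ t" using Cons.prems by (simp add: sg_Cons)
    from Cons.IH[OF _ this] Cons.prems obtain W1 W2 where "W = W1 @ W2" "sg W1 = y'" "sg W2 = t" by auto
    then show ?thesis using y' by (intro exI[of _ "a # W1"] exI[of _ W2]) (simp add: sg_Cons)
  qed
qed auto

text \<open>The only ambiguity in reading blocks from the left is between sigma(1) = 12 and sigma(d)
  = 1, and the next letter settles it. The condition on \<open>t\<close> does this for the last
  block of \<open>sg w\<close>.\<close>

lemma sg_decode:
  assumes "set W \<subseteq> {1..d}" "set w \<subseteq> {1..d}" "sg W = sg w @ t" "t = [] \<or> hd t \<noteq> 2"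
  shows "\<exists>W'. W = w @ W' \<and> sg W' = t"
  using assms
proof (induction w arbitrary: W)
  case (Cons b w)
  have "sg W \<noteq> []" using Cons.prems by (simp add: sg_Cons)
  then obtain a W' where W: "W = a # W'" by (cases W) auto
  have eq: "sigma_letter d a @ sg W' = sigma_letter d b @ sg w @ t"
    using Cons.prems(3) by (simp add: W sg_Cons)
  have n2: "hd (sg v) \<noteq> 2" if "v \<noteq> []" "set v \<subseteq> {1..d}" for v
    using that hd_sg_Cons[of "hd v" "tl v"] d3 by (cases v) auto
  have h1: "sg W' = [] \<or> hd (sg W') \<noteq> 2" using n2[of W'] Cons.prems(1) W by (cases W') auto
  have h2: "sg w @ t = [] \<or> hd (sg w @ t) \<noteq> 2"
    using n2[of w] Cons.prems by (cases w) (auto simp: sg_Cons hd_append)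
  have "a = b"
    using eq h1 h2 Cons.prems(1,2) W d3
    by (cases "sg W'"; cases "sg w @ t") (auto simp: sigma_letter_def split: if_splits)
  then have "sg W' = sg w @ t" using eq by simp
  from Cons.IH[OF _ _ this] Cons.prems W \<open>a = b\<close> show ?case by auto
qed auto

text \<open>Inverse of the cyclic permutation that sends a to the last letter of sigma(a), which is
  \<open>succ_letter\<close> below.\<close>

definition pred_letter :: "nat \<Rightarrow> nat" where
  "pred_letter b = (if b = 1 then d else b - 1)"

lemma pred_last_sl: "a \<in> {1..d} \<Longrightarrow> pred_letter (last (sigma_letter d a)) = a"
  by (auto simp: pred_letter_def last_sl)

lemma lang_pow_Suc:
  assumes "w \<in> lang d"
  shows "\<exists>W. set W \<subseteq> {1..d} \<and> sublist w (sg W) \<and> W \<in> lang d"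
proof -
  obtain N where N: "sublist w ((sg ^^ N) [1])" using assms lang_iff by auto
  have "prefix ((sg ^^ N) [1]) ((sg ^^ Suc N) [1])" by (rule sigma_pow_prefix) simp
  then have "sublist w ((sg ^^ Suc N) [1])" using N by (meson prefix_imp_sublist sublist_order.order_trans)
  moreover have "(sg ^^ N) [1] \<in> lang d" unfolding lang_iff by blast
  ultimately show ?thesis using lang_map_range by auto
qed

text \<open>The last letter of sigma(a) determines a, so a left extension can be desubstituted
  although only the end of its first block is visible. The letter \<open>x\<close>, being different
  from 2, certifies that the last block of \<open>sg w\<close> is complete.\<close>

lemma lang_desubst_left:
  assumes "b # sg w @ [x] \<in> lang d" "x \<noteq> 2" "set w \<subseteq> {1..d}" "w \<noteq> []"
  shows "pred_letter b # w \<in> lang d"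
proof -
  obtain W y z where W: "set W \<subseteq> {1..d}" "W \<in> lang d" "sg W = y @ (b # sg w @ [x]) @ z"
    using lang_pow_Suc[OF assms(1)] by (auto simp: sublist_def)
  have "sg W = (y @ [b]) @ (sg w @ x # z)" using W by simp
  moreover have "hd (sg w @ x # z) \<noteq> 2"
    using assms(3,4) hd_sg_Cons[of "hd w" "tl w"] d3 by (cases w) (auto simp: sg_Cons)
  ultimately obtain W1 W2 where W12: "W = W1 @ W2" "sg W1 = y @ [b]" "sg W2 = sg w @ x # z"
    using sg_cut[OF W(1)] by blast
  then obtain W3 where W3: "W2 = w @ W3"
    using sg_decode[of W2 w "x # z"] W(1) assms(2,3) by auto
  have "W1 \<noteq> []" using W12(2) by auto
  then obtain W0 a where W0: "W1 = W0 @ [a]" by (metis rev_exhaust)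
  have "sg W0 @ sigma_letter d a = y @ [b]" using W12(2) W0 by (simp add: sigma_append sg_Cons)
  then have "last (sigma_letter d a) = b" by (metis last_appendR last_snoc sl_nonempty)
  then have "pred_letter b = a" using pred_last_sl[of a] W(1) W12(1) W0 by auto
  then have "W = W0 @ (pred_letter b # w) @ W3" using W12 W0 W3 by simp
  then show ?thesis using W(2) lang_sublist by (metis sublist_appendI)
qed

lemma SS_prefix_next:
  assumes "\<And>i. V i \<in> {1..d}"
  shows "\<exists>x. x \<noteq> 2 \<and> prefix (sg (sprefix l V) @ [x]) (sprefix (length (sg (sprefix (Suc l) V))) (SS V))"
proof -
  obtain x v where xv: "sigma_letter d (V l) = x # v" by (metis neq_Nil_conv sl_nonempty)
  have "x \<noteq> 2" using xv assms[of l] d3 by (auto simp: sigma_letter_def split: if_splits)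
  moreover have "sg (sprefix (Suc l) V) = sg (sprefix l V) @ x # v"
    by (simp add: sprefix_Suc sigma_append sg_Cons xv)
  ultimately show ?thesis by (metis SS_prefix append_Cons append_Nil append_assoc prefixI)
qed

lemma SS_Omega_plus_left:
  assumes V: "\<And>i. V i \<in> {1..d}" and X: "swapp [b] (SS V) \<in> Omega_plus d"
  shows "swapp [pred_letter b] V \<in> Omega_plus d"
  unfolding Omega_plus_iff
proof
  fix l
  obtain x where x: "x \<noteq> 2" "prefix (sg (sprefix (Suc l) V) @ [x]) (sprefix (length (sg (sprefix (Suc (Suc l)) V))) (SS V))"
    using SS_prefix_next[where V = V, OF V] by blast
  have "b # sprefix (length (sg (sprefix (Suc (Suc l)) V))) (SS V) \<in> lang d"
    using X sprefix_swapp[of "[b]"] unfolding Omega_plus_iff by (metis append_Cons append_Nil)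
  then have "b # sg (sprefix (Suc l) V) @ [x] \<in> lang d"
    using x(2) lang_sublist by (metis Cons_prefix_Cons prefix_imp_sublist)
  moreover have "sprefix (Suc l) V \<noteq> []" by (metis length_0_conv length_sprefix nat.simps(3))
  moreover have "set (sprefix (Suc l) V) \<subseteq> {1..d}" using V by (auto simp: sprefix_def)
  ultimately have *: "pred_letter b # sprefix (Suc l) V \<in> lang d"
    using lang_desubst_left x(1) by blast
  have "prefix (sprefix l (swapp [pred_letter b] V)) (sprefix (Suc (Suc l)) (swapp [pred_letter b] V))"
    by (rule sprefix_mono) simp
  also have "sprefix (Suc (Suc l)) (swapp [pred_letter b] V) = pred_letter b # sprefix (Suc l) V"
    using sprefix_swapp[of "[pred_letter b]" "Suc l" V] by simp
  finally show "sprefix l (swapp [pred_letter b] V) \<in> lang d"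
    using * lang_sublist by (metis prefix_imp_sublist)
qed

lemma SS_decode:
  assumes X: "X \<in> Omega_plus d" "X 0 \<noteq> 2"
  shows "\<exists>V. (\<forall>i. V i \<in> {1..d}) \<and> X = SS V"
proof -
  \<comment> \<open>\<open>c n\<close> is the start of block n: a block has length 2 exactly when
    its second letter is 2. The word \<open>V\<close> below reads 1 from 12, d from a 1 not followed
    by 2, and a-1 from any other a.\<close>
  define c where "c = rec_nat 0 (\<lambda>_ k. if X (Suc k) = 2 then k + 2 else k + 1)"
  have c: "c 0 = 0" "\<And>n. c (Suc n) = (if X (Suc (c n)) = 2 then c n + 2 else c n + 1)"
    by (simp_all add: c_def)
  have st: "X (Suc i) = 1 \<or> X (Suc i) = Suc (X i)" for i by (rule Omega_plus_step[OF X(1)])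
  have c2: "X (c n) \<noteq> 2" for n
  proof (induction n)
    case (Suc n)
    then show ?case using st[of "Suc (c n)"] by (auto simp: c)
  qed (simp add: c X)
  define V where "V n = (if X (Suc (c n)) = 2 then 1 else if X (c n) = 1 then d else X (c n) - 1)" for n
  have rng: "X i \<in> {1..d}" for i by (rule Omega_plus_letter[OF X(1)])
  have V: "V n \<in> {1..d}" for n
    using rng[of "c n"] c2[of n] d3 by (auto simp: V_def)
  have sl: "sigma_letter d (V n) = (if X (Suc (c n)) = 2 then [1, 2] else [X (c n)])" for n
    using rng[of "c n"] c2[of n] d3 by (auto simp: V_def sigma_letter_def)
  have pre: "sg (sprefix n V) = sprefix (c n) X" for n
  proof (induction n)
    case (Suc n)
    have "X (Suc (c n)) = 2 \<Longrightarrow> X (c n) = 1" using st[of "c n"] by auto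
    then show ?case using Suc by (auto simp: sprefix_Suc sigma_append sg_Cons sl c)
  qed (simp add: c)
  have "X = SS V" by (rule SS_unique) (simp add: pre)
  then show ?thesis using V by blast
qed

lemma SS_inject:
  assumes "\<And>i. V i \<in> {1..d}" "\<And>i. V' i \<in> {1..d}" "SS V = SS V'"
  shows "V = V'"
proof (rule eq_if_sprefix_eq)
  fix n
  obtain x where x: "x \<noteq> 2" "prefix (sg (sprefix n V) @ [x]) (sprefix (length (sg (sprefix (Suc n) V))) (SS V))"
    using SS_prefix_next[where V = V, OF assms(1)] by blast
  define M where "M = length (sg (sprefix (Suc n) V))"
  have "prefix (sprefix M (SS V)) (sg (sprefix M V'))"
    using length_sg[of "sprefix M V'"] SS_prefix[of M V'] assms(3) sprefix_mono by (metis length_sprefix)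
  then obtain t where "sg (sprefix M V') = sg (sprefix n V) @ x # t"
    using x(2) unfolding M_def prefix_def by auto
  moreover have "set (sprefix M V') \<subseteq> {1..d}" "set (sprefix n V) \<subseteq> {1..d}"
    using assms(1,2) by (auto simp: sprefix_def)
  ultimately obtain W where W: "sprefix M V' = sprefix n V @ W"
    using sg_decode x(1) by (metis list.sel(1))
  then have "n \<le> M" by (metis length_append length_sprefix le_add1)
  then show "sprefix n V = sprefix n V'"
    using W by (metis append_eq_conv_conj length_sprefix min.absorb1 take_sprefix)
qed

lemma SS_Omega_plus_iff: "(\<And>i. V i \<in> {1..d}) \<Longrightarrow> SS V \<in> Omega_plus d \<longleftrightarrow> V \<in> Omega_plus d"
  using SS_Omega_plus SS_Omega_plus_left Omega_plus_left[of "SS V"] Omega_plus_swapp by blast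

lemma Omega_plus_desubst:
  assumes "X \<in> Omega_plus d" "X 0 \<noteq> 2"
  obtains V where "V \<in> Omega_plus d" "X = SS V"
  using SS_decode[OF assms] SS_Omega_plus_iff assms by metis

lemma Omega_plus_desubst_left:
  assumes "swapp [b] X \<in> Omega_plus d" "X 0 \<noteq> 2"
  obtains V where "swapp [pred_letter b] V \<in> Omega_plus d" "X = SS V"
  using SS_decode[OF Omega_plus_swapp[OF assms(1)] assms(2)] SS_Omega_plus_left assms by metis


section \<open>Left special words\<close>

lemma om_0: "om 0 = 1"
  by (simp add: omega_def)

lemma om_letter: "om i \<in> {1..d}"
  using Omega_plus_letter[OF om_Omega_plus[of 0]] by simp

lemma om_Omega: "om \<in> Omega_plus d"
  using om_Omega_plus[of 0] by simp

lemma SS_sshift: "sshift (length (sg (sprefix j V))) (SS V) = SS (sshift j V)"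
  by (metis SS_swapp sshift_swapp swapp_sprefix_sshift)

lemma SS_1_eq_2_iff:
  assumes "V 0 \<in> {1..d}" "V 1 \<in> {1..d}"
  shows "SS V 1 = 2 \<longleftrightarrow> V 0 = 1"
proof (cases "V 0 = 1")
  case True
  then have "SS V = swapp [1, 2] (SS (sshift 1 V))"
    using SS_swapp[of "[1]" "sshift 1 V"] swapp_sprefix_0[of V] by (simp add: sg_Cons sigma_letter_def)
  then show ?thesis using True by (simp add: swapp_def)
next
  case False
  then have "SS V = swapp [SS V 0] (SS (sshift 1 V))"
    using SS_swapp[of "[V 0]" "sshift 1 V"] swapp_sprefix_0[of V] by (simp add: sg_Cons sigma_letter_def SS_0)
  then have "SS V 1 = SS (sshift 1 V) 0" by (metis One_nat_def swapp_Cons_Suc swapp_Nil)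
  moreover have "\<dots> \<noteq> 2" using SS_neq2[of "sshift 1 V"] assms(2) by (simp add: sshift_def)
  ultimately show ?thesis using False by simp
qed

lemma SS_0_eq_1: "SS V 0 = 1 \<Longrightarrow> V 0 \<in> {1..d} \<Longrightarrow> V 0 = 1 \<or> V 0 = d"
  unfolding SS_0 by (cases "V 0 = 1 \<or> V 0 = d") simp_all

lemma SS_0_collision:
  "SS V 0 = SS V' 0 \<Longrightarrow> V 0 \<noteq> V' 0 \<Longrightarrow> V 0 \<in> {1..d} \<Longrightarrow> V' 0 \<in> {1..d}
    \<Longrightarrow> V 0 = 1 \<and> V' 0 = d \<or> V 0 = d \<and> V' 0 = 1"
  unfolding SS_0 by (cases "V 0 = 1 \<or> V 0 = d"; cases "V' 0 = 1 \<or> V' 0 = d") auto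

lemma SS_0_1: "V 0 = 1 \<or> V 0 = d \<Longrightarrow> SS V 0 = 1"
  unfolding SS_0 by simp

lemma left_letter_step:
  assumes "swapp [a] V \<in> Omega_plus d"
  shows "V 0 = 1 \<or> V 0 = Suc a" "a \<in> {1..d}" "V i \<in> {1..d}"
  using Omega_plus_step[OF assms, of 0] Omega_plus_letter[OF assms, of 0] Omega_plus_letter[OF assms, of "Suc i"]
  by simp_all

lemma pred_letter_inject: "a \<in> {1..d} \<Longrightarrow> b \<in> {1..d} \<Longrightarrow> pred_letter a = pred_letter b \<Longrightarrow> a = b"
  by (auto simp: pred_letter_def split: if_splits)

text \<open>Left special words are prefixes of omega. Both words start with 1, so they desubstitute,
  still with different letters in front; the induction hypothesis applies to the longest common
  prefix of the preimages, and at most one letter of the common prefix of the images is left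
  over.\<close>

lemma common_prefix_left_special:
  assumes "swapp [a] X \<in> Omega_plus d" "swapp [b] Y \<in> Omega_plus d" "a \<noteq> b"
    "sprefix l X = sprefix l Y"
  shows "sprefix l X = sprefix l om"
  using assms
proof (induction l arbitrary: a b X Y rule: less_induct)
  case (less l)
  have "l = 0 \<or> l = 1 \<or> 2 \<le> l" by auto
  moreover have X0: "X 0 = 1" if "0 < l"
    using left_letter_step(1)[OF less.prems(1)] left_letter_step(1)[OF less.prems(2)] less.prems(3,4) that
    by (auto simp: sprefix_eq_iff)
  moreover have ?case if l: "2 \<le> l"
  proof -
    have X01: "X 0 = 1" "Y 0 = 1" "X 1 = Y 1" using X0 less.prems(4) l by (auto simp: sprefix_eq_iff)
    obtain X' where X': "swapp [pred_letter a] X' \<in> Omega_plus d" "X = SS X'"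
      using Omega_plus_desubst_left[OF less.prems(1)] X01 by auto
    obtain Y' where Y': "swapp [pred_letter b] Y' \<in> Omega_plus d" "Y = SS Y'"
      using Omega_plus_desubst_left[OF less.prems(2)] X01 by auto
    note lX = left_letter_step[OF X'(1)] and lY = left_letter_step[OF Y'(1)]
    have ab: "pred_letter a \<noteq> pred_letter b"
      using pred_letter_inject left_letter_step(2)[OF less.prems(1)] left_letter_step(2)[OF less.prems(2)] less.prems(3)
      by blast
    have "X' 0 = 1 \<longleftrightarrow> Y' 0 = 1"
      using SS_1_eq_2_iff[of X'] SS_1_eq_2_iff[of Y'] lX(3) lY(3) X01 X'(2) Y'(2) by auto
    moreover have "X' 0 \<in> {1, d}" "Y' 0 \<in> {1, d}"
      using X01(1,2) SS_0_eq_1[of X', folded X'(2), OF _ lX(3)] SS_0_eq_1[of Y', folded Y'(2), OF _ lY(3)]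
      by simp_all
    ultimately have X'0: "X' 0 = 1" "Y' 0 = 1"
      using lX(1) lY(1) ab d3 by auto
    \<comment> \<open>The bound \<open>l - 1\<close> keeps the induction hypothesis applicable. It
      is not binding in the case \<open>M < l\<close> below, because the initial 1 makes the image
      of the common prefix longer than the prefix itself.\<close>
    define J where "J = {j. j \<le> l - 1 \<and> sprefix j X' = sprefix j Y'}"
    have J: "finite J" "1 \<in> J" using X'0 l by (auto simp: J_def sprefix_Suc)
    define j where "j = Max J"
    have "j \<in> J" unfolding j_def using J by (intro Max_in) auto
    have "1 \<le> j" unfolding j_def using J by (intro Max_ge) auto
    have jm: "i \<le> j" if "i \<in> J" for i unfolding j_def using J that by (intro Max_ge) auto
    have eqj: "sprefix j X' = sprefix j Y'" "j \<le> l - 1" using \<open>j \<in> J\<close> by (auto simp: J_def)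
    have om: "sprefix j X' = sprefix j om"
      using less.IH[OF _ X'(1) Y'(1) ab eqj(1)] eqj(2) l by simp
    define M where "M = length (sg (sprefix j om))"
    have sM: "sprefix M X = sprefix M om"
      using SS_prefix[of j X'] SS_prefix[of j om] X'(2) om SS_om by (simp add: M_def)
    have "sprefix j om = 1 # sprefix (j - 1) (sshift 1 om)"
      using \<open>1 \<le> j\<close> sprefix_add[of 1 "j - 1" om] om_0 by (simp add: sprefix_Suc)
    then have "M = 2 + length (sg (sprefix (j - 1) (sshift 1 om)))"
      by (simp add: M_def sg_Cons sigma_letter_def)
    then have Mj: "j + 1 \<le> M" using length_sg[of "sprefix (j - 1) (sshift 1 om)"] by simp
    show ?thesis
    proof (cases "l \<le> M")
      case True
      then show ?thesis using sM sprefix_eq_mono by blast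
    next
      case False
      have ne: "X' j \<noteq> Y' j"
      proof
        assume "X' j = Y' j"
        then have "Suc j \<in> J" using eqj False Mj by (auto simp: J_def sprefix_Suc)
        then show False using jm by fastforce
      qed
      have shX: "X (M + i) = SS (sshift j X') i" for i
        using SS_sshift[of j X'] om X'(2) by (auto simp: M_def sshift_def fun_eq_iff add.commute)
      have shY: "Y (M + i) = SS (sshift j Y') i" for i
        using SS_sshift[of j Y'] om eqj Y'(2) by (auto simp: M_def sshift_def fun_eq_iff add.commute)
      have shO: "om (M + i) = SS (sshift j om) i" for i
        using SS_sshift[of j om] SS_om by (auto simp: M_def sshift_def fun_eq_iff add.commute)
      \<comment> \<open>Different letters whose images start alike can only be 1 and d. The word
        sigma(1) continues with 2, while sigma(d) = 1 is followed by a new block, which never starts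
        with 2; so exactly one common letter remains.\<close>
      have "X M = Y M" using less.prems(4) False by (auto simp: sprefix_eq_iff)
      then have "SS (sshift j X') 0 = SS (sshift j Y') 0" using shX[of 0] shY[of 0] by simp
      then have dj: "X' j = 1 \<and> Y' j = d \<or> X' j = d \<and> Y' j = 1"
        using SS_0_collision[of "sshift j X'" "sshift j Y'"] ne lX(3)[of j] lY(3)[of j] by (simp add: sshift_def)
      have "(SS (sshift j X') 1 = 2) \<noteq> (SS (sshift j Y') 1 = 2)"
        using ne dj SS_1_eq_2_iff[of "sshift j X'"] SS_1_eq_2_iff[of "sshift j Y'"] lX(3) lY(3)
        unfolding sshift_def by (metis add_0)
      then have "X (M + 1) \<noteq> Y (M + 1)" using shX[of 1] shY[of 1] by metis
      then have "\<not> M + 1 < l" using less.prems(4) unfolding sprefix_eq_iff by blast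
      then have "l = Suc M" using False by simp
      \<comment> \<open>It remains to see that omega has 1 at index M. Since d occurs at j in one of
        the two words, the letter before it is d-1; omega therefore continues with 1 or d, and both
        images start with 1.\<close>
      have "X' (j - 1) = om (j - 1)" "Y' (j - 1) = om (j - 1)"
        using om eqj \<open>1 \<le> j\<close> by (auto simp: sprefix_eq_iff)
      moreover have "X' j = 1 \<or> X' j = Suc (X' (j - 1))" "Y' j = 1 \<or> Y' j = Suc (Y' (j - 1))"
        using Omega_plus_step[OF Omega_plus_swapp[OF X'(1)], of "j - 1"]
          Omega_plus_step[OF Omega_plus_swapp[OF Y'(1)], of "j - 1"] \<open>1 \<le> j\<close> by auto
      ultimately have "Suc (om (j - 1)) = d" using dj d3 by auto
      then have "om j = 1 \<or> om j = d" using Omega_plus_step[OF om_Omega, of "j - 1"] \<open>1 \<le> j\<close> by auto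
      then have "om M = 1" using shO[of 0] SS_0_1[of "sshift j om"] by (simp add: sshift_def)
      moreover have "X M = 1" using shX[of 0] dj SS_0_1[of "sshift j X'"] unfolding sshift_def by auto
      ultimately show ?thesis using sM \<open>l = Suc M\<close> by (simp add: sprefix_Suc)
    qed
  qed
  ultimately show ?case using om_0 by (auto simp: sprefix_Suc)
qed

lemma left_special_unique:
  assumes "swapp [a] V \<in> Omega_plus d" "swapp [b] V \<in> Omega_plus d" "a \<noteq> b"
  shows "V = om"
  using common_prefix_left_special[OF assms refl] by (rule eq_if_sprefix_eq)

definition succ_letter :: "nat \<Rightarrow> nat" where
  "succ_letter a = (if a = d then 1 else Suc a)"

lemma last_sg: "w \<noteq> [] \<Longrightarrow> last (sg w) = succ_letter (last w)"
proof (induction w)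
  case (Cons a w)
  then show ?case
    by (cases w) (auto simp: sg_Cons[of a] last_sl succ_letter_def sg_Cons)
qed simp

lemma succ_letter_bij: "bij_betw succ_letter {1..d} {1..d}"
  by (rule bij_betw_byWitness[where f' = pred_letter]) (use d3 in \<open>auto simp: succ_letter_def pred_letter_def\<close>)

lemma succ_letter_pow_bij: "bij_betw (succ_letter ^^ n) {1..d} {1..d}"
proof (induction n)
  case 0
  then show ?case by (simp add: bij_betw_def)
next
  case (Suc n)
  then show ?case using bij_betw_trans[OF Suc succ_letter_bij] by (simp only: funpow.simps)
qed

lemma left_om_succ: "swapp [a] om \<in> Omega_plus d \<Longrightarrow> swapp [succ_letter a] om \<in> Omega_plus d"
proof -
  assume "swapp [a] om \<in> Omega_plus d"
  then have "SS (swapp [a] om) \<in> Omega_plus d" by (rule SS_Omega_plus)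
  moreover have "SS (swapp [a] om) = swapp (butlast (sg [a])) (swapp [last (sg [a])] om)"
    by (simp add: SS_swapp SS_om swapp_append[symmetric] sg_Cons)
  ultimately show ?thesis using last_sg[of "[a]"] Omega_plus_swapp by simp
qed

text \<open>Since omega is fixed by sigma, a left extension by a yields one by
  \<open>succ_letter a\<close>. This permutation is a d-cycle, so a single left extension produces
  all d of them.\<close>

lemma left_om: 
  assumes "a \<in> {1..d}"
  shows "swapp [a] om \<in> Omega_plus d"
proof -
  have up: "swapp [b + k] om \<in> Omega_plus d" if "swapp [b] om \<in> Omega_plus d" "b + k \<le> d" for b k
    using that(2)
  proof (induction k)
    case (Suc k)
    then show ?case using left_om_succ[of "b + k"] by (simp add: succ_letter_def)
  qed (simp add: that)
  obtain b where b: "b \<in> {1..d}" "swapp [b] om \<in> Omega_plus d" using Omega_plus_left[OF om_Omega] by blast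
  then have "swapp [d] om \<in> Omega_plus d" using up[of b "d - b"] by simp
  then have "swapp [1] om \<in> Omega_plus d" using left_om_succ[of d] by (simp add: succ_letter_def)
  then show ?thesis using up[of 1 "a - 1"] assms by simp
qed

lemma SS_cut:
  assumes "\<And>i. V i \<in> {1..d}" "SS V j \<noteq> 2"
  shows "\<exists>i. j = length (sg (sprefix i V))"
proof -
  define W where "W = sprefix (Suc j) V"
  have lj: "Suc j \<le> length (sg W)" using length_sg[of W] by (simp add: W_def)
  have "sg W ! j = SS V j" by (simp add: SS_def W_def)
  then have "drop j (sg W) = [] \<or> hd (drop j (sg W)) \<noteq> 2"
    using assms(2) lj by (simp add: hd_drop_conv_nth)
  moreover have "set W \<subseteq> {1..d}" using assms(1) by (auto simp: W_def sprefix_def)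
  moreover have "sg W = take j (sg W) @ drop j (sg W)" by simp
  ultimately obtain W1 W2 where W12: "W = W1 @ W2" "sg W1 = take j (sg W)" using sg_cut by blast
  have "W1 = take (length W1) W" using W12(1) by simp
  then have "W1 = sprefix (length W1) V" by (metis W_def length_sprefix take_sprefix)
  then have "j = length (sg (sprefix (length W1) V))" using W12(2) lj by simp
  then show ?thesis by blast
qed

text \<open>Descent: a return of omega starts with 1, hence at a block boundary, and it
  desubstitutes to a return at a smaller index because the first block has length 2.\<close>

lemma om_not_periodic: "0 < j \<Longrightarrow> sshift j om \<noteq> om"
proof (induction j rule: less_induct)
  case (less j)
  show ?case
  proof
    assume eq: "sshift j om = om"
    then have "om j = om 0" by (metis add_0 sshift_def)
    then have "SS om j \<noteq> 2" using om_0 SS_om by simp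
    then obtain i where i: "j = length (sg (sprefix i om))" using SS_cut[of om] om_letter by blast
    then have "i \<noteq> 0" using less.prems by (cases i) auto
    then have "sprefix i om = 1 # sprefix (i - 1) (sshift 1 om)"
      using sprefix_add[of 1 "i - 1" om] om_0 by (simp add: sprefix_Suc)
    then have "j = 2 + length (sg (sprefix (i - 1) (sshift 1 om)))"
      by (simp add: i sg_Cons sigma_letter_def)
    then have "i < j" using length_sg[of "sprefix (i - 1) (sshift 1 om)"] by simp
    have "SS (sshift i om) = SS om" using SS_sshift[of i om] eq i SS_om by simp
    then have "sshift i om = om"
      using SS_inject[of "sshift i om" om] om_letter by (auto simp: sshift_def)
    then show False using less.IH[OF \<open>i < j\<close>] \<open>i \<noteq> 0\<close> by simp
  qed
qed

lemma swapp_om_sshift: "swapp [om i] (sshift (Suc i) om) = sshift i om"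
  using swapp_sprefix_0[of "sshift i om"] by (simp add: sshift_def)

text \<open>One step back on both sides: by induction the two preceding words differ, so the common
  word is left special and hence equal to omega, against aperiodicity.\<close>

lemma sshift_om_less: "i < j \<Longrightarrow> sshift i om \<noteq> sshift j om"
proof (induction i arbitrary: j)
  case 0
  then show ?case using om_not_periodic[of j] by auto
next
  case (Suc i)
  then obtain k where k: "j = Suc k" "i < k" by (cases j) auto
  show ?case
  proof
    assume eq: "sshift (Suc i) om = sshift j om"
    have "om i \<noteq> om k"
      using Suc.IH[OF k(2)] eq k(1) swapp_om_sshift[of i] swapp_om_sshift[of k] by metis
    moreover have "swapp [om i] (sshift (Suc i) om) \<in> Omega_plus d"
      "swapp [om k] (sshift (Suc i) om) \<in> Omega_plus d"
      using eq k(1) swapp_om_sshift om_Omega_plus by metis+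
    ultimately have "sshift (Suc i) om = om" by (rule left_special_unique[rotated 2])
    then show False using om_not_periodic[of "Suc i"] by simp
  qed
qed

lemma sshift_om_inject: "sshift i om = sshift j om \<longleftrightarrow> i = j"
  by (metis linorder_neqE_nat sshift_om_less)

section \<open>Cylinders\<close>

lemma cyl_iff: "V \<in> cyl d w \<longleftrightarrow> swapp w V \<in> Omega_plus d"
  using Omega_plus_swapp by (auto simp: cyl_def)

lemma cyl_append_subset: "cyl d (u @ w) \<subseteq> cyl d w"
  unfolding subset_iff cyl_iff swapp_append using Omega_plus_swapp by blast

lemma sshift_om_cyl: "sshift k om \<in> cyl d (sprefix k om)"
  by (simp add: cyl_iff swapp_sprefix_sshift om_Omega)

text \<open>A cylinder shrinks under a left extension of \<open>w\<close> only if \<open>w\<close>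
  is left special, that is a prefix of omega. The second hypothesis excludes this in terms of the
  set \<open>cyl d w\<close> instead of the word, so that it can be checked on sets described in
  another way.\<close>

lemma cyl_Cons_eq:
  assumes "b # w \<in> lang d" "sshift (length w) om \<notin> cyl d w"
  shows "cyl d (b # w) = cyl d w"
proof
  show "cyl d (b # w) \<subseteq> cyl d w" using cyl_append_subset[of "[b]" w] by simp
  show "cyl d w \<subseteq> cyl d (b # w)"
  proof
    fix V assume "V \<in> cyl d w"
    then obtain a where a: "swapp [a] (swapp w V) \<in> Omega_plus d"
      using Omega_plus_left unfolding cyl_iff by blast
    obtain V2 where "swapp (b # w) V2 \<in> Omega_plus d" using lang_swapp[OF assms(1)] by blast
    then have V2: "swapp [b] (swapp w V2) \<in> Omega_plus d" by (simp add: swapp_append[symmetric])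
    have "a = b"
    proof (rule ccontr)
      assume "a \<noteq> b"
      from common_prefix_left_special[OF a V2 this, of "length w"] have "w = sprefix (length w) om" by simp
      then show False using sshift_om_cyl[of "length w"] assms(2) by simp
    qed
    then show "V \<in> cyl d (b # w)" using a by (simp add: cyl_iff swapp_append[symmetric])
  qed
qed

lemma cyl_extend_eq:
  assumes "u @ w \<in> lang d" "\<And>j. length w \<le> j \<Longrightarrow> j < length (u @ w) \<Longrightarrow> sshift j om \<notin> cyl d w"
  shows "cyl d (u @ w) = cyl d w"
  using assms
proof (induction u)
  case (Cons b u)
  have "u @ w \<in> lang d" using Cons.prems(1) lang_sublist[of "b # (u @ w)" "u @ w"]
    by (metis append_Cons sublist_Cons_right sublist_order.order_refl)
  then have "cyl d (u @ w) = cyl d w" using Cons.IH Cons.prems(2) by simp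
  moreover have "sshift (length (u @ w)) om \<notin> cyl d w" using Cons.prems(2)[of "length (u @ w)"] by simp
  ultimately show ?case using cyl_Cons_eq[of b "u @ w"] Cons.prems(1) by simp
qed simp

text \<open>Going left from a shift of omega there is no choice until omega itself is reached, as
  only omega is left special.\<close>

lemma swapp_sshift_om:
  assumes "swapp w (sshift j om) \<in> Omega_plus d" "length w \<le> j"
  shows "swapp w (sshift j om) = sshift (j - length w) om"
  using assms
proof (induction w)
  case (Cons a w)
  have *: "swapp [a] (swapp w (sshift j om)) \<in> Omega_plus d"
    using Cons.prems(1) by (simp add: swapp_append[symmetric])
  have IH: "swapp w (sshift j om) = sshift (j - length w) om"
    using Cons Omega_plus_swapp[OF *] by simp
  define i where "i = j - length (a # w)"
  have i: "j - length w = Suc i" using Cons.prems(2) by (simp add: i_def)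
  have "a = om i"
  proof (rule ccontr)
    assume "a \<noteq> om i"
    moreover have "swapp [a] (sshift (Suc i) om) \<in> Omega_plus d" using * IH i by simp
    moreover have "swapp [om i] (sshift (Suc i) om) \<in> Omega_plus d"
      using swapp_om_sshift om_Omega_plus by simp
    ultimately have "sshift (Suc i) om = om" using left_special_unique by blast
    then show False using om_not_periodic[of "Suc i"] by simp
  qed
  then show ?case using IH i swapp_om_sshift[of i] swapp_append[of "[a]" w] i_def by simp
qed simp

lemma sshift_om_cyl_suffix:
  assumes "sshift j om \<in> cyl d w" "length w \<le> j"
  shows "sprefix j om = sprefix (j - length w) om @ w"
proof -
  have "swapp w (sshift j om) = sshift (j - length w) om"
    using swapp_sshift_om assms by (simp add: cyl_iff)
  then have "w = sprefix (length w) (sshift (j - length w) om)" by (metis sprefix_swapp_length)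
  then show ?thesis using sprefix_add[of "j - length w" "length w" om] assms(2) by simp
qed

lemma lang_extend:
  assumes "w \<in> lang d" shows "\<exists>u. length u = n \<and> u @ w \<in> lang d"
proof (induction n)
  case (Suc n)
  then obtain u where "length u = n" "u @ w \<in> lang d" by blast
  moreover then obtain a where "a # u @ w \<in> lang d" using lang_left by blast
  ultimately show ?case by (intro exI[of _ "a # u"]) simp
qed (use assms in simp)

section \<open>Pieces of the system attached to coloured edges\<close>

text \<open>Colours h+1 and d+h share the letter h for 1 <= h <= d-2; they differ by the extra
  condition in \<open>QQ\<close>.\<close>

definition cletter :: "nat \<Rightarrow> nat" where
  "cletter i = (if i = 1 then d else if i \<le> d then i - 1 else i - d)"

definition cshift :: "nat \<Rightarrow> nat" where
  "cshift i = (if i = 1 then d else if i = d + 1 then 1 else i - 1)"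

definition children :: "nat set" where
  "children = insert 1 {d..2 * d - 2}"

text \<open>Splitting colour 2 asks for sigma(Y) to start with 1, so Y starts with 1 or d. After the
  letters d-1 and d this is automatic; after h <= d-2 it has to be imposed, which is the condition
  for colours above d.\<close>

definition QQ :: "nat \<Rightarrow> (nat \<Rightarrow> nat) set" where
  "QQ i = {X. swapp [cletter i] X \<in> Omega_plus d \<and> (d < i \<longrightarrow> X 0 = 1)}"

definition CC :: "nat \<Rightarrow> nat \<Rightarrow> nat \<Rightarrow> (nat \<Rightarrow> nat) set" where
  "CC n i k = {V. \<exists>X\<in>QQ i. swapp (sprefix k om) V = (SS ^^ n) X}"

lemma cletter_range: "i \<in> {1..2 * d - 2} \<Longrightarrow> cletter i \<in> {1..d}"
  using d3 by (auto simp: cletter_def)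

lemma cletter_children_bij: "bij_betw cletter children {1..d}"
  by (rule bij_betw_byWitness[where f' = "\<lambda>a. if a = d then 1 else if a = d - 1 then d else d + a"])
    (use d3 in \<open>auto simp: cletter_def children_def\<close>)

lemma children_range: "i \<in> children \<Longrightarrow> i \<in> {1..2 * d - 2} \<and> i \<noteq> 2"
  using d3 by (auto simp: children_def)

lemma cshift_range: "i \<in> {1..2 * d - 2} \<Longrightarrow> cshift i \<in> {1..2 * d - 2}"
  using d3 by (auto simp: cshift_def)

lemma CC_0: "i \<in> {1..d} \<Longrightarrow> CC 0 i 0 = cyl d [cletter i]"
  by (auto simp: CC_def QQ_def cyl_iff)

lemma om_QQ: "i \<in> {1..2 * d - 2} \<Longrightarrow> om \<in> QQ i"
  using left_om[OF cletter_range] om_0 by (auto simp: QQ_def)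

lemma om_CC: "i \<in> {1..2 * d - 2} \<Longrightarrow> sshift k om \<in> CC n i k"
  using om_QQ by (auto simp: CC_def swapp_sprefix_sshift intro!: bexI[of _ om])

lemma SS_left_succ:
  assumes "swapp [a] X \<in> Omega_plus d"
  shows "swapp [succ_letter a] (SS X) \<in> Omega_plus d"
proof -
  have "SS (swapp [a] X) \<in> Omega_plus d" using assms by (rule SS_Omega_plus)
  moreover have "SS (swapp [a] X) = swapp (butlast (sg [a])) (swapp [last (sg [a])] (SS X))"
    by (simp add: SS_swapp swapp_append[symmetric] sg_Cons)
  ultimately show ?thesis using last_sg[of "[a]"] Omega_plus_swapp by simp
qed

text \<open>Recolouring is desubstitution: away from colour 2 the first letter of X is not 2, so X =
  sigma(V), and the preceding letter moves back by \<open>pred_letter\<close>. For colours above d+1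
  the condition on the first letter passes to V, since V(0) = d would need d-1 in front of
  it.\<close>

lemma QQ_cshift:
  assumes "i \<in> {1..2 * d - 2}" "i \<noteq> 2"
  shows "QQ i = SS ` QQ (cshift i)"
proof
  show "QQ i \<subseteq> SS ` QQ (cshift i)"
  proof
    fix X assume "X \<in> QQ i"
    then have X: "swapp [cletter i] X \<in> Omega_plus d" "d < i \<Longrightarrow> X 0 = 1" by (auto simp: QQ_def)
    have "X 0 \<noteq> 2"
      using left_letter_step(1)[OF X(1)] X(2) assms by (auto simp: cletter_def split: if_splits)
    then obtain V where V: "swapp [pred_letter (cletter i)] V \<in> Omega_plus d" "X = SS V"
      using Omega_plus_desubst_left[OF X(1)] by blast
    have e: "pred_letter (cletter i) = cletter (cshift i)"
      using assms d3 by (auto simp: cletter_def cshift_def pred_letter_def split: if_splits)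
    have "V 0 = 1" if "d < cshift i"
    proof -
      have i: "d + 2 \<le> i" using that by (auto simp: cshift_def split: if_splits)
      then have "V 0 = 1 \<or> V 0 = d" using X(2) SS_0_eq_1[of V, folded V(2), OF _ left_letter_step(3)[OF V(1)]] by simp
      moreover have "cletter (cshift i) < d - 1" using i assms by (auto simp: cletter_def cshift_def)
      ultimately show ?thesis using left_letter_step(1)[OF V(1)] e by auto
    qed
    then show "X \<in> SS ` QQ (cshift i)" using V e by (auto simp: QQ_def)
  qed
  show "SS ` QQ (cshift i) \<subseteq> QQ i"
  proof
    fix X assume "X \<in> SS ` QQ (cshift i)"
    then obtain Y where Y: "X = SS Y" "swapp [cletter (cshift i)] Y \<in> Omega_plus d" "d < cshift i \<Longrightarrow> Y 0 = 1"
      by (auto simp: QQ_def)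
    have "succ_letter (cletter (cshift i)) = cletter i"
      using assms d3 by (auto simp: cletter_def cshift_def succ_letter_def split: if_splits)
    then have "swapp [cletter i] X \<in> Omega_plus d" using SS_left_succ[OF Y(2)] Y(1) by simp
    moreover have "X 0 = 1" if "d < i"
    proof (cases "i = d + 1")
      case True
      then have "Y 0 = 1" using left_letter_step(1)[OF Y(2)] left_letter_step(3)[OF Y(2), of 0] d3 by (auto simp: cletter_def cshift_def)
      then show ?thesis using Y(1) by (simp add: SS_0)
    next
      case False
      then have "Y 0 = 1" using Y(3) that d3 by (auto simp: cshift_def)
      then show ?thesis using Y(1) by (simp add: SS_0)
    qed
    ultimately show "X \<in> QQ i" by (simp add: QQ_def)
  qed
qed

lemma CC_cshift:
  assumes "i \<in> {1..2 * d - 2}" "i \<noteq> 2"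
  shows "CC n i k = CC (Suc n) (cshift i) k"
  unfolding CC_def QQ_cshift[OF assms] by (simp add: funpow_swap1)

lemma children_0:
  assumes "Y \<in> QQ i" "i \<in> children"
  shows "SS Y 0 = 1"
proof -
  have Y: "swapp [cletter i] Y \<in> Omega_plus d" "d < i \<Longrightarrow> Y 0 = 1" using assms by (auto simp: QQ_def)
  have "Y 0 = 1 \<or> Y 0 = d"
    using left_letter_step(1)[OF Y(1)] left_letter_step(3)[OF Y(1), of 0] Y(2) assms(2) d3 by (auto simp: cletter_def children_def split: if_splits)
  then show ?thesis by (auto simp: SS_0)
qed

text \<open>Here 1X = sigma(Y) and any letter may precede Y; its d values are the d children. The
  hypothesis says that sigma^n(1)u is again a prefix of omega, so that the children have the same
  form as the parent; \<open>omega_prefix_concat\<close> supplies it.\<close>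

lemma CC_split:
  assumes "sprefix (L n + k) om = (sg ^^ n) [1] @ sprefix k om"
  shows "CC n 2 k = (\<Union>i\<in>children. CC (Suc n) i (L n + k))"
proof
  have cl2: "cletter 2 = 1" using d3 by (simp add: cletter_def)
  show "CC n 2 k \<subseteq> (\<Union>i\<in>children. CC (Suc n) i (L n + k))"
  proof
    fix V assume "V \<in> CC n 2 k"
    then obtain X where X: "swapp [1] X \<in> Omega_plus d" "swapp (sprefix k om) V = (SS ^^ n) X"
      by (auto simp: CC_def QQ_def cl2)
    obtain b where b: "swapp [b] (swapp [1] X) \<in> Omega_plus d" using Omega_plus_left[OF X(1)] by blast
    obtain Y where Y: "swapp [pred_letter b] Y \<in> Omega_plus d" "swapp [1] X = SS Y"
      using Omega_plus_desubst_left[OF b] by auto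
    obtain i where i: "i \<in> children" "cletter i = pred_letter b"
      using cletter_children_bij left_letter_step(2)[OF Y(1)] unfolding bij_betw_def by (metis imageE)
    have "SS Y 0 = 1" using Y(2) by (metis swapp_Cons_0)
    then have "Y 0 = 1 \<or> Y 0 = d" using SS_0_eq_1 left_letter_step(3)[OF Y(1), of 0] by blast
    then have "Y \<in> QQ i"
      using Y(1) i left_letter_step(1)[OF Y(1)] d3 by (auto simp: QQ_def children_def cletter_def)
    moreover have "swapp (sprefix (L n + k) om) V = (SS ^^ Suc n) Y"
      using X(2) Y(2) by (simp add: assms swapp_append SS_pow_swapp[symmetric] funpow_swap1)
    ultimately show "V \<in> (\<Union>i\<in>children. CC (Suc n) i (L n + k))" using i(1) by (auto simp: CC_def)
  qed
  show "(\<Union>i\<in>children. CC (Suc n) i (L n + k)) \<subseteq> CC n 2 k"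
  proof
    fix V assume "V \<in> (\<Union>i\<in>children. CC (Suc n) i (L n + k))"
    then obtain i Y where i: "i \<in> children" "Y \<in> QQ i" "swapp (sprefix (L n + k) om) V = (SS ^^ Suc n) Y"
      by (auto simp: CC_def)
    define X where "X = sshift 1 (SS Y)"
    have X: "SS Y = swapp [1] X" using swapp_sprefix_0[of "SS Y"] children_0[OF i(2,1)] by (simp add: X_def)
    have "swapp ((sg ^^ n) [1]) (swapp (sprefix k om) V) = (SS ^^ n) (SS Y)"
      using i(3) by (simp add: assms swapp_append funpow_swap1)
    then have "swapp (sprefix k om) V = (SS ^^ n) X" by (simp add: X SS_pow_swapp)
    moreover have "swapp [1] X \<in> Omega_plus d"
      using i(2) X[symmetric] SS_Omega_plus[OF Omega_plus_swapp] by (auto simp: QQ_def)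
    ultimately show "V \<in> CC n 2 k" using d3 by (auto simp: CC_def QQ_def cl2)
  qed
qed

text \<open>The letter to the left of uV is the last letter of sigma^n(c(i)). This one letter tells
  the children of an edge apart.\<close>

lemma CC_left:
  assumes "V \<in> CC n i k"
  shows "swapp ((succ_letter ^^ n) (cletter i) # sprefix k om) V \<in> Omega_plus d"
proof -
  obtain X where X: "swapp [cletter i] X \<in> Omega_plus d" "swapp (sprefix k om) V = (SS ^^ n) X"
    using assms by (auto simp: CC_def QQ_def)
  have "swapp [(succ_letter ^^ m) a] ((SS ^^ m) Z) \<in> Omega_plus d" if "swapp [a] Z \<in> Omega_plus d" for m a Z
    by (induction m) (use that SS_left_succ in auto)
  from this[OF X(1)] have "swapp [(succ_letter ^^ n) (cletter i)] (swapp (sprefix k om) V) \<in> Omega_plus d"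
    by (simp add: X)
  then show ?thesis by (simp add: swapp_append[symmetric])
qed

lemma CC_Omega_plus: "CC n i k \<subseteq> Omega_plus d"
  using CC_left Omega_plus_swapp by blast

lemma left_special_cyl:
  assumes "V \<in> cyl d (a # sprefix k om)" "V \<in> cyl d (b # sprefix k om)" "a \<noteq> b"
  shows "V = sshift k om"
proof -
  have "swapp (sprefix k om) V = om"
    using left_special_unique[OF _ _ assms(3), of "swapp (sprefix k om) V"] assms(1,2)
    by (simp add: cyl_iff swapp_append[symmetric])
  then show ?thesis by (metis length_sprefix sshift_swapp)
qed

lemma children_letter_inj:
  assumes "i \<in> children" "i' \<in> children" "i \<noteq> i'"
  shows "(succ_letter ^^ n) (cletter i) \<noteq> (succ_letter ^^ n) (cletter i')"
proof -
  have "cletter i \<noteq> cletter i'"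
    using assms cletter_children_bij by (auto simp: bij_betw_def inj_on_def)
  moreover have "cletter i \<in> {1..d}" "cletter i' \<in> {1..d}"
    using assms cletter_range children_range by blast+
  ultimately show ?thesis using succ_letter_pow_bij[of n] by (metis bij_betw_inv_into_left)
qed

lemma CC_children_disjoint:
  assumes "i \<in> children" "i' \<in> children" "i \<noteq> i'" "V \<in> CC n i k" "V \<in> CC n i' k"
  shows "V = sshift k om"
  using left_special_cyl[of V _ k] CC_left[OF assms(4)] CC_left[OF assms(5)] children_letter_inj[OF assms(1-3), of n]
  by (simp add: cyl_iff)


section \<open>Lengths\<close>

lemma sg_pow_2: "k \<le> d - 2 \<Longrightarrow> (sg ^^ k) [2] = [2 + k]"
  by (induction k) (auto simp: sg_Cons sigma_letter_def)

lemma sg_pow_2_1: "d - 1 \<le> n \<Longrightarrow> (sg ^^ n) [2] = (sg ^^ (n - (d - 1))) [1]"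
proof -
  assume "d - 1 \<le> n"
  then have n: "n = (n - (d - 1)) + Suc (d - 2)" using d3 by simp
  have "(sg ^^ Suc (d - 2)) [2] = [1]"
    using d3 sg_pow_2[of "d - 2"] by (simp add: sg_Cons sigma_letter_def)
  then show ?thesis by (metis n comp_apply funpow_add)
qed

lemma L_0 [simp]: "L 0 = 1"
  by (simp add: L_def)

lemma L_Suc_small: "n < d - 1 \<Longrightarrow> L (Suc n) = L n + 1"
  unfolding L_def sigma_pow_Suc using sg_pow_2[of n] by simp

lemma L_Suc: "d - 1 \<le> n \<Longrightarrow> L (Suc n) = L n + L (n - (d - 1))"
  unfolding L_def sigma_pow_Suc using sg_pow_2_1[of n] by simp

lemma L_mono: "m \<le> n \<Longrightarrow> L m \<le> L n"
  unfolding L_def using sigma_pow_prefix prefix_length_le by blast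

lemma L_pos: "0 < L n"
  using L_gt[of n] by simp

text \<open>\<open>qq t\<close> counts the prefixes of omega that have appeared by stage t - 2d, the
  empty word counting from stage -(d-2), that is from t = d+2. The last clause encodes that the
  longest words of stage n+1 are sigma^n(1)u with u the longest prefix that has appeared by stage
  n-d+2.\<close>

function qq :: "nat \<Rightarrow> nat" where
  "qq t = (if t < d + 2 then 0 else if t \<le> 2 * d then 1 else L (t - 2 * d - 1) + qq (t - d + 1))"
  by auto
termination by (relation "Wellfounded.measure (\<lambda>t. t)") (use d3 in auto)

declare qq.simps [simp del]

lemma qq_0: "t < d + 2 \<Longrightarrow> qq t = 0"
  by (simp add: qq.simps)

lemma qq_1: "d + 2 \<le> t \<Longrightarrow> t \<le> 2 * d \<Longrightarrow> qq t = 1"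
  by (simp add: qq.simps)

lemma qq_rec: "qq (Suc (n + 2 * d)) = L n + qq (n + d + 2)"
proof -
  have "Suc (n + 2 * d) - d + 1 = n + d + 2" by simp
  moreover have "\<not> Suc (n + 2 * d) < d + 2" "\<not> Suc (n + 2 * d) \<le> 2 * d" "Suc (n + 2 * d) - 2 * d - 1 = n"
    using d3 by auto
  ultimately show ?thesis by (subst qq.simps) (simp only: if_False)
qed

text \<open>Consecutiveness of the intervals: the shortest prefix split off from stage n has length
  exactly \<open>mm n\<close>. Unfolding \<open>qq\<close> twice on the left gives L(n-1) + L(n-d),
  which is L(n).\<close>

lemma qq_key: "qq (n + 2 * d) = L n + qq (n + 2)"
proof (cases n)
  case 0
  then show ?thesis using d3 by (simp add: qq_0 qq_1)
next
  case (Suc k)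
  then have "qq (n + 2 * d) = L k + qq (k + d + 2)" using qq_rec[of k] by simp
  moreover have "L k + qq (k + d + 2) = L n + qq (n + 2)"
  proof (cases "k < d - 1")
    case True
    then show ?thesis using Suc by (simp add: L_Suc_small qq_0 qq_1)
  next
    case False
    define j where "j = k - (d - 1)"
    have k: "k = j + (d - 1)" using False by (simp add: j_def)
    have "k + d + 2 = Suc (j + 2 * d)" using k d3 by simp
    then have "qq (k + d + 2) = L j + qq (j + d + 2)" by (simp only: qq_rec)
    moreover have "j + d + 2 = n + 2" using k Suc d3 by simp
    moreover have "L n = L k + L j" using L_Suc[of k] False Suc by (simp add: j_def)
    ultimately show ?thesis by simp
  qed
  ultimately show ?thesis by simp
qed

lemma qq_mono_Suc: "qq t \<le> qq (Suc t)"
proof (induction t rule: less_induct)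
  case (less t)
  show ?case
  proof (cases "t < 2 * d")
    case True
    then show ?thesis by (cases "t < d + 2"; cases "Suc t < d + 2") (auto simp: qq_0 qq_1)
  next
    case False
    then obtain n where n: "t = n + 2 * d" by (metis add.commute le_Suc_ex not_less)
    have "n + 2 + j \<le> t \<Longrightarrow> qq (n + 2) \<le> qq (n + 2 + j)" for j
    proof (induction j)
      case (Suc j)
      then show ?case using less.IH[of "n + 2 + j"] by simp
    qed simp
    from this[of d] have "qq (n + 2) \<le> qq (n + d + 2)" using n d3 by (simp add: algebra_simps)
    then show ?thesis using qq_key[of n] qq_rec[of n] n by simp
  qed
qed

lemma qq_mono: "s \<le> t \<Longrightarrow> qq s \<le> qq t"
  by (rule lift_Suc_mono_le[of qq]) (rule qq_mono_Suc)

text \<open>Keeps the remainder k' in \<open>omega_prefix_concat\<close> inside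
  sigma^(j+1)(1).\<close>

lemma qq_le_L: "qq (j + d + 2) \<le> L (Suc j)"
proof (induction j rule: less_induct)
  case (less j)
  show ?case
  proof (cases "j + d + 2 \<le> 2 * d")
    case True
    then show ?thesis using L_pos[of "Suc j"] by (simp add: qq_1)
  next
    case False
    define n where "n = j + 1 - d"
    have n: "j + d + 2 = Suc (n + 2 * d)" "n < j" "Suc j = n + d" using False d3 by (auto simp: n_def)
    have "qq (j + d + 2) = L n + qq (n + d + 2)" unfolding n(1) by (rule qq_rec)
    also have "\<dots> \<le> L n + L (Suc n)" using less.IH[OF n(2)] by simp
    also have "\<dots> \<le> L n + L (n + d - 1)" using L_mono[of "Suc n" "n + d - 1"] d3 by simp
    also have "\<dots> = L (n + d)" using L_Suc[of "n + d - 1"] d3 by simp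
    finally show ?thesis using n(3) by simp
  qed
qed

lemma sprefix_om_take: "k \<le> L n \<Longrightarrow> sprefix k om = take k ((sg ^^ n) [1])"
  by (rule sprefix_omega)

text \<open>With j = n-d+1, the identity sigma^(n+1)(1) = sigma^n(1) sigma^j(1) settles k <= L(j).
  Longer k are reached through sigma^(n+2)(1) = sigma^n(1) sigma^j(1) sigma^(j+1)(1) and the
  induction hypothesis at j.\<close>

lemma omega_prefix_concat:
  assumes "k < qq (n + d + 2)"
  shows "sprefix (L n + k) om = (sg ^^ n) [1] @ sprefix k om"
  using assms
proof (induction n arbitrary: k rule: less_induct)
  case (less n)
  show ?case
  proof (cases "n < d - 1")
    case True
    then have "k = 0" using less.prems qq_1[of "n + d + 2"] by simp
    then show ?thesis using sprefix_omega_L by simp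
  next
    case False
    define j where "j = n - (d - 1)"
    have j: "n = j + (d - 1)" "j < n" using False d3 by (auto simp: j_def)
    have n1: "(sg ^^ Suc n) [1] = (sg ^^ n) [1] @ (sg ^^ j) [1]"
      using sigma_pow_Suc[of n d] sg_pow_2_1[of n] False by (simp add: j_def)
    have L1: "L (Suc n) = L n + L j" using L_Suc[of n] False by (simp add: j_def)
    show ?thesis
    proof (cases "k \<le> L j")
      case True
      then have "sprefix (L n + k) om = take (L n + k) ((sg ^^ Suc n) [1])"
        using L1 by (intro sprefix_om_take) simp
      also have "\<dots> = (sg ^^ n) [1] @ take k ((sg ^^ j) [1])" unfolding n1 by (simp add: L_def)
      finally show ?thesis using sprefix_om_take[OF True] by simp
    next
      case False
      define k' where "k' = k - L j"
      have k: "k = L j + k'" using False by (simp add: k'_def)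
      have "n + d + 2 = Suc (j + 2 * d)" using j d3 by simp
      then have "qq (n + d + 2) = L j + qq (j + d + 2)" by (simp only: qq_rec)
      then have k': "k' < qq (j + d + 2)" using less.prems k by simp
      have IH: "sprefix k om = (sg ^^ j) [1] @ sprefix k' om"
        using less.IH[OF j(2) k'] k by simp
      have k'L: "k' \<le> L (Suc j)" using qq_le_L[of j] k' by simp
      have "Suc n - (d - 1) = Suc j" using j d3 by simp
      then have n2: "(sg ^^ Suc (Suc n)) [1] = (sg ^^ n) [1] @ (sg ^^ j) [1] @ (sg ^^ Suc j) [1]"
        using sigma_pow_Suc[of "Suc n" d] sg_pow_2_1[of "Suc n"] n1 \<open>\<not> n < d - 1\<close> by simp
      have "L (Suc (Suc n)) = L n + L j + L (Suc j)" unfolding L_def n2 by simp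
      then have "sprefix (L n + k) om = take (L n + k) ((sg ^^ Suc (Suc n)) [1])"
        using k k'L by (intro sprefix_om_take) simp
      also have "\<dots> = (sg ^^ n) [1] @ (sg ^^ j) [1] @ take k' ((sg ^^ Suc j) [1])"
        unfolding n2 by (simp add: L_def k)
      finally show ?thesis using IH sprefix_om_take[OF k'L] by simp
    qed
  qed
qed

section \<open>The partition attached to a stage\<close>

text \<open>The edges of stage n without the tree: colour, and length of the prefix u attached to
  the origin. The bijection with the actual edges is given by \<open>key_in_idx\<close>,
  \<open>idx_key\<close> and \<open>key_inj\<close>.\<close>

primrec idx :: "nat \<Rightarrow> (nat \<times> nat) set" where
  "idx 0 = {1..d} \<times> {0}"
| "idx (Suc n) = {(cshift i, k) |i k. (i, k) \<in> idx n \<and> i \<noteq> 2} \<union> {(i, L n + k) |i k. i \<in> children \<and> (2, k) \<in> idx n}"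

text \<open>The m of the theorem, see \<open>longest_appearing\<close>.\<close>

definition mm :: "nat \<Rightarrow> nat" where
  "mm n = qq (n + 2 * d)"

text \<open>An edge runs through the colours 2d-2, ..., d+1, 1, d, ..., 2, entering at one of the
  colours in \<open>children\<close>. Colour i with 2 <= i <= d is therefore held exactly at the
  ages d-i, ..., 2d-1-i, so its prefixes appeared during d consecutive stages; colour 1 is held at
  the ages 0, ..., d-2, and i > d at 0, ..., 2d-2-i.\<close>

definition idx_range :: "nat \<Rightarrow> nat \<Rightarrow> nat set" where
  "idx_range n i = (if i = 1 then {qq (n + d + 1)..<qq (n + 2 * d)}
     else if i \<le> d then {qq (n + i)..<qq (n + d + i)}
     else {qq (n + 1 + i)..<qq (n + 2 * d)})"

lemma mm_Suc: "mm (Suc n) = L n + qq (n + d + 2)"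
  using qq_rec[of n] by (simp add: mm_def)

lemma mm_eq: "mm n = L n + qq (n + 2)"
  using qq_key[of n] by (simp add: mm_def)

lemma mm_0: "mm 0 = 1"
  using d3 by (simp add: mm_def qq_1)

lemma mm_le: "mm n \<le> mm (Suc n)"
  unfolding mm_def using qq_mono by simp

lemma idx_range_2: "idx_range n 2 = {qq (n + 2)..<qq (n + d + 2)}"
  using d3 by (simp add: idx_range_def)

lemma split_range: "(\<lambda>k. L n + k) ` idx_range n 2 = {mm n..<mm (Suc n)}"
  unfolding idx_range_2 mm_eq[of n] mm_Suc[of n] by (simp add: image_add_atLeastLessThan add.commute)

lemma idx_range_step:
  "i \<in> {1..2 * d - 2} \<Longrightarrow> idx_range (Suc n) i =
    (\<Union>j\<in>{j\<in>{1..2 * d - 2}. j \<noteq> 2 \<and> cshift j = i}. idx_range n j) \<union> (if i \<in> children then {mm n..<mm (Suc n)} else {})"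
proof -
  assume i: "i \<in> {1..2 * d - 2}"
  note m = mm_def
  have u: "{a..<b} \<union> {b..<c} = {a..<c}" if "a \<le> b" "b \<le> c" for a b c :: nat
    using that by auto
  consider "i = 1" | "2 \<le> i" "i < d" | "i = d" | "d < i" "i < 2 * d - 2" | "d < i" "i = 2 * d - 2"
    using i by force
  then show ?thesis
  proof cases
    case 1
    then have "{j\<in>{1..2 * d - 2}. j \<noteq> 2 \<and> cshift j = i} = {d + 1}"
      using d3 by (auto simp: cshift_def split: if_splits)
    then show ?thesis using 1 u[of "qq (n + 1 + (d + 1))" "mm n" "mm (Suc n)"] mm_le[of n] d3
        qq_mono[of "n + 1 + (d + 1)" "n + 2 * d"]
      by (auto simp: idx_range_def children_def m)
  next
    case 2
    then have "{j\<in>{1..2 * d - 2}. j \<noteq> 2 \<and> cshift j = i} = {Suc i}"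
      using d3 by (auto simp: cshift_def split: if_splits)
    then show ?thesis using 2 by (auto simp: idx_range_def children_def)
  next
    case 3
    then have "{j\<in>{1..2 * d - 2}. j \<noteq> 2 \<and> cshift j = i} = {1}"
      using d3 by (auto simp: cshift_def split: if_splits)
    moreover have "idx_range (Suc n) i = {qq (n + d + 1)..<mm (Suc n)}"
      unfolding 3 idx_range_def m using d3 by (simp add: mult_2 add.assoc)
    moreover have "idx_range n 1 = {qq (n + d + 1)..<mm n}" by (simp add: idx_range_def m)
    moreover have "i \<in> children" unfolding 3 children_def using d3 by simp
    moreover have "qq (n + d + 1) \<le> mm n" unfolding m by (rule qq_mono) (use d3 in simp)
    ultimately show ?thesis using u[of "qq (n + d + 1)" "mm n" "mm (Suc n)"] mm_le[of n] by simp
  next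
    case 4
    then have "{j\<in>{1..2 * d - 2}. j \<noteq> 2 \<and> cshift j = i} = {Suc i}"
      using d3 by (auto simp: cshift_def split: if_splits)
    then show ?thesis using 4 u[of "qq (n + 1 + Suc i)" "mm n" "mm (Suc n)"] mm_le[of n] d3
        qq_mono[of "n + 1 + Suc i" "n + 2 * d"]
      by (auto simp: idx_range_def children_def m)
  next
    case 5
    then have "{j\<in>{1..2 * d - 2}. j \<noteq> 2 \<and> cshift j = i} = {}"
      using d3 by (auto simp: cshift_def split: if_splits)
    moreover have "Suc n + 1 + i = n + 2 * d" using 5 d3 by simp
    then have "idx_range (Suc n) i = {mm n..<mm (Suc n)}"
      unfolding m using 5(1) d3 by (simp only: idx_range_def) simp
    moreover have "i \<in> children" using 5 by (simp add: children_def)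
    ultimately show ?thesis by (simp only: UN_empty Un_empty_left if_True)
  qed
qed

lemma idx_iff: "(i, k) \<in> idx n \<longleftrightarrow> i \<in> {1..2 * d - 2} \<and> k \<in> idx_range n i"
proof (induction n arbitrary: i k)
  case 0
  have "idx_range 0 i = (if i \<le> d then {0} else {})" if "i \<in> {1..2 * d - 2}"
    using that d3 by (auto simp: idx_range_def qq_0 qq_1)
  then show ?case using d3 by (auto split: if_splits)
next
  case (Suc n)
  have "(i, k) \<in> idx (Suc n) \<longleftrightarrow> (\<exists>j. j \<noteq> 2 \<and> cshift j = i \<and> (j, k) \<in> idx n)
      \<or> i \<in> children \<and> k \<in> (\<lambda>k. L n + k) ` idx_range n 2"
    using Suc.IH d3 by auto
  also have "\<dots> \<longleftrightarrow> i \<in> {1..2 * d - 2} \<and> k \<in> idx_range (Suc n) i"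
  proof (cases "i \<in> {1..2 * d - 2}")
    case True
    show ?thesis unfolding idx_range_step[OF True] split_range Suc.IH using True by (auto split: if_splits)
  next
    case False
    have "j \<notin> {1..2 * d - 2}" if "cshift j = i" for j using False cshift_range[of j] that by blast
    moreover have "i \<notin> children" using False children_range by blast
    ultimately show ?thesis unfolding Suc.IH using False by blast
  qed
  finally show ?case .
qed

lemma idx_less: "(i, k) \<in> idx n \<Longrightarrow> k < mm n"
proof -
  assume "(i, k) \<in> idx n"
  then have "k < qq (n + 2 * d) \<or> (i \<le> d \<and> k < qq (n + d + i))"
    by (auto simp: idx_iff idx_range_def split: if_splits)
  moreover have "i \<le> d \<Longrightarrow> qq (n + d + i) \<le> qq (n + 2 * d)" by (rule qq_mono) simp
  ultimately show ?thesis by (auto simp: mm_def)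
qed

lemma idx_2: "(2, k) \<in> idx n \<longleftrightarrow> k \<in> idx_range n 2"
  using d3 by (auto simp: idx_iff)

lemma idx_2_prefix: "(2, k) \<in> idx n \<Longrightarrow> sprefix (L n + k) om = (sg ^^ n) [1] @ sprefix k om"
  by (rule omega_prefix_concat) (simp add: idx_2 idx_range_2)

lemma idx_2_split: "(2, k) \<in> idx n \<Longrightarrow> CC n 2 k = (\<Union>i\<in>children. CC (Suc n) i (L n + k))"
  by (rule CC_split) (rule idx_2_prefix)

lemma idx_2_bounds: "(2, k) \<in> idx n \<Longrightarrow> mm n \<le> L n + k \<and> L n + k < mm (Suc n)"
  using split_range[of n] by (force simp: idx_2)

lemma idx_2_exists: "mm n \<le> j \<Longrightarrow> j < mm (Suc n) \<Longrightarrow> \<exists>k. (2, k) \<in> idx n \<and> j = L n + k"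
proof -
  assume "mm n \<le> j" "j < mm (Suc n)"
  then have "j \<in> (\<lambda>k. L n + k) ` idx_range n 2" unfolding split_range by simp
  then show ?thesis by (auto simp only: idx_2)
qed

lemma idx_colour: "(i, k) \<in> idx n \<Longrightarrow> i \<in> {1..2 * d - 2}"
  by (simp add: idx_iff)

lemma idx_Suc_cases:
  assumes "(i, k) \<in> idx (Suc n)"
  obtains (shift) j where "(j, k) \<in> idx n" "j \<noteq> 2" "i = cshift j" "CC (Suc n) i k = CC n j k"
  | (split) k' where "(2, k') \<in> idx n" "i \<in> children" "k = L n + k'" "CC (Suc n) i k \<subseteq> CC n 2 k'"
proof -
  from assms consider (1) j where "(j, k) \<in> idx n" "j \<noteq> 2" "i = cshift j"
    | (2) k' where "(2, k') \<in> idx n" "i \<in> children" "k = L n + k'" by auto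
  then show thesis
  proof cases
    case 1
    then show thesis using that(1) CC_cshift[of j n k] idx_colour[of j k n] by simp
  next
    case 2
    then show thesis using that(2) idx_2_split by blast
  qed
qed

lemma cshift_inject: "i \<in> {1..2 * d - 2} \<Longrightarrow> i \<noteq> 2 \<Longrightarrow> i' \<in> {1..2 * d - 2} \<Longrightarrow> i' \<noteq> 2
   \<Longrightarrow> cshift i = cshift i' \<Longrightarrow> i = i'"
proof -
  define g where "g c = (if c = d then 1 else if c = 1 then d + 1 else Suc c)" for c
  have g: "g (cshift j) = j" if "j \<in> {1..2 * d - 2}" "j \<noteq> 2" for j
  proof -
    consider "j = 1" | "j = d + 1" | "j \<noteq> 1" "j \<noteq> d + 1" by blast
    then show ?thesis
    proof cases
      case 3
      then have "cshift j = j - 1" by (simp add: cshift_def)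
      moreover have "j - 1 \<noteq> d" "j - 1 \<noteq> 1" "Suc (j - 1) = j" using 3 that by auto
      ultimately show ?thesis by (simp add: g_def)
    qed (use d3 in \<open>simp_all add: cshift_def g_def\<close>)
  qed
  assume "i \<in> {1..2 * d - 2}" "i \<noteq> 2" "i' \<in> {1..2 * d - 2}" "i' \<noteq> 2" "cshift i = cshift i'"
  then show ?thesis using g by metis
qed


text \<open>Pieces of one stage may overlap, but only where two left extensions are possible. A
  common point of two pieces is either inherited from their parents or is the point at which
  siblings were just separated.\<close>

lemma CC_disjoint:
  assumes "(i, k) \<in> idx n" "(i', k') \<in> idx n" "(i, k) \<noteq> (i', k')" "V \<in> CC n i k" "V \<in> CC n i' k'"
  shows "\<exists>j<mm n. V = sshift j om"
  using assms
proof (induction n arbitrary: i k i' k')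
  case 0
  then have ii: "i \<in> {1..d}" "i' \<in> {1..d}" "i \<noteq> i'" "k = 0" "k' = 0" by auto
  have "bij_betw cletter {1..d} {1..d}"
    by (rule bij_betw_byWitness[where f' = "succ_letter"]) (use d3 in \<open>auto simp: cletter_def succ_letter_def\<close>)
  then have "cletter i \<noteq> cletter i'" using ii unfolding bij_betw_def inj_on_def by blast
  moreover have "V \<in> cyl d (cletter i # sprefix 0 om)" "V \<in> cyl d (cletter i' # sprefix 0 om)"
    using 0(4,5) CC_0[OF ii(1)] CC_0[OF ii(2)] ii(4,5) by simp_all
  ultimately have "V = sshift 0 om" using left_special_cyl by blast
  then show ?case using mm_0 by auto
next
  case (Suc n)
  have *: "\<exists>j<mm (Suc n). V = sshift j om" if "\<exists>j<mm n. V = sshift j om"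
    using that mm_le[of n] less_le_trans by blast
  from Suc.prems(1) show ?case
  proof (cases rule: idx_Suc_cases)
    case (shift j)
    from Suc.prems(2) show ?thesis
    proof (cases rule: idx_Suc_cases)
      case s: (shift j')
      then have "(j, k) \<noteq> (j', k')" using shift Suc.prems(3) by auto
      then show ?thesis using * Suc.IH[OF shift(1) s(1)] Suc.prems shift s by auto
    next
      case s: (split k'')
      then show ?thesis using * Suc.IH[OF shift(1) s(1)] Suc.prems shift s by auto
    qed
  next
    case (split k1)
    from Suc.prems(2) show ?thesis
    proof (cases rule: idx_Suc_cases)
      case s: (shift j')
      then show ?thesis using * Suc.IH[OF split(1) s(1)] Suc.prems split s by auto
    next
      case s: (split k2)
      show ?thesis
      proof (cases "k1 = k2")
        case True
        then have "i \<noteq> i'" "k = k'" using Suc.prems(3) split s by auto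
        then have "V = sshift k om"
          using CC_children_disjoint[OF split(2) s(2), of V "Suc n" k] Suc.prems by simp
        moreover have "k < mm (Suc n)" using idx_less[OF Suc.prems(1)] .
        ultimately show ?thesis by blast
      next
        case False
        then show ?thesis using * Suc.IH[OF split(1) s(1)] Suc.prems split s by auto
      qed
    qed
  qed
qed

text \<open>A shift whose index is split off at the next step still lies in a single piece, the one
  of colour 2 about to be split there: a second piece would force j < \<open>mm n\<close> by
  \<open>CC_disjoint\<close>.\<close>

lemma sshift_om_CC:
  assumes "(i, k) \<in> idx n" "mm n \<le> j" "j < mm (Suc n)" "sshift j om \<in> CC n i k"
  shows "i = 2 \<and> j = L n + k"
proof -
  obtain k' where k': "(2, k') \<in> idx n" "j = L n + k'" using idx_2_exists assms by blast
  have "1 \<in> children" by (simp add: children_def)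
  moreover then have "sshift j om \<in> CC (Suc n) 1 (L n + k')"
    unfolding k'(2) by (intro om_CC) (use children_range in blast)
  ultimately have "sshift j om \<in> CC n 2 k'" using idx_2_split[OF k'(1)] by blast
  then have "(i, k) = (2, k')"
    using CC_disjoint[OF assms(1) k'(1) _ assms(4)] assms(2) sshift_om_inject by fastforce
  then show ?thesis using k' by simp
qed

text \<open>Inside the parent cylinder the letter b in front of the prefix of length K decides the
  child, except for S^K(om), which lies in all children. From length K+1 up to
  \<open>mm (Suc n)\<close> no further splitting occurs, since the shifts S^j(om) responsible for it
  belong to other parents.\<close>

lemma cyl_child:
  assumes k: "(2, k) \<in> idx n" "CC n 2 k = cyl d w" "length w = mm n" and i: "i \<in> children"
  defines "K \<equiv> L n + k"
  defines "b \<equiv> (succ_letter ^^ Suc n) (cletter i)"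
  shows "CC (Suc n) i K = cyl d (b # sprefix K om)" "b # sprefix K om \<in> lang d"
    and "\<And>w'. length w' = mm (Suc n) \<Longrightarrow> w' \<in> lang d \<Longrightarrow> (\<exists>u. w' = u @ b # sprefix K om)
          \<Longrightarrow> cyl d w' = CC (Suc n) i K"
proof -
  have spl: "CC n 2 k = (\<Union>i\<in>children. CC (Suc n) i K)" unfolding K_def by (rule idx_2_split[OF k(1)])
  have KK: "mm n \<le> K" "K < mm (Suc n)" using idx_2_bounds[OF k(1)] by (simp_all add: K_def)
  have ir: "i \<in> {1..2 * d - 2}" using children_range[OF i] by simp
  have Kin: "sshift K om \<in> CC (Suc n) i K" by (rule om_CC[OF ir])
  then have "sshift K om \<in> cyl d w" using spl k(2) i by blast
  then have wK: "sprefix K om = sprefix (K - length w) om @ w"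
    using sshift_om_cyl_suffix KK k(3) by simp
  have sub: "CC (Suc n) c K \<subseteq> cyl d ((succ_letter ^^ Suc n) (cletter c) # sprefix K om)" for c
    using CC_left[of _ "Suc n" c K] unfolding cyl_iff subset_iff by blast
  show eq: "CC (Suc n) i K = cyl d (b # sprefix K om)"
  proof
    show "CC (Suc n) i K \<subseteq> cyl d (b # sprefix K om)" using sub b_def by simp
    show "cyl d (b # sprefix K om) \<subseteq> CC (Suc n) i K"
    proof
      fix V assume V: "V \<in> cyl d (b # sprefix K om)"
      have "V \<in> cyl d w" using V cyl_append_subset[of "b # sprefix (K - length w) om" w] wK by auto
      then obtain c where c: "c \<in> children" "V \<in> CC (Suc n) c K" using spl k(2) by blast
      show "V \<in> CC (Suc n) i K"
      proof (cases "c = i")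
        case False
        then have "b \<noteq> (succ_letter ^^ Suc n) (cletter c)"
          unfolding b_def by (intro children_letter_inj[OF i c(1)]) auto
        moreover have "V \<in> cyl d ((succ_letter ^^ Suc n) (cletter c) # sprefix K om)" using sub c(2) by blast
        ultimately have "V = sshift K om" using left_special_cyl[OF V] by blast
        then show ?thesis using Kin by simp
      qed (use c in simp)
    qed
  qed
  show "b # sprefix K om \<in> lang d" using Kin eq swapp_lang by (auto simp: cyl_iff)
  fix w' assume w': "length w' = mm (Suc n)" "w' \<in> lang d" "\<exists>u. w' = u @ b # sprefix K om"
  then obtain u where u: "w' = u @ b # sprefix K om" by blast
  have "cyl d (u @ b # sprefix K om) = cyl d (b # sprefix K om)"
  proof (rule cyl_extend_eq)
    show "u @ b # sprefix K om \<in> lang d" using w' u by simp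
    fix j assume j: "length (b # sprefix K om) \<le> j" "j < length (u @ b # sprefix K om)"
    have jj: "K < j" "j < mm (Suc n)" using j w'(1) unfolding u[symmetric] by auto
    show "sshift j om \<notin> cyl d (b # sprefix K om)"
    proof
      assume "sshift j om \<in> cyl d (b # sprefix K om)"
      then have "sshift j om \<in> CC n 2 k" using eq spl i by blast
      then show False using sshift_om_CC[OF k(1), of j] KK jj by (simp add: K_def)
    qed
  qed
  then show "cyl d w' = CC (Suc n) i K" using u eq by simp
qed

text \<open>Between the lengths \<open>mm n\<close> and \<open>mm (Suc n)\<close> a cylinder can
  split only at a j with S^j(om) in it; by \<open>sshift_om_CC\<close> this happens once for each
  piece of colour 2 and never for the others.\<close>

theorem idx_partition:
  "(\<forall>(i, k)\<in>idx n. CC n i k \<in> cyl_partition d (mm n)) \<and>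
   (\<forall>P\<in>cyl_partition d (mm n). \<exists>(i, k)\<in>idx n. P = CC n i k)"
proof (induction n)
  case 0
  have "[a] \<in> lang d" if "a \<in> {1..d}" for a using swapp_lang[OF left_om[OF that]] .
  moreover have "bij_betw cletter {1..d} {1..d}"
    by (rule bij_betw_byWitness[where f' = "succ_letter"]) (use d3 in \<open>auto simp: cletter_def succ_letter_def\<close>)
  then have cl: "cletter ` {1..d} = {1..d}" by (simp add: bij_betw_def)
  ultimately have 1: "CC 0 i 0 \<in> cyl_partition d 1" if "i \<in> {1..d}" for i
    using CC_0[OF that] that unfolding cyl_partition_def by (metis (mono_tags, lifting) One_nat_def
        image_eqI length_Cons list.size(3) mem_Collect_eq)
  have 2: "\<exists>i\<in>{1..d}. P = CC 0 i 0" if "P \<in> cyl_partition d 1" for P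
  proof -
    obtain a where a: "P = cyl d [a]" "[a] \<in> lang d"
      using \<open>P \<in> cyl_partition d 1\<close> by (auto simp: cyl_partition_def length_Suc_conv)
    then have "a \<in> {1..d}" using lang_map_range by fastforce
    then obtain i where "i \<in> {1..d}" "a = cletter i" using cl by blast
    then show ?thesis using a CC_0 by auto
  qed
  show ?case using 1 2 by (simp add: mm_0)
next
  case (Suc n)
  have part: "\<exists>w. P = cyl d w \<and> w \<in> lang d \<and> length w = m" if "P \<in> cyl_partition d m" for P m
    using that by (auto simp: cyl_partition_def)
  \<comment> \<open>The last premise stops the extension of a colour 2 word before the length at
    which its cylinder splits.\<close>
  have noshift: "cyl d (u @ w) = CC n i k" if "(i, k) \<in> idx n" "CC n i k = cyl d w" "u @ w \<in> lang d"
    "length w = mm n" "length (u @ w) \<le> mm (Suc n)" "i = 2 \<longrightarrow> length (u @ w) \<le> L n + k" for u w i k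
    using cyl_extend_eq[OF that(3)] sshift_om_CC[OF that(1)] that by fastforce
  have A: "CC (Suc n) i k \<in> cyl_partition d (mm (Suc n))" if ik: "(i, k) \<in> idx (Suc n)" for i k
    using ik
  proof (cases rule: idx_Suc_cases)
    case (shift j)
    then have "CC n j k \<in> cyl_partition d (mm n)" using Suc.IH by auto
    then obtain w where w: "CC n j k = cyl d w" "w \<in> lang d" "length w = mm n" using part by blast
    obtain u where u: "length u = mm (Suc n) - mm n" "u @ w \<in> lang d" using lang_extend[OF w(2)] by blast
    have "length (u @ w) = mm (Suc n)" using u w mm_le[of n] by simp
    moreover have "cyl d (u @ w) = CC n j k"
      using noshift[OF shift(1) w(1) u(2) w(3)] calculation shift(2) by simp
    ultimately show ?thesis using shift(4) u(2) unfolding cyl_partition_def by blast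
  next
    case (split k')
    then have "CC n 2 k' \<in> cyl_partition d (mm n)" using Suc.IH by auto
    then obtain w where w: "CC n 2 k' = cyl d w" "w \<in> lang d" "length w = mm n" using part by blast
    define b where "b = (succ_letter ^^ Suc n) (cletter i)"
    note ch = cyl_child[OF split(1) w(1,3) split(2), folded b_def split(3)]
    obtain u where u: "length u = mm (Suc n) - Suc k" "u @ b # sprefix k om \<in> lang d"
      using lang_extend[OF ch(2)] by blast
    have "length (u @ b # sprefix k om) = mm (Suc n)" using u(1) idx_less[OF ik] by simp
    then have "cyl d (u @ b # sprefix k om) = CC (Suc n) i k" using ch(3) u(2) by blast
    then show ?thesis using u(2) \<open>length (u @ b # sprefix k om) = mm (Suc n)\<close> 
      unfolding cyl_partition_def by blast
  qed
  have B: "\<exists>(i, k)\<in>idx (Suc n). P = CC (Suc n) i k" if P: "P \<in> cyl_partition d (mm (Suc n))" for P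
  proof -
    obtain w' where w': "P = cyl d w'" "w' \<in> lang d" "length w' = mm (Suc n)" using part[OF P] by blast
    define u w where "u = take (mm (Suc n) - mm n) w'" and "w = drop (mm (Suc n) - mm n) w'"
    have uw: "w' = u @ w" "length w = mm n" using w'(3) mm_le[of n] by (simp_all add: u_def w_def)
    have "w \<in> lang d" using w'(2) uw(1) lang_sublist by (metis sublist_append_leftI)
    then have "cyl d w \<in> cyl_partition d (mm n)" using uw(2) by (auto simp: cyl_partition_def)
    from bspec[OF conjunct2[OF Suc.IH] this]
    obtain i k where "(i, k) \<in> idx n" "cyl d w = CC n i k" by (elim bexE) (simp split: prod.splits)
    then have ik: "(i, k) \<in> idx n" "CC n i k = cyl d w" by simp_all
    show ?thesis
    proof (cases "i = 2")
      case False
      then have "P = CC n i k" using noshift[OF ik _ uw(2), of u] w' uw(1) by simp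
      moreover have "(cshift i, k) \<in> idx (Suc n)" using ik(1) False by auto
      moreover have "CC n i k = CC (Suc n) (cshift i) k" using CC_cshift idx_colour[OF ik(1)] False by blast
      ultimately show ?thesis by blast
    next
      case True
      define K where "K = L n + k"
      have KK: "mm n \<le> K" "K < mm (Suc n)" using idx_2_bounds[of k n] ik True by (simp_all add: K_def)
      \<comment> \<open>The word is cut at the one place where the cylinder splits:
        \<open>y\<close>, of length K, must be a prefix of omega, and the letter \<open>b\<close>
        before it names the child.\<close>
      define x b y where "x = take (mm (Suc n) - Suc K) w'" and "b = w' ! (mm (Suc n) - Suc K)"
        and "y = drop (mm (Suc n) - K) w'"
      have "Suc (mm (Suc n) - Suc K) = mm (Suc n) - K" using KK by simp
      then have xy: "w' = x @ b # y" 
        using id_take_nth_drop[of "mm (Suc n) - Suc K" w'] KK w'(3) by (simp add: x_def b_def y_def)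
      have ly: "length y = K" using w'(3) KK by (simp add: y_def)
      define y1 where "y1 = take (K - mm n) y"
      have "drop (K - mm n) y = w" using KK by (simp add: y_def w_def)
      then have y1: "y = y1 @ w" by (metis append_take_drop_id y1_def)
      have "y \<in> lang d" using w'(2) xy lang_sublist[of w' y] by (metis sublist_append_leftI append_Cons append_Nil append_assoc)
      then have "cyl d y = CC n 2 k"
        using noshift[OF ik(1)[unfolded True] ik(2)[unfolded True], of y1] y1 uw(2) ly KK K_def by simp
      moreover have "sshift K om \<in> CC n 2 k"
      proof -
        have c1: "1 \<in> children" by (simp add: children_def)
        have "sshift K om \<in> CC (Suc n) 1 K" by (intro om_CC) (use children_range c1 in blast)
        then show ?thesis using idx_2_split[of k n] ik(1) True c1 unfolding K_def by blast
      qed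
      ultimately have y: "y = sprefix K om" using sshift_om_cyl_suffix[of K y] ly by simp
      have "b \<in> {1..d}" using lang_map_range[OF w'(2)] xy by auto
      then obtain a where a: "a \<in> {1..d}" "b = (succ_letter ^^ Suc n) a"
        using succ_letter_pow_bij[of "Suc n"] unfolding bij_betw_def by (metis imageE)
      then obtain c where c: "c \<in> children" "a = cletter c"
        using cletter_children_bij unfolding bij_betw_def by (metis imageE)
      have "cyl d w' = CC (Suc n) c K"
        using cyl_child(3)[of k n w c w'] ik True uw(2) c a w' xy y by (auto simp: K_def)
      moreover have "(c, K) \<in> idx (Suc n)" using ik(1) True c(1) by (auto simp: K_def)
      ultimately show ?thesis using w'(1) by blast
    qed
  qed
  show ?case using A B by blast
qed

end

section \<open>Geometric side: the free product, edges in gated position, the limit tree\<close>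

section \<open>Geometry of the free product\<close>

text \<open>The Gromov product at O, that is the length of the common initial arc of the geodesics
  from O to the two points. First differing letters in the same copy and of the same sign still
  share an arc of the smaller length.\<close>

fun gp :: "fpword \<Rightarrow> fpword \<Rightarrow> real" where
  "gp ((j, t) # u) ((k, s) # v) =
    (if (j, t) = (k, s) then \<bar>t\<bar> + gp u v else if j = k \<and> 0 < t * s then min \<bar>t\<bar> \<bar>s\<bar> else 0)"
| "gp _ _ = 0"

lemma gp_Nil [simp]: "gp [] v = 0" "gp u [] = 0"
  by (cases v; simp) (cases u; simp)

lemma gp_nonneg: "0 \<le> gp u v"
  by (induction u v rule: gp.induct) auto

lemma gp_commute: "gp u v = gp v u"
  by (induction u v rule: gp.induct) (auto simp: mult.commute min.commute)

text \<open>0-hyperbolicity at the base point. Only the first differing letters need care: having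
  the same copy and sign is transitive.\<close>

lemma gp_ultra: "min (gp u v) (gp v w) \<le> gp u w"
proof (induction u arbitrary: v w)
  case (Cons a u)
  show ?case
  proof (cases v)
    case (Cons b v')
    note v = this
    show ?thesis
    proof (cases w)
      case (Cons c w')
      define h :: "nat \<times> real \<Rightarrow> nat \<times> real \<Rightarrow> real" where
        "h x y = (if fst x = fst y \<and> 0 < snd x * snd y then min \<bar>snd x\<bar> \<bar>snd y\<bar> else 0)" for x y
      have h: "gp (x # p) (y # q) = (if x = y then \<bar>snd x\<bar> + gp p q else h x y)" for x y p q
        by (cases x; cases y) (simp add: h_def)
      have h_le: "h x y \<le> \<bar>snd x\<bar>" for x y by (simp add: h_def)
      have h_nn: "0 \<le> h x y" for x y by (simp add: h_def)
      have sgn: "0 < p * q \<Longrightarrow> 0 < q * r \<Longrightarrow> 0 < p * r" for p q r :: real by (auto simp: zero_less_mult_iff)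
      have h_ultra: "min (h a b) (h b c) \<le> h a c"
      proof (cases "fst a = fst b \<and> 0 < snd a * snd b \<and> fst b = fst c \<and> 0 < snd b * snd c")
        case True
        then have "0 < snd a * snd c" using sgn by blast
        then show ?thesis using True by (simp add: h_def min_le_iff_disj)
      next
        case False
        then have "h a b = 0 \<or> h b c = 0" by (auto simp: h_def)
        then show ?thesis using h_nn[of a c] by (auto simp: min_def)
      qed
      consider "a = b" "b = c" | "a = b" "b \<noteq> c" | "a \<noteq> b" "b = c" | "a \<noteq> b" "b \<noteq> c" "a = c"
        | "a \<noteq> b" "b \<noteq> c" "a \<noteq> c" by blast
      then show ?thesis
      proof cases
        case 1
        then show ?thesis using Cons.IH[of v' w'] unfolding v Cons h by (auto simp: min_def)
      next
        case 4
        then show ?thesis using h_le[of a b] gp_nonneg[of u w'] unfolding v Cons h by (auto simp: min_def)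
      next
        case 5
        then show ?thesis using h_ultra unfolding v Cons h by simp
      qed (unfold v Cons h, auto)
    qed (use gp_nonneg in \<open>simp add: min_le_iff_disj\<close>)
  qed (use gp_nonneg in \<open>simp add: min_le_iff_disj\<close>)
qed (simp add: min_le_iff_disj)

lemma fp_inv_Cons: "fp_inv ((j, t) # u) = fp_inv u @ [(j, - t)]"
  by (simp add: fp_inv_def)

lemma fp_dist_gp:
  assumes "u \<in> fp_carrier d" "v \<in> fp_carrier d"
  shows "fp_dist u v = fp_norm u + fp_norm v - 2 * gp u v"
  using assms
proof (induction u arbitrary: v)
  case Nil
  then show ?case by (simp add: fp_dist_def fp_mult_eq fp_inv_def)
next
  case (Cons a u)
  obtain j t where a: "a = (j, t)" by fastforce
  have u: "u \<in> fp_carrier d" "j < d" "t \<noteq> 0" "u \<noteq> [] \<Longrightarrow> fst (hd u) \<noteq> j"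
    using Cons.prems(1) by (auto simp: a fp_carrier_Cons)
  have z: "gp u ((j, s) # w) = 0" for s w
    using u(4) by (cases u) auto
  have cl: "fp_cons (j, - t) v \<in> fp_carrier d" using Cons.prems(2) u(2) by (simp add: fp_cons_closed)
  have "fp_dist (a # u) v = fp_dist u (fp_cons (j, - t) v)"
    using Cons.prems(2) cl by (simp add: fp_dist_def fp_mult_eq a fp_inv_Cons)
  also have "\<dots> = fp_norm u + fp_norm (fp_cons (j, - t) v) - 2 * gp u (fp_cons (j, - t) v)"
    by (rule Cons.IH[OF u(1) cl])
  also have "\<dots> = fp_norm (a # u) + fp_norm v - 2 * gp (a # u) v"
  proof (cases v)
    case Nil
    then show ?thesis using z u(3) by (simp add: fp_cons_def fp_letter_def a)
  next
    case (Cons b v')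
    obtain k s where b: "b = (k, s)" by fastforce
    have s: "s \<noteq> 0" using Cons.prems(2) Cons b by (auto simp: fp_carrier_Cons)
    have ab: "0 < t * s \<Longrightarrow> \<bar>s - t\<bar> = \<bar>s\<bar> + \<bar>t\<bar> - 2 * min \<bar>t\<bar> \<bar>s\<bar>"
      "\<not> 0 < t * s \<Longrightarrow> \<bar>s - t\<bar> = \<bar>s\<bar> + \<bar>t\<bar>"
      using u(3) s by (auto simp: zero_less_mult_iff min_def abs_if)
    show ?thesis
    proof (cases "j = k \<and> t = s")
      case True
      then show ?thesis by (simp add: fp_cons_def fp_letter_def a b Cons)
    next
      case False
      then show ?thesis using z u(3) ab by (auto simp: fp_cons_def fp_letter_def a b Cons)
    qed
  qed
  finally show ?case .
qed

text \<open>The four-point condition of a real tree, deduced from \<open>gp_ultra\<close>. It serves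
  for points not known to be vertices (\<open>closure_vertices_convex\<close>) and for the
  uniqueness of the descending edge (\<open>lower_unique\<close>).\<close>

lemma fp_four_point:
  assumes "a \<in> fp_carrier d" "b \<in> fp_carrier d" "c \<in> fp_carrier d" "e \<in> fp_carrier d"
  shows "fp_dist a b + fp_dist c e \<le> max (fp_dist a c + fp_dist b e) (fp_dist a e + fp_dist b c)"
proof -
  have "min (gp a c + gp b e) (gp a e + gp b c) \<le> gp a b + gp c e"
    using gp_ultra[of a c b] gp_ultra[of a e b] gp_ultra[of c b e] gp_ultra[of c a e]
      gp_commute[of c b] gp_commute[of e b] gp_commute[of c a]
    by (smt (verit))
  then show ?thesis
    unfolding fp_dist_gp[OF assms(1,2)] fp_dist_gp[OF assms(3,4)] fp_dist_gp[OF assms(1,3)]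
      fp_dist_gp[OF assms(2,4)] fp_dist_gp[OF assms(1,4)] fp_dist_gp[OF assms(2,3)]
    by (auto simp: min_def max_def split: if_splits)
qed

lemma fp_mult_inv_left: "x \<in> fp_carrier d \<Longrightarrow> w \<in> fp_carrier d \<Longrightarrow> fp_mult (fp_inv x) (fp_mult x w) = w"
  using fp_mult_inv[OF fp_inv_closed] by (simp add: fp_inv_inv)

lemma fp_dist_mult: "x \<in> fp_carrier d \<Longrightarrow> w \<in> fp_carrier d \<Longrightarrow> fp_dist x (fp_mult x w) = fp_norm w"
  by (simp add: fp_dist_def fp_mult_inv_left)

lemma fp_dist_left_invariant:
  assumes "z \<in> fp_carrier d" "a \<in> fp_carrier d" "c \<in> fp_carrier d"
  shows "fp_dist (fp_mult z a) (fp_mult z c) = fp_dist a c"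
proof -
  define w where "w = fp_mult (fp_inv a) c"
  have w: "w \<in> fp_carrier d" using assms by (simp add: w_def fp_mult_closed fp_inv_closed)
  have "c = fp_mult a w" using fp_mult_inv[OF assms(2,3)] by (simp add: w_def)
  then have "fp_mult z c = fp_mult (fp_mult z a) w" using fp_mult_assoc[OF assms(1,2) w] by simp
  then have "fp_dist (fp_mult z a) (fp_mult z c) = fp_norm w"
    using fp_dist_mult[OF fp_mult_closed[OF assms(1,2)] w] by simp
  then show ?thesis by (simp add: fp_dist_def w_def)
qed

lemma fp_singleton_carrier: "[(j, t)] \<in> fp_carrier d \<longleftrightarrow> j < d \<and> t \<noteq> 0"
  by (auto simp: fp_carrier_Cons)

text \<open>Equality in the triangle inequality forbids cancellation in the product of z^-1 p and
  p^-1 b; a merging of letters is still possible, but the result starts in the same copy.\<close>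

lemma fp_direction:
  assumes "z \<in> fp_carrier d" "p \<in> fp_carrier d" "b \<in> fp_carrier d"
    and "fp_mult (fp_inv z) p = [(j, r)]" and "r \<noteq> 0" and "fp_dist z b = fp_dist z p + fp_dist p b"
  shows "\<exists>r' v. fp_mult (fp_inv z) b = (j, r') # v"
proof -
  define B where "B = fp_mult (fp_inv p) b"
  have B: "B \<in> fp_carrier d" using assms by (simp add: B_def fp_mult_closed fp_inv_closed)
  have "fp_mult (fp_inv z) b = fp_mult (fp_inv z) (fp_mult p B)"
    using fp_mult_inv[OF assms(2,3)] by (simp add: B_def)
  also have "\<dots> = fp_mult (fp_mult (fp_inv z) p) B"
    using fp_mult_assoc[OF fp_inv_closed[OF assms(1)] assms(2) B] by simp
  also have "\<dots> = fp_cons (j, r) B" using B by (simp add: assms(4) fp_mult_eq)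
  finally have e: "fp_mult (fp_inv z) b = fp_cons (j, r) B" .
  have n: "fp_norm (fp_cons (j, r) B) = \<bar>r\<bar> + fp_norm B"
    using assms(6) unfolding fp_dist_def e assms(4) B_def[symmetric] by simp
  show ?thesis
  proof (cases B)
    case Nil
    then show ?thesis using e assms(5) by (simp add: fp_cons_def fp_letter_def)
  next
    case (Cons c v)
    then show ?thesis using e n assms(5) by (cases c) (auto simp: fp_cons_def fp_letter_def split: if_splits)
  qed
qed

lemma fp_dist_attach:
  assumes "z \<in> fp_carrier d" "b \<in> fp_carrier d" "fp_mult (fp_inv z) b = (j, r) # v"
    and "k < d" "k \<noteq> j" "t \<noteq> 0"
  shows "fp_dist (fp_mult z [(k, t)]) b = \<bar>t\<bar> + fp_dist z b"
proof -
  define B where "B = fp_mult (fp_inv z) b"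
  have B: "B \<in> fp_carrier d" unfolding B_def using assms(1,2) by (simp only: fp_mult_closed fp_inv_closed)
  have k: "[(k, t)] \<in> fp_carrier d" using assms by (simp add: fp_singleton_carrier)
  have "b = fp_mult z B" using fp_mult_inv[OF assms(1,2)] by (simp add: B_def)
  then have "fp_dist (fp_mult z [(k, t)]) b = fp_dist [(k, t)] B"
    using fp_dist_left_invariant[OF assms(1) k B] by simp
  also have "\<dots> = \<bar>t\<bar> + fp_norm B - 2 * gp [(k, t)] B" using fp_dist_gp[OF k B] by simp
  also have "gp [(k, t)] B = 0" using assms(3,5) by (simp add: B_def)
  finally show ?thesis by (simp add: fp_dist_def B_def)
qed

lemma fp_dist_letters:
  assumes "z \<in> fp_carrier d" "j < d" "k < d" "t \<noteq> 0" "s \<noteq> 0" "j \<noteq> k \<or> t * s < 0"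
  shows "fp_dist (fp_mult z [(j, t)]) (fp_mult z [(k, s)]) = \<bar>t\<bar> + \<bar>s\<bar>"
proof -
  have c: "[(j, t)] \<in> fp_carrier d" "[(k, s)] \<in> fp_carrier d" using assms by (simp_all add: fp_singleton_carrier)
  have "gp [(j, t)] [(k, s)] = 0" using assms(6) by auto
  then show ?thesis using fp_dist_left_invariant[OF assms(1) c] fp_dist_gp[OF c] by simp
qed

lemma fp_mult_letter_letter:
  assumes "y \<in> fp_carrier d" "j < d" "t \<noteq> 0" "s \<noteq> 0"
  shows "fp_mult (fp_inv (fp_mult y [(j, t)])) (fp_mult y [(j, s)]) = fp_letter j (s - t)"
proof -
  have c: "[(j, t)] \<in> fp_carrier d" "fp_letter j (s - t) \<in> fp_carrier d" "[(j, - t)] \<in> fp_carrier d"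
    using assms by (simp_all add: fp_singleton_carrier fp_letter_def)
  have "[(j, s)] = fp_mult [(j, t)] (fp_letter j (s - t))"
    unfolding fp_mult_eq[OF c(2)] using assms by (auto simp: fp_letter_def fp_cons_def)
  then have "fp_mult y [(j, s)] = fp_mult (fp_mult y [(j, t)]) (fp_letter j (s - t))"
    using fp_mult_assoc[OF assms(1) c(1,2)] by simp
  then show ?thesis using fp_mult_inv_left[OF fp_mult_closed[OF assms(1) c(1)] c(2)] by simp
qed

lemma fp_mult_inv_letter:
  assumes "y \<in> fp_carrier d" "j < d" "t \<noteq> 0"
  shows "fp_mult (fp_inv (fp_mult y [(j, t)])) y = [(j, - t)]"
proof -
  have c: "[(j, t)] \<in> fp_carrier d" "[(j, - t)] \<in> fp_carrier d"
    using assms by (simp_all add: fp_singleton_carrier)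
  have "fp_mult [(j, t)] [(j, - t)] = []"
    by (simp add: fp_mult_eq[OF c(2)] fp_letter_def fp_cons_def)
  then have "fp_mult (fp_mult y [(j, t)]) [(j, - t)] = y"
    using fp_mult_assoc[OF assms(1) c] fp_reduce_reduced[OF assms(1)] by (simp add: fp_mult_def)
  then show ?thesis using fp_mult_inv_left[OF fp_mult_closed[OF assms(1) c(1)] c(2)] by simp
qed

lemma fp_dist_nonneg: "0 \<le> fp_dist x y"
  by (simp add: fp_dist_def fp_norm_nonneg)

lemma fp_dist_commute: "x \<in> fp_carrier d \<Longrightarrow> y \<in> fp_carrier d \<Longrightarrow> fp_dist x y = fp_dist y x"
  using Metric_space.commute[OF Metric_space_fp] by blast

lemma fp_dist_triangle: "x \<in> fp_carrier d \<Longrightarrow> y \<in> fp_carrier d \<Longrightarrow> z \<in> fp_carrier d \<Longrightarrow> fp_dist x z \<le> fp_dist x y + fp_dist y z"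
  using Metric_space.triangle[OF Metric_space_fp] by blast

lemma fp_dist_0: "x \<in> fp_carrier d \<Longrightarrow> y \<in> fp_carrier d \<Longrightarrow> fp_dist x y = 0 \<longleftrightarrow> x = y"
  using Metric_space.zero[OF Metric_space_fp] by blast

section \<open>The simplicial trees\<close>

context subst
begin

abbreviation "E \<equiv> stree_at d"

lemma E_Suc: "E (Suc n) = subst_tree d (E n)"
  by (simp add: stree_at_def)

lemma E_0: "E 0 = {(Base 0, Base j, j) |j. 1 \<le> j \<and> j \<le> d}"
  by (simp add: stree_at_def)

definition ends :: "vertex \<times> vertex \<times> nat \<Rightarrow> vertex set" where
  "ends e = {fst e, fst (snd e)}"

lemma ends_simp [simp]: "ends (x, y, i) = {x, y}"
  by (simp add: ends_def)

lemma verts_ends: "verts T = (\<Union>e\<in>T. ends e)"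
  by (force simp: verts_def ends_def)

lemma subst_edge_2: "subst_edge d (x, y, 2) =
    {(New x y 0, x, d), (New x y 0, y, 1)} \<union> {(New x y 0, New x y h, d + h) |h. 1 \<le> h \<and> h \<le> d - 2}"
  by simp

lemma subst_edge_shift: "i \<noteq> 2 \<Longrightarrow> subst_edge d (x, y, i) = {(x, y, cshift i)}"
  by (simp add: cshift_def)

declare subst_edge.simps [simp del]

definition desc :: "nat \<Rightarrow> vertex \<times> vertex \<times> nat \<Rightarrow> stree" where
  "desc k e = (subst_tree d ^^ k) {e}"

lemma desc_0 [simp]: "desc 0 e = {e}"
  by (simp add: desc_def)

lemma subst_tree_UN: "subst_tree d (\<Union>e\<in>T. A e) = (\<Union>e\<in>T. subst_tree d (A e))"
  by (auto simp: subst_tree_def)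

lemma subst_tree_pow: "(subst_tree d ^^ k) T = (\<Union>e\<in>T. desc k e)"
proof (induction k)
  case (Suc k)
  show ?case by (simp add: Suc subst_tree_UN) (simp add: desc_def)
qed simp

lemma desc_Suc: "desc (Suc k) e = (\<Union>f\<in>subst_edge d e. desc k f)"
proof -
  have "desc (Suc k) e = (subst_tree d ^^ k) (subst_tree d {e})"
    by (simp add: desc_def funpow_swap1)
  then show ?thesis by (simp add: subst_tree_pow subst_tree_def)
qed

lemma E_add: "E (n + k) = (\<Union>e\<in>E n. desc k e)"
proof -
  have "E (n + k) = (subst_tree d ^^ k) (E n)" by (simp add: stree_at_def add.commute funpow_add)
  then show ?thesis by (simp add: subst_tree_pow)
qed

lemma E_SucE:
  assumes "f \<in> E (Suc n)"
  obtains e where "e \<in> E n" "f \<in> subst_edge d e"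
  using assms by (auto simp: E_Suc subst_tree_def)

lemma E_SucI: "e \<in> E n \<Longrightarrow> f \<in> subst_edge d e \<Longrightarrow> f \<in> E (Suc n)"
  by (auto simp: E_Suc subst_tree_def)

lemma subst_edge_cases:
  assumes "f \<in> subst_edge d (x, y, i)"
  obtains (shift) "i \<noteq> 2" "f = (x, y, cshift i)"
  | (first) "i = 2" "f = (New x y 0, x, d)"
  | (second) "i = 2" "f = (New x y 0, y, 1)"
  | (new) h where "i = 2" "1 \<le> h" "h \<le> d - 2" "f = (New x y 0, New x y h, d + h)"
proof (cases "i = 2")
  case True
  then have "f \<in> subst_edge d (x, y, 2)" using assms by simp
  then show thesis unfolding subst_edge_2 using True that by blast
next
  case False
  then show thesis using assms that by (simp add: subst_edge_shift)
qed

definition ch :: "vertex \<times> vertex \<times> nat \<Rightarrow> vertex set" where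
  "ch e = verts (subst_edge d e)"

lemma ch_2: "ch (x, y, 2) = {x, y} \<union> {New x y h |h. h \<le> d - 2}"
proof
  show "ch (x, y, 2) \<subseteq> {x, y} \<union> {New x y h |h. h \<le> d - 2}"
    unfolding ch_def verts_ends subst_edge_2 by auto
  have "(New x y 0, New x y h, d + h) \<in> subst_edge d (x, y, 2)" if "1 \<le> h" "h \<le> d - 2" for h
    unfolding subst_edge_2 using that by blast
  then have "New x y h \<in> ch (x, y, 2)" if "1 \<le> h" "h \<le> d - 2" for h
    unfolding ch_def verts_ends using that by force
  moreover have "New x y 0 \<in> ch (x, y, 2)" "x \<in> ch (x, y, 2)" "y \<in> ch (x, y, 2)"
    unfolding ch_def verts_ends subst_edge_2 by auto
  ultimately show "{x, y} \<union> {New x y h |h. h \<le> d - 2} \<subseteq> ch (x, y, 2)"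
    by (auto simp: Suc_le_eq) (metis One_nat_def Suc_leI neq0_conv)
qed

lemma ch_shift: "i \<noteq> 2 \<Longrightarrow> ch (x, y, i) = {x, y}"
  by (auto simp: ch_def verts_ends subst_edge_shift)

lemma ends_ch: "ends e \<subseteq> ch e"
  by (cases e; cases "snd (snd e) = 2") (auto simp: ch_2 ch_shift)

lemma subst_edge_ends_ch: "f \<in> subst_edge d e \<Longrightarrow> ends f \<subseteq> ch e"
  by (auto simp: ch_def verts_ends)

lemma verts_E_Suc: "verts (E (Suc n)) = (\<Union>e\<in>E n. ch e)"
  by (auto simp: E_Suc subst_tree_def verts_ends ch_def)

lemma verts_E_mono: "m \<le> n \<Longrightarrow> verts (E m) \<subseteq> verts (E n)"
proof (rule lift_Suc_mono_le[of "\<lambda>n. verts (E n)"])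
  show "verts (E n) \<subseteq> verts (E (Suc n))" for n
    unfolding verts_E_Suc verts_ends[of "E n"] using ends_ch by blast
qed

lemma finite_E: "finite (E n)"
proof (induction n)
  case 0
  have "E 0 = (\<lambda>j. (Base 0, Base j, j)) ` {1..d}" by (auto simp: E_0)
  then show ?case by simp
next
  case (Suc n)
  have "finite (subst_edge d (x, y, i))" for x y i
    by (cases "i = 2") (simp_all add: subst_edge_2 subst_edge_shift)
  then show ?case using Suc unfolding E_Suc subst_tree_def by auto
qed

lemma E_colour: "(x, y, i) \<in> E n \<Longrightarrow> i \<in> {1..2 * d - 2}"
proof (induction n arbitrary: x y i)
  case 0
  then show ?case using d3 by (auto simp: E_0)
next
  case (Suc n)
  then obtain x' y' i' where e: "(x', y', i') \<in> E n" "(x, y, i) \<in> subst_edge d (x', y', i')"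
    by (metis E_SucE prod_cases3)
  from e(2) show ?case
  proof (cases rule: subst_edge_cases)
    case shift
    then show ?thesis using Suc.IH[OF e(1)] cshift_range by simp
  qed (use d3 in auto)
qed

lemma birth_le:
  assumes "v \<in> verts (E n)"
  shows "birth d v \<le> n" "v \<in> verts (E (birth d v))"
  unfolding birth_def by (rule Least_le, rule assms) (rule LeastI[of "\<lambda>n. v \<in> verts (E n)", OF assms])

lemma birth_new:
  assumes "v \<in> verts (E (Suc n))" "v \<notin> verts (E n)"
  shows "birth d v = Suc n"
proof -
  have "\<not> birth d v \<le> n" using birth_le(2)[OF assms(1)] verts_E_mono assms(2) by blast
  then show ?thesis using birth_le(1)[OF assms(1)] by simp
qed

text \<open>The name of a vertex records the edge that created it, so a premature occurrence of the
  name would exhibit (x, y, 2) at an earlier stage; \<open>split_pos_exists\<close> refutes this by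
  lengths.\<close>

lemma New_in_verts: "New x y h \<in> verts (E n) \<Longrightarrow> \<exists>k<n. (x, y, 2) \<in> E k"
proof (induction n)
  case 0
  then show ?case by (auto simp: verts_ends E_0)
next
  case (Suc n)
  then obtain x' y' i' where e: "(x', y', i') \<in> E n" "New x y h \<in> ch (x', y', i')"
    unfolding verts_E_Suc by auto
  show ?case
  proof (cases "i' = 2 \<and> x' = x \<and> y' = y")
    case True
    then show ?thesis using e by blast
  next
    case False
    then have "New x y h \<in> {x', y'}" using e(2) by (cases "i' = 2") (auto simp: ch_2 ch_shift)
    then have "New x y h \<in> verts (E n)" using e(1) by (force simp: verts_ends)
    then show ?thesis using Suc.IH less_Suc_eq by blast
  qed
qed

end

section \<open>The embedded trees\<close>

locale tree_subst = subst +
  fixes \<eta> :: real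
  assumes eta1: "1 < \<eta>" and eta_eq: "\<eta> ^ d = \<eta> + 1"
begin

definition th :: real where "th = 1 / \<eta>"

lemma th: "0 < th" "th < 1" "th * \<eta> = 1"
  using eta1 by (simp_all add: th_def)

lemma powi_th: "\<eta> powi (- int k) = th ^ k"
  by (simp add: power_int_minus th_def power_one_over inverse_eq_divide)

definition N :: "vertex \<Rightarrow> fpword" where
  "N v = nu d \<eta> (birth d v) v"

lemma nu_eq_N: "v \<in> verts (E n) \<Longrightarrow> nu d \<eta> n v = N v"
proof -
  assume v: "v \<in> verts (E n)"
  have "nu d \<eta> (birth d v + k) v = nu d \<eta> (birth d v) v" for k
  proof (induction k)
    case (Suc k)
    have "v \<in> verts (E (birth d v + k))"
      using birth_le(2)[OF v] verts_E_mono[of "birth d v" "birth d v + k"] by auto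
    then show ?case using Suc by simp
  qed simp
  from this[of "n - birth d v"] show ?thesis using birth_le(1)[OF v] by (simp add: N_def)
qed

definition DD :: "vertex \<Rightarrow> vertex \<Rightarrow> real" where
  "DD v w = fp_dist (N v) (N w)"

text \<open>Edge lengths up to the factor th^n. They form an eigenvector:
  \<open>wl i = th * wl (cshift i)\<close> for i other than 2, and
  \<open>wl 2 = th * (wl d + wl 1)\<close>, where the second identity is eta^d = eta + 1
  (\<open>wl_2\<close>).\<close>

definition wl :: "nat \<Rightarrow> real" where
  "wl i = (if i = 1 then 1 else if i \<le> d then \<eta> ^ (d - i + 1) else th ^ (i - d))"

lemma wl_pos: "0 < wl i"
  using eta1 th(1) by (simp add: wl_def)

lemma wl_shift: "i \<in> {1..2 * d - 2} \<Longrightarrow> i \<noteq> 2 \<Longrightarrow> wl i = th * wl (cshift i)"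
proof -
  assume i: "i \<in> {1..2 * d - 2}" "i \<noteq> 2"
  have e: "th * (\<eta> * z) = z" for z using th(3) by (simp add: mult.assoc[symmetric])
  consider "i = 1" | "3 \<le> i" "i \<le> d" | "i = d + 1" | "d + 2 \<le> i" using i by force
  then show ?thesis
  proof cases
    case 1
    then show ?thesis using d3 e[of 1] by (simp add: wl_def cshift_def)
  next
    case 2
    then have "cshift i = i - 1" "d - (i - 1) + 1 = Suc (d - i + 1)" "i - 1 \<noteq> 1" "i - 1 \<le> d" "i \<noteq> 1"
      by (auto simp: cshift_def)
    then show ?thesis using 2(2) unfolding wl_def by (simp only: if_False if_True power_Suc e)
  next
    case 3
    then show ?thesis using d3 by (simp add: wl_def cshift_def)
  next
    case 4
    then have "cshift i = i - 1" "i - d = Suc (i - 1 - d)" "\<not> i - 1 \<le> d" by (auto simp: cshift_def)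
    then show ?thesis using 4 d3 by (simp add: wl_def)
  qed
qed

text \<open>That the two ends differ by a single letter is what the definition of \<open>nu\<close>
  presupposes when it reads off the copy j.\<close>

definition good_edge :: "nat \<Rightarrow> vertex \<times> vertex \<times> nat \<Rightarrow> bool" where
  "good_edge n e \<longleftrightarrow> (case e of (x, y, i) \<Rightarrow> N x \<in> fp_carrier d \<and> N y \<in> fp_carrier d \<and>
     (\<exists>j p. j < d \<and> N y = fp_mult (N x) [(j, p)] \<and> \<bar>p\<bar> = th ^ n * wl i))"

lemma good_edge_DD:
  assumes "good_edge n (x, y, i)"
  shows "DD x y = th ^ n * wl i"
proof -
  obtain j p where jp: "j < d" "N y = fp_mult (N x) [(j, p)]" "\<bar>p\<bar> = th ^ n * wl i" "N x \<in> fp_carrier d"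
    using assms by (auto simp: good_edge_def)
  have "0 < th ^ n * wl i" using wl_pos[of i] th(1) by simp
  then have "p \<noteq> 0" using jp(3) by auto
  then have "[(j, p)] \<in> fp_carrier d" using jp(1) by (simp add: fp_singleton_carrier)
  then show ?thesis using fp_dist_mult[OF jp(4)] jp(2,3) by (simp add: DD_def)
qed

lemma N_Base_0: "N (Base 0) = []"
proof -
  have "Base 0 \<in> verts (E 0)" using d3 by (auto simp: verts_ends E_0 intro!: exI[of _ "{Base 0, Base 1}"] exI[of _ "1::nat"])
  then show ?thesis using nu_eq_N[of "Base 0" 0] by simp
qed

lemma N_Base: "1 \<le> j \<Longrightarrow> j \<le> d \<Longrightarrow> N (Base j) = [(j - 1, wl j)]"
proof -
  assume j: "1 \<le> j" "j \<le> d"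
  then have "Base j \<in> verts (E 0)" by (force simp: verts_ends E_0)
  then have "N (Base j) = nu d \<eta> 0 (Base j)" by (rule nu_eq_N[symmetric])
  also have "\<dots> = [(j - 1, wl j)]" using j wl_pos[of j] eta1 by (auto simp: fp_letter_def wl_def)
  finally show ?thesis .
qed

lemma good_edge_0: "e \<in> E 0 \<Longrightarrow> good_edge 0 e"
proof -
  assume "e \<in> E 0"
  then obtain j where j: "e = (Base 0, Base j, j)" "1 \<le> j" "j \<le> d" by (auto simp: E_0)
  have c: "[(j - 1, wl j)] \<in> fp_carrier d" using j wl_pos[of j] by (simp add: fp_singleton_carrier)
  then have "fp_mult [] [(j - 1, wl j)] = [(j - 1, wl j)]" by (simp add: fp_mult_eq)
  then show ?thesis using c j wl_pos[of j] by (auto simp: good_edge_def N_Base_0 N_Base intro!: exI[of _ "j - 1"] exI[of _ "wl j"])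
qed

definition split_pos :: "nat \<Rightarrow> vertex \<Rightarrow> vertex \<Rightarrow> nat \<Rightarrow> real \<Rightarrow> bool" where
  "split_pos n x y j p \<longleftrightarrow> j < d \<and> \<bar>p\<bar> = th ^ Suc n * \<eta> + th ^ Suc n \<and> N y \<in> fp_carrier d \<and>
     N x = fp_mult (N y) [(j, p)] \<and>
     N (New x y 0) = fp_mult (N y) [(j, sgn p * th ^ Suc n)] \<and>
     (\<forall>h. 1 \<le> h \<and> h \<le> d - 2 \<longrightarrow> N (New x y h) = fp_mult (N (New x y 0)) [((j + h) mod d, th ^ (Suc n + h))])"

lemma wl_2: "th ^ n * wl 2 = th ^ Suc n * \<eta> + th ^ Suc n"
proof -
  have "d - 2 + 1 = d - 1" using d3 by simp
  then have "wl 2 = \<eta> ^ (d - 1)" using d3 unfolding wl_def by simp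
  moreover have "\<eta> ^ d = \<eta> * \<eta> ^ (d - 1)" using d3 by (cases d) auto
  ultimately have "wl 2 = th * (\<eta> + 1)" using eta_eq th(3) by (metis mult.assoc mult.left_neutral)
  then show ?thesis by (simp add: algebra_simps)
qed

text \<open>Freshness is metric: if \<open>New x y h\<close> existed already, (x, y, 2) would have
  been an edge of some stage k < n, with a length th^k wl(2) different from its present length th^n
  wl(2). This needs the lengths at all stages up to n, hence the hypothesis and the strong induction
  in \<open>good_edges\<close>.\<close>

lemma split_pos_exists:
  assumes e: "(x, y, 2) \<in> E n" and good: "\<And>k e. k \<le> n \<Longrightarrow> e \<in> E k \<Longrightarrow> good_edge k e"
  shows "(\<forall>h\<le>d - 2. New x y h \<notin> verts (E n) \<and> birth d (New x y h) = Suc n) \<and> (\<exists>j p. split_pos n x y j p)"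
proof -
  have g: "good_edge n (x, y, 2)" using good e by blast
  have fresh: "New x y h \<notin> verts (E n)" for h
  proof
    assume "New x y h \<in> verts (E n)"
    then obtain k where k: "k < n" "(x, y, 2) \<in> E k" using New_in_verts by blast
    then have "th ^ k * wl 2 = th ^ n * wl 2"
      using good_edge_DD[OF g] good_edge_DD[of k x y 2] good[of k] by simp
    then have "th ^ k = th ^ n" using wl_pos[of 2] by simp
    moreover have "th ^ n < th ^ k" using k th by (simp add: power_strict_decreasing)
    ultimately show False by simp
  qed
  have new: "New x y h \<in> verts (E (Suc n))" if "h \<le> d - 2" for h
    unfolding verts_E_Suc using e that ch_2[of x y] by blast
  have birth: "birth d (New x y h) = Suc n" if "h \<le> d - 2" for h
    using birth_new[OF new[OF that] fresh] .
  obtain j p' where jp: "j < d" "N y = fp_mult (N x) [(j, p')]" "\<bar>p'\<bar> = th ^ n * wl 2"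
    "N x \<in> fp_carrier d" "N y \<in> fp_carrier d"
    using g by (auto simp: good_edge_def)
  have p': "p' \<noteq> 0" using jp(3) wl_pos[of 2] th(1) by auto
  define p where "p = - p'"
  have yx: "fp_mult (fp_inv (N y)) (N x) = [(j, p)]"
    using fp_mult_inv_letter[OF jp(4,1) p'] jp(2) by (simp add: p_def)
  then have Nx: "N x = fp_mult (N y) [(j, p)]" using fp_mult_inv[OF jp(5,4)] by simp
  have xy: "x \<in> verts (E n)" "y \<in> verts (E n)" using e by (force simp: verts_ends)+
  have "p / \<bar>p\<bar> = sgn p" using p' by (simp add: p_def sgn_if)
  moreover have "sgn p * th ^ Suc n \<noteq> 0" using p' th(1) by (simp add: p_def sgn_if)
  moreover have "\<eta> powi (- int (Suc n)) = th ^ Suc n" by (rule powi_th)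
  ultimately have sg: "p / \<bar>p\<bar> * \<eta> powi (- int (Suc n)) = sgn p * th ^ Suc n" 
    and letter: "fp_letter j (sgn p * th ^ Suc n) = [(j, sgn p * th ^ Suc n)]" 
    unfolding fp_letter_def by simp_all
  have nuS: "nu d \<eta> (Suc n) (New x y h) =
     (if h = 0 then fp_mult (N y) [(j, sgn p * th ^ Suc n)]
      else fp_mult (fp_mult (N y) [(j, sgn p * th ^ Suc n)]) (fp_letter ((j + h) mod d) (\<eta> powi (- int (Suc n) - int h))))" for h
    using fresh[of h] sg letter by (simp add: nu_eq_N[OF xy(1)] nu_eq_N[OF xy(2)] yx Let_def del: of_nat_Suc power_Suc)
  have Nz: "N (New x y 0) = fp_mult (N y) [(j, sgn p * th ^ Suc n)]"
    unfolding N_def birth[OF le0] nuS by simp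
  have "N (New x y h) = fp_mult (N (New x y 0)) [((j + h) mod d, th ^ (Suc n + h))]" if "1 \<le> h" "h \<le> d - 2" for h
  proof -
    have "\<eta> powi (- int (Suc n) - int h) = th ^ (Suc n + h)" using powi_th[of "Suc n + h"] by (simp only: of_nat_add minus_add_distrib diff_conv_add_uminus)
    moreover have "th ^ (Suc n + h) \<noteq> 0" using th(1) by simp
    ultimately have "fp_letter ((j + h) mod d) (\<eta> powi (- int (Suc n) - int h)) = [((j + h) mod d, th ^ (Suc n + h))]"
      by (simp only: fp_letter_def if_False)
    then show ?thesis unfolding Nz unfolding N_def birth[OF that(2)] nuS using that(1) by simp
  qed
  moreover have "\<bar>p\<bar> = th ^ n * wl 2" using jp(3) by (simp add: p_def)
  ultimately have "split_pos n x y j p"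
    unfolding split_pos_def wl_2[symmetric] using jp(1,5) Nx Nz by blast
  then show ?thesis using fresh birth by blast
qed

lemma split_letters:
  assumes "split_pos n x y j p"
  shows "\<exists>r s. N (New x y 0) \<in> fp_carrier d \<and> N x = fp_mult (N (New x y 0)) [(j, r)]
    \<and> N y = fp_mult (N (New x y 0)) [(j, s)] \<and> \<bar>r\<bar> = th ^ Suc n * \<eta> \<and> \<bar>s\<bar> = th ^ Suc n \<and> r * s < 0"
proof -
  note S = assms[unfolded split_pos_def]
  define z where "z = New x y 0"
  define t where "t = th ^ Suc n"
  have t: "0 < t" using th(1) by (simp add: t_def)
  have te: "0 < t * \<eta>" using t eta1 by simp
  have ap: "\<bar>p\<bar> = t * \<eta> + t" using S by (simp add: t_def)
  then have p0: "p \<noteq> 0" using t te by auto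
  have sp: "sgn p * t \<noteq> 0" using p0 t by (simp add: sgn_if)
  have y: "N y \<in> fp_carrier d" "j < d" using S by blast+
  have Nx: "N x = fp_mult (N y) [(j, p)]" and Nz: "N z = fp_mult (N y) [(j, sgn p * t)]"
    using S by (simp_all add: z_def t_def)
  have c: "[(j, p)] \<in> fp_carrier d" "[(j, sgn p * t)] \<in> fp_carrier d"
    using y p0 sp by (simp_all add: fp_singleton_carrier)
  have xz: "N x \<in> fp_carrier d" "N z \<in> fp_carrier d" using fp_mult_closed y(1) c unfolding Nx Nz by blast+
  have pt: "p - sgn p * t \<noteq> 0" "\<bar>p - sgn p * t\<bar> = t * \<eta>" using ap p0 t te by (auto simp: sgn_if abs_if split: if_splits)
  have "fp_mult (fp_inv (N z)) (N x) = [(j, p - sgn p * t)]"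
    using fp_mult_letter_letter[OF y sp p0] pt(1) by (simp add: Nx Nz fp_letter_def)
  then have 1: "N x = fp_mult (N z) [(j, p - sgn p * t)]" using fp_mult_inv[OF xz(2,1)] by simp
  have "fp_mult (fp_inv (N z)) (N y) = [(j, - (sgn p * t))]"
    using fp_mult_inv_letter[OF y sp] by (simp add: Nz)
  then have 2: "N y = fp_mult (N z) [(j, - (sgn p * t))]" using fp_mult_inv[OF xz(2) y(1)] by simp
  have 3: "\<bar>- (sgn p * t)\<bar> = t" using p0 t by (simp add: abs_mult)
  have "(p - sgn p * t) * - (sgn p * t) < 0"
  proof (cases "0 < p")
    case True
    then have "p = t * \<eta> + t" using ap by simp
    then show ?thesis using True t te by simp
  next
    case False
    then have "p = - (t * \<eta> + t)" using ap by simp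
    then show ?thesis using False p0 t te by (simp add: sgn_if)
  qed
  then show ?thesis using 1 2 3 pt(2) xz(2) unfolding z_def t_def by blast
qed

lemma split_pos_good:
  assumes s: "split_pos n x y j p" and f: "f \<in> subst_edge d (x, y, 2)"
  shows "good_edge (Suc n) f"
proof -
  define z where "z = New x y 0"
  define t where "t = th ^ Suc n"
  have t: "0 < t" using th(1) by (simp add: t_def)
  obtain r u where ru: "N z \<in> fp_carrier d" "N x = fp_mult (N z) [(j, r)]" "N y = fp_mult (N z) [(j, u)]"
    "\<bar>r\<bar> = t * \<eta>" "\<bar>u\<bar> = t"
    using split_letters[OF s] unfolding z_def t_def by blast
  have j: "j < d" using s by (simp add: split_pos_def)
  have "r \<noteq> 0" "u \<noteq> 0" using ru(4,5) t eta1 by auto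
  then have c: "[(j, r)] \<in> fp_carrier d" "[(j, u)] \<in> fp_carrier d" using j by (simp_all add: fp_singleton_carrier)
  have xy: "N x \<in> fp_carrier d" "N y \<in> fp_carrier d" using fp_mult_closed ru(1) c unfolding ru(2,3) by blast+
  from f show ?thesis
  proof (cases rule: subst_edge_cases)
    case first
    have "wl d = \<eta>" using d3 by (simp add: wl_def)
    then show ?thesis unfolding first good_edge_def z_def[symmetric] t_def[symmetric]
      using ru xy j by (intro case_prodI conjI exI[of _ j] exI[of _ r]) simp_all
  next
    case second
    have "wl 1 = 1" by (simp add: wl_def)
    then show ?thesis unfolding second good_edge_def z_def[symmetric] t_def[symmetric]
      using ru xy j by (intro case_prodI conjI exI[of _ j] exI[of _ u]) simp_all
  next
    case (new h)
    have "N (New x y h) = fp_mult (N z) [((j + h) mod d, th ^ (Suc n + h))]"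
      using s new(2,3) unfolding z_def split_pos_def by blast
    then have Nh: "N (New x y h) = fp_mult (N z) [((j + h) mod d, t * th ^ h)]"
      unfolding t_def power_add .
    have "(j + h) mod d < d" using d3 by simp
    moreover have "t * th ^ h \<noteq> 0" using t th by simp
    ultimately have c3: "[((j + h) mod d, t * th ^ h)] \<in> fp_carrier d" by (simp add: fp_singleton_carrier)
    have "N (New x y h) \<in> fp_carrier d" unfolding Nh using fp_mult_closed ru(1) c3 by blast
    moreover have "\<bar>t * th ^ h\<bar> = t * wl (d + h)" using new(2) d3 t th(1) by (simp add: wl_def abs_mult)
    ultimately show ?thesis unfolding new(4) good_edge_def z_def[symmetric] t_def[symmetric]
      using ru(1) Nh \<open>(j + h) mod d < d\<close> by auto
  qed simp
qed

theorem good_edges: "e \<in> E n \<Longrightarrow> good_edge n e"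
proof (induction n arbitrary: e rule: less_induct)
  case (less n)
  show ?case
  proof (cases n)
    case 0
    then show ?thesis using good_edge_0 less.prems by simp
  next
    case (Suc m)
    then obtain x y i where e': "(x, y, i) \<in> E m" "e \<in> subst_edge d (x, y, i)"
      using less.prems by (metis E_SucE prod_cases3)
    have IH: "\<And>k e. k \<le> m \<Longrightarrow> e \<in> E k \<Longrightarrow> good_edge k e" using less.IH Suc by simp
    show ?thesis
    proof (cases "i = 2")
      case True
      then show ?thesis using split_pos_exists[of x y m] IH e' split_pos_good Suc by blast
    next
      case False
      have "wl i = th * wl (cshift i)" using wl_shift E_colour[OF e'(1)] False by blast
      then have "th ^ m * wl i = th ^ Suc m * wl (cshift i)" by simp
      moreover have "e = (x, y, cshift i)" using e'(2) False by (simp add: subst_edge_shift)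
      moreover have "good_edge m (x, y, i)" using IH e'(1) by simp
      ultimately show ?thesis unfolding good_edge_def Suc by (simp del: power_Suc)
    qed
  qed
qed

lemma New_fresh: "(x, y, 2) \<in> E n \<Longrightarrow> h \<le> d - 2 \<Longrightarrow> New x y h \<notin> verts (E n)"
  using split_pos_exists good_edges by blast

lemma birth_New: "(x, y, 2) \<in> E n \<Longrightarrow> h \<le> d - 2 \<Longrightarrow> birth d (New x y h) = Suc n"
  using split_pos_exists good_edges by blast

lemma split_pos: "(x, y, 2) \<in> E n \<Longrightarrow> \<exists>j p. split_pos n x y j p"
  using split_pos_exists good_edges by blast

lemma N_carrier: "v \<in> verts (E n) \<Longrightarrow> N v \<in> fp_carrier d"
  using good_edges by (force simp: verts_ends good_edge_def)

lemma DD_edge: "(x, y, i) \<in> E n \<Longrightarrow> DD x y = th ^ n * wl i"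
  using good_edges good_edge_DD by blast

definition VV :: "vertex set" where
  "VV = (\<Union>n. verts (E n))"

lemma VV_I: "v \<in> verts (E n) \<Longrightarrow> v \<in> VV"
  by (auto simp: VV_def)

lemma N_VV: "v \<in> VV \<Longrightarrow> N v \<in> fp_carrier d"
  using N_carrier by (auto simp: VV_def)

lemma DD_self: "v \<in> VV \<Longrightarrow> DD v v = 0"
  unfolding DD_def using fp_dist_0 N_VV by blast

lemma DD_commute: "v \<in> VV \<Longrightarrow> w \<in> VV \<Longrightarrow> DD v w = DD w v"
  unfolding DD_def using fp_dist_commute N_VV by blast

lemma DD_triangle: "u \<in> VV \<Longrightarrow> v \<in> VV \<Longrightarrow> w \<in> VV \<Longrightarrow> DD u w \<le> DD u v + DD v w"
  unfolding DD_def using fp_dist_triangle N_VV by blast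

lemma DD_nonneg: "0 \<le> DD v w"
  by (simp add: DD_def fp_dist_nonneg)


section \<open>Distances between vertices\<close>

lemma E_ends_VV: "e \<in> E n \<Longrightarrow> ends e \<subseteq> VV"
  by (auto simp: VV_def verts_ends)

lemma ch_VV: "e \<in> E n \<Longrightarrow> ch e \<subseteq> VV"
  using verts_E_Suc[of n] by (auto simp: VV_def)

lemma DD_edge_pos: "(x, y, i) \<in> E n \<Longrightarrow> 0 < DD x y"
  using DD_edge wl_pos th(1) by simp

lemma E_neq: "(x, y, i) \<in> E n \<Longrightarrow> x \<noteq> y"
  using DD_edge_pos[of x y i n] DD_self[of x] E_ends_VV[of "(x, y, i)" n] by auto

lemma mod_shift: "j < d \<Longrightarrow> h < d \<Longrightarrow> (j + h) mod d = (if j + h < d then j + h else j + h - d)"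
  by (simp add: mod_if)

text \<open>Directions at the new vertex z: the old ends x and y use the two opposite directions of
  copy j, the spoke h uses copy j+h mod d, and 1 <= h <= d-2 makes these copies distinct. So no two
  arms overlap.\<close>

lemma star_letters:
  assumes e: "(x, y, 2) \<in> E n"
  defines "z \<equiv> New x y 0"
  shows "\<exists>J R. (\<forall>a\<in>ch (x, y, 2) - {z}. J a < d \<and> R a \<noteq> 0 \<and> N a = fp_mult (N z) [(J a, R a)]
      \<and> (\<forall>b\<in>ch (x, y, 2) - {z}. a \<noteq> b \<longrightarrow> J a \<noteq> J b \<or> R a * R b < 0)
      \<and> (a \<notin> {x, y} \<longrightarrow> J a \<noteq> J x \<and> J a \<noteq> J y))"
proof -
  obtain j p where sp: "split_pos n x y j p" using split_pos[OF e] by blast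
  obtain r s where rs: "N x = fp_mult (N z) [(j, r)]" "N y = fp_mult (N z) [(j, s)]" "r * s < 0"
    using split_letters[OF sp] unfolding z_def by blast
  have j: "j < d" using sp by (simp add: split_pos_def)
  have Nh: "N (New x y h) = fp_mult (N z) [((j + h) mod d, th ^ (Suc n + h))]" if "1 \<le> h" "h \<le> d - 2" for h
    using sp that unfolding z_def split_pos_def by blast
  have xy: "x \<in> verts (E n)" "y \<in> verts (E n)" using e by (force simp: verts_ends)+
  have nx: "New x y h \<noteq> x" "New x y h \<noteq> y" if "h \<le> d - 2" for h using New_fresh[OF e that] xy by metis+
  have xny: "x \<noteq> y" using E_neq[OF e] .
  define J where "J a = (if a = x \<or> a = y then j else case a of New _ _ h \<Rightarrow> (j + h) mod d | Base _ \<Rightarrow> 0)" for a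
  define R where "R a = (if a = x then r else if a = y then s else case a of New _ _ h \<Rightarrow> th ^ (Suc n + h) | Base _ \<Rightarrow> 1)" for a
  have Jxy: "J x = j" "J y = j" "R x = r" "R y = s" using xny by (simp_all add: J_def R_def)
  have Jh: "J (New x y h) = (j + h) mod d" "R (New x y h) = th ^ (Suc n + h)" if "h \<le> d - 2" for h
    using nx[OF that] by (simp_all add: J_def R_def del: power_Suc)
  have m1: "(j + h) mod d \<noteq> j" "(j + h) mod d < d" if "1 \<le> h" "h \<le> d - 2" for h
    using mod_shift[OF j, of h] that d3 j by auto
  have m2: "(j + h) mod d \<noteq> (j + h') mod d" if "1 \<le> h" "h \<le> d - 2" "1 \<le> h'" "h' \<le> d - 2" "h \<noteq> h'" for h h'
    using mod_shift[OF j, of h] mod_shift[OF j, of h'] that d3 j by auto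
  have r0: "r \<noteq> 0" "s \<noteq> 0" "s * r < 0" using rs(3) by (auto simp: mult.commute)
  have th0: "th ^ k \<noteq> 0" for k using th(1) by simp
  have cases: "a = x \<or> a = y \<or> (\<exists>h. 1 \<le> h \<and> h \<le> d - 2 \<and> a = New x y h)" if "a \<in> ch (x, y, 2) - {z}" for a
  proof -
    have "a = x \<or> a = y \<or> (\<exists>h. h \<le> d - 2 \<and> a = New x y h)" "a \<noteq> New x y 0"
      using that ch_2[of x y] by (auto simp: z_def)
    then show ?thesis by (metis One_nat_def Suc_leI neq0_conv)
  qed
  show ?thesis
  proof (rule exI[of _ J], rule exI[of _ R], rule ballI)
    fix a assume a: "a \<in> ch (x, y, 2) - {z}"
    have 1: "J a < d \<and> R a \<noteq> 0 \<and> N a = fp_mult (N z) [(J a, R a)]"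
      using cases[OF a]
    proof (elim disjE exE conjE)
      fix h assume h: "1 \<le> h" "h \<le> d - 2" "a = New x y h"
      then show ?thesis using Nh[OF h(1,2)] Jh[OF h(2)] m1(2)[OF h(1,2)] th0 by metis
    qed (use Jxy rs j r0 in auto)
    have 2: "J a \<noteq> J b \<or> R a * R b < 0" if b: "b \<in> ch (x, y, 2) - {z}" "a \<noteq> b" for b
      using cases[OF a]
    proof (elim disjE exE conjE)
      assume ax: "a = x"
      show ?thesis using cases[OF b(1)] 
      proof (elim disjE exE conjE)
        fix h assume h: "1 \<le> h" "h \<le> d - 2" "b = New x y h"
        then show ?thesis using Jh[OF h(2)] m1(1)[OF h(1,2)] ax Jxy by metis
      qed (use ax b(2) Jxy rs r0 in auto)
    next
      assume ay: "a = y"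
      show ?thesis using cases[OF b(1)] 
      proof (elim disjE exE conjE)
        fix h assume h: "1 \<le> h" "h \<le> d - 2" "b = New x y h"
        then show ?thesis using Jh[OF h(2)] m1(1)[OF h(1,2)] ay Jxy by metis
      qed (use ay b(2) Jxy rs r0 in auto)
    next
      fix h assume h: "1 \<le> h" "h \<le> d - 2" "a = New x y h"
      show ?thesis using cases[OF b(1)] 
      proof (elim disjE exE conjE)
        fix h' assume h': "1 \<le> h'" "h' \<le> d - 2" "b = New x y h'"
        then have "h \<noteq> h'" using h b(2) by auto
        then show ?thesis using Jh[OF h(2)] Jh[OF h'(2)] m2[OF h(1,2) h'(1,2)] h h' by metis
      qed (use Jh[OF h(2)] m1(1)[OF h(1,2)] h Jxy in metis)+
    qed
    have 3: "J a \<noteq> J x \<and> J a \<noteq> J y" if "a \<notin> {x, y}"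
      using cases[OF a] that
    proof (elim disjE exE conjE)
      fix h assume h: "1 \<le> h" "h \<le> d - 2" "a = New x y h"
      then show ?thesis using Jh[OF h(2)] m1(1)[OF h(1,2)] Jxy by metis
    qed auto
    show "J a < d \<and> R a \<noteq> 0 \<and> N a = fp_mult (N z) [(J a, R a)]
      \<and> (\<forall>b\<in>ch (x, y, 2) - {z}. a \<noteq> b \<longrightarrow> J a \<noteq> J b \<or> R a * R b < 0)
      \<and> (a \<notin> {x, y} \<longrightarrow> J a \<noteq> J x \<and> J a \<noteq> J y)"
      using 1 2 3 by blast
  qed
qed

lemma ch_2_memb: "(x, y, 2) \<in> E n \<Longrightarrow> x \<in> ch (x, y, 2) - {New x y 0} \<and> y \<in> ch (x, y, 2) - {New x y 0} \<and> New x y 0 \<in> ch (x, y, 2)"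
  using New_fresh[of x y n 0] by (force simp: ch_2 verts_ends)

lemma star:
  assumes e: "(x, y, 2) \<in> E n" and ab: "a \<in> ch (x, y, 2)" "b \<in> ch (x, y, 2)" "a \<noteq> b"
  shows "DD a b = DD a (New x y 0) + DD (New x y 0) b"
proof -
  define z where "z = New x y 0"
  obtain J R where JR: "\<forall>a\<in>ch (x, y, 2) - {z}. J a < d \<and> R a \<noteq> 0 \<and> N a = fp_mult (N z) [(J a, R a)]
      \<and> (\<forall>b\<in>ch (x, y, 2) - {z}. a \<noteq> b \<longrightarrow> J a \<noteq> J b \<or> R a * R b < 0)
      \<and> (a \<notin> {x, y} \<longrightarrow> J a \<noteq> J x \<and> J a \<noteq> J y)"
    using star_letters[OF e] unfolding z_def by blast
  have zV: "z \<in> VV" using ch_2_memb[OF e] ch_VV[OF e] by (auto simp: z_def)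
  show ?thesis
  proof (cases "a = z \<or> b = z")
    case True
    then show ?thesis using DD_self[OF zV] by (auto simp: z_def)
  next
    case False
    then have a: "a \<in> ch (x, y, 2) - {z}" "b \<in> ch (x, y, 2) - {z}" using ab by auto
    have L: "[(J c, R c)] \<in> fp_carrier d" "DD z c = \<bar>R c\<bar>" if c: "c \<in> ch (x, y, 2) - {z}" for c
    proof -
      show l: "[(J c, R c)] \<in> fp_carrier d" using JR c by (simp add: fp_singleton_carrier)
      have "N c = fp_mult (N z) [(J c, R c)]" using JR c by blast
      then show "DD z c = \<bar>R c\<bar>" unfolding DD_def using fp_dist_mult[OF N_VV[OF zV] l] by simp
    qed
    have "DD a b = \<bar>R a\<bar> + \<bar>R b\<bar>"
      using fp_dist_letters[OF N_VV[OF zV], of "J a" "J b" "R a" "R b"] JR a ab(3) unfolding DD_def by metis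
    moreover have "DD a z = DD z a" using DD_commute zV a ch_VV[OF e] by blast
    ultimately show ?thesis using L(2)[OF a(1)] L(2)[OF a(2)] by (simp add: z_def)
  qed
qed

text \<open>Seen from z, the point b lies behind p and so in the copy of p, while a spoke leaves z
  in another copy. Only the copy of the first letter is controlled, not its sign, hence the
  restriction to \<open>a\<close> outside {x, y}.\<close>

lemma star_attach:
  assumes e: "(x, y, 2) \<in> E n" and a: "a \<in> ch (x, y, 2)" "a \<notin> {x, y}" and p: "p \<in> {x, y}" and b: "b \<in> VV"
    and bz: "DD (New x y 0) b = DD (New x y 0) p + DD p b"
  shows "DD a b = DD a (New x y 0) + DD (New x y 0) b"
proof -
  define z where "z = New x y 0"
  obtain J R where JR: "\<forall>a\<in>ch (x, y, 2) - {z}. J a < d \<and> R a \<noteq> 0 \<and> N a = fp_mult (N z) [(J a, R a)]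
      \<and> (\<forall>b\<in>ch (x, y, 2) - {z}. a \<noteq> b \<longrightarrow> J a \<noteq> J b \<or> R a * R b < 0)
      \<and> (a \<notin> {x, y} \<longrightarrow> J a \<noteq> J x \<and> J a \<noteq> J y)"
    using star_letters[OF e] unfolding z_def by blast
  have zV: "z \<in> VV" using ch_2_memb[OF e] ch_VV[OF e] by (auto simp: z_def)
  show ?thesis
  proof (cases "a = z")
    case True
    then show ?thesis using DD_self[OF zV] by (simp add: z_def)
  next
    case False
    then have a': "a \<in> ch (x, y, 2) - {z}" using a by auto
    have p': "p \<in> ch (x, y, 2) - {z}" using ch_2_memb[OF e] p by (auto simp: z_def)
    have pV: "p \<in> VV" using p' ch_VV[OF e] by auto
    have Jp: "J p < d" "R p \<noteq> 0" "N p = fp_mult (N z) [(J p, R p)]" using JR p' by blast+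
    have Ja: "J a < d" "R a \<noteq> 0" "N a = fp_mult (N z) [(J a, R a)]" "J a \<noteq> J p" using JR a' a(2) p by blast+
    have lp: "[(J p, R p)] \<in> fp_carrier d" "[(J a, R a)] \<in> fp_carrier d" using Jp Ja by (simp_all add: fp_singleton_carrier)
    have "fp_mult (fp_inv (N z)) (N p) = [(J p, R p)]"
      using fp_mult_inv_left[OF N_VV[OF zV] lp(1)] Jp(3) by simp
    then obtain r v where "fp_mult (fp_inv (N z)) (N b) = (J p, r) # v"
      using fp_direction[OF N_VV[OF zV] N_VV[OF pV] N_VV[OF b] _ Jp(2)] bz unfolding DD_def z_def by blast
    from fp_dist_attach[OF N_VV[OF zV] N_VV[OF b] this Ja(1,4,2)]
    have "DD a b = \<bar>R a\<bar> + DD z b" using Ja(3) by (simp add: DD_def)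
    moreover have "DD z a = \<bar>R a\<bar>" unfolding DD_def Ja(3) using fp_dist_mult[OF N_VV[OF zV] lp(2)] by simp
    moreover have "DD a z = DD z a" using DD_commute zV a ch_VV[OF e] by blast
    ultimately show ?thesis by (simp add: z_def)
  qed
qed

text \<open>If the old ends see b through p, so do the new vertices. The far end q sees p through z,
  hence z sees b through p as well, and the spokes follow by \<open>star_attach\<close>.\<close>

lemma extend_to_children:
  assumes e: "e \<in> E n" and p: "p \<in> ends e" and b: "b \<in> VV"
    and eq: "\<And>a. a \<in> ends e \<Longrightarrow> DD a b = DD a p + DD p b" and a: "a \<in> ch e"
  shows "DD a b = DD a p + DD p b"
proof -
  obtain x y i where xyi: "e = (x, y, i)" by (metis prod_cases3)
  show ?thesis
  proof (cases "i = 2 \<and> a \<notin> {x, y}")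
    case False
    then have "a \<in> ends e" using a xyi by (cases "i = 2") (auto simp: ch_shift)
    then show ?thesis by (rule eq)
  next
    case True
    then have e2: "(x, y, 2) \<in> E n" and xyi2: "e = (x, y, 2)" using e xyi by auto
    define z where "z = New x y 0"
    obtain q where q: "ends e = {p, q}" using p xyi by auto
    have m: "x \<in> ch e" "y \<in> ch e" "z \<in> ch e" "x \<noteq> z" "y \<noteq> z" using ch_2_memb[OF e2] by (auto simp: z_def xyi2)
    have V: "p \<in> VV" "q \<in> VV" "z \<in> VV" "a \<in> VV"
      using ch_VV[OF e] m(3) q E_ends_VV[OF e] a by auto
    have pxy: "p \<in> {x, y}" "q \<in> {x, y}" "p \<noteq> q" using q xyi2 E_neq[OF e2] by auto
    have "DD q p = DD q z + DD z p" using star[OF e2, of q p] pxy m by (auto simp: z_def xyi2)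
    moreover have "DD q b = DD q p + DD p b" by (rule eq) (simp add: q)
    moreover have "DD q b \<le> DD q z + DD z b" "DD z b \<le> DD z p + DD p b" using DD_triangle V b by blast+
    ultimately have zb: "DD z b = DD z p + DD p b" by simp
    have "DD a b = DD a z + DD z b"
      using star_attach[OF e2 _ _ pxy(1) b] zb a True by (simp add: z_def xyi2)
    moreover have "DD a p = DD a z + DD z p"
      using star[OF e2, of a p] True pxy m a by (auto simp: z_def xyi2)
    ultimately show ?thesis using zb by simp
  qed
qed

text \<open>p and p' are the ends facing each other: geodesics between the two edges run through
  both. Being an equality of distances, the condition passes to descendants and to closures, which
  makes it a convenient substitute for the combinatorial tree structure.\<close>

definition gate :: "vertex \<times> vertex \<times> nat \<Rightarrow> vertex \<Rightarrow> vertex \<times> vertex \<times> nat \<Rightarrow> vertex \<Rightarrow> bool" where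
  "gate e p e' p' \<longleftrightarrow> p \<in> ends e \<and> p' \<in> ends e' \<and>
     (\<forall>a\<in>ends e. \<forall>b\<in>ends e'. DD a b = DD a p + DD p p' + DD p' b)"

lemma gate_children:
  assumes e: "e \<in> E n" "e' \<in> E n" and g: "gate e p e' p'" and ab: "a \<in> ch e" "b \<in> ch e'"
  shows "DD a b = DD a p + DD p p' + DD p' b"
proof -
  note G = g[unfolded gate_def]
  have V: "p \<in> VV" "p' \<in> VV" "a \<in> VV" "b \<in> VV" 
    using G E_ends_VV e ch_VV[OF e(1)] ch_VV[OF e(2)] ab by blast+
  have 1: "DD c b' = DD c p + DD p b'" if c: "c \<in> ch e" and b': "b' \<in> ends e'" for c b'
  proof (rule extend_to_children[OF e(1) _ _ _ c])
    show "p \<in> ends e" "b' \<in> VV" using G b' E_ends_VV[OF e(2)] by blast+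
    fix a' assume "a' \<in> ends e"
    then have "DD a' b' = DD a' p + DD p p' + DD p' b'" "DD p b' = DD p p + DD p p' + DD p' b'" using G b' by blast+
    then show "DD a' b' = DD a' p + DD p b'" using DD_self[OF V(1)] by simp
  qed
  have 2: "DD b a = DD b p' + DD p' a"
  proof (rule extend_to_children[OF e(2) _ V(3) _ ab(2)])
    show "p' \<in> ends e'" using G by blast
    fix b' assume b': "b' \<in> ends e'"
    have b'V: "b' \<in> VV" using b' E_ends_VV[OF e(2)] by blast
    have "DD a b' = DD a p + DD p b'" "DD a p' = DD a p + DD p p'" using 1[OF ab(1)] b' G by blast+
    moreover have "DD p b' = DD p p + DD p p' + DD p' b'" using G b' by blast
    ultimately have "DD a b' = DD a p' + DD p' b'" using DD_self[OF V(1)] by simp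
    then show "DD b' a = DD b' p' + DD p' a"
      using DD_commute[OF V(3) b'V] DD_commute[OF V(3,2)] DD_commute[OF V(2) b'V] by simp
  qed
  have "DD a p' = DD a p + DD p p'" using 1[OF ab(1)] G by blast
  then show ?thesis using 2 DD_commute[OF V(3,4)] DD_commute[OF V(3,2)] DD_commute[OF V(2,4)] by simp
qed

lemma subst_edge_gate:
  assumes e: "e \<in> E n" and f: "f \<in> subst_edge d e" and p: "p \<in> ends e"
  shows "\<exists>g\<in>ends f. \<forall>a\<in>ends f. DD a p = DD a g + DD g p"
proof -
  obtain x y i where xyi: "e = (x, y, i)" by (metis prod_cases3)
  have pV: "p \<in> VV" using E_ends_VV[OF e] p by blast
  show ?thesis
  proof (cases "p \<in> ends f")
    case True
    then show ?thesis using DD_self[OF pV] by (intro bexI[of _ p]) auto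
  next
    case False
    then have i2: "i = 2" using f p by (cases "i = 2") (auto simp: xyi subst_edge_shift)
    then have e2: "(x, y, 2) \<in> E n" "e = (x, y, 2)" using e xyi by auto
    have "New x y 0 \<in> ends f" using f unfolding xyi by (cases rule: subst_edge_cases) (use i2 in auto)
    moreover have "DD a p = DD a (New x y 0) + DD (New x y 0) p" if "a \<in> ends f" for a
      using star[OF e2(1), of a p] subst_edge_ends_ch[OF f] ends_ch[of e] p that False e2(2) by auto
    ultimately show ?thesis by blast
  qed
qed

lemma subst_edge_2_gate:
  assumes e: "(x, y, 2) \<in> E n" and f: "f \<in> subst_edge d (x, y, 2)" "f' \<in> subst_edge d (x, y, 2)" "f \<noteq> f'"
  shows "gate f (New x y 0) f' (New x y 0)"
proof -
  define z where "z = New x y 0"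
  have "z \<in> ends g" if "g \<in> subst_edge d (x, y, 2)" for g
    using that by (cases rule: subst_edge_cases) (auto simp: z_def)
  then have z: "z \<in> ends f" "z \<in> ends f'" using f by blast+
  have zV: "z \<in> VV" using ch_2_memb[OF e] ch_VV[OF e] by (auto simp: z_def)
  have "DD a b = DD a z + DD z z + DD z b" if ab: "a \<in> ends f" "b \<in> ends f'" for a b
  proof (cases "a = b")
    case False
    then show ?thesis using star[OF e, of a b] DD_self[OF zV] subst_edge_ends_ch[OF f(1)] subst_edge_ends_ch[OF f(2)] ab
      by (auto simp: z_def)
  next
    case True
    have "a = z"
    proof (rule ccontr)
      assume "a \<noteq> z"
      have "x \<noteq> y" "New x y 0 \<noteq> x" "New x y 0 \<noteq> y" using E_neq[OF e] ch_2_memb[OF e] by auto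
      moreover have "New x y h \<noteq> x" "New x y h \<noteq> y" if "h \<le> d - 2" for h
        using New_fresh[OF e that] e by (force simp: verts_ends)+
      ultimately show False
        using f(3) ab True \<open>a \<noteq> z\<close>
        by (cases rule: subst_edge_cases[OF f(1)]; cases rule: subst_edge_cases[OF f(2)]) (auto simp: z_def)
    qed
    then show ?thesis using True DD_self[OF zV] by simp
  qed
  then show ?thesis using z unfolding gate_def z_def by blast
qed

text \<open>Children of different edges inherit a gate, moved to the nearest end of the child;
  children of the same edge face each other at the new vertex.\<close>

theorem gates:
  assumes "e \<in> E n" "e' \<in> E n" "e \<noteq> e'"
  shows "\<exists>p p'. gate e p e' p'"
  using assms
proof (induction n arbitrary: e e')
  case 0
  then obtain i j where ij: "e = (Base 0, Base i, i)" "e' = (Base 0, Base j, j)" "1 \<le> i" "i \<le> d" "1 \<le> j" "j \<le> d" "i \<noteq> j"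
    by (auto simp: E_0)
  have V: "ends e \<subseteq> VV" "ends e' \<subseteq> VV" using E_ends_VV 0 by blast+
  have c: "[(k - 1, wl k)] \<in> fp_carrier d" if "1 \<le> k" "k \<le> d" for k
    using that wl_pos[of k] by (simp add: fp_singleton_carrier)
  have "gp [(i - 1, wl i)] [(j - 1, wl j)] = 0" using ij by auto
  then have "DD (Base i) (Base j) = wl i + wl j"
    using fp_dist_gp[OF c[OF ij(3,4)] c[OF ij(5,6)]] N_Base ij wl_pos[of i] wl_pos[of j] by (simp add: DD_def)
  moreover have b: "DD (Base 0) (Base k) = wl k" "DD (Base k) (Base 0) = wl k" if "1 \<le> k" "k \<le> d" for k
    using fp_dist_gp[OF fp_carrier_Nil c[OF that]] fp_dist_gp[OF c[OF that] fp_carrier_Nil]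
      N_Base[OF that] N_Base_0 wl_pos[of k] by (simp_all add: DD_def)
  moreover have "DD (Base 0) (Base 0) = 0" using DD_self[of "Base 0"] V ij by simp
  ultimately have "gate e (Base 0) e' (Base 0)"
    using b[OF ij(3,4)] b[OF ij(5,6)] unfolding gate_def ij(1,2) by simp
  then show ?case by blast
next
  case (Suc n)
  obtain f where f: "f \<in> E n" "e \<in> subst_edge d f" using Suc.prems(1) by (rule E_SucE)
  obtain f' where f': "f' \<in> E n" "e' \<in> subst_edge d f'" using Suc.prems(2) by (rule E_SucE)
  show ?case
  proof (cases "f = f'")
    case True
    obtain x y i where xyi: "f = (x, y, i)" by (metis prod_cases3)
    have "i = 2" using f(2) f'(2) Suc.prems(3) True xyi by (cases "i = 2") (auto simp: subst_edge_shift)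
    then show ?thesis using subst_edge_2_gate[of x y n e e'] f f' True xyi Suc.prems(3) by blast
  next
    case False
    then obtain p p' where g: "gate f p f' p'" using Suc.IH f f' by blast
    then have p: "p \<in> ends f" "p' \<in> ends f'" by (simp_all add: gate_def)
    obtain q where q: "q \<in> ends e" "\<forall>a\<in>ends e. DD a p = DD a q + DD q p" using subst_edge_gate[OF f p(1)] by blast
    obtain q' where q': "q' \<in> ends e'" "\<forall>a\<in>ends e'. DD a p' = DD a q' + DD q' p'" using subst_edge_gate[OF f' p(2)] by blast
    have V: "p \<in> VV" "p' \<in> VV" "ends e \<subseteq> VV" "ends e' \<subseteq> VV" using p E_ends_VV f f' Suc.prems by blast+
    have gc: "DD a b = DD a p + DD p p' + DD p' b" if "a \<in> ends e" "b \<in> ends e'" for a b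
      using gate_children[OF f(1) f'(1) g] subst_edge_ends_ch f(2) f'(2) that by blast
    have "DD a b = DD a q + DD q q' + DD q' b" if ab: "a \<in> ends e" "b \<in> ends e'" for a b
    proof -
      have "DD a p = DD a q + DD q p" "DD b p' = DD b q' + DD q' p'" using q q' ab by blast+
      moreover have "DD p' b = DD b p'" "DD q' b = DD b q'" "DD p' q' = DD q' p'"
        using DD_commute V ab q'(1) by blast+
      ultimately show ?thesis using gc[OF ab] gc[OF q(1) q'(1)] by simp
    qed
    then show ?thesis using q(1) q'(1) unfolding gate_def by blast
  qed
qed

text \<open>Both ends of a common child would be at distance 0 from the gate, but an edge has
  positive length.\<close>

lemma subst_edge_disjoint:
  assumes "e \<in> E n" "e' \<in> E n" "e \<noteq> e'" "f \<in> subst_edge d e"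
  shows "f \<notin> subst_edge d e'"
proof
  assume f': "f \<in> subst_edge d e'"
  obtain p p' where g: "gate e p e' p'" using gates assms by blast
  obtain u v i where f: "f = (u, v, i)" by (metis prod_cases3)
  have V: "u \<in> VV" "v \<in> VV" "p \<in> VV" "p' \<in> VV"
    using E_ends_VV[OF E_SucI[OF assms(1,4)]] f g E_ends_VV[OF assms(1)] E_ends_VV[OF assms(2)] by (auto simp: gate_def)
  have gc: "DD a b = DD a p + DD p p' + DD p' b" if "a \<in> {u, v}" "b \<in> {u, v}" for a b
    using gate_children[OF assms(1,2) g] subst_edge_ends_ch[OF assms(4)] subst_edge_ends_ch[OF f'] f that by auto
  have "DD w p = 0" if w: "w \<in> {u, v}" for w
  proof -
    have "DD w w = DD w p + DD p p' + DD p' w" using gc w by blast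
    moreover have "DD w w = 0" using DD_self V w by blast
    ultimately show ?thesis using DD_nonneg[of w p] DD_nonneg[of p p'] DD_nonneg[of p' w] by linarith
  qed
  then have "DD u p = 0" "DD v p = 0" by simp_all
  then have "DD u v \<le> 0" using DD_triangle[OF V(1,3,2)] DD_commute[OF V(3,2)] by simp
  then show False using DD_edge_pos[of u v i "Suc n"] E_SucI[OF assms(1,4)] f by simp
qed

section \<open>Descendants of an edge\<close>

definition descV :: "nat \<Rightarrow> vertex \<times> vertex \<times> nat \<Rightarrow> vertex set" where
  "descV k e = verts (desc k e)"

lemma descV_0: "descV 0 e = ends e"
  by (simp add: descV_def verts_ends)

lemma descV_Suc: "descV (Suc k) e = (\<Union>f\<in>subst_edge d e. descV k f)"
  by (auto simp: descV_def verts_ends desc_Suc)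

lemma verts_E_add: "verts (E (n + k)) = (\<Union>e\<in>E n. descV k e)"
  by (auto simp: E_add verts_ends descV_def)

lemma descV_VV: "e \<in> E n \<Longrightarrow> descV k e \<subseteq> VV"
  using verts_E_add[of n k] by (auto simp: VV_def)

lemma ends_descV: "ends e \<subseteq> descV k e"
proof (induction k arbitrary: e)
  case (Suc k)
  have "ends e \<subseteq> (\<Union>f\<in>subst_edge d e. ends f)" using ends_ch[of e] by (simp add: ch_def verts_ends)
  then show ?case unfolding descV_Suc using Suc by blast
qed (simp add: descV_0)

text \<open>The gates of two children may differ from p and p', but by \<open>gate_children\<close>
  the way between them passes through p and p'; triangle inequalities then carry the identity to a
  and b.\<close>

lemma gate_desc:
  assumes "e \<in> E n" "e' \<in> E n" "e \<noteq> e'" "gate e p e' p'" "a \<in> descV k e" "b \<in> descV k e'"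
  shows "DD a b = DD a p + DD p p' + DD p' b"
  using assms
proof (induction k arbitrary: n e e' p p' a b)
  case 0
  then show ?case unfolding descV_0 gate_def by blast
next
  case (Suc k)
  obtain f where f: "f \<in> subst_edge d e" "a \<in> descV k f" using Suc.prems(5) by (auto simp: descV_Suc)
  obtain f' where f': "f' \<in> subst_edge d e'" "b \<in> descV k f'" using Suc.prems(6) by (auto simp: descV_Suc)
  have ff: "f \<noteq> f'" using subst_edge_disjoint[OF Suc.prems(1-3)] f f' by blast
  have fE: "f \<in> E (Suc n)" "f' \<in> E (Suc n)" using E_SucI Suc.prems f f' by blast+
  obtain g g' where g: "gate f g f' g'" using gates[OF fE ff] by blast
  have IH: "DD a b = DD a g + DD g g' + DD g' b" by (rule Suc.IH[OF fE ff g f(2) f'(2)])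
  have gg: "g \<in> ends f" "g' \<in> ends f'" using g by (simp_all add: gate_def)
  have "DD g g' = DD g p + DD p p' + DD p' g'"
    using gate_children[OF Suc.prems(1,2,4)] gg subst_edge_ends_ch f(1) f'(1) by blast
  moreover have V: "a \<in> VV" "b \<in> VV" "g \<in> VV" "g' \<in> VV" "p \<in> VV" "p' \<in> VV"
    using descV_VV[OF fE(1)] descV_VV[OF fE(2)] f(2) f'(2) gg E_ends_VV[OF fE(1)] E_ends_VV[OF fE(2)]
      Suc.prems(4) E_ends_VV[OF Suc.prems(1)] E_ends_VV[OF Suc.prems(2)] unfolding gate_def by blast+
  moreover have "DD a p \<le> DD a g + DD g p" "DD p' b \<le> DD p' g' + DD g' b"
    "DD a b \<le> DD a p + DD p b" "DD p b \<le> DD p p' + DD p' b"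
    using DD_triangle V by blast+
  ultimately show ?case using IH by simp
qed

lemma between_children:
  assumes e: "e \<in> E n" and vw: "v \<in> ch e" "w \<in> ch e" "v \<noteq> w"
  shows "\<exists>u. \<exists>f\<in>subst_edge d e. ends f = {v, u} \<and> DD v w = DD v u + DD u w"
proof -
  obtain x y i where xyi: "e = (x, y, i)" by (metis prod_cases3)
  have V: "v \<in> VV" "w \<in> VV" using ch_VV[OF e] vw by blast+
  show ?thesis
  proof (cases "i = 2")
    case False
    then have "{v, w} = {x, y}" using vw xyi by (auto simp: ch_shift)
    then have "\<exists>f\<in>subst_edge d e. ends f = {v, w}" using False xyi by (auto simp: subst_edge_shift)
    then show ?thesis using DD_self[OF V(2)] by (intro exI[of _ w]) simp
  next
    case True
    then have e2: "(x, y, 2) \<in> E n" "e = (x, y, 2)" using e xyi by auto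
    have spoke: "\<exists>f\<in>subst_edge d e. ends f = {New x y 0, a}" if "a \<in> ch e" "a \<noteq> New x y 0" for a
    proof -
      have "a \<in> verts (subst_edge d (x, y, 2))" using that(1) e2(2) by (simp add: ch_def)
      then obtain f where f: "f \<in> subst_edge d (x, y, 2)" "a \<in> ends f" by (auto simp: verts_ends)
      from f(1) have "New x y 0 \<in> ends f" by (cases rule: subst_edge_cases) auto
      then have "ends f = {New x y 0, a}" using f(2) that(2) by (auto simp: ends_def)
      then show ?thesis using f(1) e2(2) by blast
    qed
    show ?thesis
    proof (cases "v = New x y 0")
      case True
      then have "\<exists>f\<in>subst_edge d e. ends f = {v, w}" using spoke[of w] vw by auto
      then show ?thesis using DD_self[OF V(2)] by (intro exI[of _ w]) simp
    next
      case False
      then obtain f where "f \<in> subst_edge d e" "ends f = {v, New x y 0}" using spoke[of v] vw by (auto simp: insert_commute)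
      moreover have "DD v w = DD v (New x y 0) + DD (New x y 0) w" using star[OF e2(1)] vw e2(2) by simp
      ultimately show ?thesis by blast
    qed
  qed
qed

text \<open>Discrete geodesics: the first step towards w follows an edge of the same stage. If v is
  the gate p already and differs from p', the step towards p' given by the previous stage is
  refined.\<close>

theorem between:
  assumes "v \<in> verts (E n)" "w \<in> verts (E n)" "v \<noteq> w"
  shows "\<exists>u. \<exists>f\<in>E n. ends f = {v, u} \<and> DD v w = DD v u + DD u w"
  using assms
proof (induction n arbitrary: v w)
  case 0
  have "(Base 0, Base 1, 1) \<in> E 0" using d3 by (simp add: E_0)
  then have B: "Base 0 \<in> VV" "w \<in> VV" "v \<in> VV" using E_ends_VV VV_I 0(1,2) by fastforce+
  show ?case
  proof (cases "v = Base 0")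
    case True
    then obtain j where "w = Base j" "(Base 0, Base j, j) \<in> E 0" using 0 by (auto simp: verts_ends E_0)
    then show ?thesis using True DD_self[OF B(2)] by (intro exI[of _ w] bexI[of _ "(Base 0, Base j, j)"]) auto
  next
    case False
    then obtain j where j: "v = Base j" "(Base 0, Base j, j) \<in> E 0" using 0 by (auto simp: verts_ends E_0)
    have "DD v w = DD v (Base 0) + DD (Base 0) w"
    proof (cases "w = Base 0")
      case True
      then show ?thesis using DD_self[OF B(1)] by simp
    next
      case F: False
      then obtain k where k: "w = Base k" "(Base 0, Base k, k) \<in> E 0" using 0 by (auto simp: verts_ends E_0)
      have e1: "DD (Base 0) v = wl j" "DD (Base 0) w = wl k" using DD_edge[OF j(2)] DD_edge[OF k(2)] j(1) k(1) by simp_all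
      obtain p p' where g: "gate (Base 0, Base j, j) p (Base 0, Base k, k) p'" using gates[OF j(2) k(2)] 0(3) j k by auto
      have pj: "1 \<le> j" "j \<le> d" "1 \<le> k" "k \<le> d" "j \<noteq> k" using j k 0(3) by (auto simp: E_0)
      have c: "[(i - 1, wl i)] \<in> fp_carrier d" if "1 \<le> i" "i \<le> d" for i
        using that wl_pos[of i] by (simp add: fp_singleton_carrier)
      have "gp [(j - 1, wl j)] [(k - 1, wl k)] = 0" using pj by auto
      then have "DD v w = wl j + wl k"
        using fp_dist_gp[OF c[OF pj(1,2)] c[OF pj(3,4)]] N_Base pj wl_pos[of j] wl_pos[of k] j(1) k(1) by (simp add: DD_def)
      then show ?thesis using e1 DD_commute[OF B(3,1)] by simp
    qed
    then show ?thesis using j by (intro exI[of _ "Base 0"] bexI[of _ "(Base 0, Base j, j)"]) auto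
  qed
next
  case (Suc n)
  obtain e where e: "e \<in> E n" "v \<in> ch e" using Suc.prems(1) by (auto simp: verts_E_Suc)
  obtain e' where e': "e' \<in> E n" "w \<in> ch e'" using Suc.prems(2) by (auto simp: verts_E_Suc)
  have fin: "\<exists>u. \<exists>f\<in>E (Suc n). ends f = {v, u} \<and> DD v w = DD v u + DD u w"
    if "\<exists>u. \<exists>f\<in>subst_edge d g. ends f = {v, u} \<and> DD v w = DD v u + DD u w" "g \<in> E n" for g
    using that E_SucI by blast
  show ?case
  proof (cases "e = e'")
    case True
    then show ?thesis using fin[OF between_children[OF e(1,2) _ Suc.prems(3)] e(1)] e' by simp
  next
    case False
    then obtain p p' where g: "gate e p e' p'" using gates e e' by blast
    have pe: "p \<in> ends e" "p' \<in> ends e'" using g by (simp_all add: gate_def)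
    have pch: "p \<in> ch e" "p' \<in> ch e'" using pe ends_ch by blast+
    have V: "v \<in> VV" "w \<in> VV" "p \<in> VV" "p' \<in> VV" using e e' pch ch_VV by blast+
    have gc: "\<And>a. a \<in> ch e \<Longrightarrow> DD a w = DD a p + DD p p' + DD p' w"
      using gate_children[OF e(1) e'(1) g _ e'(2)] by blast
    show ?thesis
    proof (cases "v = p")
      case vp: False
      obtain u f where u: "f \<in> subst_edge d e" "ends f = {v, u}" "DD v p = DD v u + DD u p"
        using between_children[OF e(1,2) pch(1) vp] by blast
      have "u \<in> ch e" using u subst_edge_ends_ch by blast
      then have "DD v w = DD v u + DD u w" using gc[OF e(2)] gc[of u] u(3) by simp
      then show ?thesis using fin[of e] u e(1) by blast
    next
      case vp: True
      show ?thesis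
      proof (cases "p = p'")
        case True
        then show ?thesis using fin[of e', OF between_children[OF e'(1) _ e'(2)]] pch(2) e'(1) vp Suc.prems(3) by simp
      next
        case pp: False
        have "p \<in> verts (E n)" "p' \<in> verts (E n)" using pe e e' by (auto simp: verts_ends)
        then obtain u f where u: "f \<in> E n" "ends f = {p, u}" "DD p p' = DD p u + DD u p'" using Suc.IH pp by blast
        have pu: "p \<in> ch f" "u \<in> ch f" using u(2) ends_ch[of f] by auto
        have "p \<noteq> u" using u(2) E_neq u(1) by (cases f) (auto simp: doubleton_eq_iff)
        then obtain u' f' where u': "f' \<in> subst_edge d f" "ends f' = {p, u'}" "DD p u = DD p u' + DD u' u"
          using between_children[OF u(1) pu] by blast
        have uV: "u \<in> VV" "u' \<in> VV" using pu(2) u'(2) subst_edge_ends_ch[OF u'(1)] ch_VV[OF u(1)] by auto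
        have "DD p w = DD p p' + DD p' w" using gc[of p] pch(1) DD_self[OF V(3)] by simp
        moreover have "DD u' w \<le> DD u' u + DD u w" "DD u w \<le> DD u p' + DD p' w" "DD p w \<le> DD p u' + DD u' w"
          using DD_triangle V uV by blast+
        ultimately have "DD p w = DD p u' + DD u' w" using u(3) u'(3) by simp
        then show ?thesis using fin[of f] u' u(1) vp by blast
      qed
    qed
  qed
qed

text \<open>Chosen to satisfy \<open>BB * th + 1 \<le> BB\<close> and to bound all
  \<open>wl i\<close>. The second summand is the geometric series of the distances th^n travelled at
  successive splittings.\<close>

definition BB :: real where "BB = \<eta> ^ (d - 1) + 1 / (1 - th)"

lemma wl_le: "i \<in> {1..2 * d - 2} \<Longrightarrow> wl i \<le> \<eta> ^ (d - 1)"
proof -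
  assume i: "i \<in> {1..2 * d - 2}"
  have "1 \<le> \<eta> ^ (d - 1)" using eta1 by simp
  moreover have "th ^ (i - d) \<le> 1" using th by (simp add: power_le_one)
  moreover have "\<eta> ^ (d - i + 1) \<le> \<eta> ^ (d - 1)" if "2 \<le> i" "i \<le> d" using that eta1 by (intro power_increasing) auto
  ultimately show ?thesis using i by (auto simp: wl_def)
qed

lemma BB: "0 < BB" "BB * th + 1 \<le> BB" "i \<in> {1..2 * d - 2} \<Longrightarrow> wl i \<le> BB"
proof -
  have e: "0 < \<eta> ^ (d - 1)" using eta1 by simp
  have t: "0 < 1 / (1 - th)" using th by simp
  show "0 < BB" unfolding BB_def using e t by (rule add_pos_pos)
  have "1 = 1 / (1 - th) * (1 - th)" using th by simp
  also have "\<dots> \<le> BB * (1 - th)" using th e unfolding BB_def by (intro mult_right_mono) auto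
  finally show "BB * th + 1 \<le> BB" by (simp add: algebra_simps)
  show "wl i \<le> BB" if "i \<in> {1..2 * d - 2}" unfolding BB_def using wl_le[OF that] t by linarith
qed

text \<open>At a splitting the reference point moves from x to z, at the cost th^(n+1) eta = th^n at
  most; the inequality \<open>BB * th + 1 \<le> BB\<close> absorbs this.\<close>

lemma desc_diameter:
  assumes "(x, y, i) \<in> E n" "a \<in> descV k (x, y, i)"
  shows "DD a x \<le> BB * th ^ n"
  using assms
proof (induction k arbitrary: n x y i a)
  case 0
  have V: "x \<in> VV" "y \<in> VV" using E_ends_VV[OF 0(1)] by auto
  have "DD y x = th ^ n * wl i" using DD_edge[OF 0(1)] DD_commute[OF V] by simp
  moreover have "th ^ n * wl i \<le> th ^ n * BB" using BB(3)[OF E_colour[OF 0(1)]] th by (intro mult_left_mono) auto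
  moreover have "0 \<le> BB * th ^ n" using BB(1) th(1) by simp
  ultimately show ?case using 0(2) DD_self[OF V(1)] by (auto simp: descV_0 mult.commute)
next
  case (Suc k)
  obtain f where f: "f \<in> subst_edge d (x, y, i)" "a \<in> descV k f" using Suc.prems(2) by (auto simp: descV_Suc)
  have fE: "f \<in> E (Suc n)" using E_SucI Suc.prems f by blast
  have tn: "0 < th ^ n" using th(1) by simp
  have small: "BB * th ^ Suc n \<le> BB * th ^ n - th ^ n"
  proof -
    have "(BB * th + 1) * th ^ n \<le> BB * th ^ n" using BB(2) tn by (intro mult_right_mono) auto
    then show ?thesis by (simp add: algebra_simps)
  qed
  show ?case
  proof (cases "i = 2")
    case False
    then have "f = (x, y, cshift i)" using f by (simp add: subst_edge_shift)
    then have "DD a x \<le> BB * th ^ Suc n" using Suc.IH[of x y "cshift i" "Suc n" a] f fE by simp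
    then show ?thesis using small tn by simp
  next
    case True
    then have e2: "(x, y, 2) \<in> E n" using Suc.prems by simp
    define z where "z = New x y 0"
    obtain w c where fz: "f = (z, w, c)" using f(1) True by (cases rule: subst_edge_cases) (auto simp: z_def)
    have V: "a \<in> VV" "z \<in> VV" "x \<in> VV" using descV_VV[OF fE] f(2) E_ends_VV[OF fE] E_ends_VV[OF e2] fz by auto
    have "DD a z \<le> BB * th ^ Suc n" using Suc.IH[of z w c "Suc n" a] f fE fz by simp
    moreover have "(z, x, d) \<in> E (Suc n)" using E_SucI[OF e2] by (auto simp: subst_edge_2 z_def)
    then have "DD z x = th ^ Suc n * wl d" by (rule DD_edge)
    then have "DD z x = th ^ n * (th * \<eta>)" using d3 by (simp add: wl_def)
    then have "DD z x = th ^ n" unfolding th(3) by simp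
    moreover have "DD a x \<le> DD a z + DD z x" using DD_triangle V by blast
    ultimately show ?thesis using small by linarith
  qed
qed

text \<open>The bracket is twice the Gromov product of a and t at s, so this says quantitatively
  that s does not separate a from t; mere positivity would be lost in the closure. The induction
  follows the child at s while a descends from it, with z in place of t. Otherwise a lies beyond z,
  the product equals the distance from z to s, at least th^(n+1), and \<open>desc_diameter\<close>
  bounds the distance from a to z.\<close>

lemma desc_separation:
  assumes "e \<in> E n" "a \<in> descV k e" "ends e = {s, t}"
  shows "DD a s \<le> (BB + 1) * (DD a s + DD s t - DD a t)"
  using assms
proof (induction k arbitrary: n e a s t)
  case 0
  have V: "s \<in> VV" "t \<in> VV" using E_ends_VV[OF 0(1)] 0(3) by auto
  consider "a = s" | "a = t" using 0(2,3) by (auto simp: descV_0)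
  then show ?case
  proof cases
    case 1
    then show ?thesis using DD_self V by simp
  next
    case 2
    have "DD t s * 1 \<le> DD t s * (2 * (BB + 1))" using BB(1) DD_nonneg by (intro mult_left_mono) auto
    then show ?thesis using 2 DD_self[OF V(2)] DD_commute[OF V] by (simp add: algebra_simps)
  qed
next
  case (Suc k)
  obtain x y i where xyi: "e = (x, y, i)" by (metis prod_cases3)
  obtain f where f: "f \<in> subst_edge d e" "a \<in> descV k f" using Suc.prems(2) by (auto simp: descV_Suc)
  have fE: "f \<in> E (Suc n)" using E_SucI Suc.prems(1) f by blast
  show ?case
  proof (cases "i = 2")
    case False
    then have "ends f = {s, t}" using f xyi Suc.prems(3) by (simp add: subst_edge_shift)
    then show ?thesis using Suc.IH[OF fE f(2)] by blast
  next
    case True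
    then have e2: "(x, y, 2) \<in> E n" "e = (x, y, 2)" using Suc.prems xyi by auto
    define z where "z = New x y 0"
    have st: "{s, t} = {x, y}" using Suc.prems(3) e2(2) by simp
    have "s \<noteq> t" using st E_neq[OF e2(1)] by (auto simp: doubleton_eq_iff)
    have m: "s \<in> ch e" "t \<in> ch e" "s \<noteq> z" "t \<noteq> z" using ch_2_memb[OF e2(1)] st e2(2) by (auto simp: z_def doubleton_eq_iff)
    have V: "s \<in> VV" "t \<in> VV" "z \<in> VV" "a \<in> VV"
      using E_ends_VV[OF Suc.prems(1)] Suc.prems(3) ch_2_memb[OF e2(1)] ch_VV[OF e2(1)] descV_VV[OF fE] f(2)
      by (auto simp: z_def)
    have spoke: "\<exists>g\<in>subst_edge d e. ends g = {z, u}" if "u \<in> {s, t}" for u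
      using that st unfolding e2(2) subst_edge_2 z_def by auto
    obtain fs where fs: "fs \<in> subst_edge d e" "ends fs = {z, s}" using spoke by blast
    obtain ft where ft: "ft \<in> subst_edge d e" "ends ft = {z, t}" using spoke by blast
    have through: "DD a u = DD a z + DD z u" if g: "g \<in> subst_edge d e" "ends g = {z, u}" "f \<noteq> g" for g u
    proof -
      have "gate f z g z" using subst_edge_2_gate[OF e2(1)] f(1) g e2(2) by (simp add: z_def)
      moreover have "u \<in> descV k g" using ends_descV[of g k] g(2) by auto
      ultimately have "DD a u = DD a z + DD z z + DD z u"
        using gate_desc[OF fE E_SucI[OF Suc.prems(1) g(1)] g(3)] f(2) by blast
      then show ?thesis using DD_self[OF V(3)] by simp
    qed
    have st_z: "DD s t = DD s z + DD z t" using star[OF e2(1), of s t] m \<open>s \<noteq> t\<close> e2(2) by (simp add: z_def)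
    show ?thesis
    proof (cases "f = fs")
      case True
      have "f \<noteq> ft" using True fs ft \<open>s \<noteq> t\<close> m by (auto simp: doubleton_eq_iff)
      then have "DD a t = DD a z + DD z t" using through[OF ft] by simp
      moreover have "DD a s \<le> (BB + 1) * (DD a s + DD s z - DD a z)"
        using Suc.IH[OF fE f(2), of s z] fs(2) True by (simp add: insert_commute)
      moreover have "DD a s + DD s t - DD a t = DD a s + DD s z - DD a z" using st_z calculation(1) by simp
      ultimately show ?thesis by metis
    next
      case False
      have as: "DD a s = DD a z + DD z s" using through[OF fs] False by simp
      obtain w c where fz: "f = (z, w, c)" using f(1) unfolding e2(2) by (cases rule: subst_edge_cases) (auto simp: z_def)
      have az: "DD a z \<le> BB * th ^ Suc n" using desc_diameter[of z w c "Suc n" a k] fE f(2) fz by simp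
      have zs: "th ^ Suc n \<le> DD z s"
      proof -
        have "s = x \<or> s = y" using st by auto
        moreover have "(z, x, d) \<in> E (Suc n)" "(z, y, 1) \<in> E (Suc n)"
          using E_SucI[OF e2(1)] by (auto simp: subst_edge_2 z_def)
        then have "DD z x = th ^ Suc n * wl d" "DD z y = th ^ Suc n * wl 1" using DD_edge by blast+
        moreover have "1 \<le> wl d" "1 \<le> wl 1" using d3 eta1 by (simp_all add: wl_def)
        moreover have "0 < th ^ Suc n" using th(1) by simp
        ultimately show ?thesis by (metis mult.right_neutral mult_le_cancel_left_pos)
      qed
      have "DD a t \<le> DD a z + DD z t" using DD_triangle V by blast
      then have "2 * DD z s \<le> DD a s + DD s t - DD a t"
        using as st_z DD_commute[OF V(1,3)] by simp
      then have "(BB + 1) * (2 * DD z s) \<le> (BB + 1) * (DD a s + DD s t - DD a t)"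
        using BB(1) by (intro mult_left_mono) auto
      moreover have "DD a s \<le> (BB + 1) * (2 * DD z s)"
      proof -
        have "BB * th ^ Suc n \<le> BB * DD z s" using zs BB(1) by (intro mult_left_mono) auto
        moreover have "0 \<le> BB * DD z s" "0 \<le> DD z s" using BB(1) DD_nonneg by auto
        ultimately show ?thesis using as az by (simp add: algebra_simps)
      qed
      ultimately show ?thesis by linarith
    qed
  qed
qed


section \<open>The limit tree and its pieces\<close>

abbreviation "CM \<equiv> fp_completion d"
abbreviation "cdist \<equiv> mdist CM"

definition emb :: "vertex \<Rightarrow> cpoint" where
  "emb v = fp_embed d (N v)"

lemma fp_metric_simps [simp]: "mspace (fp_metric d) = fp_carrier d" "mdist (fp_metric d) = fp_dist"
  using Metric_space.mspace_metric[OF Metric_space_fp] Metric_space.mdist_metric[OF Metric_space_fp]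
  by (simp_all add: fp_metric_def)

lemma completion: "is_completion (fp_metric d) CM (fp_embed d)"
  using is_completion_completion_pair[of "fp_metric d"] by (simp add: fp_completion_def fp_embed_def)

lemma embed_in: "p \<in> fp_carrier d \<Longrightarrow> fp_embed d p \<in> mspace CM"
  using completion by (auto simp: is_completion_def)

lemma embed_dist: "p \<in> fp_carrier d \<Longrightarrow> q \<in> fp_carrier d \<Longrightarrow> cdist (fp_embed d p) (fp_embed d q) = fp_dist p q"
  using completion by (auto simp: is_completion_def)

lemma emb_in: "v \<in> VV \<Longrightarrow> emb v \<in> mspace CM"
  unfolding emb_def using embed_in N_VV by blast

lemma emb_dist: "v \<in> VV \<Longrightarrow> w \<in> VV \<Longrightarrow> cdist (emb v) (emb w) = DD v w"
  unfolding emb_def DD_def using embed_dist N_VV by blast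

lemma emb_image: "S \<subseteq> VV \<Longrightarrow> emb ` S \<subseteq> mspace CM"
  using emb_in by blast

interpretation C: Metric_space "mspace CM" cdist
  by (rule Metric_space_mspace_mdist)

lemma top_C: "mtopology_of CM = C.mtopology"
  by (simp add: mtopology_of_def)

lemma closure_iff: "S \<subseteq> mspace CM \<Longrightarrow>
    q \<in> mtopology_of CM closure_of S \<longleftrightarrow> q \<in> mspace CM \<and> (\<forall>r>0. \<exists>y\<in>S. cdist q y < r)"
  unfolding top_C C.metric_closure_of by (auto simp: subset_iff C.in_mball)

text \<open>Linear inequalities in two distances are closed conditions. The general coefficients
  cover diameters, gates (an equality being two inequalities) and
  \<open>desc_separation\<close>.\<close>

lemma closure_linear:
  assumes S: "S \<subseteq> mspace CM" and q: "q \<in> mtopology_of CM closure_of S"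
    and u: "u \<in> mspace CM" "w \<in> mspace CM"
    and le: "\<And>y. y \<in> S \<Longrightarrow> 0 \<le> \<alpha> * cdist y u + \<beta> * cdist y w + \<gamma>"
  shows "0 \<le> \<alpha> * cdist q u + \<beta> * cdist q w + \<gamma>"
proof (rule ccontr)
  define v where "v = \<alpha> * cdist q u + \<beta> * cdist q w + \<gamma>"
  assume "\<not> ?thesis"
  then have v: "v < 0" by (simp add: v_def)
  \<comment> \<open>The left-hand side is Lipschitz in q with constant \<bar>\<alpha>\<bar> +
    \<bar>\<beta>\<bar>; the added 1 makes K positive.\<close>
  define K where "K = \<bar>\<alpha>\<bar> + \<bar>\<beta>\<bar> + 1"
  have K: "0 < K" by (simp add: K_def)
  have "0 < - v / K" using v K by (simp add: divide_neg_pos)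
  then obtain y where y: "y \<in> S" "cdist q y < - v / K" and qC: "q \<in> mspace CM"
    using q unfolding closure_iff[OF S] by blast
  have yC: "y \<in> mspace CM" using y(1) S by blast
  have dc: "\<bar>cdist q x - cdist y x\<bar> \<le> cdist q y" if "x \<in> mspace CM" for x
    using C.triangle[OF qC yC that] C.triangle[OF yC qC that] C.commute[of q y] by simp
  have ab: "c * (cdist y x - cdist q x) \<le> \<bar>c\<bar> * cdist q y" if "x \<in> mspace CM" for c x
  proof -
    have "c * (cdist y x - cdist q x) \<le> \<bar>c\<bar> * \<bar>cdist y x - cdist q x\<bar>"
      using abs_ge_self[of "c * (cdist y x - cdist q x)"] by (simp only: abs_mult)
    also have "\<dots> \<le> \<bar>c\<bar> * cdist q y"
      using dc[OF that] by (intro mult_left_mono) (simp_all only: abs_minus_commute abs_ge_zero)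
    finally show ?thesis .
  qed
  note ab[OF u(1), of \<alpha>]
  moreover note ab[OF u(2), of \<beta>]
  moreover have "0 \<le> \<alpha> * cdist y u + \<beta> * cdist y w + \<gamma>" using le y(1) by blast
  ultimately have "- v \<le> (\<bar>\<alpha>\<bar> + \<bar>\<beta>\<bar>) * cdist q y" by (simp add: v_def algebra_simps)
  also have "\<dots> \<le> K * cdist q y" by (intro mult_right_mono) (simp_all add: K_def)
  also have "\<dots> < - v" using y(2) unfolding pos_less_divide_eq[OF K] by (simp only: mult.commute)
  finally show False by simp
qed

text \<open>Vertices of stage n are dense on geodesics between vertices up to the edge length: after
  the last vertex within distance a, \<open>between\<close> gives a next one, which lies beyond
  a.\<close>

lemma path_point:
  assumes vw: "v \<in> verts (E n)" "w \<in> verts (E n)" and a: "0 \<le> a" "a \<le> DD v w"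
  shows "\<exists>u\<in>verts (E n). DD v u + DD u w = DD v w \<and> DD v u \<le> a \<and> a - BB * th ^ n \<le> DD v u"
proof -
  have VVn: "u \<in> VV" if "u \<in> verts (E n)" for u using VV_I[OF that] .
  define S where "S = {u\<in>verts (E n). DD v u + DD u w = DD v w \<and> DD v u \<le> a}"
  have "finite (verts (E n))" unfolding verts_ends using finite_E by (auto simp: ends_def)
  then have fin: "finite (DD v ` S)" unfolding S_def by simp
  have vS: "v \<in> S" using vw a DD_self[OF VVn[OF vw(1)]] by (simp add: S_def)
  then have "Max (DD v ` S) \<in> DD v ` S" using fin by (intro Max_in) auto
  then obtain u where u: "u \<in> S" "DD v u = Max (DD v ` S)" by auto
  have mx: "DD v u' \<le> DD v u" if "u' \<in> S" for u' using u(2) fin that by simp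
  have uV: "u \<in> verts (E n)" "DD v u + DD u w = DD v w" "DD v u \<le> a" using u(1) by (auto simp: S_def)
  have "a - BB * th ^ n \<le> DD v u"
  proof (cases "u = w")
    case True
    moreover have "0 \<le> BB * th ^ n" using BB(1) th(1) by simp
    ultimately show ?thesis using a(2) by simp
  next
    case False
    then obtain u' f where f: "f \<in> E n" "ends f = {u, u'}" "DD u w = DD u u' + DD u' w"
      using between[OF uV(1) vw(2)] by blast
    have u'V: "u' \<in> verts (E n)" using f by (auto simp: verts_ends)
    obtain x y i where xyi: "f = (x, y, i)" by (metis prod_cases3)
    have "DD u u' = DD x y"
      using f(2) xyi DD_commute[OF VVn[OF uV(1)] VVn[OF u'V]] by (auto simp: doubleton_eq_iff)
    then have duu: "DD u u' = th ^ n * wl i" using DD_edge f(1) xyi by simp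
    have "th ^ n * wl i \<le> th ^ n * BB" using BB(3)[OF E_colour] f(1) xyi th by (intro mult_left_mono) auto
    then have small: "DD u u' \<le> BB * th ^ n" using duu by (simp add: mult.commute)
    have pos: "0 < DD u u'" using duu wl_pos[of i] th(1) by simp
    have t: "DD v w \<le> DD v u' + DD u' w" "DD v u' \<le> DD v u + DD u u'"
      using DD_triangle VVn vw u'V uV(1) by blast+
    then have vu': "DD v u' = DD v u + DD u u'" using f(3) uV(2) by simp
    have "\<not> DD v u' \<le> a"
    proof
      assume "DD v u' \<le> a"
      then have "u' \<in> S" using u'V vu' f(3) uV(2) by (simp add: S_def)
      then show False using mx vu' pos by fastforce
    qed
    then show ?thesis using vu' small by simp
  qed
  then show ?thesis using uV by blast
qed

lemma edge_small: "0 < \<epsilon> \<Longrightarrow> \<exists>n\<ge>n0. BB * th ^ n < \<epsilon>"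
proof -
  assume e: "0 < \<epsilon>"
  have "(\<lambda>n. BB * th ^ n) \<longlonglongrightarrow> BB * 0"
    by (intro tendsto_intros LIMSEQ_power_zero) (use th in auto)
  then have "(\<lambda>n. BB * th ^ n) \<longlonglongrightarrow> 0" by simp
  from order_tendstoD(2)[OF this e] have "\<forall>\<^sub>F n in sequentially. BB * th ^ n < \<epsilon>" .
  then obtain M where "\<forall>n\<ge>M. BB * th ^ n < \<epsilon>" by (auto simp: eventually_sequentially)
  then show ?thesis by (intro exI[of _ "max M n0"]) auto
qed

lemma Vpts_eq: "Vpts d \<eta> n = N ` verts (E n)"
  unfolding Vpts_def using nu_eq_N by (auto simp: image_def)

lemma VV_subset: "S \<subseteq> VV \<Longrightarrow> emb ` S \<subseteq> mtopology_of CM closure_of (emb ` S)"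
  using emb_image by (intro closure_of_subset) auto

text \<open>Approximate the two ends by vertices v and w, take a vertex u on the way from v to w at
  about the distance of z from v, and bound the distance from z to u by the four-point inequality.
  The loss is at most five times epsilon, which r/8 accommodates.\<close>

lemma closure_vertices_convex:
  assumes pq: "p \<in> fp_carrier d" "q \<in> fp_carrier d" "z \<in> fp_carrier d"
    and cl: "fp_embed d p \<in> mtopology_of CM closure_of (emb ` VV)" "fp_embed d q \<in> mtopology_of CM closure_of (emb ` VV)"
    and z: "fp_dist p z + fp_dist z q = fp_dist p q"
  shows "fp_embed d z \<in> mtopology_of CM closure_of (emb ` VV)"
  unfolding closure_iff[OF emb_image[OF order_refl]]
proof (intro conjI allI impI)
  show "fp_embed d z \<in> mspace CM" using embed_in pq(3) .
  fix r :: real assume r: "0 < r"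
  define \<epsilon> where "\<epsilon> = r / 8"
  have e: "0 < \<epsilon>" using r by (simp add: \<epsilon>_def)
  have near: "\<exists>v\<in>VV. fp_dist p' (N v) < \<epsilon>" if p': "p' \<in> fp_carrier d" "fp_embed d p' \<in> mtopology_of CM closure_of (emb ` VV)" for p'
  proof -
    obtain v where "v \<in> VV" "cdist (fp_embed d p') (emb v) < \<epsilon>"
      using p'(2) e unfolding closure_iff[OF emb_image[OF order_refl]] by blast
    then show ?thesis using embed_dist[OF p'(1) N_VV] by (auto simp: emb_def)
  qed
  obtain v where v: "v \<in> VV" "fp_dist p (N v) < \<epsilon>" using near pq(1) cl(1) by blast
  obtain w where w: "w \<in> VV" "fp_dist q (N w) < \<epsilon>" using near pq(2) cl(2) by blast
  obtain n1 n2 where n12: "v \<in> verts (E n1)" "w \<in> verts (E n2)" using v w by (auto simp: VV_def)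
  obtain n where n: "max n1 n2 \<le> n" "BB * th ^ n < \<epsilon>" using edge_small[OF e] by blast
  have vw: "v \<in> verts (E n)" "w \<in> verts (E n)"
    using n12 verts_E_mono[of n1 n] verts_E_mono[of n2 n] n(1) by auto
  have c: "N v \<in> fp_carrier d" "N w \<in> fp_carrier d" using N_VV v w by blast+
  define A where "A = fp_dist z (N v)"
  define B where "B = fp_dist z (N w)"
  have "A \<le> fp_dist z p + fp_dist p (N v)" "B \<le> fp_dist z q + fp_dist q (N w)"
    unfolding A_def B_def using fp_dist_triangle pq c by blast+
  moreover have "fp_dist p q \<le> fp_dist p (N v) + fp_dist (N v) q" "fp_dist (N v) q \<le> fp_dist (N v) (N w) + fp_dist (N w) q"
    using fp_dist_triangle pq c by blast+
  moreover have "fp_dist z p = fp_dist p z" "fp_dist (N w) q = fp_dist q (N w)" using fp_dist_commute pq c by blast+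
  ultimately have AB: "A + B \<le> DD v w + 4 * \<epsilon>" using v(2) w(2) z by (simp add: DD_def)
  have nn: "0 \<le> A" "0 \<le> B" by (simp_all add: A_def B_def fp_dist_nonneg)
  define a where "a = min A (DD v w)"
  have a: "0 \<le> a" "a \<le> DD v w" using nn DD_nonneg by (simp_all add: a_def)
  obtain u where u: "u \<in> verts (E n)" "DD v u + DD u w = DD v w" "DD v u \<le> a" "a - BB * th ^ n \<le> DD v u"
    using path_point[OF vw a] by blast
  have uc: "N u \<in> fp_carrier d" and uV: "u \<in> VV" using u(1) N_VV VV_I by blast+
  have "fp_dist z (N u) + fp_dist (N v) (N w) \<le> max (fp_dist z (N v) + fp_dist (N u) (N w)) (fp_dist z (N w) + fp_dist (N u) (N v))"
    by (rule fp_four_point[OF pq(3) uc c])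
  then have "fp_dist z (N u) + DD v w \<le> max (A + DD u w) (B + DD v u)"
    using fp_dist_commute[OF uc c(1)] by (simp add: A_def B_def DD_def)
  moreover have "A + DD u w \<le> DD v w + 5 * \<epsilon>" using u(2,4) n(2) AB nn e
    unfolding a_def by (simp add: min_def split: if_splits)
  moreover have "B + DD v u \<le> DD v w + 4 * \<epsilon>" using u AB by (simp add: a_def)
  ultimately have "fp_dist z (N u) \<le> 5 * \<epsilon>" using e by (simp split: if_splits add: max_def)
  then have "fp_dist z (N u) < r" using e by (simp add: \<epsilon>_def)
  then have "cdist (fp_embed d z) (emb u) < r" using embed_dist[OF pq(3) uc] by (simp add: emb_def)
  then show "\<exists>y\<in>emb ` VV. cdist (fp_embed d z) y < r" using uV by blast
qed

text \<open>Removes the convex hulls: the points of the free product lying in the closure of the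
  vertices already form a convex set, so the hulls stay inside that closure.\<close>

theorem T_tau_closure: "T_tau d \<eta> = mtopology_of CM closure_of (emb ` VV)"
proof
  have "emb ` VV \<subseteq> (\<Union>n. fp_embed d ` rtree d \<eta> n)"
  proof
    fix q assume "q \<in> emb ` VV"
    then obtain v n where v: "q = emb v" "v \<in> verts (E n)" by (auto simp: VV_def)
    then have "N v \<in> rtree d \<eta> n" unfolding rtree_def using hull_subset[of "Vpts d \<eta> n"] by (auto simp: Vpts_eq)
    then show "q \<in> (\<Union>n. fp_embed d ` rtree d \<eta> n)" using v(1) by (auto simp: emb_def)
  qed
  then show "mtopology_of CM closure_of (emb ` VV) \<subseteq> T_tau d \<eta>"
    unfolding T_tau_def by (rule closure_of_mono)
  define Y where "Y = {p \<in> fp_carrier d. fp_embed d p \<in> mtopology_of CM closure_of (emb ` VV)}"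
  have "tree_convex (fp_metric d) Y"
    unfolding tree_convex_def seg_def Y_def using closure_vertices_convex by auto
  moreover have "Vpts d \<eta> n \<subseteq> Y" for n
    unfolding Vpts_eq Y_def using VV_subset[OF order_refl] N_VV VV_I by (auto simp: emb_def)
  ultimately have "rtree d \<eta> n \<subseteq> Y" for n unfolding rtree_def by (intro hull_minimal)
  then have "(\<Union>n. fp_embed d ` rtree d \<eta> n) \<subseteq> mtopology_of CM closure_of (emb ` VV)"
    by (auto simp: Y_def)
  then show "T_tau d \<eta> \<subseteq> mtopology_of CM closure_of (emb ` VV)"
    unfolding T_tau_def by (rule closure_of_minimal) simp
qed

definition descVs :: "vertex \<times> vertex \<times> nat \<Rightarrow> vertex set" where
  "descVs e = (\<Union>k. descV k e)"

text \<open>The geometric piece of an edge; \<open>T_tau_arc_edge\<close> identifies it with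
  T_tau(s,t).\<close>

definition KK :: "vertex \<times> vertex \<times> nat \<Rightarrow> cpoint set" where
  "KK e = mtopology_of CM closure_of (emb ` descVs e)"

lemma descVs_VV: "e \<in> E n \<Longrightarrow> descVs e \<subseteq> VV"
  unfolding descVs_def using descV_VV by blast

lemma ends_descVs: "ends e \<subseteq> descVs e"
  unfolding descVs_def using ends_descV by blast

lemma descVs_children: "descVs e = (\<Union>f\<in>subst_edge d e. descVs f)"
proof
  have "descV k e \<subseteq> (\<Union>f\<in>subst_edge d e. descVs f)" for k
  proof (cases k)
    case 0
    have "ends e \<subseteq> (\<Union>f\<in>subst_edge d e. ends f)" using ends_ch[of e] by (simp add: ch_def verts_ends)
    then show ?thesis using 0 ends_descVs by (force simp: descV_0)
  next
    case (Suc l)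
    then show ?thesis by (auto simp: descV_Suc descVs_def)
  qed
  then show "descVs e \<subseteq> (\<Union>f\<in>subst_edge d e. descVs f)" unfolding descVs_def[of e] by blast
  show "(\<Union>f\<in>subst_edge d e. descVs f) \<subseteq> descVs e"
    unfolding descVs_def using descV_Suc by blast
qed

lemma VV_edges: "VV = (\<Union>e\<in>E n. descVs e)"
proof
  show "VV \<subseteq> (\<Union>e\<in>E n. descVs e)"
  proof
    fix v assume "v \<in> VV"
    then obtain m where "v \<in> verts (E m)" by (auto simp: VV_def)
    then have "v \<in> verts (E (n + m))" using verts_E_mono[of m "n + m"] by auto
    then show "v \<in> (\<Union>e\<in>E n. descVs e)" by (auto simp: verts_E_add descVs_def)
  qed
qed (use descVs_VV in blast)

lemma KK_closure: "e \<in> E n \<Longrightarrow> emb ` descVs e \<subseteq> mspace CM"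
  using descVs_VV emb_image by blast

lemma emb_KK: "e \<in> E n \<Longrightarrow> v \<in> descVs e \<Longrightarrow> emb v \<in> KK e"
  unfolding KK_def using VV_subset[OF descVs_VV] by blast

lemma KK_mspace: "KK e \<subseteq> mspace CM"
  unfolding KK_def using closure_of_subset_topspace[of "mtopology_of CM"] by simp

lemma closure_emb_UN:
  "finite F \<Longrightarrow> mtopology_of CM closure_of (emb ` (\<Union>e\<in>F. descVs e)) = (\<Union>e\<in>F. KK e)"
proof -
  assume "finite F"
  then have "mtopology_of CM closure_of \<Union> ((\<lambda>e. emb ` descVs e) ` F) = (\<Union>S\<in>(\<lambda>e. emb ` descVs e) ` F. mtopology_of CM closure_of S)"
    by (intro closure_of_Union) simp
  moreover have "emb ` (\<Union>e\<in>F. descVs e) = \<Union> ((\<lambda>e. emb ` descVs e) ` F)" by blast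
  ultimately show ?thesis by (simp add: KK_def)
qed

lemma T_tau_KK: "T_tau d \<eta> = (\<Union>e\<in>E n. KK e)"
  unfolding T_tau_closure VV_edges[of n] by (rule closure_emb_UN[OF finite_E])

lemma finite_subst_edge: "finite (subst_edge d e)"
  by (cases e; cases "snd (snd e) = 2") (auto simp: subst_edge_2 subst_edge_shift)

lemma KK_children: "KK e = (\<Union>f\<in>subst_edge d e. KK f)"
  unfolding KK_def[of e] descVs_children[of e] by (rule closure_emb_UN[OF finite_subst_edge])

lemma KK_diameter:
  assumes e: "e \<in> E n" and q: "q \<in> KK e" "q' \<in> KK e"
  shows "cdist q q' \<le> 2 * BB * th ^ n"
proof -
  obtain x y i where xyi: "e = (x, y, i)" by (metis prod_cases3)
  have x: "x \<in> VV" using E_ends_VV[OF e] xyi by auto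
  have "cdist q (emb x) \<le> BB * th ^ n" if "q \<in> KK e" for q
  proof -
    have "0 \<le> - 1 * cdist q (emb x) + 0 * cdist q (emb x) + BB * th ^ n"
    proof (rule closure_linear[OF KK_closure[OF e] that[unfolded KK_def] emb_in[OF x] emb_in[OF x]])
      fix y' assume "y' \<in> emb ` descVs e"
      then obtain a k where a: "y' = emb a" "a \<in> descV k e" by (auto simp: descVs_def)
      then have "DD a x \<le> BB * th ^ n" using desc_diameter[of x y i n a k] e xyi by simp
      moreover have "a \<in> VV" using a(2) descV_VV[OF e] by blast
      ultimately show "0 \<le> - 1 * cdist y' (emb x) + 0 * cdist y' (emb x) + BB * th ^ n"
        using a(1) emb_dist x by simp
    qed
    then show ?thesis by simp
  qed
  then have "cdist q (emb x) \<le> BB * th ^ n" "cdist q' (emb x) \<le> BB * th ^ n" using q by blast+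
  moreover have "cdist q q' \<le> cdist q (emb x) + cdist (emb x) q'"
    using C.triangle KK_mspace q emb_in[OF x] by blast
  ultimately show ?thesis using C.commute[of "emb x" q'] by simp
qed

lemma KK_unique:
  assumes "\<And>k. n \<le> k \<Longrightarrow> e k \<in> E k" "\<And>k. n \<le> k \<Longrightarrow> q \<in> KK (e k)" "\<And>k. n \<le> k \<Longrightarrow> q' \<in> KK (e k)"
  shows "q = q'"
proof (rule ccontr)
  assume "q \<noteq> q'"
  have qq: "q \<in> mspace CM" "q' \<in> mspace CM" using assms(2)[of n] assms(3)[of n] KK_mspace[of "e n"] by blast+
  then have "0 < cdist q q' / 2" using C.mdist_pos_eq[of q q'] \<open>q \<noteq> q'\<close> by simp
  from edge_small[OF this, of n] obtain k where k: "n \<le> k" "BB * th ^ k < cdist q q' / 2" by blast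
  have "cdist q q' \<le> 2 * BB * th ^ k" using KK_diameter assms k(1) by blast
  then show False using k(2) by simp
qed

lemma gate_KK:
  assumes e: "e \<in> E n" "e' \<in> E n" "e \<noteq> e'" and g: "gate e p e' p'" and a: "a \<in> ends e" and q: "q \<in> KK e'"
  shows "cdist q (emb a) = cdist q (emb p) + DD p a"
proof -
  have V: "p \<in> VV" "a \<in> VV" using g a E_ends_VV[OF e(1)] by (auto simp: gate_def)
  have eq: "cdist y (emb a) = cdist y (emb p) + DD p a" if "y \<in> emb ` descVs e'" for y
  proof -
    obtain b k where b: "y = emb b" "b \<in> descV k e'" using \<open>y \<in> emb ` descVs e'\<close> by (auto simp: descVs_def)
    have bV: "b \<in> VV" using b(2) descV_VV[OF e(2)] by blast
    have cb: "DD c b = DD c p + DD p p' + DD p' b" if "c \<in> ends e" for c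
      using gate_desc[OF e g _ b(2), of c] ends_descV that by blast
    have "p \<in> ends e" using g by (simp add: gate_def)
    then have "DD a b = DD a p + DD p b" using cb[OF a] cb[of p] DD_self[OF V(1)] by linarith
    then show ?thesis
      unfolding b(1) using emb_dist[OF bV V(1)] emb_dist[OF bV V(2)] DD_commute[OF bV V(1)] DD_commute[OF bV V(2)]
        DD_commute[OF V] by linarith
  qed
  have "0 \<le> 1 * cdist q (emb a) + (- 1) * cdist q (emb p) + (- DD p a)"
    by (rule closure_linear[OF KK_closure[OF e(2)] q[unfolded KK_def] emb_in[OF V(2)] emb_in[OF V(1)]]) (use eq in auto)
  moreover have "0 \<le> (- 1) * cdist q (emb a) + 1 * cdist q (emb p) + DD p a"
    by (rule closure_linear[OF KK_closure[OF e(2)] q[unfolded KK_def] emb_in[OF V(2)] emb_in[OF V(1)]]) (use eq in auto)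
  ultimately show ?thesis by simp
qed

text \<open>The source of the uniqueness of P_u: if the pieces agreed, the end of e other than the
  gate would lie in the piece of e' and be seen through the gate, which forces length 0.\<close>

lemma KK_inject:
  assumes e: "e \<in> E n" "e' \<in> E n" and eq: "KK e = KK e'"
  shows "e = e'"
proof (rule ccontr)
  assume ne: "e \<noteq> e'"
  then obtain p p' where g: "gate e p e' p'" using gates e by blast
  obtain x y i where xyi: "e = (x, y, i)" by (metis prod_cases3)
  obtain a where a: "a \<in> ends e" "a \<noteq> p" using E_neq[of x y i n] e(1) xyi by auto
  have p: "p \<in> ends e" using g by (simp add: gate_def)
  have V: "p \<in> VV" "a \<in> VV" using p a E_ends_VV[OF e(1)] by auto
  have "emb a \<in> KK e'" using emb_KK[OF e(1)] ends_descVs a eq by blast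
  from gate_KK[OF e ne g a(1) this] have "DD a p + DD p a = 0"
    using emb_dist V DD_self[OF V(2)] by simp
  then have "DD x y = 0" using a p xyi DD_nonneg[of x y] DD_nonneg[of y x] by auto
  then show False using DD_edge_pos[of x y i n] e(1) xyi by simp
qed

text \<open>A point of another piece is seen through a gate p, so p separates it from the other end
  unless the point is p itself. Conversely, the limit of \<open>desc_separation\<close> prevents an
  end of e from separating a point of its piece from the other end.\<close>

theorem T_tau_arc_edge:
  assumes e: "e \<in> E n" and st: "ends e = {s, t}"
  shows "T_tau_arc d \<eta> (N s) (N t) = KK e"
proof -
  have V: "s \<in> VV" "t \<in> VV" using st E_ends_VV[OF e] by auto
  have sn: "s \<noteq> t" using st E_neq e by (cases e) (auto simp: doubleton_eq_iff)
  have arc: "T_tau_arc d \<eta> (N s) (N t) =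
      {q \<in> T_tau d \<eta>. emb s \<notin> open_seg CM q (emb t) \<and> emb t \<notin> open_seg CM q (emb s)}"
    by (simp add: T_tau_arc_def emb_def)
  have memb: "emb a \<in> open_seg CM q (emb b) \<longleftrightarrow> cdist q (emb a) + DD a b = cdist q (emb b) \<and> emb a \<noteq> q \<and> emb a \<noteq> emb b"
    if "a \<in> VV" "b \<in> VV" for a b q
    using that emb_in emb_dist by (simp add: open_seg_def seg_def)
  show ?thesis
  proof
    show "T_tau_arc d \<eta> (N s) (N t) \<subseteq> KK e"
    proof
      fix q assume "q \<in> T_tau_arc d \<eta> (N s) (N t)"
      then have q: "q \<in> T_tau d \<eta>" "emb s \<notin> open_seg CM q (emb t)" "emb t \<notin> open_seg CM q (emb s)"
        unfolding arc by blast+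
      obtain e' where e': "e' \<in> E n" "q \<in> KK e'" using q(1) T_tau_KK[of n] by blast
      show "q \<in> KK e"
      proof (cases "e = e'")
        case False
        then obtain p p' where g: "gate e p e' p'" using gates e e' by blast
        then have p: "p \<in> {s, t}" using st by (simp add: gate_def)
        obtain a where a: "a \<in> {s, t}" "a \<noteq> p" using sn by auto
        have aV: "a \<in> VV" "p \<in> VV" using a p V by auto
        have "cdist q (emb a) = cdist q (emb p) + DD p a" using gate_KK[OF e e'(1) False g _ e'(2)] a st by simp
        moreover have "emb p \<notin> open_seg CM q (emb a)" using q(2,3) p a by auto
        ultimately have "emb p = q \<or> emb p = emb a" using memb[OF aV(2,1)] by simp
        moreover have "emb p \<noteq> emb a"
        proof
          assume "emb p = emb a"
          then have "DD p a = 0" using emb_dist[OF aV(2,1)] emb_dist[OF aV(1) aV(1)] DD_self[OF aV(1)] by simp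
          moreover obtain x y i where xyi: "e = (x, y, i)" by (metis prod_cases3)
          moreover have "{p, a} = {x, y}" using p a st xyi by auto
          ultimately have "DD x y = 0" using DD_commute[OF aV] by (auto simp: doubleton_eq_iff)
          then show False using DD_edge_pos[of x y i n] e xyi by simp
        qed
        ultimately show ?thesis using emb_KK[OF e] ends_descVs[of e] p st by auto
      qed (use e' in simp)
    qed
    show "KK e \<subseteq> T_tau_arc d \<eta> (N s) (N t)"
    proof
      fix q assume q: "q \<in> KK e"
      have qC: "q \<in> mspace CM" using q KK_mspace by blast
      have "q \<in> T_tau d \<eta>" using q e T_tau_KK[of n] by blast
      moreover have "emb a \<notin> open_seg CM q (emb b)" if ab: "ends e = {a, b}" for a b
      proof
        have abV: "a \<in> VV" "b \<in> VV" using ab E_ends_VV[OF e] by auto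
        assume "emb a \<in> open_seg CM q (emb b)"
        then have h: "cdist q (emb a) + DD a b = cdist q (emb b)" "emb a \<noteq> q" using memb abV by blast+
        \<comment> \<open>This is \<open>desc_separation\<close> with terms collected. If a lies
          between q and b, the expression reduces to the negative of the distance from q to a, so q
          = a.\<close>
        have "0 \<le> BB * cdist q (emb a) + (- (BB + 1)) * cdist q (emb b) + (BB + 1) * DD a b"
        proof (rule closure_linear[OF KK_closure[OF e] q[unfolded KK_def] emb_in[OF abV(1)] emb_in[OF abV(2)]])
          fix y assume "y \<in> emb ` descVs e"
          then obtain c k where c: "y = emb c" "c \<in> descV k e" by (auto simp: descVs_def)
          have "DD c a \<le> (BB + 1) * (DD c a + DD a b - DD c b)" by (rule desc_separation[OF e c(2) ab])
          moreover have "c \<in> VV" using c(2) descV_VV[OF e] by blast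
          ultimately show "0 \<le> BB * cdist y (emb a) + (- (BB + 1)) * cdist y (emb b) + (BB + 1) * DD a b"
            using c(1) emb_dist abV by (simp add: algebra_simps)
        qed
        then have "cdist q (emb a) \<le> 0" unfolding h(1)[symmetric] by (simp add: algebra_simps)
        then have "q = emb a" using C.zero[OF qC emb_in[OF abV(1)]] C.nonneg[of q "emb a"] by simp
        then show False using h(2) by simp
      qed
      ultimately show "q \<in> T_tau_arc d \<eta> (N s) (N t)"
        unfolding arc using st by (auto simp: insert_commute)
    qed
  qed
qed

text \<open>By \<open>between\<close>, the first vertex on the way from s lies in the arc and is
  joined to s by an edge, so it must be t. Conversely, a vertex inside the arc of an edge would
  coincide with a gate, which is an end.\<close>

theorem simple_arc_iff:
  "simple_arc d \<eta> n s t \<longleftrightarrow> (\<exists>e\<in>E n. \<exists>v w. ends e = {v, w} \<and> s = N v \<and> t = N w)"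
proof
  assume "simple_arc d \<eta> n s t"
  then obtain v w where vw: "v \<in> verts (E n)" "w \<in> verts (E n)" "s = N v" "t = N w" "s \<noteq> t"
    and op: "open_seg (fp_metric d) s t \<inter> N ` verts (E n) = {}"
    by (auto simp: simple_arc_def Vpts_eq)
  have "v \<noteq> w" using vw by blast
  then obtain u e where u: "e \<in> E n" "ends e = {v, u}" "DD v w = DD v u + DD u w" using between vw by blast
  have uE: "u \<in> verts (E n)" using u by (auto simp: verts_ends)
  have "N u \<in> seg (fp_metric d) s t" using u(3) N_VV[OF VV_I[OF uE]] vw by (simp add: seg_def DD_def)
  then have "N u = s \<or> N u = t" using op uE by (auto simp: open_seg_def)
  moreover have "N u \<noteq> s"
  proof
    assume "N u = s"
    then have "DD v u = 0" "DD u v = 0" using vw(3) fp_dist_0 N_VV[OF VV_I[OF uE]] by (auto simp: DD_def)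
    moreover obtain x y i where xyi: "e = (x, y, i)" by (metis prod_cases3)
    moreover have "{v, u} = {x, y}" using u(2) xyi by simp
    ultimately have "DD x y = 0" by (auto simp: doubleton_eq_iff)
    then show False using DD_edge_pos[of x y i n] u(1) xyi by simp
  qed
  ultimately show "\<exists>e\<in>E n. \<exists>v w. ends e = {v, w} \<and> s = N v \<and> t = N w"
    using u(1,2) vw(3) by blast
next
  assume "\<exists>e\<in>E n. \<exists>v w. ends e = {v, w} \<and> s = N v \<and> t = N w"
  then obtain e v w where e: "e \<in> E n" "ends e = {v, w}" "s = N v" "t = N w" by blast
  have vE: "v \<in> verts (E n)" "w \<in> verts (E n)" using e by (auto simp: verts_ends)
  have V: "v \<in> VV" "w \<in> VV" using vE VV_I by blast+
  obtain x y i where xyi: "e = (x, y, i)" by (metis prod_cases3)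
  have "{v, w} = {x, y}" using e(2) xyi by simp
  then have vw0: "DD v w \<noteq> 0" using DD_edge_pos[of x y i n] e(1) xyi DD_commute[OF V] by (auto simp: doubleton_eq_iff)
  then have st: "s \<noteq> t" using e(3,4) DD_self[OF V(1)] by (auto simp: DD_def)
  have hullc: "seg (fp_metric d) s t \<subseteq> rtree d \<eta> n"
    unfolding rtree_def hull_def e(3,4) tree_convex_def Vpts_eq using vE by blast
  have "u' = s \<or> u' = t" if u': "u' \<in> seg (fp_metric d) s t" "u' \<in> N ` verts (E n)" for u'
  proof -
    obtain u where u: "u' = N u" "u \<in> verts (E n)" using u'(2) by blast
    have du: "DD v u + DD u w = DD v w" using u'(1) u(1) e(3,4) by (simp add: seg_def DD_def)
    obtain e' where e': "e' \<in> E n" "u \<in> ends e'" using u(2) by (auto simp: verts_ends)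
    show ?thesis
    proof (cases "e = e'")
      case True
      then show ?thesis using e' e u(1) by auto
    next
      case False
      then obtain p p' where g: "gate e p e' p'" using gates e(1) e'(1) by blast
      then have p: "p \<in> {v, w}" using e(2) by (simp add: gate_def)
      have uV: "u \<in> VV" using VV_I u(2) by blast
      have pV: "p \<in> VV" using p V by auto
      have G: "DD a u = DD a p + DD p p' + DD p' u" if "a \<in> {v, w}" for a
        using g that e(2) e'(2) unfolding gate_def by blast
      have pu: "DD p u = DD p p' + DD p' u" using G[OF p] DD_self[OF pV] by simp
      have "DD v u = DD v p + DD p u" "DD w u = DD w p + DD p u" using G[of v] G[of w] pu by simp_all
      moreover have "DD v p + DD w p = DD v w" using p DD_self V DD_commute by auto
      ultimately have "DD p u = 0" using du DD_commute[OF uV V(2)] by simp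
      then have "N p = N u" using fp_dist_0[OF N_VV[OF pV] N_VV[OF uV]] by (simp add: DD_def)
      then show ?thesis using p e u(1) by auto
    qed
  qed
  then have "open_seg (fp_metric d) s t \<inter> Vpts d \<eta> n = {}" unfolding open_seg_def Vpts_eq by blast
  then show "simple_arc d \<eta> n s t" unfolding simple_arc_def using st hullc e(3,4) vE by (auto simp: Vpts_eq)
qed

text \<open>The pieces are closed and their diameters tend to 0, so being eventually in each of them
  gives a Cauchy sequence with its limit in all of them.\<close>

lemma nested_limit:
  assumes e: "\<And>k. n \<le> k \<Longrightarrow> e k \<in> E k" and X: "\<And>j. X j \<in> mspace CM"
    and ev: "\<And>k. n \<le> k \<Longrightarrow> eventually (\<lambda>j. X j \<in> KK (e k)) sequentially"
  shows "\<exists>q. limitin (mtopology_of CM) X q sequentially \<and> (\<forall>k\<ge>n. q \<in> KK (e k))"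
proof -
  have "C.MCauchy X"
    unfolding C.MCauchy_def
  proof (intro conjI allI impI)
    show "range X \<subseteq> mspace CM" using X by blast
    fix \<epsilon> :: real assume "0 < \<epsilon>"
    then have "0 < \<epsilon> / 2" by simp
    from edge_small[OF this, of n] obtain k where k: "n \<le> k" "BB * th ^ k < \<epsilon> / 2" by blast
    obtain M where M: "\<And>j. M \<le> j \<Longrightarrow> X j \<in> KK (e k)" using ev[OF k(1)] by (auto simp: eventually_sequentially)
    have "cdist (X j) (X j') < \<epsilon>" if "M \<le> j" "M \<le> j'" for j j'
      using KK_diameter[OF e[OF k(1)] M[OF that(1)] M[OF that(2)]] k(2) by simp
    then show "\<exists>N. \<forall>j j'. N \<le> j \<longrightarrow> N \<le> j' \<longrightarrow> cdist (X j) (X j') < \<epsilon>" by blast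
  qed
  moreover have "C.mcomplete" using completion by (simp add: is_completion_def mcomplete_of_def)
  ultimately obtain q where q: "limitin C.mtopology X q sequentially" unfolding C.mcomplete_def by blast
  moreover have "q \<in> KK (e k)" if "n \<le> k" for k
  proof -
    have "closedin (mtopology_of CM) (KK (e k))" unfolding KK_def by simp
    then show ?thesis using limitin_closedin[OF q _ ev[OF that]] top_C by simp
  qed
  ultimately show ?thesis unfolding top_C by blast
qed

lemma limit_unique:
  "limitin (mtopology_of CM) X q sequentially \<Longrightarrow> limitin (mtopology_of CM) X q' sequentially \<Longrightarrow> q = q'"
  unfolding top_C using C.limitin_metric_unique by (metis sequentially_bot)


section \<open>The dictionary between edges, prefixes of omega and cylinders\<close>

section \<open>Branch vertices and prefixes of the fixed point\<close>

text \<open>For a branch vertex v this is the length of the u with f_0(v) = u^-1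
  (\<open>f_zero_eq\<close>): substituting (x, y, 2) at stage n puts sigma^n(1) in front of the
  prefix attached to x.\<close>

primrec kap :: "vertex \<Rightarrow> nat" where
  "kap (Base j) = 0"
| "kap (New x y h) = L (birth d (New x y h) - 1) + kap x"

declare kap.simps(2) [simp del]

text \<open>Branch vertices recognised by their names; \<open>branch_verts_iff\<close> is the
  comparison with the degree.\<close>

definition isB :: "vertex \<Rightarrow> bool" where
  "isB v \<longleftrightarrow> v = Base 0 \<or> (\<exists>x y. v = New x y 0)"

lemma isB_simps [simp]: "isB (Base j) \<longleftrightarrow> j = 0" "isB (New x y h) \<longleftrightarrow> h = 0"
  by (auto simp: isB_def)

lemma kap_New: "(x, y, 2) \<in> E n \<Longrightarrow> h \<le> d - 2 \<Longrightarrow> kap (New x y h) = L n + kap x"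
  using birth_New by (simp add: kap.simps(2))

lemma E_0_iff: "(x, y, i) \<in> E 0 \<longleftrightarrow> x = Base 0 \<and> y = Base i \<and> 1 \<le> i \<and> i \<le> d"
  by (auto simp: E_0)

text \<open>Orientations always leave a branch vertex, so every edge has a prefix of omega attached
  to its origin.\<close>

lemma E_origin: "(x, y, i) \<in> E n \<Longrightarrow> isB x"
proof (induction n arbitrary: x y i)
  case 0
  then show ?case by (simp add: E_0_iff)
next
  case (Suc n)
  then obtain x' y' i' where e: "(x', y', i') \<in> E n" "(x, y, i) \<in> subst_edge d (x', y', i')"
    by (metis E_SucE prod_cases3)
  from e(2) show ?case by (cases rule: subst_edge_cases) (use Suc.IH[OF e(1)] in auto)
qed

lemma E_Suc_cases:
  assumes "(x, y, i) \<in> E (Suc n)"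
  obtains (shift) j where "(x, y, j) \<in> E n" "j \<noteq> 2" "i = cshift j"
  | (split) x' y' where "(x', y', 2) \<in> E n" "x = New x' y' 0" "i \<in> children" "kap x = L n + kap x'"
     "(x, y, i) \<in> subst_edge d (x', y', 2)"
proof -
  obtain x' y' i' where e: "(x', y', i') \<in> E n" "(x, y, i) \<in> subst_edge d (x', y', i')"
    using assms by (metis E_SucE prod_cases3)
  show thesis
  proof (cases "i' = 2")
    case False
    then show thesis using e that(1)[of i'] by (simp add: subst_edge_shift)
  next
    case True
    then have e2: "(x', y', 2) \<in> E n" "(x, y, i) \<in> subst_edge d (x', y', 2)" using e by auto
    from e2(2) have "x = New x' y' 0 \<and> i \<in> children"
      by (cases rule: subst_edge_cases) (use d3 in \<open>auto simp: children_def\<close>)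
    then show thesis using that(2)[OF e2(1)] e2 kap_New[OF e2(1), of 0] by simp
  qed
qed

lemma child_edge: "(x, y, 2) \<in> E n \<Longrightarrow> i \<in> children \<Longrightarrow> \<exists>v. (New x y 0, v, i) \<in> subst_edge d (x, y, 2)"
proof -
  assume "i \<in> children"
  then consider "i = 1" | "i = d" | "1 \<le> i - d" "i - d \<le> d - 2" "i = d + (i - d)" 
    unfolding children_def by fastforce
  then show ?thesis
  proof cases
    case 3
    then have "(New x y 0, New x y (i - d), d + (i - d)) \<in> subst_edge d (x, y, 2)"
      unfolding subst_edge_2 by blast
    then show ?thesis using 3(3) by metis
  qed (unfold subst_edge_2, blast+)
qed

definition key :: "vertex \<times> vertex \<times> nat \<Rightarrow> nat \<times> nat" where
  "key e = (snd (snd e), kap (fst e))"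

lemma key_simp [simp]: "key (x, y, i) = (i, kap x)"
  by (simp add: key_def)

lemma key_in_idx: "(x, y, i) \<in> E n \<Longrightarrow> (i, kap x) \<in> idx n"
proof (induction n arbitrary: x y i)
  case 0
  then show ?case by (auto simp: E_0_iff)
next
  case (Suc n)
  from Suc.prems show ?case
  proof (cases rule: E_Suc_cases)
    case (shift j)
    then show ?thesis using Suc.IH by auto
  next
    case (split x' y')
    then show ?thesis using Suc.IH by auto
  qed
qed

lemma idx_key: "(i, k) \<in> idx n \<Longrightarrow> \<exists>x y. (x, y, i) \<in> E n \<and> kap x = k"
proof (induction n arbitrary: i k)
  case 0
  then show ?case by (auto simp: E_0_iff)
next
  case (Suc n)
  from Suc.prems consider (1) j where "(j, k) \<in> idx n" "j \<noteq> 2" "i = cshift j"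
    | (2) k' where "(2, k') \<in> idx n" "i \<in> children" "k = L n + k'" by auto
  then show ?case
  proof cases
    case 1
    then obtain x y where xy: "(x, y, j) \<in> E n" "kap x = k" using Suc.IH by blast
    then have "(x, y, i) \<in> E (Suc n)" using E_SucI[OF xy(1)] subst_edge_shift[OF 1(2)] 1(3) by simp
    then show ?thesis using xy(2) by blast
  next
    case 2
    then obtain x y where xy: "(x, y, 2) \<in> E n" "kap x = k'" using Suc.IH by blast
    obtain v where "(New x y 0, v, i) \<in> subst_edge d (x, y, 2)" using child_edge[OF xy(1) 2(2)] by blast
    then have "(New x y 0, v, i) \<in> E (Suc n)" using E_SucI[OF xy(1)] by blast
    moreover have "kap (New x y 0) = k" using kap_New[OF xy(1), of 0] xy(2) 2(3) by simp
    ultimately show ?thesis by blast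
  qed
qed

lemma subst_edge_2_colour:
  assumes "f \<in> subst_edge d (x, y, 2)" "f' \<in> subst_edge d (x, y, 2)" "snd (snd f) = snd (snd f')"
  shows "f = f'"
  using assms(1)
proof (cases rule: subst_edge_cases)
  case first
  from assms(2) show ?thesis by (cases rule: subst_edge_cases) (use first assms(3) d3 in auto)
next
  case second
  from assms(2) show ?thesis by (cases rule: subst_edge_cases) (use second assms(3) d3 in auto)
next
  case (new h)
  from assms(2) show ?thesis by (cases rule: subst_edge_cases) (use new assms(3) d3 in auto)
qed simp

text \<open>Old and new edges cannot collide, because lengths at old origins are below
  \<open>mm n\<close> and lengths at new ones are not. Among new edges the length determines the
  parent by induction, and the colour determines the child.\<close>

lemma key_inj: "e \<in> E n \<Longrightarrow> e' \<in> E n \<Longrightarrow> key e = key e' \<Longrightarrow> e = e'"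
proof (induction n arbitrary: e e')
  case 0
  then show ?case by (auto simp: E_0)
next
  case (Suc n)
  obtain x y i where e: "e = (x, y, i)" by (metis prod_cases3)
  obtain x' y' i' where e': "e' = (x', y', i')" by (metis prod_cases3)
  have k: "i = i'" "kap x = kap x'" using Suc.prems(3) e e' by auto
  from Suc.prems(1)[unfolded e] show ?case
  proof (cases rule: E_Suc_cases)
    case (shift j)
    from Suc.prems(2)[unfolded e'] show ?thesis
    proof (cases rule: E_Suc_cases)
      case s: (shift j')
      have "j = j'" using cshift_inject E_colour[OF shift(1)] E_colour[OF s(1)] shift s k(1) by blast
      then have "(x, y, j) = (x', y', j')" using Suc.IH[OF shift(1) s(1)] k by simp
      then show ?thesis using e e' k by simp
    next
      case s: (split u v)
      have "kap x < mm n" using idx_less[OF key_in_idx[OF shift(1)]] .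
      moreover have "mm n \<le> kap x'" using idx_2_bounds[OF key_in_idx[OF s(1)]] s(4) by simp
      ultimately show ?thesis using k by simp
    qed
  next
    case (split u v)
    from Suc.prems(2)[unfolded e'] show ?thesis
    proof (cases rule: E_Suc_cases)
      case s: (shift j')
      have "kap x' < mm n" using idx_less[OF key_in_idx[OF s(1)]] .
      moreover have "mm n \<le> kap x" using idx_2_bounds[OF key_in_idx[OF split(1)]] split(4) by simp
      ultimately show ?thesis using k by simp
    next
      case s: (split u' v')
      have "(u, v, 2) = (u', v', 2::nat)" using Suc.IH[OF split(1) s(1)] split(4) s(4) k(2) by simp
      then show ?thesis using subst_edge_2_colour[of "(x, y, i)" u v "(x', y', i')"] split(5) s(5) e e' k by simp
    qed
  qed
qed

subsection \<open>Degrees\<close>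

definition inc :: "nat \<Rightarrow> vertex \<Rightarrow> stree" where
  "inc n v = {f \<in> E n. v \<in> ends f}"

lemma degree_inc: "degree (E n) v = card (inc n v)"
  unfolding degree_def inc_def by (rule arg_cong[of _ _ card]) (auto simp: ends_def)

lemma card_subst_edge_2: "card (subst_edge d (x, y, 2)) = d"
proof -
  have "inj_on (\<lambda>f. snd (snd f)) (subst_edge d (x, y, 2))"
    by (rule inj_onI) (use subst_edge_2_colour in blast)
  moreover have "(\<lambda>f. snd (snd f)) ` subst_edge d (x, y, 2) = insert 1 (insert d ((\<lambda>h. d + h) ` {1..d - 2}))"
  proof -
    have "{(New x y 0, New x y h, d + h) |h. 1 \<le> h \<and> h \<le> d - 2} = (\<lambda>h. (New x y 0, New x y h, d + h)) ` {1..d - 2}" by auto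
    then show ?thesis unfolding subst_edge_2 by (simp add: image_image image_Un insert_commute)
  qed
  moreover have "card (insert 1 (insert d ((\<lambda>h. d + h) ` {1..d - 2}))) = d"
  proof -
    have "card ((\<lambda>h. d + h) ` {1..d - 2}) = d - 2" by (simp add: card_image)
    moreover have "d \<notin> (\<lambda>h. d + h) ` {1..d - 2}" "1 \<notin> insert d ((\<lambda>h. d + h) ` {1..d - 2})" using d3 by auto
    ultimately show ?thesis using d3 by simp
  qed
  ultimately show ?thesis using card_image by metis
qed

text \<open>Old vertices keep their degree: every edge at v has exactly one child at v, the map
  \<open>c\<close> in the proof. A new centre meets all d children and a new leaf only its own
  spoke.\<close>

lemma card_inc: "v \<in> verts (E n) \<Longrightarrow> card (inc n v) = (if isB v then d else 1)"
proof (induction n arbitrary: v)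
  case 0
  then obtain x y i where xyi: "(x, y, i) \<in> E 0" "v \<in> {x, y}" by (auto simp: verts_ends ends_def)
  show ?case
  proof (cases "v = Base 0")
    case True
    have "inc 0 v = (\<lambda>j. (Base 0, Base j, j)) ` {1..d}" unfolding inc_def True by (auto simp: E_0)
    moreover have "inj_on (\<lambda>j. (Base 0, Base j, j)) {1..d}" by (rule inj_onI) simp
    ultimately show ?thesis using True by (simp add: card_image)
  next
    case False
    then have v: "v = Base i" "1 \<le> i" "i \<le> d" using xyi by (auto simp: E_0_iff)
    then have "inc 0 v = {(Base 0, Base i, i)}" unfolding inc_def by (auto simp: E_0)
    then show ?thesis using v by simp
  qed
next
  case (Suc n)
  show ?case
  proof (cases "v \<in> verts (E n)")
    case True
    define c where "c = (\<lambda>(x, y, i). if i \<noteq> 2 then (x, y, cshift i) else if v = x then (New x y 0, x, d) else (New x y 0, y, 1))"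
    have c: "c e \<in> subst_edge d e \<and> v \<in> ends (c e)" if "e \<in> inc n v" for e
    proof -
      obtain x y i where e: "e = (x, y, i)" by (metis prod_cases3)
      show ?thesis
      proof (cases "i = 2")
        case False
        then show ?thesis using that e by (simp add: c_def inc_def subst_edge_shift)
      next
        case True
        then show ?thesis using that unfolding e True subst_edge_2 by (auto simp: c_def inc_def)
      qed
    qed
    have "inc (Suc n) v = c ` inc n v"
    proof
      show "c ` inc n v \<subseteq> inc (Suc n) v"
      proof
        fix f assume "f \<in> c ` inc n v"
        then obtain e where e: "e \<in> inc n v" "f = c e" by blast
        then have "e \<in> E n" by (simp add: inc_def)
        then show "f \<in> inc (Suc n) v" using c[OF e(1)] E_SucI[of e n f] e(2) by (simp add: inc_def)
      qed
      show "inc (Suc n) v \<subseteq> c ` inc n v"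
      proof
        fix f assume "f \<in> inc (Suc n) v"
        then have f: "f \<in> E (Suc n)" "v \<in> ends f" by (auto simp: inc_def)
        obtain e where e: "e \<in> E n" "f \<in> subst_edge d e" using f(1) by (rule E_SucE)
        obtain x y i where xyi: "e = (x, y, i)" by (metis prod_cases3)
        have vch: "v \<in> ch e" using subst_edge_ends_ch e(2) f(2) by blast
        have ve: "v \<in> ends e" "i = 2 \<Longrightarrow> \<forall>h\<le>d - 2. v \<noteq> New x y h"
        proof -
          show 2: "\<forall>h\<le>d - 2. v \<noteq> New x y h" if "i = 2" using New_fresh[of x y n] e(1) xyi True that by blast
          show "v \<in> ends e"
          proof (cases "i = 2")
            case i: True
            then show ?thesis using vch 2[OF i] unfolding xyi i ch_2 by auto
          next
            case i: False
            then show ?thesis using vch ch_shift xyi by auto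
          qed
        qed
        from e(2)[unfolded xyi] have "f = c e"
        proof (cases rule: subst_edge_cases)
          case shift
          then show ?thesis by (simp add: c_def xyi)
        next
          case first
          then have "v = x" using f(2) ve(2) by auto
          then show ?thesis using first by (simp add: c_def xyi)
        next
          case second
          then have "v = y" using f(2) ve(2) by auto
          moreover have "x \<noteq> y" using E_neq e(1) xyi by blast
          ultimately show ?thesis using second by (simp add: c_def xyi)
        next
          case (new h)
          then show ?thesis using f(2) ve(2) by auto
        qed
        then show "f \<in> c ` inc n v" using e(1) ve(1) by (auto simp: inc_def)
      qed
    qed
    moreover have "inj_on c (inc n v)"
    proof (rule inj_onI)
      fix e e' assume ee: "e \<in> inc n v" "e' \<in> inc n v" "c e = c e'"
      show "e = e'"
      proof (rule ccontr)
        assume "e \<noteq> e'"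
        moreover have "e \<in> E n" "e' \<in> E n" using ee by (auto simp: inc_def)
        ultimately show False using subst_edge_disjoint c[OF ee(1)] c[OF ee(2)] ee(3) by metis
      qed
    qed
    ultimately show ?thesis using Suc.IH[OF True] by (simp add: card_image)
  next
    case False
    obtain e where e: "e \<in> E n" "v \<in> ch e" using Suc.prems by (auto simp: verts_E_Suc)
    have key': "\<exists>x y h. e' = (x, y, 2) \<and> v = New x y h \<and> h \<le> d - 2" if "e' \<in> E n" "v \<in> ch e'" for e'
    proof -
      obtain x y i where xyi: "e' = (x, y, i)" by (metis prod_cases3)
      have nv: "v \<notin> {x, y}" using False that(1) xyi by (force simp: verts_ends)
      then have "i = 2" using that(2) xyi ch_shift by auto
      then show ?thesis using that(2) nv unfolding xyi by (auto simp: ch_2)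
    qed
    obtain x y h where xyh: "e = (x, y, 2)" "v = New x y h" "h \<le> d - 2" using key'[OF e] by blast
    have inc1: "inc (Suc n) v = {f \<in> subst_edge d (x, y, 2). v \<in> ends f}"
    proof
      show "inc (Suc n) v \<subseteq> {f \<in> subst_edge d (x, y, 2). v \<in> ends f}"
      proof
        fix f assume "f \<in> inc (Suc n) v"
        then have f: "f \<in> E (Suc n)" "v \<in> ends f" by (auto simp: inc_def)
        obtain e' where e': "e' \<in> E n" "f \<in> subst_edge d e'" using f(1) by (rule E_SucE)
        then have "v \<in> ch e'" using subst_edge_ends_ch f(2) by blast
        then have "e' = e" using key'[OF e'(1)] xyh by auto
        then show "f \<in> {f \<in> subst_edge d (x, y, 2). v \<in> ends f}" using e' f(2) xyh(1) by simp
      qed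
      show "{f \<in> subst_edge d (x, y, 2). v \<in> ends f} \<subseteq> inc (Suc n) v"
        unfolding inc_def using E_SucI[OF e(1)] xyh(1) by blast
    qed
    show ?thesis
    proof (cases "h = 0")
      case True
      have "v \<in> ends f" if "f \<in> subst_edge d (x, y, 2)" for f
        using that by (cases rule: subst_edge_cases) (simp_all add: xyh(2) True)
      then have "inc (Suc n) v = subst_edge d (x, y, 2)" using inc1 by blast
      then show ?thesis using card_subst_edge_2 xyh(2) True by simp
    next
      case h: False
      have vn: "v \<noteq> x" "v \<noteq> y" using False e(1) xyh(1) by (force simp: verts_ends)+
      define f0 where "f0 = (New x y 0, New x y h, d + h)"
      have uniq: "f = f0" if "f \<in> subst_edge d (x, y, 2)" "v \<in> ends f" for f
        unfolding f0_def using that(1) by (cases rule: subst_edge_cases) (use that(2) vn xyh(2) h in auto)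
      have h1: "1 \<le> h" using h by simp
      have "f0 \<in> subst_edge d (x, y, 2)"
        unfolding f0_def subst_edge_2 using h1 xyh(3) by blast
      moreover have "v \<in> ends f0" by (simp add: f0_def xyh(2))
      ultimately have "inc (Suc n) v = {f0}" unfolding inc1 using uniq by blast
      then show ?thesis using xyh(2) h by simp
    qed
  qed
qed

lemma branch_verts_iff: "v \<in> branch_verts d n \<longleftrightarrow> v \<in> verts (E n) \<and> isB v"
  unfolding branch_verts_def degree_inc using card_inc[of v n] d3 by (cases "isB v") auto

lemma leaf_edge_unique:
  assumes "(x, v, i) \<in> E n" "(x', v, i') \<in> E n" "\<not> isB v"
  shows "x = x' \<and> i = i'"
proof -
  have "v \<in> verts (E n)" using assms(1) by (force simp: verts_ends)
  then have "card (inc n v) = 1" using card_inc assms(3) by simp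
  then obtain f where "inc n v = {f}" by (auto simp: card_1_singleton_iff)
  moreover have "(x, v, i) \<in> inc n v" "(x', v, i') \<in> inc n v" using assms by (auto simp: inc_def)
  ultimately show ?thesis by auto
qed

subsection \<open>Enumeration of the branch vertices\<close>

lemma New_branch: "(x, y, 2) \<in> E n \<Longrightarrow> New x y 0 \<in> branch_verts d (Suc n)"
  unfolding branch_verts_iff verts_E_Suc using ch_2_memb by auto

lemma branch_mono: "m \<le> n \<Longrightarrow> branch_verts d m \<subseteq> branch_verts d n"
  unfolding subset_iff branch_verts_iff using verts_E_mono by blast

lemma Base_0_verts: "Base 0 \<in> verts (E n)"
proof -
  have "(Base 0, Base 1, 1) \<in> E 0" using d3 by (simp add: E_0_iff)
  then have "Base 0 \<in> verts (E 0)" by (force simp: verts_ends)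
  then show ?thesis using verts_E_mono[of 0 n] by auto
qed

lemma kap_bounds: "(x, y, 2) \<in> E n \<Longrightarrow> mm n \<le> kap (New x y 0) \<and> kap (New x y 0) < mm (Suc n)"
  using idx_2_bounds[OF key_in_idx] kap_New[of x y n 0] by simp

lemma mm_mono: "m \<le> n \<Longrightarrow> mm m \<le> mm n"
  by (rule lift_Suc_mono_le[of mm]) (rule mm_le)

lemma branch_cases:
  assumes "v \<in> branch_verts d n"
  obtains (root) "v = Base 0" | (new) x y k where "k < n" "(x, y, 2) \<in> E k" "v = New x y 0"
proof -
  have v: "v \<in> verts (E n)" "isB v" using assms by (simp_all add: branch_verts_iff)
  then consider "v = Base 0" | x y where "v = New x y 0" by (auto simp: isB_def)
  then show thesis
  proof cases
    case 2
    then show thesis using New_in_verts[of x y 0 n] v(1) that(2) by blast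
  qed (rule that(1))
qed

lemma kap_less: "v \<in> branch_verts d n \<Longrightarrow> kap v < mm n"
proof (erule branch_cases)
  assume "v = Base 0"
  then show "kap v < mm n" using mm_mono[of 0 n] mm_0 by simp
next
  fix x y k assume "k < n" "(x, y, 2) \<in> E k" "v = New x y 0"
  then show "kap v < mm n" using kap_bounds[of x y k] mm_mono[of "Suc k" n] by simp
qed

text \<open>Vertices created at stage k+1 have lengths between \<open>mm k\<close> and
  \<open>mm (Suc k)\<close>, so equal lengths force equal stages, and then equal parents by
  \<open>key_inj\<close>.\<close>

lemma kap_inj: "v \<in> branch_verts d n \<Longrightarrow> w \<in> branch_verts d m \<Longrightarrow> kap v = kap w \<Longrightarrow> v = w"
proof -
  assume v: "v \<in> branch_verts d n" and w: "w \<in> branch_verts d m" and eq: "kap v = kap w"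
  have pos: "0 < kap (New x y 0)" if "(x, y, 2) \<in> E k" for x y k
    using kap_bounds[OF that] mm_mono[of 0 k] mm_0 by simp
  show "v = w"
    using v
  proof (cases rule: branch_cases)
    case root
    from w show ?thesis by (cases rule: branch_cases) (use root eq pos in fastforce)+
  next
    case n: (new x y k)
    from w show ?thesis
    proof (cases rule: branch_cases)
      case root
      then show ?thesis using pos[OF n(2)] n(3) eq by simp
    next
      case m: (new x' y' k')
      have "k = k'"
      proof (rule ccontr)
        assume "k \<noteq> k'"
        then consider "Suc k \<le> k'" | "Suc k' \<le> k" by linarith
        then show False
          by cases (use kap_bounds[OF n(2)] kap_bounds[OF m(2)] mm_mono[of "Suc k" k'] mm_mono[of "Suc k'" k] n(3) m(3) eq in auto)
      qed
      then have "kap x = kap x'" using kap_New[OF n(2), of 0] kap_New[OF m(2), of 0] n(3) m(3) eq by simp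
      then have "(x, y, 2) = (x', y', 2::nat)" using key_inj[OF n(2), of "(x', y', 2)"] m(2) \<open>k = k'\<close> by simp
      then show ?thesis using n(3) m(3) by simp
    qed
  qed
qed

lemma kap_surj: "k < mm n \<Longrightarrow> \<exists>v\<in>branch_verts d n. kap v = k"
proof (induction n)
  case 0
  then have "k = 0" by (simp add: mm_0)
  then show ?case using Base_0_verts by (intro bexI[of _ "Base 0"]) (simp_all add: branch_verts_iff)
next
  case (Suc n)
  show ?case
  proof (cases "k < mm n")
    case True
    then show ?thesis using Suc.IH branch_mono[of n "Suc n"] by auto
  next
    case False
    then obtain k' where k': "(2, k') \<in> idx n" "k = L n + k'" using idx_2_exists[of n k] Suc.prems by auto
    then obtain x y where xy: "(x, y, 2) \<in> E n" "kap x = k'" using idx_key by blast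
    then show ?thesis using New_branch[OF xy(1)] kap_New[OF xy(1), of 0] k'(2) by auto
  qed
qed

subsection \<open>Labels of edges\<close>

definition plab :: "nat \<Rightarrow> nat list" where
  "plab i = (if i \<le> d then [i] else (sg ^^ (i - d)) [1])"

text \<open>The reason why f_0 is independent of the stage: passing to the next stage applies sigma
  once more, and recolouring compensates for it in sigma^n(p_*(i)).\<close>

lemma sg_plab:
  assumes "i \<in> {1..2 * d - 2}" "i \<noteq> 2"
  shows "sg (plab (cshift i)) = plab i"
proof -
  consider "i = 1" | "3 \<le> i" "i \<le> d" | "i = d + 1" | "d + 2 \<le> i" using assms by force
  then show ?thesis
  proof cases
    case 1
    then show ?thesis using d3 by (simp add: plab_def cshift_def sg_Cons sigma_letter_def)
  next
    case 2
    then have "cshift i = i - 1" "i - 1 \<le> d" "i - 1 \<noteq> 1" "i - 1 \<noteq> d" "i - 1 + 1 = i" by (auto simp: cshift_def)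
    then show ?thesis using 2(2) by (simp add: plab_def sg_Cons sigma_letter_def)
  next
    case 3
    then show ?thesis using d3 by (simp add: plab_def cshift_def)
  next
    case 4
    then have "cshift i = i - 1" "\<not> i - 1 \<le> d" "\<not> i \<le> d" "i - d = Suc (i - 1 - d)" by (auto simp: cshift_def)
    then show ?thesis by (simp add: plab_def)
  qed
qed

text \<open>Following the orientation removes sigma^n(p_*(i)) on the left. At a splitting this is
  the factorisation sigma^n(1)u towards x, and sigma^(n+1)(1) = sigma^n(1) sigma^n(2) towards
  y.\<close>

lemma edge_words: "(x, y, i) \<in> E n \<Longrightarrow> isB y \<Longrightarrow>
   sprefix (kap x) om = (sg ^^ n) (plab i) @ sprefix (kap y) om"
proof (induction n arbitrary: x y i)
  case 0
  then show ?case by (auto simp: E_0_iff)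
next
  case (Suc n)
  from Suc.prems(1) show ?case
  proof (cases rule: E_Suc_cases)
    case (shift j)
    have "sprefix (kap x) om = (sg ^^ n) (plab j) @ sprefix (kap y) om" using Suc.IH[OF shift(1) Suc.prems(2)] .
    moreover have "plab j = sg (plab i)" using sg_plab[OF E_colour[OF shift(1)] shift(2)] shift(3) by simp
    ultimately show ?thesis by (simp add: funpow_swap1)
  next
    case (split x' y')
    have kx: "sprefix (kap x) om = (sg ^^ n) [1] @ sprefix (kap x') om"
      using idx_2_prefix[OF key_in_idx[OF split(1)]] split(4) by simp
    from split(5) show ?thesis
    proof (cases rule: subst_edge_cases)
      case first
      have "sg (plab d) = [1]" using d3 by (simp add: plab_def sg_Cons sigma_letter_def)
      then show ?thesis using first kx by (simp add: funpow_swap1)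
    next
      case second
      have "sprefix (kap x') om = (sg ^^ n) (plab 2) @ sprefix (kap y') om"
        using Suc.IH[OF split(1)] Suc.prems(2) second by simp
      moreover have "sg (plab 1) = [1] @ plab 2" using d3 by (simp add: plab_def sg_Cons sigma_letter_def)
      ultimately show ?thesis using second kx by (simp add: funpow_swap1 sigma_pow_append[symmetric])
    next
      case (new h)
      then show ?thesis using Suc.prems(2) by simp
    qed simp
  qed
qed

text \<open>For the far end of an edge the desubstituted word is X = p_*(i) followed by omega.
  Membership starts at colour 2, where it says that 12 followed by omega belongs to the system, and
  is transported by \<open>QQ_cshift\<close> in the order 2, ..., d, 1, d+1, ..., 2d-2.\<close>

lemma plab_QQ: "i \<in> {1..2 * d - 2} \<Longrightarrow> swapp (plab i) om \<in> QQ i"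
proof -
  have st: "swapp (plab i) om \<in> QQ i" if "i \<in> {1..2 * d - 2}" "i \<noteq> 2" "swapp (plab (cshift i)) om \<in> QQ (cshift i)" for i
  proof -
    have "SS (swapp (plab (cshift i)) om) \<in> QQ i" unfolding QQ_cshift[OF that(1,2)] using that(3) by blast
    then show ?thesis by (simp add: SS_swapp SS_om sg_plab[OF that(1,2)])
  qed
  have two: "swapp (plab 2) om \<in> QQ 2"
  proof -
    have "SS (swapp [1] om) \<in> Omega_plus d" using left_om[of 1] d3 by (intro SS_Omega_plus) simp
    moreover have "SS (swapp [1] om) = swapp [1] (swapp [2] om)"
      by (simp add: SS_swapp SS_om swapp_append[symmetric] sg_Cons sigma_letter_def)
    ultimately show ?thesis using d3 by (simp add: QQ_def plab_def cletter_def)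
  qed
  have low: "swapp (plab (2 + k)) om \<in> QQ (2 + k)" if "2 + k \<le> d" for k
    using that
  proof (induction k)
    case 0
    then show ?case using two by simp
  next
    case (Suc k)
    have "cshift (2 + Suc k) = 2 + k" using Suc.prems by (simp add: cshift_def)
    then show ?case using Suc st[of "2 + Suc k"] by simp
  qed
  have d2: "2 + (d - 2) = d" using d3 by simp
  have "swapp (plab d) om \<in> QQ d" using low[of "d - 2"] unfolding d2 by simp
  then have one: "swapp (plab 1) om \<in> QQ 1" using st[of 1] d3 by (simp add: cshift_def)
  have high: "swapp (plab (d + 1 + k)) om \<in> QQ (d + 1 + k)" if "d + 1 + k \<le> 2 * d - 2" for k
    using that
  proof (induction k)
    case 0
    then show ?case using st[of "d + 1"] one d3 by (simp add: cshift_def)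
  next
    case (Suc k)
    have "cshift (d + 1 + Suc k) = d + 1 + k" using d3 by (simp add: cshift_def)
    then show ?case using Suc st[of "d + 1 + Suc k"] d3 by simp
  qed
  assume i: "i \<in> {1..2 * d - 2}"
  consider "i = 1" | "2 \<le> i" "i \<le> d" | "d + 1 \<le> i" using i by force
  then show ?thesis
  proof cases
    case 1
    then show ?thesis using one by simp
  next
    case 2
    then have "2 + (i - 2) = i" by simp
    then show ?thesis using low[of "i - 2"] 2(2) by metis
  next
    case 3
    then have "d + 1 + (i - (d + 1)) = i" by simp
    then show ?thesis using high[of "i - (d + 1)"] i by (metis atLeastAtMost_iff)
  qed
qed

definition CE :: "nat \<Rightarrow> vertex \<times> vertex \<times> nat \<Rightarrow> (nat \<Rightarrow> nat) set" where
  "CE n e = CC n (snd (snd e)) (kap (fst e))"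

lemma CE_simp [simp]: "CE n (x, y, i) = CC n i (kap x)"
  by (simp add: CE_def)

lemma ends_CE:
  assumes e: "e \<in> E n" and v: "v \<in> ends e" "isB v"
  shows "sshift (kap v) om \<in> CE n e"
proof -
  obtain x y i where xyi: "e = (x, y, i)" by (metis prod_cases3)
  have i: "i \<in> {1..2 * d - 2}" using E_colour e xyi by blast
  show ?thesis
  proof (cases "v = x")
    case True
    then show ?thesis using om_CC[OF i] xyi by simp
  next
    case False
    then have vy: "v = y" using v xyi by simp
    have "sprefix (kap x) om = (sg ^^ n) (plab i) @ sprefix (kap y) om" using edge_words e xyi v vy by blast
    then have "swapp (sprefix (kap x) om) (sshift (kap y) om) = (SS ^^ n) (swapp (plab i) om)"
      by (simp add: swapp_append swapp_sprefix_sshift SS_pow_swapp)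
    then show ?thesis using plab_QQ[OF i] xyi vy by (auto simp: CC_def)
  qed
qed

lemma CE_child: "e \<in> E n \<Longrightarrow> f \<in> subst_edge d e \<Longrightarrow> CE (Suc n) f \<subseteq> CE n e"
proof -
  assume e: "e \<in> E n" and f: "f \<in> subst_edge d e"
  obtain x y i where xyi: "e = (x, y, i)" by (metis prod_cases3)
  show ?thesis
  proof (cases "i = 2")
    case False
    then show ?thesis using f xyi CC_cshift[OF E_colour, of x y i n n "kap x"] e by (simp add: subst_edge_shift)
  next
    case True
    then have e2: "(x, y, 2) \<in> E n" and f2: "f \<in> subst_edge d (x, y, 2)" using e f xyi by auto
    obtain u w c where fu: "f = (u, w, c)" by (metis prod_cases3)
    from f2 have "u = New x y 0 \<and> c \<in> children"
      by (cases rule: subst_edge_cases) (use fu d3 in \<open>auto simp: children_def\<close>)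
    then show ?thesis
      using idx_2_split[OF key_in_idx[OF e2]] kap_New[OF e2, of 0] fu xyi True by auto
  qed
qed

lemma CE_children: "e \<in> E n \<Longrightarrow> V \<in> CE n e \<Longrightarrow> \<exists>f\<in>subst_edge d e. V \<in> CE (Suc n) f"
proof -
  assume e: "e \<in> E n" and V: "V \<in> CE n e"
  obtain x y i where xyi: "e = (x, y, i)" by (metis prod_cases3)
  show ?thesis
  proof (cases "i = 2")
    case False
    then show ?thesis using V xyi CC_cshift[OF E_colour, of x y i n n "kap x"] e by (simp add: subst_edge_shift)
  next
    case True
    then have e2: "(x, y, 2) \<in> E n" using e xyi by auto
    obtain c where c: "c \<in> children" "V \<in> CC (Suc n) c (L n + kap x)"
      using idx_2_split[OF key_in_idx[OF e2]] V xyi True by auto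
    obtain v where "(New x y 0, v, c) \<in> subst_edge d (x, y, 2)" using child_edge[OF e2 c(1)] by blast
    then show ?thesis using c(2) kap_New[OF e2, of 0] xyi True by (intro bexI[of _ "(New x y 0, v, c)"]) auto
  qed
qed

text \<open>A converse of \<open>ends_CE\<close> for indices already split off. When an edge splits,
  the child at v contains S^j(om); another child containing it would make it the new splitting
  point, whose index is at least \<open>mm n\<close>.\<close>

lemma CE_ends:
  assumes "e \<in> E n" "sshift j om \<in> CE n e" "j < mm n"
  shows "\<exists>v\<in>ends e. isB v \<and> kap v = j"
  using assms
proof (induction n arbitrary: e)
  case 0
  then have "j = 0" by (simp add: mm_0)
  then show ?case using 0(1) by (auto simp: E_0)
next
  case (Suc n)
  obtain e' where e': "e' \<in> E n" "e \<in> subst_edge d e'" using Suc.prems(1) by (rule E_SucE)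
  obtain x y i where xyi: "e' = (x, y, i)" by (metis prod_cases3)
  have Ve': "sshift j om \<in> CE n e'" using CE_child[OF e'] Suc.prems(2) by blast
  show ?case
  proof (cases "j < mm n")
    case True
    obtain v where v: "v \<in> ends e'" "isB v" "kap v = j" using Suc.IH[OF e'(1) Ve' True] by blast
    show ?thesis
    proof (cases "i = 2")
      case False
      then have "ends e = ends e'" using e' xyi by (simp add: subst_edge_shift)
      then show ?thesis using v by blast
    next
      case i2: True
      then have e2: "(x, y, 2) \<in> E n" and f2: "e \<in> subst_edge d (x, y, 2)" using e' xyi by auto
      define z where "z = New x y 0"
      have kz: "kap z = L n + kap x" using kap_New[OF e2, of 0] by (simp add: z_def)
      have "\<exists>f\<in>subst_edge d e'. v \<in> ends f" using v(1) ends_ch[of e'] by (auto simp: ch_def verts_ends)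
      then obtain f where f: "f \<in> subst_edge d (x, y, 2)" "v \<in> ends f" using xyi i2 by blast
      have or: "fst g = z \<and> snd (snd g) \<in> children" if "g \<in> subst_edge d (x, y, 2)" for g
        using that by (cases rule: subst_edge_cases) (use d3 in \<open>auto simp: children_def z_def\<close>)
      have fv: "sshift j om \<in> CE (Suc n) f" using ends_CE[OF E_SucI[OF e2 f(1)] f(2) v(2)] v(3) by simp
      have "f = e"
      proof (rule ccontr)
        assume "f \<noteq> e"
        then have "snd (snd f) \<noteq> snd (snd e)" using subst_edge_2_colour[OF f(1) f2] by blast
        then have "sshift j om = sshift (kap z) om"
          using CC_children_disjoint[of "snd (snd f)" "snd (snd e)" _ "Suc n" "kap z"] or[OF f(1)] or[OF f2]
            fv Suc.prems(2) unfolding CE_def by metis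
        then have "j = kap z" by (simp only: sshift_om_inject)
        moreover have "mm n \<le> kap z" using kap_bounds[OF e2] by (simp add: z_def)
        ultimately show False using True by simp
      qed
      then show ?thesis using f(2) v by blast
    qed
  next
    case False
    have ik: "(i, kap x) \<in> idx n" using key_in_idx e'(1) xyi by blast
    have "i = 2 \<and> j = L n + kap x"
      using sshift_om_CC[OF ik, of j] False Suc.prems(3) Ve' xyi by simp
    moreover then have e2: "(x, y, 2) \<in> E n" using e' xyi by simp
    ultimately have "kap (New x y 0) = j" using kap_New[OF e2, of 0] by simp
    moreover have "New x y 0 \<in> ends e"
      using e'(2)[unfolded xyi] \<open>i = 2 \<and> j = L n + kap x\<close> by (cases rule: subst_edge_cases) auto
    ultimately show ?thesis by (intro bexI[of _ "New x y 0"]) simp_all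
  qed
qed

theorem CE_partition:
  "CE n ` E n = cyl_partition d (mm n)"
proof
  show "CE n ` E n \<subseteq> cyl_partition d (mm n)"
  proof
    fix P assume "P \<in> CE n ` E n"
    then obtain x y i where e: "(x, y, i) \<in> E n" "P = CC n i (kap x)" by auto
    then show "P \<in> cyl_partition d (mm n)" using conjunct1[OF idx_partition[of n]] key_in_idx[OF e(1)] by auto
  qed
  show "cyl_partition d (mm n) \<subseteq> CE n ` E n"
  proof
    fix P assume "P \<in> cyl_partition d (mm n)"
    then obtain i k where ik: "(i, k) \<in> idx n" "P = CC n i k" using conjunct2[OF idx_partition[of n]] by auto
    then obtain x y where "(x, y, i) \<in> E n" "kap x = k" using idx_key by blast
    then show "P \<in> CE n ` E n" using ik(2) by (intro image_eqI[of _ _ "(x, y, i)"]) simp_all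
  qed
qed

end

section \<open>Free group computations and the values of f_0\<close>

section \<open>The free group\<close>

definition cancels :: "nat \<times> bool \<Rightarrow> nat \<times> bool \<Rightarrow> bool" where
  "cancels a b \<longleftrightarrow> fst a = fst b \<and> snd a \<noteq> snd b"

definition red :: "sword \<Rightarrow> bool" where
  "red w \<longleftrightarrow> successively (\<lambda>a b. \<not> cancels a b) w"

lemma red_Nil [simp]: "red []"
  by (simp add: red_def)

lemma red_Cons: "red (a # w) \<longleftrightarrow> red w \<and> (w = [] \<or> \<not> cancels a (hd w))"
  by (auto simp: red_def successively_Cons)

lemma fg_cons_Cons: "fg_cons a (b # v) = (if cancels a b then v else a # b # v)"
  by (simp add: fg_cons_def cancels_def)

lemma fg_cons_Nil: "fg_cons a [] = [a]"
  by (simp add: fg_cons_def)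

lemma red_fg_cons: "red w \<Longrightarrow> red (fg_cons a w)"
  by (cases w) (auto simp: fg_cons_Nil fg_cons_Cons red_Cons)

lemma red_foldr: "red w \<Longrightarrow> red (foldr fg_cons u w)"
  by (induction u) (auto intro: red_fg_cons)

lemma red_fg_reduce: "red (fg_reduce w)"
  by (simp add: fg_reduce_def red_foldr)

lemma fg_reduce_red: "red w \<Longrightarrow> fg_reduce w = w"
proof (induction w)
  case (Cons a w)
  then have "fg_reduce w = w" by (simp add: red_Cons)
  then show ?case using Cons.prems by (cases w) (auto simp: fg_reduce_def fg_cons_Nil fg_cons_Cons red_Cons)
qed (simp add: fg_reduce_def)

lemma fg_cons_cancel:
  assumes "red w" "cancels a b" shows "fg_cons a (fg_cons b w) = w"
proof (cases w)
  case Nil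
  then show ?thesis using assms by (simp add: fg_cons_Nil fg_cons_Cons)
next
  case (Cons c v)
  show ?thesis
  proof (cases "cancels b c")
    case True
    then have "a = c" using assms(2) by (auto simp: cancels_def prod_eq_iff)
    then show ?thesis using True assms(1) Cons by (cases v) (auto simp: fg_cons_Nil fg_cons_Cons red_Cons)
  next
    case False
    then show ?thesis using assms(2) Cons by (simp add: fg_cons_Cons)
  qed
qed

lemma foldr_fg_cons:
  assumes "red x" shows "foldr fg_cons (fg_cons a w) x = fg_cons a (foldr fg_cons w x)"
proof (cases w)
  case Nil
  then show ?thesis by (simp add: fg_cons_Nil)
next
  case (Cons b v)
  then show ?thesis using fg_cons_cancel[OF red_foldr[OF assms]] by (simp add: fg_cons_Cons)
qed

lemma foldr_fg_reduce: "red x \<Longrightarrow> foldr fg_cons (fg_reduce u) x = foldr fg_cons u x"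
  by (induction u) (simp_all add: fg_reduce_def foldr_fg_cons)

text \<open>Equality in the free group for words that need not be reduced. Reduction is postponed to
  the end, where \<open>feq_red\<close> turns it into equality of words.\<close>

definition feq :: "sword \<Rightarrow> sword \<Rightarrow> bool" where
  "feq u v \<longleftrightarrow> fg_reduce u = fg_reduce v"

lemma feq_refl [simp]: "feq u u"
  by (simp add: feq_def)

lemma feq_sym: "feq u v \<Longrightarrow> feq v u"
  by (simp add: feq_def)

lemma feq_trans [trans]: "feq u v \<Longrightarrow> feq v w \<Longrightarrow> feq u w"
  by (simp add: feq_def)

lemma fg_reduce_append: "fg_reduce (u @ v) = foldr fg_cons (fg_reduce u) (fg_reduce v)"
  using foldr_fg_reduce[OF red_fg_reduce] by (simp add: fg_reduce_def)

lemma feq_append: "feq u u' \<Longrightarrow> feq v v' \<Longrightarrow> feq (u @ v) (u' @ v')"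
  by (simp add: feq_def fg_reduce_append)

lemma feq_reduce: "feq (fg_reduce u) u"
  by (simp add: feq_def fg_reduce_red red_fg_reduce)

lemma feq_red: "feq u v \<Longrightarrow> red u \<Longrightarrow> red v \<Longrightarrow> u = v"
  by (simp add: feq_def fg_reduce_red)

lemma fg_inv_Cons: "fg_inv (a # w) = fg_inv w @ [(fst a, \<not> snd a)]"
  by (simp add: fg_inv_def case_prod_beta)

lemma fg_inv_Nil [simp]: "fg_inv [] = []"
  by (simp add: fg_inv_def)

lemma fg_inv_append: "fg_inv (u @ v) = fg_inv v @ fg_inv u"
  by (simp add: fg_inv_def)

lemma fg_inv_inv [simp]: "fg_inv (fg_inv w) = w"
  by (simp add: fg_inv_def rev_map case_prod_beta map_idI)

lemma feq_cancel: "cancels a b \<Longrightarrow> feq [a, b] []"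
  by (simp add: feq_def fg_reduce_def fg_cons_Nil fg_cons_Cons)

lemma feq_inv_right: "feq (w @ fg_inv w) []"
proof (induction w)
  case (Cons a w)
  have "feq ([a] @ (w @ fg_inv w) @ [(fst a, \<not> snd a)]) ([a] @ [] @ [(fst a, \<not> snd a)])"
    by (intro feq_append Cons feq_refl)
  also have "feq ([a] @ [] @ [(fst a, \<not> snd a)]) []" using feq_cancel[of a "(fst a, \<not> snd a)"] by (simp add: cancels_def)
  finally show ?case by (simp add: fg_inv_Cons)
qed simp

lemma feq_inv_left: "feq (fg_inv w @ w) []"
  using feq_inv_right[of "fg_inv w"] by simp

text \<open>\<open>fg_lift\<close> before reduction: a homomorphism for concatenation
  itself.\<close>

definition fhom :: "(nat \<Rightarrow> sword) \<Rightarrow> sword \<Rightarrow> sword" where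
  "fhom h w = concat (map (\<lambda>(k, b). if b then fg_inv (h k) else h k) w)"

lemma fg_lift_fhom: "fg_lift h w = fg_reduce (fhom h w)"
  by (simp add: fg_lift_def fhom_def)

lemma fhom_append: "fhom h (u @ v) = fhom h u @ fhom h v"
  by (simp add: fhom_def)

lemma fhom_Nil [simp]: "fhom h [] = []"
  by (simp add: fhom_def)

lemma fhom_cancel: "cancels a b \<Longrightarrow> feq (fhom h [a, b]) []"
  using feq_inv_right[of "h (fst a)"] feq_inv_left[of "h (fst a)"]
  by (cases a; cases b; cases "snd a") (auto simp: fhom_def cancels_def)

lemma fhom_reduce: "feq (fhom h (fg_reduce w)) (fhom h w)"
proof (induction w)
  case (Cons a w)
  define r where "r = fg_reduce w"
  have IH: "feq (fhom h ([a] @ r)) (fhom h ([a] @ w))"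
    unfolding fhom_append using Cons by (intro feq_append) (simp_all add: r_def)
  have e: "fg_reduce (a # w) = fg_cons a r" by (simp add: fg_reduce_def r_def)
  show ?case
  proof (cases "\<exists>b v. r = b # v \<and> cancels a b")
    case True
    then obtain b v where bv: "r = b # v" "cancels a b" by blast
    have "feq (fhom h [a, b] @ fhom h v) ([] @ fhom h v)" using fhom_cancel[OF bv(2)] by (intro feq_append) simp_all
    then have "feq (fhom h v) (fhom h ([a] @ r))" using bv(1) by (simp add: fhom_append[symmetric] feq_sym)
    then show ?thesis using IH e bv feq_trans by (simp add: fg_cons_Cons)
  next
    case False
    then have "fg_cons a r = [a] @ r" by (cases r) (auto simp: fg_cons_Nil fg_cons_Cons)
    then show ?thesis using IH e by simp
  qed
qed (simp add: fg_reduce_def)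

lemma fhom_feq: "feq u v \<Longrightarrow> feq (fhom h u) (fhom h v)"
  using fhom_reduce[of h u] fhom_reduce[of h v] by (metis feq_def)

lemma fhom_inv: "fhom h (fg_inv w) = fg_inv (fhom h w)"
proof (induction w)
  case (Cons a w)
  have "fhom h [(fst a, \<not> snd a)] = fg_inv (fhom h [a])" by (cases a) (auto simp: fhom_def)
  then show ?case using Cons fhom_append[of h "[a]" w] by (simp add: fg_inv_Cons fhom_append fg_inv_append)
qed simp

definition hsig :: "nat \<Rightarrow> sword \<Rightarrow> sword" where
  "hsig d = fhom (\<lambda>k. fg_pos (sigma_letter d k))"

lemma fg_pos_append: "fg_pos (u @ v) = fg_pos u @ fg_pos v"
  by (simp add: fg_pos_def)

lemma hsig_pos: "hsig d (fg_pos w) = fg_pos (sigma_word d w)"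
  by (induction w) (simp_all add: hsig_def fhom_def fg_pos_def sigma_word_def)

lemma hsig_pow_pos: "(hsig d ^^ n) (fg_pos w) = fg_pos ((sigma_word d ^^ n) w)"
  by (induction n) (simp_all add: hsig_pos)

lemma hsig_pow_append: "(hsig d ^^ n) (u @ v) = (hsig d ^^ n) u @ (hsig d ^^ n) v"
  by (induction n) (simp_all add: hsig_def fhom_append)

lemma hsig_pow_inv: "(hsig d ^^ n) (fg_inv w) = fg_inv ((hsig d ^^ n) w)"
  by (induction n) (simp_all add: hsig_def fhom_inv)

lemma hsig_pow_feq: "feq u v \<Longrightarrow> feq ((hsig d ^^ n) u) ((hsig d ^^ n) v)"
  by (induction n) (simp_all add: hsig_def fhom_feq)

lemma fg_sigma_pow: "feq ((fg_sigma d ^^ n) w) ((hsig d ^^ n) w)"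
proof (induction n)
  case (Suc n)
  have "feq (fg_sigma d ((fg_sigma d ^^ n) w)) (hsig d ((fg_sigma d ^^ n) w))"
    by (simp add: fg_sigma_def fg_lift_fhom hsig_def feq_reduce)
  also have "feq (hsig d ((fg_sigma d ^^ n) w)) (hsig d ((hsig d ^^ n) w))"
    unfolding hsig_def by (rule fhom_feq) (use Suc in \<open>simp add: hsig_def\<close>)
  finally show ?case by simp
qed simp

lemma red_fg_sigma_pow: "red w \<Longrightarrow> red ((fg_sigma d ^^ n) w)"
  by (cases n) (simp_all add: fg_sigma_def fg_lift_fhom red_fg_reduce)

lemma red_inv_pos: "red (fg_inv (fg_pos w))"
proof -
  have "successively (\<lambda>a b. \<not> cancels b a) (map (\<lambda>(k, b). (k, \<not> b)) (fg_pos w))"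
    unfolding fg_pos_def map_map successively_map by (induction w rule: induct_list012) (simp_all add: cancels_def)
  then show ?thesis unfolding red_def fg_inv_def by simp
qed

lemma fg_inv_pos_inject: "fg_inv (fg_pos u) = fg_inv (fg_pos v) \<longleftrightarrow> u = v"
proof
  assume "fg_inv (fg_pos u) = fg_inv (fg_pos v)"
  then have "fg_pos u = fg_pos v" by (metis fg_inv_inv)
  then have "map fst (fg_pos u) = map fst (fg_pos v)" by simp
  then show "u = v" by (simp add: fg_pos_def comp_def)
qed simp

lemma length_fg_inv_pos: "length (fg_inv (fg_pos w)) = length w"
  by (simp add: fg_inv_def fg_pos_def)

context tree_subst
begin

section \<open>Shortest walks\<close>

definition estep :: "nat \<Rightarrow> vertex \<Rightarrow> nat \<times> bool \<Rightarrow> vertex \<Rightarrow> bool" where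
  "estep n v s u \<longleftrightarrow> (if snd s then (u, v, fst s) \<in> E n else (v, u, fst s) \<in> E n)"

text \<open>Walks that approach x by the full length of every edge. They are shown to be the unique
  shortest walks, which gives the \<open>THE\<close> in \<open>gamma\<close> its value.\<close>

inductive geo :: "nat \<Rightarrow> vertex \<Rightarrow> vertex \<Rightarrow> sword \<Rightarrow> bool" for n x where
  geo_refl: "geo n x x []"
| geo_step: "estep n v s u \<Longrightarrow> DD v x = DD v u + DD u x \<Longrightarrow> geo n x u w \<Longrightarrow> geo n x v (s # w)"

lemma estep_edge: "estep n v s u \<Longrightarrow> \<exists>f\<in>E n. ends f = {v, u}"
  unfolding estep_def by (cases "snd s") (auto intro: bexI[of _ "(u, v, fst s)"] bexI[of _ "(v, u, fst s)"])

lemma estep_verts: "estep n v s u \<Longrightarrow> v \<in> verts (E n) \<and> u \<in> verts (E n)"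
  using estep_edge[of n v s u] by (auto simp: verts_ends)

lemma estep_pos: "estep n v s u \<Longrightarrow> 0 < DD v u"
proof -
  assume s: "estep n v s u"
  have "v \<in> VV" "u \<in> VV" using estep_verts[OF s] VV_I by blast+
  then have "DD v u = DD u v" by (rule DD_commute)
  then show ?thesis using s DD_edge_pos unfolding estep_def by (metis (full_types))
qed

lemma estep_sym: "estep n v s u \<Longrightarrow> estep n u (fst s, \<not> snd s) v"
  by (auto simp: estep_def split: if_splits)

text \<open>Two different edges at v have their gates there, so u and u' lie on different sides of
  v; the four-point inequality then forbids both to be nearer to x by the full edge length.\<close>

lemma lower_unique:
  assumes f: "f \<in> E n" "f' \<in> E n" "ends f = {v, u}" "ends f' = {v, u'}"
    and x: "x \<in> VV" "DD v x = DD v u + DD u x" "DD v x = DD v u' + DD u' x"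
  shows "f = f'"
proof (rule ccontr)
  assume "f \<noteq> f'"
  then obtain p p' where g: "gate f p f' p'" using gates f by blast
  then have p: "p = v \<or> p = u" "p' = v \<or> p' = u'" using f by (auto simp: gate_def)
  have V: "v \<in> VV" "u \<in> VV" "u' \<in> VV" using E_ends_VV f by blast+
  have pos: "0 < DD v w" if "h \<in> E n" "ends h = {v, w}" for h w
  proof -
    obtain a b i where h: "h = (a, b, i)" by (metis prod_cases3)
    have "w \<in> VV" using E_ends_VV that by blast
    then have "DD v w = DD w v" using DD_commute V by blast
    moreover have "{a, b} = {v, w}" using that(2) h by simp
    ultimately show ?thesis using DD_edge_pos[of a b i n] that(1) h by (auto simp: doubleton_eq_iff)
  qed
  have G: "DD a b = DD a p + DD p p' + DD p' b" if "a \<in> {v, u}" "b \<in> {v, u'}" for a b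
    using g f that unfolding gate_def by blast
  have "DD v v = DD v p + DD p p' + DD p' v" using G by blast
  then have z: "DD v p = 0" "DD p' v = 0"
    using DD_self[OF V(1)] DD_nonneg[of v p] DD_nonneg[of p p'] DD_nonneg[of p' v] by linarith+
  have "p = v" using p(1) z(1) pos[OF f(1,3)] by auto
  moreover have "p' = v" using p(2) z(2) pos[OF f(2,4)] DD_commute[OF V(1,3)] by auto
  ultimately have "DD u u' = DD u v + DD v v + DD v u'" using G[of u u'] by simp
  then have uu: "DD u u' = DD v u + DD v u'" using DD_self[OF V(1)] DD_commute[OF V(1,2)] by simp
  have "DD v x + DD u u' \<le> max (DD v u + DD x u') (DD v u' + DD x u)"
    unfolding DD_def by (rule fp_four_point) (use V x(1) N_VV in blast)+
  moreover have "DD x u' = DD u' x" "DD x u = DD u x" using DD_commute V x(1) by blast+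
  ultimately show False using uu x(2,3) pos[OF f(1,3)] pos[OF f(2,4)] by (simp add: max_def split: if_splits)
qed

lemma edge_separates:
  assumes f: "f \<in> E n" "ends f = {v, u}" and x: "x \<in> verts (E n)"
  shows "DD v x = DD v u + DD u x \<or> DD u x = DD u v + DD v x"
proof -
  have V: "v \<in> VV" "u \<in> VV" using E_ends_VV[OF f(1)] f(2) by auto
  obtain e where e: "e \<in> E n" "x \<in> ends e" using x by (auto simp: verts_ends)
  show ?thesis
  proof (cases "f = e")
    case True
    then have "x = v \<or> x = u" using e f(2) by auto
    then show ?thesis using DD_self V by auto
  next
    case False
    then obtain p p' where g: "gate f p e p'" using gates f(1) e(1) by blast
    have p: "p = v \<or> p = u" using g f(2) by (auto simp: gate_def)
    have G: "DD a x = DD a p + DD p p' + DD p' x" if "a \<in> {v, u}" for a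
      using g f(2) that e(2) unfolding gate_def by blast
    have gv: "DD v x = DD v p + DD p p' + DD p' x" and gu: "DD u x = DD u p + DD p p' + DD p' x"
      using G by blast+
    from p show ?thesis
    proof
      assume "p = v"
      then show ?thesis using gv gu DD_self[OF V(1)] by simp
    next
      assume "p = u"
      then show ?thesis using gv gu DD_self[OF V(2)] by simp
    qed
  qed
qed

lemma estep_lower_unique:
  assumes "estep n v s u" "estep n v s' u'" "x \<in> VV" "DD v x = DD v u + DD u x" "DD v x = DD v u' + DD u' x"
  shows "s = s' \<and> u = u'"
proof -
  obtain i b where s: "s = (i, b)" by fastforce
  obtain i' b' where s': "s' = (i', b')" by fastforce
  define f where "f = (if b then (u, v, i) else (v, u, i))"
  define f' where "f' = (if b' then (u', v, i') else (v, u', i'))"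
  have ff: "f \<in> E n" "f' \<in> E n" "ends f = {v, u}" "ends f' = {v, u'}"
    using assms(1,2) s s' by (auto simp: f_def f'_def estep_def)
  have "f = f'" by (rule lower_unique[OF ff assms(3-5)])
  moreover have "v \<noteq> u" "v \<noteq> u'"
    using estep_pos[OF assms(1)] estep_pos[OF assms(2)] DD_self[of v] VV_I estep_verts[OF assms(1)] by auto
  ultimately show ?thesis using s s' by (auto simp: f_def f'_def split: if_splits)
qed

lemma geo_exists:
  assumes x: "x \<in> verts (E n)"
  shows "v \<in> verts (E n) \<Longrightarrow> \<exists>w. geo n x v w"
proof (induction "card {u \<in> verts (E n). DD u x < DD v x}" arbitrary: v rule: less_induct)
  case less
  show ?case
  proof (cases "v = x")
    case True
    then show ?thesis using geo_refl by blast
  next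
    case False
    then obtain u f where u: "f \<in> E n" "ends f = {v, u}" "DD v x = DD v u + DD u x"
      using between[OF less.prems x] by blast
    have uE: "u \<in> verts (E n)" using u by (auto simp: verts_ends)
    obtain a b i where f: "f = (a, b, i)" by (metis prod_cases3)
    have "\<exists>s. estep n v s u"
    proof (cases "a = v")
      case True
      then have "b = u" using u(2) f by (auto simp: doubleton_eq_iff)
      then show ?thesis using True u(1) f by (intro exI[of _ "(i, False)"]) (simp add: estep_def)
    next
      case False
      then have "a = u" "b = v" using u(2) f by (auto simp: doubleton_eq_iff)
      then show ?thesis using u(1) f by (intro exI[of _ "(i, True)"]) (simp add: estep_def)
    qed
    then obtain s where s: "estep n v s u" by blast
    have lt: "DD u x < DD v x" using u(3) estep_pos[OF s] by simp
    have "finite (verts (E n))" unfolding verts_ends using finite_E by (auto simp: ends_def)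
    then have "card {c \<in> verts (E n). DD c x < DD u x} < card {c \<in> verts (E n). DD c x < DD v x}"
      using lt uE by (intro psubset_card_mono) auto
    then obtain w where "geo n x u w" using less.hyps uE by blast
    then show ?thesis using geo_step[OF s u(3)] by blast
  qed
qed

lemma geo_unique:
  assumes x: "x \<in> VV"
  shows "geo n x v w \<Longrightarrow> geo n x v w' \<Longrightarrow> w = w'"
proof (induction arbitrary: w' rule: geo.induct)
  case geo_refl
  then show ?case
  proof (cases rule: geo.cases)
    case (geo_step s u w)
    then show ?thesis using DD_self[OF x] estep_pos[OF geo_step(2)] DD_nonneg[of u x] by simp
  qed auto
next
  case (geo_step v s u w)
  from geo_step.prems show ?case
  proof (cases rule: geo.cases)
    case geo_refl
    then show ?thesis using geo_step.hyps(2) DD_self[OF x] estep_pos[OF geo_step.hyps(1)] DD_nonneg[of u x] by simp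
  next
    case g: (geo_step s' u' w'')
    have "s = s' \<and> u = u'" using estep_lower_unique[OF geo_step.hyps(1) g(2) x geo_step.hyps(2) g(3)] .
    then show ?thesis using geo_step.IH g by blast
  qed
qed

lemma walk_estep: "estep n v s u \<Longrightarrow> walk (E n) u w x \<Longrightarrow> walk (E n) v (s # w) x"
  using walk_fwd[of v u "fst s" "E n" w x] walk_bwd[of u v "fst s" "E n" w x]
  by (cases s) (auto simp: estep_def split: if_splits)

lemma geo_walk: "geo n x v w \<Longrightarrow> walk (E n) v w x"
  by (induction rule: geo.induct) (auto intro: walk_refl walk_estep)

text \<open>After a step towards x, the geodesic walk from v is that step followed by the geodesic
  walk from u. After a step away, the geodesic walk from u first returns to v, so it is longer than
  w.\<close>

lemma walk_shortest_step:
  assumes x: "x \<in> verts (E n)" and s: "estep n v s u"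
    and IH: "\<And>w. geo n x u w \<Longrightarrow> length w < length w' \<or> w = w'" and g: "geo n x v w"
  shows "length w < length (s # w') \<or> w = s # w'"
proof -
  have xV: "x \<in> VV" using VV_I[OF x] .
  obtain f where f: "f \<in> E n" "ends f = {v, u}" using estep_edge[OF s] by blast
  from edge_separates[OF f x] show ?thesis
  proof
    assume low: "DD v x = DD v u + DD u x"
    obtain wu where wu: "geo n x u wu" using geo_exists[OF x] estep_verts[OF s] by blast
    have "w = s # wu" using geo_unique[OF xV g geo_step[OF s low wu]] .
    then show ?thesis using IH[OF wu] by auto
  next
    assume high: "DD u x = DD u v + DD v x"
    have "geo n x u ((fst s, \<not> snd s) # w)" by (rule geo_step[OF estep_sym[OF s] high g])
    from IH[OF this] show ?thesis by auto
  qed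
qed

lemma walk_shortest:
  assumes "x \<in> verts (E n)"
  shows "walk (E n) v w' x' \<Longrightarrow> x' = x \<Longrightarrow> geo n x v w \<Longrightarrow> length w < length w' \<or> w = w'"
proof (induction arbitrary: w rule: walk.induct)
  case (walk_refl y)
  then show ?case using geo_unique[OF VV_I[OF assms] walk_refl(2)] geo_refl by blast
next
  case (walk_fwd y u i w' z)
  have "estep n y (i, False) u" using walk_fwd.hyps(1) by (simp add: estep_def)
  from walk_shortest_step[OF assms this _ walk_fwd.prems(2)] show ?case
    using walk_fwd.IH walk_fwd.prems(1) by blast
next
  case (walk_bwd u y i w' z)
  have "estep n y (i, True) u" using walk_bwd.hyps(1) by (simp add: estep_def)
  from walk_shortest_step[OF assms this _ walk_bwd.prems(2)] show ?case
    using walk_bwd.IH walk_bwd.prems(1) by blast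
qed

lemma gamma_walk:
  assumes "v \<in> verts (E n)" "x \<in> verts (E n)"
  shows "walk (E n) v (gamma d n v x) x"
proof -
  obtain w where w: "geo n x v w" using geo_exists assms by blast
  have "gamma d n v x = w" unfolding gamma_def
  proof (rule the_equality)
    show "walk (E n) v w x \<and> (\<forall>w'. walk (E n) v w' x \<longrightarrow> length w \<le> length w')"
      using geo_walk[OF w] walk_shortest[OF assms(2) _ refl w] by fastforce
    fix w' assume w': "walk (E n) v w' x \<and> (\<forall>w''. walk (E n) v w'' x \<longrightarrow> length w' \<le> length w'')"
    then have "length w' \<le> length w" using geo_walk[OF w] by blast
    then show "w' = w" using walk_shortest[OF assms(2) _ refl w] w' by fastforce
  qed
  then show ?thesis using geo_walk[OF w] by simp
qed

section \<open>The labelling of the branch vertices\<close>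

definition pinv :: "nat \<Rightarrow> sword" where
  "pinv k = fg_inv (fg_pos (sprefix k om))"

definition hp :: "sword \<Rightarrow> sword" where
  "hp = fhom (\<lambda>k. if k \<le> d then fg_pos [k] else fg_pos ((sg ^^ (k - d)) [1]))"

lemma p_star_hp: "p_star d w = fg_reduce (hp w)"
  by (simp add: p_star_def fg_lift_fhom hp_def)

lemma hp_letter: "hp [(i, b)] = (if b then fg_inv (fg_pos (plab i)) else fg_pos (plab i))"
  by (simp add: hp_def fhom_def plab_def)

text \<open>A potential on the vertices of stage \<open>n\<close>: it changes by \<open>\<sigma>\<^sup>n(p\<^sub>*(i))\<close> along an edge of
  colour \<open>i\<close>. A leaf lies on a single edge, which determines its value.\<close>

definition pot :: "nat \<Rightarrow> vertex \<Rightarrow> sword" where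
  "pot n v = (if isB v then pinv (kap v)
     else (case (SOME (x, i). (x, v, i) \<in> E n) of (x, i) \<Rightarrow> pinv (kap x) @ fg_pos ((sg ^^ n) (plab i))))"

lemma pot_edge:
  assumes e: "(x, y, i) \<in> E n"
  shows "feq (pot n x @ fg_pos ((sg ^^ n) (plab i))) (pot n y)"
proof -
  have px: "pot n x = pinv (kap x)" using E_origin[OF e] by (simp add: pot_def)
  show ?thesis
  proof (cases "isB y")
    case True
    define A where "A = fg_pos ((sg ^^ n) (plab i))"
    have "sprefix (kap x) om = (sg ^^ n) (plab i) @ sprefix (kap y) om" by (rule edge_words[OF e True])
    then have "pinv (kap x) = pinv (kap y) @ fg_inv A" by (simp add: pinv_def fg_pos_append fg_inv_append A_def)
    then have "feq (pot n x @ A) (pinv (kap y) @ (fg_inv A @ A))" by (simp add: px)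
    also have "feq \<dots> (pinv (kap y) @ [])" by (intro feq_append feq_refl feq_inv_left)
    finally show ?thesis using True by (simp add: pot_def A_def)
  next
    case False
    have "(SOME (x, i). (x, y, i) \<in> E n) = (x, i)"
    proof (rule some_equality)
      show "case (x, i) of (x, i) \<Rightarrow> (x, y, i) \<in> E n" using e by simp
      fix q assume "case q of (x, i) \<Rightarrow> (x, y, i) \<in> E n"
      moreover obtain x' i' where q: "q = (x', i')" by fastforce
      ultimately have "(x', y, i') \<in> E n" by simp
      then show "q = (x, i)" using leaf_edge_unique[OF _ e False] q by blast
    qed
    then have "pot n y = pinv (kap x) @ fg_pos ((sg ^^ n) (plab i))" unfolding pot_def using False by simp
    then show ?thesis unfolding px by simp
  qed
qed


lemma hsig_pow_hp_Nil: "(hsig d ^^ n) (hp []) = []"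
proof -
  have "hp [] = []" unfolding hp_def by (rule fhom_Nil)
  moreover have "(hsig d ^^ n) [] = []" for n
    by (induction n) (simp_all add: hsig_def)
  ultimately show ?thesis by metis
qed

lemma hp_Cons: "hp ((i, b) # w) = (if b then fg_inv (fg_pos (plab i)) else fg_pos (plab i)) @ hp w"
proof -
  have "hp ([(i, b)] @ w) = hp [(i, b)] @ hp w" unfolding hp_def by (rule fhom_append)
  then show ?thesis using hp_letter[of i b] by (simp only: append_Cons append_Nil)
qed

text \<open>The potential differences telescope, so all walks from v to x give the same group
  element.\<close>

lemma walk_pot: "walk T v w x \<Longrightarrow> T = E n \<Longrightarrow> feq (pot n v @ (hsig d ^^ n) (hp w)) (pot n x)"
proof (induction rule: walk.induct)
  case (walk_refl x)
  show ?case unfolding hsig_pow_hp_Nil by simp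
next
  case (walk_fwd x y i w z)
  define A where "A = fg_pos ((sg ^^ n) (plab i))"
  have "(hsig d ^^ n) (hp ((i, False) # w)) = A @ (hsig d ^^ n) (hp w)"
    unfolding hp_Cons hsig_pow_append if_False hsig_pow_pos A_def ..
  then have "feq (pot n x @ (hsig d ^^ n) (hp ((i, False) # w))) ((pot n x @ A) @ (hsig d ^^ n) (hp w))"
    by simp
  also have "feq \<dots> (pot n y @ (hsig d ^^ n) (hp w))"
    unfolding A_def using walk_fwd.hyps(1) walk_fwd.prems by (intro feq_append pot_edge feq_refl) simp
  also have "feq \<dots> (pot n z)" by (rule walk_fwd.IH[OF walk_fwd.prems])
  finally show ?case .
next
  case (walk_bwd y x i w z)
  define A where "A = fg_pos ((sg ^^ n) (plab i))"
  define R where "R = (hsig d ^^ n) (hp w)"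
  have "(hsig d ^^ n) (hp ((i, True) # w)) = fg_inv A @ R"
    unfolding hp_Cons hsig_pow_append if_True hsig_pow_inv hsig_pow_pos A_def R_def ..
  then have "feq (pot n x @ (hsig d ^^ n) (hp ((i, True) # w))) (pot n x @ (fg_inv A @ R))"
    by simp
  also have "feq \<dots> ((pot n y @ A) @ (fg_inv A @ R))"
    unfolding A_def using walk_bwd.hyps(1) walk_bwd.prems by (intro feq_append feq_refl feq_sym[OF pot_edge]) simp
  also have "feq \<dots> (pot n y @ ((A @ fg_inv A) @ R))" by simp
  also have "feq \<dots> (pot n y @ ([] @ R))"
    by (intro feq_append feq_refl feq_inv_right)
  also have "feq \<dots> (pot n z)" using walk_bwd.IH[OF walk_bwd.prems] by (simp add: R_def)
  finally show ?case .
qed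

text \<open>The root has the empty word as potential, so the walk from it evaluates to the potential
  of x; both sides are reduced, hence equal as words.\<close>

theorem f_zero_eq:
  assumes "x \<in> branch_verts d n"
  shows "f_zero d x = pinv (kap x)"
proof -
  have x: "x \<in> verts (E n)" "isB x" using assms by (simp_all add: branch_verts_iff)
  define k where "k = birth d x"
  have xk: "x \<in> verts (E k)" using birth_le(2)[OF x(1)] by (simp add: k_def)
  define g where "g = gamma d k (Base 0) x"
  have "walk (E k) (Base 0) g x" unfolding g_def by (rule gamma_walk[OF Base_0_verts xk])
  from walk_pot[OF this refl] have A: "feq ((hsig d ^^ k) (hp g)) (pinv (kap x))"
    using x(2) by (simp add: pot_def pinv_def fg_pos_def)
  have "feq ((fg_sigma d ^^ k) (p_star d g)) ((hsig d ^^ k) (p_star d g))" by (rule fg_sigma_pow)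
  also have "feq \<dots> ((hsig d ^^ k) (hp g))" unfolding p_star_hp by (intro hsig_pow_feq feq_reduce)
  also note A
  finally have "feq (f_zero d x) (pinv (kap x))"
    unfolding f_zero_def Let_def k_def[symmetric] g_def[symmetric] .
  moreover have "red (f_zero d x)"
    unfolding f_zero_def Let_def p_star_hp by (intro red_fg_sigma_pow red_fg_reduce)
  moreover have "red (pinv (kap x))" unfolding pinv_def by (rule red_inv_pos)
  ultimately show ?thesis by (rule feq_red)
qed

lemma pinv_inject: "pinv k = pinv l \<longleftrightarrow> k = l"
  unfolding pinv_def fg_inv_pos_inject by (metis length_sprefix)

lemma length_pinv: "length (pinv k) = k"
  by (simp add: pinv_def length_fg_inv_pos)

theorem orbit_point_eq:
  assumes "x \<in> branch_verts d n"
  shows "orbit_point d \<eta> (pinv (kap x)) = N x"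
proof -
  have inj: "inj_on (f_zero d) (\<Union>n. branch_verts d n)"
  proof (rule inj_onI)
    fix v w assume "v \<in> (\<Union>n. branch_verts d n)" "w \<in> (\<Union>n. branch_verts d n)" and eq: "f_zero d v = f_zero d w"
    then obtain k l where kl: "v \<in> branch_verts d k" "w \<in> branch_verts d l" by blast
    then have "kap v = kap w" using eq f_zero_eq pinv_inject by simp
    then show "v = w" using kap_inj kl by blast
  qed
  have "inv_into (\<Union>n. branch_verts d n) (f_zero d) (f_zero d x) = x"
    using assms by (intro inv_into_f_f[OF inj]) blast
  then show ?thesis unfolding orbit_point_def f_zero_eq[OF assms] by (simp add: N_def)
qed

lemma mm_gt: "n < mm n"
  using mm_eq[of n] L_gt[of n] by simp

lemma branch_exists: "\<exists>x n. x \<in> branch_verts d n \<and> kap x = l"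
  using kap_surj[OF mm_gt[of l]] by blast

section \<open>Words appearing at a stage\<close>

text \<open>Equivalently, every stage has an edge of colour 2, so that a word appears at each stage
  from 1 on.\<close>

lemma qq_strict: "qq (n + 2) < qq (n + d + 2)"
proof (induction n rule: less_induct)
  case (less n)
  consider "n < d" | "d \<le> n" "n < 2 * d - 2" | "2 * d - 2 \<le> n" by linarith
  then show ?case
  proof cases
    case 1
    then have "qq (n + 2) = 0" "qq (d + 2) = 1" using d3 by (simp_all add: qq_0 qq_1)
    then show ?thesis using qq_mono[of "d + 2" "n + d + 2"] by simp
  next
    case 2
    then have "qq (n + 2) = 1" by (intro qq_1) auto
    moreover have "qq (Suc (0 + 2 * d)) = 2" using qq_rec[of 0] qq_1[of "d + 2"] d3 by simp
    moreover have "qq (Suc (0 + 2 * d)) \<le> qq (n + d + 2)" using 2 by (intro qq_mono) simp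
    ultimately show ?thesis by simp
  next
    case 3
    define k where "k = n + 2 - 2 * d"
    have k: "n + 2 = k + 2 * d" "k < n" using 3 d3 by (simp_all add: k_def)
    have "qq (n + 2) < qq (Suc (n + 2))" using less.IH[OF k(2)] qq_key[of k] qq_rec[of k] k(1) by simp
    also have "\<dots> \<le> qq (n + d + 2)" using d3 by (intro qq_mono) simp
    finally show ?thesis .
  qed
qed

lemma mm_strict: "mm n < mm (Suc n)"
  using mm_eq[of n] mm_Suc[of n] qq_strict[of n] by simp

lemma appears_iff: "appears d w (int (Suc n)) \<longleftrightarrow> (\<exists>x y. (x, y, 2) \<in> E n \<and> w = pinv (kap (New x y 0)))"
proof -
  have "appears d w (int (Suc n)) \<longleftrightarrow> (\<exists>x\<in>branch_verts d (Suc n). x \<notin> verts (E n) \<and> w = f_zero d x)"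
    unfolding appears_def using d3 by (simp add: nat_add_distrib)
  also have "\<dots> \<longleftrightarrow> (\<exists>x y. (x, y, 2) \<in> E n \<and> w = pinv (kap (New x y 0)))"
  proof
    assume "\<exists>x\<in>branch_verts d (Suc n). x \<notin> verts (E n) \<and> w = f_zero d x"
    then obtain v where v: "v \<in> branch_verts d (Suc n)" "v \<notin> verts (E n)" "w = f_zero d v" by blast
    from v(1) show "\<exists>x y. (x, y, 2) \<in> E n \<and> w = pinv (kap (New x y 0))"
    proof (cases rule: branch_cases)
      case root
      then show ?thesis using v(2) Base_0_verts by blast
    next
      case (new x y k)
      have "k = n"
      proof (rule ccontr)
        assume "k \<noteq> n"
        then have "v \<in> branch_verts d n" using New_branch[OF new(2)] branch_mono[of "Suc k" n] new by auto
        then show False using v(2) by (simp add: branch_verts_iff)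
      qed
      then show ?thesis using new v f_zero_eq by auto
    qed
  next
    assume "\<exists>x y. (x, y, 2) \<in> E n \<and> w = pinv (kap (New x y 0))"
    then obtain x y where xy: "(x, y, 2) \<in> E n" "w = pinv (kap (New x y 0))" by blast
    then show "\<exists>x\<in>branch_verts d (Suc n). x \<notin> verts (E n) \<and> w = f_zero d x"
      using New_branch[OF xy(1)] New_fresh[OF xy(1), of 0] f_zero_eq by (intro bexI[of _ "New x y 0"]) auto
  qed
  finally show ?thesis .
qed

text \<open>The lengths of the words of stage n+1 fill the interval from \<open>mm n\<close> to
  \<open>mm (Suc n) - 1\<close>, which is nonempty by \<open>mm_strict\<close>.\<close>

theorem longest_appearing:
  assumes "appears d w (int (Suc n))" "\<And>w'. appears d w' (int (Suc n)) \<Longrightarrow> length w' \<le> length w"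
  shows "length w + 1 = mm (Suc n)"
proof -
  obtain x y where xy: "(x, y, 2) \<in> E n" "w = pinv (kap (New x y 0))" using assms(1) appears_iff by blast
  have "length w < mm (Suc n)" using kap_bounds[OF xy(1)] xy(2) by (simp add: length_pinv)
  moreover have "mm n \<le> mm (Suc n) - 1" "mm (Suc n) - 1 < mm (Suc n)" using mm_strict[of n] by auto
  then obtain k where k: "(2, k) \<in> idx n" "mm (Suc n) - 1 = L n + k" using idx_2_exists by blast
  obtain x' y' where xy': "(x', y', 2) \<in> E n" "kap x' = k" using idx_key[OF k(1)] by blast
  then have "appears d (pinv (mm (Suc n) - 1)) (int (Suc n))"
    unfolding appears_iff using kap_New[OF xy'(1), of 0] k(2) by (intro exI[of _ x'] exI[of _ y']) simp
  then have "mm (Suc n) - 1 \<le> length w" using assms(2) length_pinv by metis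
  ultimately show ?thesis by simp
qed

end

section \<open>Two-sided words and prefix-suffix developments\<close>

context subst
begin

section \<open>Two-sided words\<close>

definition rh :: "(int \<Rightarrow> nat) \<Rightarrow> int \<Rightarrow> nat \<Rightarrow> nat" where
  "rh W j = (\<lambda>i. W (j + int i))"

lemma rh_apply: "rh W j i = W (j + int i)"
  by (simp add: rh_def)

lemma rh_0 [simp]: "rh W j 0 = W j"
  by (simp add: rh_def)

lemma Omega_iff: "W \<in> Omega d \<longleftrightarrow> (\<forall>j. rh W j \<in> Omega_plus d)"
  by (simp add: Omega_def Omega_plus_iff sprefix_def rh_def)

lemma rh_sshift: "rh W (j + int n) = sshift n (rh W j)"
  by (auto simp: rh_def sshift_def fun_eq_iff algebra_simps)

lemma rh_left: "rh W (j - 1) = swapp [W (j - 1)] (rh W j)"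
proof
  fix i show "rh W (j - 1) i = swapp [W (j - 1)] (rh W j) i"
    by (cases i) (simp_all add: rh_def algebra_simps)
qed

lemma orbit_iff: "V \<in> Omega_orbit d \<longleftrightarrow> (\<exists>n. V = sshift n om)"
  by (auto simp: Omega_orbit_def)

lemma orbit_swapp: "swapp u V \<in> Omega_orbit d \<Longrightarrow> V \<in> Omega_orbit d"
  unfolding orbit_iff by (metis sshift_sshift sshift_swapp)

lemma orbit_sshift: "V \<in> Omega_orbit d \<Longrightarrow> sshift n V \<in> Omega_orbit d"
  unfolding orbit_iff by (metis sshift_sshift)

lemma om_orbit: "om \<in> Omega_orbit d"
  unfolding orbit_iff by (metis sshift_0)

text \<open>Off the orbit of omega a right-infinite word has only one past, as omega alone is left
  special. This gives the uniqueness of U in the definition of f_Q.\<close>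

lemma Omega_eq:
  assumes "W \<in> Omega d" "W' \<in> Omega d" and eq: "rh W j = rh W' j" and no: "rh W j \<notin> Omega_orbit d"
  shows "W = W'"
proof -
  have left: "rh W (j - int k) = rh W' (j - int k) \<and> rh W (j - int k) \<notin> Omega_orbit d" for k
  proof (induction k)
    case 0
    then show ?case using eq no by simp
  next
    case (Suc k)
    define i where "i = j - int k"
    have i: "j - int (Suc k) = i - 1" by (simp add: i_def)
    have IH: "rh W i = rh W' i" "rh W i \<notin> Omega_orbit d" using Suc unfolding i_def by blast+
    have "rh W (i - 1) \<in> Omega_plus d" "rh W' (i - 1) \<in> Omega_plus d" using assms(1,2) by (simp_all only: Omega_iff)
    then have "swapp [W (i - 1)] (rh W i) \<in> Omega_plus d" "swapp [W' (i - 1)] (rh W i) \<in> Omega_plus d"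
      unfolding rh_left IH(1) by simp_all
    then have "W (i - 1) = W' (i - 1)" using left_special_unique[of _ "rh W i"] IH(2) om_orbit by metis
    then have "rh W (i - 1) = rh W' (i - 1)" unfolding rh_left IH(1) by simp
    moreover have "rh W (i - 1) \<notin> Omega_orbit d" unfolding rh_left using orbit_swapp IH(2) by blast
    ultimately show ?case unfolding i by blast
  qed
  show ?thesis
  proof
    fix i :: int
    define k where "k = nat (j - i)"
    have "j - int k \<le> i" by (simp add: k_def)
    then have "i = (j - int k) + int (nat (i - (j - int k)))" by simp
    then show "W i = W' i" using left[of k] by (metis rh_apply)
  qed
qed

text \<open>Left letters are chosen one after the other; \<open>W\<close> reads index i in any of
  the words \<open>f k\<close> that reaches far enough to the left, and \<open>st\<close> makes the
  readings agree.\<close>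

lemma Omega_extension:
  assumes V: "V \<in> Omega_plus d"
  shows "\<exists>W\<in>Omega d. rh W 0 = V"
proof -
  have "\<exists>f. f 0 = V \<and> (\<forall>n. f n \<in> Omega_plus d \<and> sshift 1 (f (Suc n)) = f n)"
  proof -
    have "\<exists>f. \<forall>n. (f n \<in> Omega_plus d \<and> (n = 0 \<longrightarrow> f n = V)) \<and> sshift 1 (f (Suc n)) = f n"
    proof (rule dependent_nat_choice)
      show "\<exists>x. x \<in> Omega_plus d \<and> ((0::nat) = 0 \<longrightarrow> x = V)" using V by blast
      fix x and n :: nat assume "x \<in> Omega_plus d \<and> (n = 0 \<longrightarrow> x = V)"
      then obtain a where "swapp [a] x \<in> Omega_plus d" using Omega_plus_left by blast
      moreover have "sshift 1 (swapp [a] x) = x" using sshift_swapp[of "[a]" x] by simp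
      ultimately show "\<exists>y. (y \<in> Omega_plus d \<and> (Suc n = 0 \<longrightarrow> y = V)) \<and> sshift 1 y = x" by blast
    qed
    then show ?thesis by blast
  qed
  then obtain f where f: "f 0 = V" "\<And>n. f n \<in> Omega_plus d" "\<And>n. sshift 1 (f (Suc n)) = f n" by blast
  have st: "sshift k (f (n + k)) = f n" for n k
  proof (induction k)
    case (Suc k)
    have "sshift (Suc k) (f (n + Suc k)) = sshift k (sshift 1 (f (Suc (n + k))))" by (simp add: sshift_sshift)
    then show ?case using f(3) Suc by simp
  qed simp
  define W where "W i = f (nat (- i)) (nat (i + int (nat (- i))))" for i :: int
  have W: "W i = f k (nat (i + int k))" if "0 \<le> i + int k" for i k
  proof -
    define l where "l = nat (- i)"
    have "l \<le> k" using that by (simp add: l_def)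
    then have "f l = sshift (k - l) (f k)" using st[of "k - l" l] by simp
    then have "W i = f k (nat (i + int l) + (k - l))" by (simp add: W_def l_def[symmetric] sshift_def)
    moreover have "nat (i + int l) + (k - l) = nat (i + int k)"
      using \<open>l \<le> k\<close> by (cases "0 \<le> i") (auto simp: l_def nat_add_distrib)
    ultimately show ?thesis by simp
  qed
  have rhW: "rh W (- int k) = f k" for k
  proof
    fix i
    have "W (- int k + int i) = f k (nat (- int k + int i + int k))" by (rule W) simp
    then show "rh W (- int k) i = f k i" by (simp add: rh_apply)
  qed
  have "rh W j \<in> Omega_plus d" for j
  proof -
    define k where "k = nat (- j)"
    have "j = - int k + int (nat (j + int k))" by (simp add: k_def)
    then have "rh W j = sshift (nat (j + int k)) (rh W (- int k))" by (metis rh_sshift)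
    then show ?thesis using rhW f(2) Omega_plus_sshift by simp
  qed
  then have "W \<in> Omega d" by (simp add: Omega_iff)
  moreover have "rh W 0 = V" using rhW[of 0] f(1) by simp
  ultimately show ?thesis by blast
qed

subsection \<open>The substitution on two-sided words\<close>

lemma block_start_0 [simp]: "block_start d W 0 = 0"
  by (simp add: block_start_def)

lemma block_start_Suc: "block_start d W (i + 1) = block_start d W i + int (length (sigma_letter d (W i)))"
proof (cases "0 \<le> i")
  case True
  then have "{0..<i + 1} = insert i {0..<i}" by auto
  then show ?thesis using True by (simp add: block_start_def)
next
  case False
  then have "{i..<0} = insert i {i + 1..<0}" by auto
  then have "(\<Sum>j\<in>{i..<0}. int (length (sigma_letter d (W j)))) =
      int (length (sigma_letter d (W i))) + (\<Sum>j\<in>{i + 1..<0}. int (length (sigma_letter d (W j))))" by simp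
  moreover have "i + 1 = 0 \<or> i + 1 < 0" using False by auto
  ultimately show ?thesis using False by (auto simp: block_start_def)
qed

lemma block_start_less: "i < i' \<Longrightarrow> block_start d W i + int (length (sigma_letter d (W i))) \<le> block_start d W i'"
proof (induction i' rule: int_gr_induct)
  case base
  then show ?case by (simp add: block_start_Suc)
next
  case (step i')
  then show ?case by (simp add: block_start_Suc)
qed

lemma block_start_le: "block_start d W (- int k) \<le> - int k"
proof (induction k)
  case (Suc k)
  have "block_start d W (- int k) = block_start d W (- int (Suc k)) + int (length (sigma_letter d (W (- int (Suc k)))))"
    using block_start_Suc[of W "- int (Suc k)"] by simp
  moreover have "0 < length (sigma_letter d (W (- int (Suc k))))" by simp
  ultimately show ?case using Suc by linarith
qed simp

lemma sigma_bi_block: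
  assumes k: "k < length (sigma_letter d (W i))"
  shows "sigma_bi d W (block_start d W i + int k) = sigma_letter d (W i) ! k"
  unfolding sigma_bi_def
proof (rule the_equality)
  show "\<exists>i' k'. k' < length (sigma_letter d (W i')) \<and> block_start d W i + int k = block_start d W i' + int k' \<and>
      sigma_letter d (W i) ! k = sigma_letter d (W i') ! k'" using k by blast
  fix a assume "\<exists>i' k'. k' < length (sigma_letter d (W i')) \<and> block_start d W i + int k = block_start d W i' + int k' \<and>
      a = sigma_letter d (W i') ! k'"
  then obtain i' k' where h: "k' < length (sigma_letter d (W i'))" "block_start d W i + int k = block_start d W i' + int k'"
    "a = sigma_letter d (W i') ! k'" by blast
  have "i = i'"
  proof (rule ccontr)
    assume "i \<noteq> i'"
    then consider "i < i'" | "i' < i" by linarith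
    then show False
      by cases (use block_start_less[of i i' W] block_start_less[of i' i W] h k in linarith)+
  qed
  then show "a = sigma_letter d (W i) ! k" using h by simp
qed

text \<open>Links the two-sided substitution to \<open>SS\<close>, so that one-sided desubstitution
  can be applied at block boundaries.\<close>

lemma rh_sigma_bi: "rh (sigma_bi d W) (block_start d W j) = SS (rh W j)"
proof (rule SS_unique)
  fix l
  have bl: "block_start d W (j + int l) = block_start d W j + int (length (sg (sprefix l (rh W j))))" for l
  proof (induction l)
    case (Suc l)
    have "j + int (Suc l) = j + int l + 1" by simp
    then have "block_start d W (j + int (Suc l)) = block_start d W (j + int l) + int (length (sigma_letter d (W (j + int l))))"
      using block_start_Suc by metis
    then show ?case using Suc by (simp add: sprefix_Suc sigma_append sg_Cons rh_apply)
  qed simp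
  show "sprefix (length (sg (sprefix l (rh W j)))) (rh (sigma_bi d W) (block_start d W j)) = sg (sprefix l (rh W j))"
  proof (induction l)
    case (Suc l)
    define M where "M = length (sg (sprefix l (rh W j)))"
    define sl where "sl = sigma_letter d (W (j + int l))"
    have e: "sg (sprefix (Suc l) (rh W j)) = sg (sprefix l (rh W j)) @ sl"
      by (simp add: sprefix_Suc sigma_append sg_Cons sl_def rh_apply)
    have "sprefix (length sl) (sshift M (rh (sigma_bi d W) (block_start d W j))) = sl"
    proof (rule nth_equalityI)
      fix k assume "k < length (sprefix (length sl) (sshift M (rh (sigma_bi d W) (block_start d W j))))"
      then have k: "k < length sl" by simp
      have "sigma_bi d W (block_start d W (j + int l) + int k) = sl ! k"
        unfolding sl_def by (rule sigma_bi_block) (use k in \<open>simp add: sl_def\<close>)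
      moreover have "block_start d W (j + int l) + int k = block_start d W j + int (k + M)"
        using bl[of l] by (simp add: M_def)
      ultimately show "sprefix (length sl) (sshift M (rh (sigma_bi d W) (block_start d W j))) ! k = sl ! k"
        using k by (simp add: sshift_def rh_apply)
    qed simp
    then show ?case unfolding e length_append M_def[symmetric] sprefix_add using Suc by (simp add: M_def)
  qed simp
qed

lemma sigma_bi_Omega: "W \<in> Omega d \<Longrightarrow> sigma_bi d W \<in> Omega d"
proof -
  assume W: "W \<in> Omega d"
  have "rh (sigma_bi d W) j \<in> Omega_plus d" for j
  proof -
    define k where "k = nat (- j)"
    define b where "b = block_start d W (- int k)"
    have "- int k \<le> j" by (simp add: k_def)
    then have "b \<le> j" using block_start_le[of W k] unfolding b_def by linarith
    then have "j = b + int (nat (j - b))" by simp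
    then have "rh (sigma_bi d W) j = sshift (nat (j - b)) (rh (sigma_bi d W) b)" by (metis rh_sshift)
    moreover have "rh (sigma_bi d W) b = SS (rh W (- int k))" unfolding b_def by (rule rh_sigma_bi)
    ultimately show ?thesis using W SS_Omega_plus Omega_plus_sshift by (simp add: Omega_iff)
  qed
  then show ?thesis by (simp add: Omega_iff)
qed

lemma SS_orbit: "V \<in> Omega_orbit d \<Longrightarrow> SS V \<in> Omega_orbit d"
  unfolding orbit_iff using SS_sshift[of _ om] SS_om by metis

section \<open>Prefix-suffix developments\<close>

definition ps_step :: "(int \<Rightarrow> nat) \<Rightarrow> (int \<Rightarrow> nat) \<Rightarrow> nat list \<times> nat \<times> nat list \<Rightarrow> bool" where
  "ps_step W W' t \<longleftrightarrow> W' \<in> Omega d \<and> (case t of (p, a, s) \<Rightarrow>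
     sigma_letter d (W' 0) = p @ a # s \<and> W = bshift (length p) (sigma_bi d W') \<and> a = W 0)"

lemma ps_development_iff:
  "ps_development d W D \<longleftrightarrow> (\<exists>Ws. Ws 0 = W \<and> (\<forall>i. ps_step (Ws i) (Ws (Suc i)) (D i)))"
  by (simp add: ps_development_def ps_step_def)

lemma rh_bshift: "rh (bshift k W) j = rh W (j + int k)"
  by (simp add: rh_def bshift_def fun_eq_iff algebra_simps)

text \<open>The only letter not at the start of a block is the 2 in sigma(1) = 12. Hence W(0) alone
  decides the prefix p, and a nonempty p forces W'(0) = 1.\<close>

lemma ps_step_props:
  assumes W: "W \<in> Omega d" "rh W 0 \<notin> Omega_orbit d" and st: "ps_step W W' (p, a, s)"
  shows "p = (if W 0 = 2 then [1] else [])" "swapp p (rh W 0) = SS (rh W' 0)" "rh W' 0 \<notin> Omega_orbit d"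
    "W' \<in> Omega d" "p = [1] \<longrightarrow> W' 0 = 1" "sigma_letter d (W' 0) = p @ W 0 # s" "a = W 0"
    "rh W (- int (length p)) = SS (rh W' 0)"
proof -
  have S: "W' \<in> Omega d" "sigma_letter d (W' 0) = p @ a # s" "W = bshift (length p) (sigma_bi d W')" "a = W 0"
    using st by (auto simp: ps_step_def)
  have rhW: "rh W (- int (length p)) = SS (rh W' 0)"
    using rh_sigma_bi[of W' 0] by (simp add: S(3) rh_bshift)
  have X0: "rh W (- int (length p)) 0 \<noteq> 2"
    unfolding rhW using S(1) Omega_plus_letter[of "rh W' 0" 0] by (intro SS_neq2) (simp add: Omega_iff)
  have p: "p = [] \<or> (p = [1] \<and> a = 2 \<and> W' 0 = 1)"
    using S(2) by (cases p; cases "tl p") (auto simp: sigma_letter_def split: if_splits)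
  show pp: "p = (if W 0 = 2 then [1] else [])"
  proof (cases "p = []")
    case True
    then have "W 0 \<noteq> 2" using X0 by simp
    then show ?thesis using True by simp
  next
    case False
    then show ?thesis using p S(4) by simp
  qed
  show "p = [1] \<longrightarrow> W' 0 = 1" using p by auto
  show sw: "swapp p (rh W 0) = SS (rh W' 0)"
  proof (cases "p = []")
    case True
    then show ?thesis using rhW by simp
  next
    case False
    then have p1: "p = [1]" "W' 0 = 1" using p by auto
    have "SS (rh W' 0) = rh W (0 - 1)" using rhW p1 by simp
    also have "\<dots> = swapp [W (0 - 1)] (rh W 0)" by (rule rh_left)
    finally have e: "SS (rh W' 0) = swapp [W (0 - 1)] (rh W 0)" .
    have "SS (rh W' 0) 0 = 1" using p1(2) by (intro SS_0_1) simp
    then have "W (0 - 1) = 1" unfolding e by simp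
    then show ?thesis using e p1(1) by simp
  qed
  show "rh W' 0 \<notin> Omega_orbit d"
  proof
    assume "rh W' 0 \<in> Omega_orbit d"
    then have "swapp p (rh W 0) \<in> Omega_orbit d" unfolding sw by (rule SS_orbit)
    then show False using orbit_swapp W(2) by blast
  qed
  show "W' \<in> Omega d" "sigma_letter d (W' 0) = p @ W 0 # s" "a = W 0" using S by simp_all
  show "rh W (- int (length p)) = SS (rh W' 0)" by (rule rhW)
qed

text \<open>The prefix is decided by W(0), the right half of the desubstituted word by the
  injectivity of sigma on infinite words, and its past by \<open>Omega_eq\<close>.\<close>

lemma ps_step_unique:
  assumes W: "W \<in> Omega d" "rh W 0 \<notin> Omega_orbit d" and st: "ps_step W W1 t" "ps_step W W2 t'"
  shows "W1 = W2 \<and> t = t'"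
proof -
  obtain p a s where t: "t = (p, a, s)" by (metis prod_cases3)
  obtain p' a' s' where t': "t' = (p', a', s')" by (metis prod_cases3)
  note P = ps_step_props[OF W st(1)[unfolded t]] and P' = ps_step_props[OF W st(2)[unfolded t']]
  have pp: "p = p'" using P(1) P'(1) by simp
  have lt: "\<And>i. rh W1 0 i \<in> {1..d}" "\<And>i. rh W2 0 i \<in> {1..d}"
    using P(4) P'(4) Omega_plus_letter unfolding Omega_iff by blast+
  have "SS (rh W1 0) = SS (rh W2 0)" using P(2) P'(2) pp by simp
  then have "rh W1 0 = rh W2 0" using SS_inject[of "rh W1 0" "rh W2 0"] lt by blast
  then have W12: "W1 = W2" using Omega_eq[OF P(4) P'(4)] P(3) by blast
  then have "p @ W 0 # s = p' @ W 0 # s'" using P(6) P'(6) by simp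
  then show ?thesis using W12 pp P(7) P'(7) t t' by simp
qed

text \<open>Desubstitute the right half and extend the result to the left arbitrarily. Its image and
  the shifted W share a right half off the orbit, so they coincide by
  \<open>Omega_eq\<close>.\<close>

lemma ps_step_exists:
  assumes W: "W \<in> Omega d" "rh W 0 \<notin> Omega_orbit d"
  shows "\<exists>W' t. ps_step W W' t"
proof -
  define p :: "nat list" where "p = (if W 0 = 2 then [1] else [])"
  define X where "X = rh W (- int (length p))"
  have XO: "X \<in> Omega_plus d" using W(1) by (simp add: X_def Omega_iff)
  have X0: "X 0 \<noteq> 2 \<and> (W 0 = 2 \<longrightarrow> X 0 = 1 \<and> X 1 = 2)"
  proof (cases "W 0 = 2")
    case True
    then have "X 1 = 2" "length p = 1" by (simp_all add: X_def p_def rh_apply)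
    moreover have "X (Suc 0) = 1 \<or> X (Suc 0) = Suc (X 0)" by (rule Omega_plus_step[OF XO])
    ultimately show ?thesis by auto
  next
    case False
    then show ?thesis by (simp add: X_def p_def)
  qed
  then obtain V where V: "V \<in> Omega_plus d" "X = SS V" using Omega_plus_desubst[OF XO] by blast
  have Xno: "X \<notin> Omega_orbit d"
  proof
    assume "X \<in> Omega_orbit d"
    then have "sshift (length p) X \<in> Omega_orbit d" by (rule orbit_sshift)
    moreover have "sshift (length p) X = rh W 0" using rh_sshift[of W "- int (length p)" "length p"] by (simp add: X_def)
    ultimately show False using W(2) by simp
  qed
  obtain W' where W': "W' \<in> Omega d" "rh W' 0 = V" using Omega_extension[OF V(1)] by blast
  have W'0: "W' 0 = V 0" using W'(2) by (metis add_0 of_nat_0 rh_apply)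
  define W2 where "W2 i = W (i - int (length p))" for i
  have rhW2: "rh W2 j = rh W (j - int (length p))" for j by (simp add: rh_def W2_def fun_eq_iff algebra_simps)
  have "W2 \<in> Omega d" using W(1) unfolding Omega_iff rhW2 by blast
  moreover have sbO: "sigma_bi d W' \<in> Omega d" using sigma_bi_Omega W'(1) .
  moreover have "rh (sigma_bi d W') 0 = X" using rh_sigma_bi[of W' 0] W'(2) V(2) by simp
  moreover have "rh W2 0 = X" unfolding rhW2 X_def by simp
  ultimately have "W2 = sigma_bi d W'" using Omega_eq[of W2 "sigma_bi d W'" 0] Xno by simp
  moreover have "W = bshift (length p) W2" by (rule ext) (simp add: bshift_def W2_def)
  ultimately have Wb: "W = bshift (length p) (sigma_bi d W')" by simp
  have "\<exists>s. sigma_letter d (W' 0) = p @ W 0 # s"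
  proof (cases "W 0 = 2")
    case True
    have "V 0 \<in> {1..d}" "V 1 \<in> {1..d}" using Omega_plus_letter[OF V(1)] by blast+
    then have "V 0 = 1" using SS_1_eq_2_iff[of V] X0 True V(2) by simp
    then show ?thesis using True W'0 by (simp add: p_def sigma_letter_def)
  next
    case False
    then have "W 0 = SS V 0" using V(2) by (metis X_def p_def add_0 add.inverse_neutral list.size(3) of_nat_0 rh_apply)
    then show ?thesis using False W'0 by (auto simp: p_def SS_0 sigma_letter_def)
  qed
  then obtain s where "sigma_letter d (W' 0) = p @ W 0 # s" by blast
  then have "ps_step W W' (p, W 0, s)" using W'(1) Wb by (simp add: ps_step_def)
  then show ?thesis by blast
qed

definition nonsing :: "(int \<Rightarrow> nat) \<Rightarrow> bool" where
  "nonsing W \<longleftrightarrow> W \<in> Omega d \<and> rh W 0 \<notin> Omega_orbit d"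

lemma ps_step_nonsing: "nonsing W \<Longrightarrow> ps_step W W' t \<Longrightarrow> nonsing W'"
  unfolding nonsing_def using ps_step_props(3,4) by (metis prod_cases3)

lemma ps_chain_nonsing: "nonsing (Ws 0) \<Longrightarrow> \<forall>i. ps_step (Ws i) (Ws (Suc i)) (D i) \<Longrightarrow> nonsing (Ws n)"
  by (induction n) (auto intro: ps_step_nonsing)

theorem ps_development_ex1:
  assumes "nonsing W"
  shows "\<exists>!D. ps_development d W D"
proof -
  have "\<exists>Ws. \<forall>n. (nonsing (Ws n) \<and> (n = 0 \<longrightarrow> Ws n = W)) \<and> (\<exists>t. ps_step (Ws n) (Ws (Suc n)) t)"
  proof (rule dependent_nat_choice)
    show "\<exists>x. nonsing x \<and> ((0::nat) = 0 \<longrightarrow> x = W)" using assms by blast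
    fix x and n :: nat assume "nonsing x \<and> (n = 0 \<longrightarrow> x = W)"
    then obtain y t where "ps_step x y t" using ps_step_exists nonsing_def by blast
    then show "\<exists>y. (nonsing y \<and> (Suc n = 0 \<longrightarrow> y = W)) \<and> (\<exists>t. ps_step x y t)"
      using ps_step_nonsing \<open>nonsing x \<and> (n = 0 \<longrightarrow> x = W)\<close> by blast
  qed
  then obtain Ws where Ws: "Ws 0 = W" "\<And>n. \<exists>t. ps_step (Ws n) (Ws (Suc n)) t" by blast
  then obtain D where D: "\<And>n. ps_step (Ws n) (Ws (Suc n)) (D n)" by metis
  show ?thesis
  proof (rule ex1I[of _ D])
    show "ps_development d W D" unfolding ps_development_iff using Ws(1) D by blast
    fix D' assume "ps_development d W D'"
    then obtain Ws' where Ws': "Ws' 0 = W" "\<forall>i. ps_step (Ws' i) (Ws' (Suc i)) (D' i)"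
      unfolding ps_development_iff by blast
    have eq: "Ws n = Ws' n" for n
    proof (induction n)
      case 0
      then show ?case using Ws Ws' by simp
    next
      case (Suc n)
      have "nonsing (Ws n)" using ps_chain_nonsing[of Ws D n] Ws(1) assms D by simp
      then show ?case using ps_step_unique[of "Ws n"] D[of n] Ws'(2) Suc unfolding nonsing_def by metis
    qed
    show "D' = D"
    proof
      fix n
      have "nonsing (Ws n)" using ps_chain_nonsing[of Ws D n] Ws(1) assms D by simp
      moreover have "ps_step (Ws n) (Ws (Suc n)) (D' n)" using Ws'(2) eq by metis
      ultimately show "D' n = D n" using ps_step_unique[of "Ws n"] D[of n] unfolding nonsing_def by metis
    qed
  qed
qed

text \<open>The word u_n itself, whose inverse is \<open>ps_inverse\<close>
  (\<open>ps_inverse_word\<close>).\<close>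

primrec ps_word :: "(nat \<Rightarrow> nat list \<times> nat \<times> nat list) \<Rightarrow> nat \<Rightarrow> nat list" where
  "ps_word D 0 = fst (D 0)"
| "ps_word D (Suc n) = (sg ^^ Suc n) (fst (D (Suc n))) @ ps_word D n"

lemma ps_inverse_word: "ps_inverse d D n = fg_inv (fg_pos (ps_word D n))"
proof (induction n)
  case (Suc n)
  have e: "(fg_sigma d ^^ k) (fg_inv (fg_pos p)) = fg_inv (fg_pos ((sg ^^ k) p))" for k p
  proof (rule feq_red)
    show "feq ((fg_sigma d ^^ k) (fg_inv (fg_pos p))) (fg_inv (fg_pos ((sg ^^ k) p)))"
      using fg_sigma_pow[where d = d and n = k and w = "fg_inv (fg_pos p)"] by (simp add: hsig_pow_inv hsig_pow_pos)
  qed (intro red_fg_sigma_pow red_inv_pos)+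
  have "ps_inverse d D (Suc n) = fg_reduce (fg_inv (fg_pos (ps_word D n)) @ fg_inv (fg_pos ((sg ^^ Suc n) (fst (D (Suc n))))))"
    by (simp only: ps_inverse.simps Suc e fg_mult_def)
  also have "\<dots> = fg_reduce (fg_inv (fg_pos (ps_word D (Suc n))))"
    by (simp only: ps_word.simps fg_pos_append fg_inv_append)
  also have "\<dots> = fg_inv (fg_pos (ps_word D (Suc n)))" by (rule fg_reduce_red[OF red_inv_pos])
  finally show ?case .
qed simp

text \<open>The third claim makes u_n a prefix of omega: p_n = [1] occurs only under the letter 1,
  and then u_n is a prefix of sigma^(n+1)(1), while an empty p_n leaves u_n unchanged.\<close>

lemma ps_word_props:
  assumes Ws: "nonsing (Ws 0)" "\<forall>i. ps_step (Ws i) (Ws (Suc i)) (D i)"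
  shows "swapp (ps_word D n) (rh (Ws 0) 0) = (SS ^^ Suc n) (rh (Ws (Suc n)) 0)"
    and "prefix (ps_word D n) ((sg ^^ Suc n) [Ws (Suc n) 0])"
    and "ps_word D n = sprefix (length (ps_word D n)) om"
proof -
  have P: "fst (D k) = [] \<or> (fst (D k) = [1] \<and> Ws (Suc k) 0 = 1)"
    "swapp (fst (D k)) (rh (Ws k) 0) = SS (rh (Ws (Suc k)) 0)"
    "prefix (fst (D k) @ [Ws k 0]) (sigma_letter d (Ws (Suc k) 0))" for k
  proof -
    obtain p a s where D: "D k = (p, a, s)" by (metis prod_cases3)
    have "nonsing (Ws k)" by (rule ps_chain_nonsing[OF Ws])
    then have W: "Ws k \<in> Omega d" "rh (Ws k) 0 \<notin> Omega_orbit d" by (simp_all add: nonsing_def)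
    have st: "ps_step (Ws k) (Ws (Suc k)) (p, a, s)" using Ws(2) D by metis
    note Q = ps_step_props[OF W st]
    show "fst (D k) = [] \<or> (fst (D k) = [1] \<and> Ws (Suc k) 0 = 1)" using Q(1,5) D by (auto split: if_splits)
    show "swapp (fst (D k)) (rh (Ws k) 0) = SS (rh (Ws (Suc k)) 0)" using Q(2) D by simp
    show "prefix (fst (D k) @ [Ws k 0]) (sigma_letter d (Ws (Suc k) 0))" using Q(6) D by simp
  qed
  show "swapp (ps_word D n) (rh (Ws 0) 0) = (SS ^^ Suc n) (rh (Ws (Suc n)) 0)"
  proof (induction n)
    case 0
    then show ?case using P(2)[of 0] by simp
  next
    case (Suc n)
    have "swapp (ps_word D (Suc n)) (rh (Ws 0) 0) = swapp ((sg ^^ Suc n) (fst (D (Suc n)))) ((SS ^^ Suc n) (rh (Ws (Suc n)) 0))"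
      unfolding ps_word.simps swapp_append Suc ..
    also have "\<dots> = (SS ^^ Suc n) (SS (rh (Ws (Suc (Suc n))) 0))"
      unfolding SS_pow_swapp[symmetric] P(2) ..
    finally show ?case by (simp only: funpow_Suc_right comp_apply)
  qed
  have pre: "prefix (ps_word D n) ((sg ^^ Suc n) [Ws (Suc n) 0])" for n
  proof (induction n)
    case 0
    have "(sg ^^ Suc 0) [Ws (Suc 0) 0] = sigma_letter d (Ws (Suc 0) 0)" by (simp add: sg_Cons)
    then show ?case using P(3)[of 0] by (metis append_prefixD ps_word.simps(1))
  next
    case (Suc n)
    obtain t where t: "sigma_letter d (Ws (Suc (Suc n)) 0) = fst (D (Suc n)) @ [Ws (Suc n) 0] @ t"
      using P(3)[of "Suc n"] by (auto simp: prefix_def)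
    have "(sg ^^ Suc (Suc n)) [Ws (Suc (Suc n)) 0] = (sg ^^ Suc n) (sigma_letter d (Ws (Suc (Suc n)) 0))"
      unfolding funpow_Suc_right comp_apply by (simp add: sg_Cons)
    also have "\<dots> = (sg ^^ Suc n) (fst (D (Suc n))) @ (sg ^^ Suc n) [Ws (Suc n) 0] @ (sg ^^ Suc n) t"
      unfolding t sigma_pow_append ..
    finally show ?case unfolding ps_word.simps using Suc by (simp only: same_prefix_prefix) (metis prefix_prefix)
  qed
  show "prefix (ps_word D n) ((sg ^^ Suc n) [Ws (Suc n) 0])" by (rule pre)
  have main: "ps_word D n = sprefix (length (ps_word D n)) om" if "fst (D n) = [1]" for n
  proof -
    have "Ws (Suc n) 0 = 1" using P(1)[of n] that by auto
    then obtain t where t: "(sg ^^ Suc n) [1] = ps_word D n @ t" using pre[of n] by (auto simp: prefix_def)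
    then have "length (ps_word D n) \<le> L (Suc n)" by (simp add: L_def)
    then have "sprefix (length (ps_word D n)) om = take (length (ps_word D n)) ((sg ^^ Suc n) [1])" by (rule sprefix_omega)
    then show ?thesis unfolding t by simp
  qed
  show "ps_word D n = sprefix (length (ps_word D n)) om"
  proof (induction n)
    case 0
    then show ?case using P(1)[of 0] main[of 0] by fastforce
  next
    case (Suc n)
    then show ?case using P(1)[of "Suc n"] main[of "Suc n"] by (cases "fst (D (Suc n)) = [1]") auto
  qed
qed

text \<open>At most d-1 applications of sigma turn a letter into 1, from where \<open>L_gt\<close>
  takes over.\<close>

lemma length_sg_pow_ge: "a \<in> {1..d} \<Longrightarrow> n \<le> length ((sg ^^ (n + d)) [a])"
proof -
  assume a: "a \<in> {1..d}"
  define k where "k = (if a = 1 then 0 else d + 1 - a)"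
  have "(sg ^^ k) [a] = [1]"
  proof (cases "a = 1")
    case False
    have "j \<le> d - a \<Longrightarrow> (sg ^^ j) [a] = [a + j]" for j
      using False a by (induction j) (auto simp: sg_Cons sigma_letter_def)
    from this[of "d - a"] have "(sg ^^ (d - a)) [a] = [d]" using a by simp
    then have "(sg ^^ Suc (d - a)) [a] = [1]" using d3 by (simp add: sg_Cons sigma_letter_def)
    moreover have "Suc (d - a) = k" using False a by (simp add: k_def Suc_diff_le)
    ultimately show ?thesis by simp
  qed (simp add: k_def)
  moreover have "n + d = (n + d - k) + k" using a by (simp add: k_def)
  then have "(sg ^^ (n + d)) [a] = (sg ^^ (n + d - k)) ((sg ^^ k) [a])" by (metis comp_apply funpow_add)
  ultimately have "(sg ^^ (n + d)) [a] = (sg ^^ (n + d - k)) [1]" by simp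
  then have "length ((sg ^^ (n + d)) [a]) = L (n + d - k)" by (simp add: L_def)
  moreover have "n \<le> n + d - k" using a by (auto simp: k_def)
  ultimately show ?thesis using L_gt[of "n + d - k"] by simp
qed

text \<open>Both \<open>V\<close> and the orbit point with prefix \<open>u\<^sub>n\<close> lie in the cylinder of \<open>\<sigma>\<^sup>n\<^sup>+\<^sup>1(a) u\<^sub>n\<close>, where \<open>a\<close> is the
  letter at index \<open>-1\<close> of the \<open>(n+1)\<close>-st desubstitution.\<close>

lemma ps_word_cylinder:
  assumes Ws: "nonsing (Ws 0)" "\<forall>i. ps_step (Ws i) (Ws (Suc i)) (D i)" and n: "m + d \<le> Suc n"
  shows "\<exists>w\<in>lang d. length w = m \<and> rh (Ws 0) 0 \<in> cyl d w \<and> sshift (length (ps_word D n)) om \<in> cyl d w"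
proof -
  define a where "a = Ws (Suc n) (0 - 1)"
  define u where "u = (sg ^^ Suc n) [a] @ ps_word D n"
  have Wn: "Ws (Suc n) \<in> Omega d" using ps_chain_nonsing[OF Ws] by (simp add: nonsing_def)
  then have "rh (Ws (Suc n)) (0 - 1) \<in> Omega_plus d" by (simp only: Omega_iff)
  then have left: "swapp [a] (rh (Ws (Suc n)) 0) \<in> Omega_plus d" unfolding rh_left a_def .
  have a: "a \<in> {1..d}" using left_letter_step(2)[OF left] .
  have "swapp u (rh (Ws 0) 0) = (SS ^^ Suc n) (swapp [a] (rh (Ws (Suc n)) 0))"
    unfolding u_def swapp_append ps_word_props(1)[OF Ws] SS_pow_swapp ..
  then have 1: "rh (Ws 0) 0 \<in> cyl d u" using SS_pow_Omega_plus[OF left] by (simp only: cyl_iff)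
  have "swapp (ps_word D n) (sshift (length (ps_word D n)) om) = om"
    using ps_word_props(3)[OF Ws, of n] swapp_sprefix_sshift by metis
  then have "swapp u (sshift (length (ps_word D n)) om) = (SS ^^ Suc n) (swapp [a] om)"
    unfolding u_def swapp_append by (simp only: SS_pow_swapp SS_pow_om)
  then have 2: "sshift (length (ps_word D n)) om \<in> cyl d u"
    using SS_pow_Omega_plus[OF left_om[OF a]] by (simp only: cyl_iff)
  obtain k where k: "Suc n = k + d" "m \<le> k" using n by (metis add_le_cancel_right le_Suc_ex add.commute trans_le_add2 le_add2)
  have lu: "m \<le> length u" using length_sg_pow_ge[OF a, of k] k unfolding u_def k(1) by simp
  define w where "w = drop (length u - m) u"
  have uw: "u = take (length u - m) u @ w" by (simp add: w_def)
  have "cyl d u \<subseteq> cyl d w" using cyl_append_subset uw by metis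
  then have "rh (Ws 0) 0 \<in> cyl d w" "sshift (length (ps_word D n)) om \<in> cyl d w" using 1 2 by blast+
  moreover have "length w = m" using lu by (simp add: w_def)
  moreover then have "w \<in> lang d" using calculation(1) swapp_lang by (simp only: cyl_iff)
  ultimately show ?thesis by blast
qed

end

section \<open>The map f_Q carries the cylinder of an edge onto its piece\<close>

context tree_subst
begin

section \<open>The map on words\<close>

lemma f_Q_orbit:
  assumes "x \<in> branch_verts d m"
  shows "f_Q d \<eta> (sshift (kap x) om) = emb x"
proof -
  have "sshift (kap x) om \<in> Omega_orbit d" unfolding orbit_iff by blast
  moreover have "(THE l. sshift (kap x) om = sshift l om) = kap x"
    unfolding sshift_om_inject by (rule the_equality) simp_all
  ultimately show ?thesis
    unfolding f_Q_def Let_def emb_def using orbit_point_eq[OF assms] by (simp only: if_True pinv_def)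
qed

text \<open>Descend through the edges whose cylinders contain the orbit point until a stage at which
  x exists; there \<open>CE_ends\<close> recognises x as an end of the edge reached.\<close>

lemma orbit_descVs:
  assumes x: "x \<in> branch_verts d m" and e: "e \<in> E k" and V: "sshift (kap x) om \<in> CE k e"
  shows "x \<in> descVs e"
proof -
  have "\<exists>f\<in>desc j e. sshift (kap x) om \<in> CE (k + j) f" for j
  proof (induction j)
    case 0
    then show ?case using V by simp
  next
    case (Suc j)
    then obtain f where f: "f \<in> desc j e" "sshift (kap x) om \<in> CE (k + j) f" by blast
    have "f \<in> E (k + j)" using f(1) e E_add by blast
    then obtain g where g: "g \<in> subst_edge d f" "sshift (kap x) om \<in> CE (Suc (k + j)) g"
      using CE_children f(2) by blast
    have "desc (Suc j) e = subst_tree d (desc j e)" by (simp add: desc_def)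
    then have "g \<in> desc (Suc j) e" using f(1) g(1) by (auto simp: subst_tree_def)
    then show ?case using g(2) by auto
  qed
  then obtain f where f: "f \<in> desc m e" "sshift (kap x) om \<in> CE (k + m) f" by blast
  have fE: "f \<in> E (k + m)" using f(1) e E_add by blast
  have xb: "x \<in> branch_verts d (k + m)" using x branch_mono[of m "k + m"] by auto
  obtain v where v: "v \<in> ends f" "isB v" "kap v = kap x" using CE_ends[OF fE f(2) kap_less[OF xb]] by blast
  have "v \<in> branch_verts d (k + m)" unfolding branch_verts_iff using v fE by (auto simp: verts_ends)
  then have "v = x" using kap_inj xb v(3) by blast
  then have "x \<in> descV m e" using v(1) f(1) by (auto simp: descV_def verts_ends)
  then show ?thesis by (auto simp: descVs_def)
qed

lemma CE_cyl: "e \<in> E k \<Longrightarrow> \<exists>w. CE k e = cyl d w"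
proof -
  assume "e \<in> E k"
  then have "CE k e \<in> cyl_partition d (mm k)" using CE_partition by blast
  then show ?thesis by (auto simp: cyl_partition_def)
qed

lemma cyl_CE:
  assumes "w \<in> lang d" "length w = mm k"
  shows "\<exists>e\<in>E k. cyl d w = CE k e"
proof -
  have "cyl d w \<in> cyl_partition d (mm k)" using assms by (auto simp: cyl_partition_def)
  then show ?thesis unfolding CE_partition[symmetric] by blast
qed

lemma CE_cover:
  assumes "V \<in> Omega_plus d"
  shows "\<exists>e\<in>E k. V \<in> CE k e"
proof -
  have "\<exists>u. length u = n \<and> swapp u V \<in> Omega_plus d" for n
  proof (induction n)
    case (Suc n)
    then obtain u where u: "length u = n" "swapp u V \<in> Omega_plus d" by blast
    then obtain a where "swapp [a] (swapp u V) \<in> Omega_plus d" using Omega_plus_left by blast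
    then show ?case using u(1) by (intro exI[of _ "a # u"]) (simp add: swapp_append[symmetric])
  qed (use assms in simp)
  then obtain u where u: "length u = mm k" "swapp u V \<in> Omega_plus d" by blast
  obtain e where "e \<in> E k" "cyl d u = CE k e" using cyl_CE[OF swapp_lang[OF u(2)] u(1)] by blast
  then show ?thesis using u(2) cyl_iff by blast
qed

lemma CE_unique:
  assumes V: "V \<notin> Omega_orbit d" and e: "e \<in> E k" "e' \<in> E k" and "V \<in> CE k e" "V \<in> CE k e'"
  shows "e = e'"
proof (rule ccontr)
  assume "e \<noteq> e'"
  then have "key e \<noteq> key e'" using key_inj e by blast
  moreover obtain x y i where xyi: "e = (x, y, i)" by (metis prod_cases3)
  moreover obtain x' y' i' where xyi': "e' = (x', y', i')" by (metis prod_cases3)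
  ultimately have "(i, kap x) \<noteq> (i', kap x')" by simp
  then obtain j where "V = sshift j om"
    using CC_disjoint[OF key_in_idx key_in_idx, of x y i k x' y' i' V] e assms(4,5) xyi xyi' by auto
  then show False using V orbit_iff by blast
qed

text \<open>At each stage exactly one edge holds V. By \<open>ps_word_cylinder\<close> the
  approximating orbit points eventually lie in the same cylinder, so their vertices descend from
  this edge and the limit falls into its piece.\<close>

lemma f_Q_not_orbit:
  assumes V: "V \<in> Omega_plus d" "V \<notin> Omega_orbit d" and e: "e \<in> E k" "V \<in> CE k e"
  shows "f_Q d \<eta> V \<in> KK e"
proof -
  obtain W where W: "W \<in> Omega d" "rh W 0 = V" using Omega_extension[OF V(1)] by blast
  have ns: "nonsing W" using W V(2) by (simp add: nonsing_def)
  have W_the: "(THE W. W \<in> Omega d \<and> (\<forall>i. W (int i) = V i)) = W"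
  proof (rule the_equality)
    show "W \<in> Omega d \<and> (\<forall>i. W (int i) = V i)" using W(1) W(2)[symmetric] by (simp add: rh_apply)
    fix W' assume W': "W' \<in> Omega d \<and> (\<forall>i. W' (int i) = V i)"
    then have "rh W' 0 = V" by (intro ext) (simp add: rh_apply)
    then show "W' = W" using Omega_eq[of W' W 0] W' W V(2) by metis
  qed
  obtain D where D1: "ps_development d W D" using ps_development_ex1[OF ns] by blast
  have "(THE D. ps_development d W D) = D"
    by (rule the1_equality[of "ps_development d W"]) (rule ps_development_ex1[OF ns], rule D1)
  note D = D1 this
  obtain Ws where Ws: "Ws 0 = W" "\<forall>i. ps_step (Ws i) (Ws (Suc i)) (D i)"
    using D(1) unfolding ps_development_iff by blast
  have ns0: "nonsing (Ws 0)" using ns Ws(1) by simp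
  obtain xb mb where xb: "\<And>l. xb l \<in> branch_verts d (mb l)" "\<And>l. kap (xb l) = l"
    using branch_exists by metis
  define X where "X n = fp_embed d (orbit_point d \<eta> (ps_inverse d D n))" for n
  have X: "X n = emb (xb (length (ps_word D n)))" for n
  proof -
    have "ps_inverse d D n = pinv (length (ps_word D n))"
      unfolding ps_inverse_word pinv_def ps_word_props(3)[OF ns0 Ws(2), of n, symmetric] ..
    then show ?thesis
      using orbit_point_eq[OF xb(1)[of "length (ps_word D n)"]] xb(2) by (simp only: X_def emb_def)
  qed
  have xbV: "xb l \<in> VV" for l using xb(1)[of l] VV_I by (auto simp: branch_verts_iff)
  obtain ee where ee: "\<And>k. ee k \<in> E k" "\<And>k. V \<in> CE k (ee k)" using CE_cover[OF V(1)] by metis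
  have ev: "eventually (\<lambda>n. X n \<in> KK (ee k)) sequentially" for k
  proof (rule eventually_sequentiallyI)
    fix n assume "mm k + d \<le> n"
    then have "mm k + d \<le> Suc n" by simp
    from ps_word_cylinder[OF ns0 Ws(2) this] obtain w where w: "w \<in> lang d" "length w = mm k"
      "V \<in> cyl d w" "sshift (length (ps_word D n)) om \<in> cyl d w"
      unfolding Ws(1) W(2) by blast
    obtain e' where e': "e' \<in> E k" "cyl d w = CE k e'" using cyl_CE[OF w(1,2)] by blast
    have "e' = ee k" using CE_unique[OF V(2) e'(1) ee(1)] w(3) e'(2) ee(2) by blast
    then have "sshift (kap (xb (length (ps_word D n)))) om \<in> CE k (ee k)" using w(4) e'(2) xb(2) by simp
    then have "xb (length (ps_word D n)) \<in> descVs (ee k)" by (rule orbit_descVs[OF xb(1) ee(1)])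
    then show "X n \<in> KK (ee k)" unfolding X by (rule emb_KK[OF ee(1)])
  qed
  have "X n \<in> mspace CM" for n unfolding X by (rule emb_in[OF xbV])
  then obtain q where q: "limitin (mtopology_of CM) X q sequentially" "\<forall>k\<ge>0. q \<in> KK (ee k)"
    using nested_limit[of 0 ee X] ee(1) ev by blast
  have "f_Q d \<eta> V = (THE q. limitin (mtopology_of CM) X q sequentially)"
    unfolding f_Q_def Let_def W_the D(2) X_def using V(2) by simp
  also have "\<dots> = q" using q(1) limit_unique by blast
  finally have "f_Q d \<eta> V = q" .
  moreover have "e = ee k" by (rule CE_unique[OF V(2) e(1) ee(1) e(2) ee(2)])
  ultimately show ?thesis using q(2) by simp
qed

lemma f_Q_KK:
  assumes e: "e \<in> E n" and V: "V \<in> CE n e"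
  shows "f_Q d \<eta> V \<in> KK e"
proof (cases "V \<in> Omega_orbit d")
  case True
  then obtain l where l: "V = sshift l om" unfolding orbit_iff by blast
  obtain x m where x: "x \<in> branch_verts d m" "kap x = l" using branch_exists by blast
  have "x \<in> descVs e" using orbit_descVs[OF x(1) e] V l x(2) by simp
  then show ?thesis using f_Q_orbit[OF x(1)] emb_KK[OF e] l x(2) by simp
next
  case False
  have "V \<in> Omega_plus d" using V CC_Omega_plus unfolding CE_def by blast
  then show ?thesis using f_Q_not_orbit False e V by blast
qed

text \<open>For surjectivity, a point q lies in the pieces of a chain of successive children. The
  cylinders along the chain have a common word V by compactness, and both q and f_Q(V) lie in all
  pieces of the chain, whose diameters tend to 0.\<close>

theorem f_Q_image:
  assumes e: "e \<in> E n"
  shows "f_Q d \<eta> ` CE n e = KK e"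
proof
  show "f_Q d \<eta> ` CE n e \<subseteq> KK e" using f_Q_KK[OF e] by blast
  show "KK e \<subseteq> f_Q d \<eta> ` CE n e"
  proof
    fix q assume q: "q \<in> KK e"
    have "\<exists>f. \<forall>k. (f k \<in> E (n + k) \<and> q \<in> KK (f k) \<and> (k = 0 \<longrightarrow> f k = e)) \<and> f (Suc k) \<in> subst_edge d (f k)"
    proof (rule dependent_nat_choice)
      show "\<exists>x. x \<in> E (n + 0) \<and> q \<in> KK x \<and> ((0::nat) = 0 \<longrightarrow> x = e)"
        by (rule exI[of _ e]) (simp add: e q)
      fix x and k :: nat assume x: "x \<in> E (n + k) \<and> q \<in> KK x \<and> (k = 0 \<longrightarrow> x = e)"
      then obtain y where y: "y \<in> subst_edge d x" "q \<in> KK y" using KK_children[of x] by blast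
      then have "y \<in> E (n + Suc k)" using E_SucI[of x "n + k" y] x by simp
      then show "\<exists>y. (y \<in> E (n + Suc k) \<and> q \<in> KK y \<and> (Suc k = 0 \<longrightarrow> y = e)) \<and> y \<in> subst_edge d x"
        using y by blast
    qed
    then obtain f where f: "\<And>k. f k \<in> E (n + k)" "\<And>k. q \<in> KK (f k)" "f 0 = e"
      "\<And>k. f (Suc k) \<in> subst_edge d (f k)" by blast
    have dec: "CE (n + k') (f k') \<subseteq> CE (n + k) (f k)" if "k \<le> k'" for k k'
      using that
    proof (induction k' rule: dec_induct)
      case (step k')
      have "CE (n + Suc k') (f (Suc k')) \<subseteq> CE (n + k') (f k')" using CE_child[OF f(1) f(4)] by simp
      then show ?case using step.IH by blast
    qed simp
    \<comment> \<open>The orbit point of the origin of \<open>f k\<close> serves as a sample point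
      of the k-th cylinder; a cluster point of these samples lies in all cylinders because they are
      nested and closed.\<close>
    define U where "U k = sshift (kap (fst (f k))) om" for k
    have U: "U k \<in> CE (n + k) (f k)" for k
    proof -
      have "isB (fst (f k))" using f(1)[of k] E_origin by (metis prod.collapse)
      then show ?thesis unfolding U_def using ends_CE[OF f(1)[of k]] by (simp add: ends_def)
    qed
    have "U k i \<in> {1..d}" for k i unfolding U_def by (rule Omega_plus_letter[OF om_Omega_plus])
    then obtain V where V: "\<And>l. infinite {k. sprefix l (U k) = sprefix l V}"
      using konig_words[of "{1..d}" U] by blast
    have Vk: "V \<in> CE (n + k) (f k)" for k
    proof -
      obtain w where w: "CE (n + k) (f k) = cyl d w" using CE_cyl[OF f(1)] by blast
      have "sprefix l (swapp w V) \<in> lang d" for l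
      proof -
        obtain k' where k': "k \<le> k'" "sprefix l (U k') = sprefix l V"
          using V[of l] unfolding infinite_nat_iff_unbounded_le by auto
        have "U k' \<in> cyl d w" using U[of k'] dec[OF k'(1)] w by blast
        then have "swapp w (U k') \<in> Omega_plus d" by (simp only: cyl_iff)
        then have "sprefix (length w + l) (swapp w (U k')) \<in> lang d" by (simp only: Omega_plus_iff)
        then have "w @ sprefix l V \<in> lang d" unfolding sprefix_swapp k'(2) .
        then have "sprefix (length w + l) (swapp w V) \<in> lang d" unfolding sprefix_swapp .
        then show ?thesis using sprefix_mono[of l "length w + l"] lang_sublist by (metis le_add2 prefix_imp_sublist)
      qed
      then show ?thesis unfolding w cyl_iff Omega_plus_iff by blast
    qed
    have "q = f_Q d \<eta> V"
    proof (rule KK_unique[of n "\<lambda>k. f (k - n)"])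
      fix k assume "n \<le> k"
      then have k: "n + (k - n) = k" by simp
      show "f (k - n) \<in> E k" using f(1)[of "k - n"] unfolding k .
      show "q \<in> KK (f (k - n))" by (rule f(2))
      show "f_Q d \<eta> V \<in> KK (f (k - n))" by (rule f_Q_KK[OF f(1) Vk])
    qed
    moreover have "V \<in> CE n e" using Vk[of 0] f(3) by simp
    ultimately show "q \<in> f_Q d \<eta> ` CE n e" by blast
  qed
qed

theorem partition_determined:
  "(\<forall>s t. simple_arc d \<eta> n s t \<longrightarrow>
      (\<exists>!P. P \<in> cyl_partition d (mm n) \<and> f_Q d \<eta> ` P = T_tau_arc d \<eta> s t)) \<and>
   (\<forall>P \<in> cyl_partition d (mm n). \<exists>s t. simple_arc d \<eta> n s t \<and> f_Q d \<eta> ` P = T_tau_arc d \<eta> s t)"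
proof (intro conjI allI impI ballI)
  fix s t assume "simple_arc d \<eta> n s t"
  then obtain e v w where e: "e \<in> E n" "ends e = {v, w}" "s = N v" "t = N w" using simple_arc_iff by blast
  have arc: "T_tau_arc d \<eta> s t = KK e" unfolding e(3,4) by (rule T_tau_arc_edge[OF e(1,2)])
  show "\<exists>!P. P \<in> cyl_partition d (mm n) \<and> f_Q d \<eta> ` P = T_tau_arc d \<eta> s t"
  proof (rule ex1I[of _ "CE n e"])
    show "CE n e \<in> cyl_partition d (mm n) \<and> f_Q d \<eta> ` CE n e = T_tau_arc d \<eta> s t"
      using e(1) CE_partition f_Q_image[OF e(1)] arc by blast
    fix P assume P: "P \<in> cyl_partition d (mm n) \<and> f_Q d \<eta> ` P = T_tau_arc d \<eta> s t"
    then obtain e' where e': "e' \<in> E n" "P = CE n e'" unfolding CE_partition[symmetric] by blast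
    then have "KK e' = KK e" using f_Q_image[OF e'(1)] P arc by simp
    then show "P = CE n e" using KK_inject[OF e'(1) e(1)] e'(2) by simp
  qed
next
  fix P assume "P \<in> cyl_partition d (mm n)"
  then obtain e where e: "e \<in> E n" "P = CE n e" unfolding CE_partition[symmetric] by blast
  obtain v w where vw: "ends e = {v, w}" by (simp add: ends_def)
  have "simple_arc d \<eta> n (N v) (N w)" unfolding simple_arc_iff using e(1) vw by blast
  moreover have "f_Q d \<eta> ` P = T_tau_arc d \<eta> (N v) (N w)"
    unfolding T_tau_arc_edge[OF e(1) vw] e(2) by (rule f_Q_image[OF e(1)])
  ultimately show "\<exists>s t. simple_arc d \<eta> n s t \<and> f_Q d \<eta> ` P = T_tau_arc d \<eta> s t" by blast
qed

end

theorem mainTheorem1: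
  fixes d n m :: nat and \<eta> :: real
  assumes "d \<ge> 3"
    and "\<eta> > 1" and "\<eta> ^ d = \<eta> + 1"
    and "n = 0 \<Longrightarrow> m = 1"
    and "n \<ge> 1 \<Longrightarrow> \<exists>w. appears d w (int n) \<and>
           (\<forall>w'. appears d w' (int n) \<longrightarrow> length w' \<le> length w) \<and> m = length w + 1"
  shows "(\<forall>s t. simple_arc d \<eta> n s t \<longrightarrow>
            (\<exists>!P. P \<in> cyl_partition d m \<and> f_Q d \<eta> ` P = T_tau_arc d \<eta> s t)) \<and>
         (\<forall>P \<in> cyl_partition d m. \<exists>s t. simple_arc d \<eta> n s t \<and> f_Q d \<eta> ` P = T_tau_arc d \<eta> s t)"
proof -
  interpret tree_subst d \<eta> by unfold_locales (rule assms(1-3))+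
  have "m = mm n"
  proof (cases n)
    case 0
    then show ?thesis using assms(4) mm_0 by simp
  next
    case (Suc k)
    then obtain w where w: "appears d w (int n)" "\<forall>w'. appears d w' (int n) \<longrightarrow> length w' \<le> length w" "m = length w + 1"
      using assms(5) by auto
    then show ?thesis using longest_appearing[of w k] Suc by simp
  qed
  then show ?thesis using partition_determined[of n] by simp
qed

end
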